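(* There is a deterministic algorithm $\textsc{SparseCutOrCertify}(G,\psi,b)$ which, given an undirected $n$-vertex graph $G$ of maximum degree at most $10$, an $\alpha$-approximate decremental All-Pairs Shortest-Paths (APSP) data structure, a sparsity parameter $\psi\in(0,1]$ and a balance parameter $b\in[1/n,1/4]$, does one of the following: 1. it finds a cut $(S,\overline{S})$ with $|S|,|\overline{S}|\ge bn$ of sparsity $\Psi_G(S)\le\psi$; or 2. it certifies (i.e. correctly asserts) that every cut $(X,\overline{X})$ with $|X|,|\overline{X}|=\Omega(bn)$ has sparsity at least $$\psi\cdot\Omega\left(\frac{1}{\alpha\,\log n\cdot\log(1/b)\cdot\log(\log(n)\,\alpha/(b\psi))}\right).$$ The algorithm requires the APSP data structure to undergo $O\big(\alpha\cdot\frac{n}{\psi}\log^3 n\big)$ updates, queries it $O(n)$ times, and spends an additional $O\big(\alpha\cdot\frac{n}{\psi}\log^3 n\big)$ time.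
   Context: For an undirected graph $G=(V,E)$ and a cut $(S,\overline S)$, where $\emptyset\ne S\subsetneq V$ and $\overline{S}=V\setminus S$, let $E_G(S,\overline S)$ be the set of edges with exactly one endpoint in $S$. The sparsity of the cut is $\Psi_G(S)=\frac{|E_G(S,\overline{S})|}{\min\{|S|,|\overline{S}|\}}$. An $\alpha$-approximate decremental APSP data structure ($\alpha\ge1$) is initialized on a (weighted) graph and supports: $\textsc{IncreaseEdgeWeight}(u,v,\Delta)$ (an update), which increases the weight of edge $(u,v)$ by $\Delta$; $\textsc{QueryDistance}(u,v)$, which returns an estimate $\tilde d(u,v)\in[d(u,v),\alpha\, d(u,v)]$, where $d$ is the distance in the current weighted graph; and $\textsc{QueryPath}(u,v)$, which returns a $u$-to-$v$ path in the current graph of total weight $\tilde d(u,v)$. All constants hidden in $O(\cdot)$ and $\Omega(\cdot)$ are universal; in item 2, "every cut with $|X|,|\overline X|=\Omega(bn)$" means every cut with both sides of size at least $c\,bn$ for some universal constant $c>0$. *)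

theory Defs
  imports Complex_Main "HOL-Library.Extended_Real"
begin

section \<open>Graphs, cuts, distances\<close>

text \<open>Finite simple undirected graphs on the vertex set \<open>{..<n}\<close>; an edge is a two-element set.\<close>

type_synonym edge = "nat set"

definition simple_graph :: "nat \<Rightarrow> edge set \<Rightarrow> bool" where
  "simple_graph n E \<longleftrightarrow> (\<forall>e\<in>E. \<exists>u v. u < n \<and> v < n \<and> u \<noteq> v \<and> e = {u, v})"

definition vertex_degree :: "edge set \<Rightarrow> nat \<Rightarrow> nat" where
  "vertex_degree E v = card {e \<in> E. v \<in> e}"

definition is_cut :: "nat \<Rightarrow> nat set \<Rightarrow> bool" where
  "is_cut n S \<longleftrightarrow> S \<noteq> {} \<and> S \<subset> {..<n}"

definition cut_edges :: "edge set \<Rightarrow> nat set \<Rightarrow> edge set" where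
  "cut_edges E S = {e \<in> E. card (e \<inter> S) = 1}"

definition sparsity :: "nat \<Rightarrow> edge set \<Rightarrow> nat set \<Rightarrow> real" where
  "sparsity n E S = real (card (cut_edges E S)) / real (min (card S) (card ({..<n} - S)))"

definition is_path :: "edge set \<Rightarrow> nat \<Rightarrow> nat \<Rightarrow> nat list \<Rightarrow> bool" where
  "is_path E u v p \<longleftrightarrow> p \<noteq> [] \<and> hd p = u \<and> last p = v \<and> distinct p \<and>
     (\<forall>i. Suc i < length p \<longrightarrow> {p ! i, p ! Suc i} \<in> E)"

definition path_weight :: "(edge \<Rightarrow> real) \<Rightarrow> nat list \<Rightarrow> real" where
  "path_weight w p = (\<Sum>i<length p - 1. w {p ! i, p ! Suc i})"

text \<open>The distance is \<open>\<infinity>\<close> (the infimum of the empty set) between different components.\<close>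

definition wdist :: "edge set \<Rightarrow> (edge \<Rightarrow> real) \<Rightarrow> nat \<Rightarrow> nat \<Rightarrow> ereal" where
  "wdist E w u v = (INF p \<in> {p. is_path E u v p}. ereal (path_weight w p))"


section \<open>Decremental APSP data structures\<close>

datatype apsp_op =
    IncreaseEdgeWeight nat nat real
  | QueryDistance nat nat
  | QueryPath nat nat

fun legal_op :: "nat \<Rightarrow> edge set \<Rightarrow> apsp_op \<Rightarrow> bool" where
  "legal_op n E (IncreaseEdgeWeight u v d) \<longleftrightarrow> {u, v} \<in> E \<and> 0 \<le> d"
| "legal_op n E (QueryDistance u v) \<longleftrightarrow> u < n \<and> v < n"
| "legal_op n E (QueryPath u v) \<longleftrightarrow> u < n \<and> v < n"

fun is_update :: "apsp_op \<Rightarrow> bool" where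
  "is_update (IncreaseEdgeWeight u v d) \<longleftrightarrow> True"
| "is_update _ \<longleftrightarrow> False"

fun apply_op :: "apsp_op \<Rightarrow> (edge \<Rightarrow> real) \<Rightarrow> (edge \<Rightarrow> real)" where
  "apply_op (IncreaseEdgeWeight u v d) w = w({u, v} := w {u, v} + d)"
| "apply_op _ w = w"

text \<open>Weights after the operations \<open>h\<close> (oldest first), starting from the initial weights \<open>w\<close>.\<close>

definition current_weight :: "(edge \<Rightarrow> real) \<Rightarrow> apsp_op list \<Rightarrow> (edge \<Rightarrow> real)" where
  "current_weight w h = fold apply_op h w"

text \<open>
  A data structure is modelled by its answers as a function of everything it has seen: the initial
  weights and the list of all operations so far, queries included. This covers every internal
  state representation. \<open>estimate D w h u v\<close> and \<open>reported_path D w h u v\<close> are the answers to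
  \<open>QueryDistance(u,v)\<close> and \<open>QueryPath(u,v)\<close> issued after history \<open>h\<close>.
\<close>

record apsp =
  estimate :: "(edge \<Rightarrow> real) \<Rightarrow> apsp_op list \<Rightarrow> nat \<Rightarrow> nat \<Rightarrow> ereal"
  reported_path :: "(edge \<Rightarrow> real) \<Rightarrow> apsp_op list \<Rightarrow> nat \<Rightarrow> nat \<Rightarrow> nat list"

text \<open>
  The correctness requirement concerns one underlying graph \<open>(n, E)\<close>, so that \<open>\<alpha>\<close> may depend on
  the graph, in particular on \<open>n\<close>. The estimate belongs to the current weighted graph: the last
  conjunct says that queries do not change it (they may change the paths returned later). Nothing
  is required of the answer to \<open>QueryPath(u,v)\<close> when there is no \<open>u\<close>-\<open>v\<close> path; the estimate is
  then \<open>\<infinity>\<close>.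
\<close>

definition approx_apsp :: "nat \<Rightarrow> edge set \<Rightarrow> real \<Rightarrow> apsp \<Rightarrow> bool" where
  "approx_apsp n E \<alpha> D \<longleftrightarrow>
     (\<forall>w h u v. (\<forall>e\<in>E. 0 < w e) \<longrightarrow> (\<forall>q\<in>set h. legal_op n E q) \<longrightarrow> u < n \<longrightarrow> v < n \<longrightarrow>
        (let w' = current_weight w h; d = wdist E w' u v; est = estimate D w h u v
         in d \<le> est \<and> est \<le> ereal \<alpha> * d \<and>
            (d < \<infinity> \<longrightarrow> is_path E u v (reported_path D w h u v) \<and>
                       ereal (path_weight w' (reported_path D w h u v)) = est) \<and>
            (\<forall>q. legal_op n E q \<and> \<not> is_update q \<longrightarrow> estimate D w (h @ [q]) u v = est)))"


section \<open>Deterministic algorithms with access to an APSP data structure\<close>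

text \<open>
  Algorithms are programs of a unit-cost random access machine with arrays of natural numbers
  (addition and truncated subtraction only, so that unbounded integers give no
  unrealistic power) and arrays of real numbers (field operations and comparison, no rounding, as
  in a real RAM). Scalars are arrays used at one index. A program is a fixed finite
  syntax tree; every elementary command and every test costs one step, which is up to a
  program-dependent constant factor the number of elementary operations, because the size of the
  expressions in a fixed program is bounded.
\<close>

text \<open>\<open>PathLength\<close> and \<open>PathVertex\<close> read the answer to the last path query, one vertex at a time.\<close>

datatype nexp =
    NConst nat
  | NGet nat nexp
  | NAdd nexp nexp
  | NSub nexp nexp
  | PathLength
  | PathVertex nexp

datatype rexp =
    RConst nat
  | ROfNat nexp
  | RGet nat nexp
  | RAdd rexp rexp
  | RSub rexp rexp
  | RMul rexp rexp
  | RDiv rexp rexp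

datatype bexp =
    NLess nexp nexp
  | RLess rexp rexp
  | BNot bexp
  | BAnd bexp bexp

datatype com =
    Skip
  | NSet nat nexp nexp
  | RSet nat nexp rexp
  | Seq com com
  | Cond bexp com com
  | Loop bexp com
  | ApspInit nat
  | ApspIncrease nexp nexp rexp
  | ApspDistance nat nexp nexp
  | ApspPath nexp nexp

record state =
  nmem :: "nat \<Rightarrow> nat \<Rightarrow> nat"
  rmem :: "nat \<Rightarrow> nat \<Rightarrow> real"
  path_buffer :: "nat list"
  init_weights :: "(edge \<Rightarrow> real) option"
  history :: "apsp_op list"
  steps :: nat

fun neval :: "state \<Rightarrow> nexp \<Rightarrow> nat" where
  "neval s (NConst k) = k"
| "neval s (NGet a i) = nmem s a (neval s i)"
| "neval s (NAdd x y) = neval s x + neval s y"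
| "neval s (NSub x y) = neval s x - neval s y"
| "neval s PathLength = length (path_buffer s)"
| "neval s (PathVertex i) =
     (if neval s i < length (path_buffer s) then path_buffer s ! neval s i else 0)"

fun reval :: "state \<Rightarrow> rexp \<Rightarrow> real" where
  "reval s (RConst k) = real k"
| "reval s (ROfNat x) = real (neval s x)"
| "reval s (RGet a i) = rmem s a (neval s i)"
| "reval s (RAdd x y) = reval s x + reval s y"
| "reval s (RSub x y) = reval s x - reval s y"
| "reval s (RMul x y) = reval s x * reval s y"
| "reval s (RDiv x y) = reval s x / reval s y"

fun beval :: "state \<Rightarrow> bexp \<Rightarrow> bool" where
  "beval s (NLess x y) \<longleftrightarrow> neval s x < neval s y"
| "beval s (RLess x y) \<longleftrightarrow> reval s x < reval s y"
| "beval s (BNot x) \<longleftrightarrow> \<not> beval s x"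
| "beval s (BAnd x y) \<longleftrightarrow> beval s x \<and> beval s y"

definition nset :: "nat \<Rightarrow> nat \<Rightarrow> nat \<Rightarrow> state \<Rightarrow> state" where
  "nset a i x s = s\<lparr>nmem := (nmem s)(a := (nmem s a)(i := x))\<rparr>"

definition rset :: "nat \<Rightarrow> nat \<Rightarrow> real \<Rightarrow> state \<Rightarrow> state" where
  "rset a i x s = s\<lparr>rmem := (rmem s)(a := (rmem s a)(i := x))\<rparr>"

definition tick :: "state \<Rightarrow> state" where
  "tick s = s\<lparr>steps := Suc (steps s)\<rparr>"

definition log_op :: "apsp_op \<Rightarrow> state \<Rightarrow> state" where
  "log_op q s = s\<lparr>history := history s @ [q]\<rparr>"

definition edge_of :: "nat \<times> nat \<Rightarrow> edge" where
  "edge_of p = {fst p, snd p}"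

text \<open>An edge list stores every edge of the graph exactly once, in one of its two orientations.\<close>

definition edge_list :: "edge set \<Rightarrow> (nat \<times> nat) list \<Rightarrow> bool" where
  "edge_list E es \<longleftrightarrow> distinct (map edge_of es) \<and> set (map edge_of es) = E"

text \<open>The weight function in which the \<open>i\<close>-th edge of \<open>es\<close> has weight \<open>f i\<close>.\<close>

definition weights_from :: "(nat \<times> nat) list \<Rightarrow> (nat \<Rightarrow> real) \<Rightarrow> (edge \<Rightarrow> real)" where
  "weights_from es f e =
     (case map_of (zip (map edge_of es) (map f [0..<length es])) e of None \<Rightarrow> 0 | Some x \<Rightarrow> x)"

text \<open>
  Execution on the graph with edge list \<open>es\<close>. The data structure is initialized at
  most once, on the input graph, with positive weights read from a real array. Distance answers
  are written to index 0 of the given natural (finiteness flag) and real (value) arrays. There is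
  no rule for illegal uses of the data structure, so a program that
  makes one has no terminating execution. Commands addressed to the data structure also cost one
  step; the work inside the data structure is not charged.
\<close>

inductive exec :: "nat \<Rightarrow> (nat \<times> nat) list \<Rightarrow> apsp \<Rightarrow> com \<Rightarrow> state \<Rightarrow> state \<Rightarrow> bool"
  for n :: nat and es :: "(nat \<times> nat) list" and D :: apsp where
  exec_Skip: "exec n es D Skip s (tick s)"
| exec_NSet: "exec n es D (NSet a i x) s (tick (nset a (neval s i) (neval s x) s))"
| exec_RSet: "exec n es D (RSet a i x) s (tick (rset a (neval s i) (reval s x) s))"
| exec_Seq: "exec n es D c1 s s' \<Longrightarrow> exec n es D c2 s' s'' \<Longrightarrow> exec n es D (Seq c1 c2) s s''"
| exec_CondTrue: "beval s b \<Longrightarrow> exec n es D c1 (tick s) s' \<Longrightarrow> exec n es D (Cond b c1 c2) s s'"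
| exec_CondFalse: "\<not> beval s b \<Longrightarrow> exec n es D c2 (tick s) s' \<Longrightarrow> exec n es D (Cond b c1 c2) s s'"
| exec_LoopTrue: "beval s b \<Longrightarrow> exec n es D c (tick s) s' \<Longrightarrow> exec n es D (Loop b c) s' s''
    \<Longrightarrow> exec n es D (Loop b c) s s''"
| exec_LoopFalse: "\<not> beval s b \<Longrightarrow> exec n es D (Loop b c) s (tick s)"
| exec_Init: "init_weights s = None \<Longrightarrow> \<forall>i<length es. 0 < rmem s a i
    \<Longrightarrow> exec n es D (ApspInit a) s (tick (s\<lparr>init_weights := Some (weights_from es (rmem s a))\<rparr>))"
| exec_Increase: "init_weights s = Some w
    \<Longrightarrow> q = IncreaseEdgeWeight (neval s u) (neval s v) (reval s d)
    \<Longrightarrow> legal_op n (set (map edge_of es)) q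
    \<Longrightarrow> exec n es D (ApspIncrease u v d) s (tick (log_op q s))"
| exec_Distance: "init_weights s = Some w
    \<Longrightarrow> q = QueryDistance (neval s u) (neval s v)
    \<Longrightarrow> legal_op n (set (map edge_of es)) q
    \<Longrightarrow> x = estimate D w (history s) (neval s u) (neval s v)
    \<Longrightarrow> exec n es D (ApspDistance a u v) s
          (tick (log_op q (nset a 0 (if x = \<infinity> then 0 else 1) (rset a 0 (real_of_ereal x) s))))"
| exec_Path: "init_weights s = Some w
    \<Longrightarrow> q = QueryPath (neval s u) (neval s v)
    \<Longrightarrow> legal_op n (set (map edge_of es)) q
    \<Longrightarrow> p = reported_path D w (history s) (neval s u) (neval s v)
    \<Longrightarrow> exec n es D (ApspPath u v) s (tick (log_op q (s\<lparr>path_buffer := p\<rparr>)))"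

lemma exec_deterministic:
  "exec n es D c s t \<Longrightarrow> exec n es D c s t' \<Longrightarrow> t' = t"
proof (induction arbitrary: t' rule: exec.induct)
  case (exec_Seq c1 s s' c2 s'')
  from exec_Seq.prems show ?case
    by (cases rule: exec.cases) (use exec_Seq.IH in blast)+
next
  case (exec_LoopTrue s b c s' s'')
  from exec_LoopTrue.prems show ?case
    by (cases rule: exec.cases) (use exec_LoopTrue.IH exec_LoopTrue.hyps in blast)+
qed (erule exec.cases; auto)+

definition num_updates :: "state \<Rightarrow> nat" where
  "num_updates s = length (filter is_update (history s))"

definition num_queries :: "state \<Rightarrow> nat" where
  "num_queries s = length (filter (\<lambda>q. \<not> is_update q) (history s))"

text \<open>
  Input: natural array 0 holds \<open>n\<close> and the number of edges, natural arrays 1 and 2 the endpoints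
  of the edges, real array 0 holds \<open>\<alpha>\<close>, \<open>\<psi>\<close>, \<open>b\<close>; all other cells are 0.
\<close>

definition init_state :: "nat \<Rightarrow> (nat \<times> nat) list \<Rightarrow> real \<Rightarrow> real \<Rightarrow> real \<Rightarrow> state" where
  "init_state n es \<alpha> \<psi> b =
     \<lparr> nmem = (\<lambda>_ _. 0)
         (0 := (\<lambda>_. 0)(0 := n, 1 := length es),
          1 := (\<lambda>i. if i < length es then fst (es ! i) else 0),
          2 := (\<lambda>i. if i < length es then snd (es ! i) else 0)),
       rmem = (\<lambda>_ _. 0)(0 := (\<lambda>_. 0)(0 := \<alpha>, 1 := \<psi>, 2 := b)),
       path_buffer = [], init_weights = None, history = [], steps = 0 \<rparr>"

text \<open>
  Output: a nonzero value at index 0 of natural array 3 announces a cut, whose side \<open>S\<close> is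
  given by the nonzero entries of natural array 4; the value 0 is the assertion of the certificate.
\<close>

definition announces_cut :: "state \<Rightarrow> bool" where
  "announces_cut t \<longleftrightarrow> nmem t 3 0 \<noteq> 0"

definition output_cut :: "nat \<Rightarrow> state \<Rightarrow> nat set" where
  "output_cut n t = {v. v < n \<and> nmem t 4 v \<noteq> 0}"

end

theory Submission
  imports Defs
begin

text \<open>
  The algorithm tries to embed an explicit constant-degree expander on \<open>n\<close> vertices, folded from the
  Gabber-Galil graph on a grid, into \<open>G\<close>. Every edge of \<open>G\<close> starts with length 1, and the length is doubled
  whenever \<open>T \<approx> \<alpha> ln n ln (1/b) / \<psi>\<close> further paths have used the edge. In round \<open>i\<close> each expander
  edge not yet embedded is routed along the reported shortest path if the estimate is at most
  \<open>2^i T\<close>; since the number of unrouted pairs halves from one round to the next, every round adds only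
  \<open>O(n)\<close> to the total length.

  If at most \<open>32bn\<close> pairs remain, then all but these are embedded with congestion \<open>O(T log (T/b))\<close>, and the
  expansion of the embedded graph bounds from below the sparsity of every cut with more than a constant times
  \<open>bn\<close> vertices on both sides. If instead a round leaves too many pairs, these are far apart
  compared with the total length. Balls grown from their endpoints then stop at a sparse boundary, and their
  union is the cut, large because each vertex is in at most 32 pairs. At most one ball can
  contain more than half of the vertices. It is not cut off, but its vertices are marked: two vertices in it are
  close, so every remaining pair has an unmarked endpoint, and a ball grown from there stays small.

  The spectral gap of the grid graph is bounded through the Fourier transform, which turns its shears into the
  transposed shears of the frequency plane. These move the quadrants in a paradoxical way, so that mass which is
  almost invariant under them sits near the origin.
\<close>

section \<open>An explicit expander\<close>

text \<open>The powers of two of round \<open>i\<close> have to cancel. Routing a pair raises the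
  potential by at most \<open>2 ^ i\<close>, the threshold \<open>2 ^ i T\<close> divided by the
  doubling period \<open>T\<close>; at most \<open>16 n / 2 ^ i\<close> pairs are left to pay for.
  If too many survive, the cut they guarantee may have only about \<open>n / 2 ^ i\<close> vertices,
  so a ball may charge its boundary to the swept length only at a rate \<beta> of order
  \<open>\<psi> / (2 ^ i ln (1/b))\<close>. A ball that never meets its stopping rule grows by the
  factor \<open>1 + \<beta>\<close> per unit of time and exhausts the graph after about
  \<open>ln n / \<beta>\<close> units. This has to fit below the distance
  \<open>2 ^ i T / \<alpha>\<close> of the surviving pairs, which dictates the factors
  \<open>ln n\<close>, \<open>ln (1/b)\<close> and \<open>1 / \<psi>\<close> in \<open>T\<close>;
  the factor \<alpha> compensates for the estimates. A second charge \<gamma> per vertex gives the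
  growth a positive start, since nothing has been swept at time 0. A ball with more than half of the
  vertices cannot join the cut, which has to leave a quarter of the vertices outside. It is grown to
  at least twice the radius by which it passed one half, so that it also contains the centre of any
  later ball of this kind.\<close>

definition periodic :: "int \<Rightarrow> (int \<Rightarrow> 'a) \<Rightarrow> bool" where
  "periodic m g \<longleftrightarrow> (\<forall>x. g (x + m) = g x)"

lemma periodicD: "periodic m g \<Longrightarrow> g (x + m) = g x"
  by (simp add: periodic_def)

lemma sum_window_step:
  fixes g :: "int \<Rightarrow> 'a :: ab_group_add"
  assumes "0 < m" "periodic m g"
  shows "sum g {a + 1..<a + 1 + m} = sum g {a..<a + m}"
proof -
  have 1: "{a..<a + m} = insert a {a + 1..<a + m}" using assms(1) by auto
  have 2: "{a + 1..<a + 1 + m} = insert (a + m) {a + 1..<a + m}" using assms(1) by auto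
  have "sum g {a..<a + m} = g a + sum g {a + 1..<a + m}" by (subst 1) auto
  moreover have "sum g {a + 1..<a + 1 + m} = g (a + m) + sum g {a + 1..<a + m}" by (subst 2) auto
  ultimately show ?thesis using periodicD[OF assms(2)] by simp
qed

text \<open>This lets functions on the cyclic group be periodic functions on \<open>int\<close>:
  translations and shears need no modular reduction, and the frequency plane can later be recentred
  at 0.\<close>

lemma sum_window:
  fixes g :: "int \<Rightarrow> 'a :: ab_group_add"
  assumes "0 < m" "periodic m g"
  shows "sum g {a..<a + m} = sum g {0..<m}"
proof (induction a rule: int_induct[where k = 0])
  case (step2 i)
  then show ?case using sum_window_step[OF assms, of "i - 1"] by simp
next
  case (step1 i)
  then show ?case using sum_window_step[OF assms, of i] by simp
qed simp

lemma sum_shift: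
  fixes g :: "int \<Rightarrow> 'a :: ab_group_add"
  assumes "0 < m" "periodic m g"
  shows "(\<Sum>x=0..<m. g (x + c)) = sum g {0..<m}"
proof -
  have "(\<Sum>x=0..<m. g (x + c)) = sum g {c..<c + m}"
    by (rule sum.reindex_bij_witness[of _ "\<lambda>x. x - c" "\<lambda>x. x + c"]) auto
  then show ?thesis using sum_window[OF assms] by simp
qed

section \<open>Characters and the Fourier transform of the cyclic group\<close>

definition char :: "int \<Rightarrow> int \<Rightarrow> complex" where
  "char m k = cis (2 * pi * real_of_int k / real_of_int m)"

lemma char_add: "char m (a + b) = char m a * char m b"
  by (simp add: char_def cis_mult add_divide_distrib ring_distribs)

lemma char_multiple: "m \<noteq> 0 \<Longrightarrow> char m (m * a) = 1"
  using cis_multiple_2pi[of "real_of_int a"] by (simp add: char_def mult.assoc)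

lemma char_0 [simp]: "char m 0 = 1" by (simp add: char_def)

lemma char_period: "m \<noteq> 0 \<Longrightarrow> char m (a + m * b) = char m a"
  by (simp add: char_add char_multiple)

lemma cnj_char: "cnj (char m k) = char m (- k)"
  by (simp add: char_def cis_cnj)

lemma char_power: "char m k ^ j = char m (k * int j)"
  by (induction j) (simp_all add: char_add[symmetric] ring_distribs)

lemma char_eq_1D:
  assumes "0 < m" "\<bar>d\<bar> < m" "char m d = 1"
  shows "d = 0"
proof -
  have "cos (2 * pi * real_of_int d / real_of_int m) = 1"
    using arg_cong[OF assms(3), of Re] by (simp add: char_def)
  then obtain j :: int where j: "2 * pi * real_of_int d / real_of_int m = real_of_int j * 2 * pi"
    by (auto simp: cos_one_2pi_int)
  then have "real_of_int d = real_of_int j * real_of_int m" using assms(1) by (simp add: field_simps)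
  then have "d = j * m" by (metis of_int_eq_iff of_int_mult)
  then show ?thesis using assms(1,2) by (cases "j = 0") (auto simp: abs_mult)
qed

text \<open>A geometric series in an \<open>m\<close>-th root of unity. The bound on
  \<open>d\<close> is what a difference of two residues satisfies, and 0 is then the only value with
  trivial character.\<close>

lemma sum_char:
  assumes "0 < m" "\<bar>d\<bar> < m"
  shows "(\<Sum>k=0..<m. char m (k * d)) = (if d = 0 then of_int m else 0)"
proof (cases "d = 0")
  case False
  have "(\<Sum>k=0..<m. char m (k * d)) = (\<Sum>j<nat m. char m d ^ j)"
    by (rule sum.reindex_bij_witness[of _ int nat]) (use assms in \<open>auto simp: char_power mult.commute\<close>)
  also have "\<dots> = 0"
  proof -
    have ne: "char m d \<noteq> 1" using char_eq_1D[OF assms] False by blast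
    have "char m d ^ nat m = 1" using assms(1) using char_multiple[of m d] by (simp add: char_power mult.commute)
    then show ?thesis using ne by (simp add: sum_gp_strict)
  qed
  finally show ?thesis using False by simp
qed (use assms in \<open>simp add: \<close>)

definition dft :: "int \<Rightarrow> (int \<Rightarrow> complex) \<Rightarrow> int \<Rightarrow> complex" where
  "dft m g k = (\<Sum>x=0..<m. g x * char m (k * x))"

text \<open>Orthogonality collapses the double sum over positions. The transform is not normalised,
  hence the factor \<open>m\<close>.\<close>

lemma parseval:
  assumes "0 < m"
  shows "(\<Sum>k=0..<m. (norm (dft m g k))\<^sup>2) = of_int m * (\<Sum>x=0..<m. (norm (g x))\<^sup>2)"
proof -
  have "complex_of_real (\<Sum>k=0..<m. (norm (dft m g k))\<^sup>2)
      = (\<Sum>k=0..<m. dft m g k * cnj (dft m g k))"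
    unfolding of_real_sum complex_norm_square ..
  also have "\<dots> = (\<Sum>k=0..<m. \<Sum>x=0..<m. \<Sum>y=0..<m. g x * cnj (g y) * char m (k * (x - y)))"
  proof (rule sum.cong[OF refl])
    fix k
    have e: "char m (k * (x - y)) = char m (k * x) * char m (- (k * y))" for x y
      by (subst char_add[symmetric]) (simp add: algebra_simps)
    show "dft m g k * cnj (dft m g k) = (\<Sum>x=0..<m. \<Sum>y=0..<m. g x * cnj (g y) * char m (k * (x - y)))"
      by (simp add: dft_def cnj_sum sum_product cnj_char e mult_ac)
  qed
  also have "\<dots> = (\<Sum>x=0..<m. \<Sum>y=0..<m. \<Sum>k=0..<m. g x * cnj (g y) * char m (k * (x - y)))"
    by (subst sum.swap, rule sum.cong[OF refl], subst sum.swap, rule refl)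
  also have "\<dots> = (\<Sum>x=0..<m. \<Sum>y=0..<m. if y = x then of_int m * (g x * cnj (g x)) else 0)"
    by (intro sum.cong refl) (use assms in \<open>auto simp: sum_distrib_left[symmetric] sum_char\<close>)
  also have "\<dots> = (\<Sum>x=0..<m. of_int m * (g x * cnj (g x)))"
    by (intro sum.cong refl) (simp add: sum.delta)
  also have "\<dots> = complex_of_real (of_int m * (\<Sum>x=0..<m. (norm (g x))\<^sup>2))"
    unfolding of_real_mult of_real_sum complex_norm_square sum_distrib_left by simp
  finally show ?thesis by (simp only: of_real_eq_iff)
qed

section \<open>Sums and the Fourier transform on the torus grid\<close>

definition sum2 :: "int \<Rightarrow> (int \<Rightarrow> int \<Rightarrow> 'a) \<Rightarrow> 'a :: ab_group_add" where
  "sum2 m h = (\<Sum>x=0..<m. \<Sum>y=0..<m. h x y)"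

definition periodic2 :: "int \<Rightarrow> (int \<Rightarrow> int \<Rightarrow> 'a) \<Rightarrow> bool" where
  "periodic2 m h \<longleftrightarrow> (\<forall>x y. h (x + m) y = h x y \<and> h x (y + m) = h x y)"

lemma sum2_shear1:
  assumes "0 < m" "periodic2 m h"
  shows "sum2 m (\<lambda>x y. h (x + c * y) y) = sum2 m h"
  unfolding sum2_def
  by (subst (1 2) sum.swap, rule sum.cong[OF refl], rule sum_shift)
     (use assms in \<open>auto simp: periodic_def periodic2_def\<close>)

lemma sum2_shear2:
  assumes "0 < m" "periodic2 m h"
  shows "sum2 m (\<lambda>x y. h x (y + c * x)) = sum2 m h"
  unfolding sum2_def
  by (rule sum.cong[OF refl], rule sum_shift)
     (use assms in \<open>auto simp: periodic_def periodic2_def\<close>)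

lemma sum2_shift:
  assumes "0 < m" "periodic2 m h"
  shows "sum2 m (\<lambda>x y. h (x + a) (y + b)) = sum2 m h"
proof -
  have "sum2 m (\<lambda>x y. h (x + a) (y + b)) = sum2 m (\<lambda>x y. h (x + a) y)"
    unfolding sum2_def
    by (rule sum.cong[OF refl], rule sum_shift[where g = "h _"])
       (use assms in \<open>auto simp: periodic_def periodic2_def\<close>)
  also have "\<dots> = sum2 m h"
    unfolding sum2_def
    by (rule sum_shift[where g = "\<lambda>x. \<Sum>y=0..<m. h x y"])
       (use assms in \<open>auto simp: periodic_def periodic2_def\<close>)
  finally show ?thesis .
qed

lemma sum2_window:
  fixes h :: "int \<Rightarrow> int \<Rightarrow> 'a :: ab_group_add"
  assumes "0 < m" "periodic2 m h"
  shows "sum2 m h = (\<Sum>(x, y)\<in>{a..<a + m} \<times> {a..<a + m}. h x y)"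
proof -
  have "sum2 m h = (\<Sum>x=0..<m. \<Sum>y\<in>{a..<a + m}. h x y)"
    unfolding sum2_def
    by (rule sum.cong[OF refl], rule sum_window[symmetric])
       (use assms in \<open>auto simp: periodic_def periodic2_def\<close>)
  also have "\<dots> = (\<Sum>x\<in>{a..<a + m}. \<Sum>y\<in>{a..<a + m}. h x y)"
    by (rule sum_window[symmetric])
       (use assms in \<open>auto simp: periodic_def periodic2_def\<close>)
  finally show ?thesis by (simp add: sum.cartesian_product)
qed

definition dft2 :: "int \<Rightarrow> (int \<Rightarrow> int \<Rightarrow> complex) \<Rightarrow> int \<Rightarrow> int \<Rightarrow> complex" where
  "dft2 m f k l = sum2 m (\<lambda>x y. f x y * char m (k * x + l * y))"

lemma parseval2:
  assumes "0 < m"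
  shows "sum2 m (\<lambda>k l. (norm (dft2 m f k l))\<^sup>2) = (of_int m)\<^sup>2 * sum2 m (\<lambda>x y. (norm (f x y))\<^sup>2)"
proof -
  have "dft2 m f k l = dft m (\<lambda>x. dft m (f x) l) k" for k l
    by (simp add: dft2_def sum2_def dft_def char_add sum_distrib_left sum_distrib_right mult_ac)
  then have "sum2 m (\<lambda>k l. (norm (dft2 m f k l))\<^sup>2)
      = (\<Sum>l=0..<m. \<Sum>k=0..<m. (norm (dft m (\<lambda>x. dft m (f x) l) k))\<^sup>2)"
    unfolding sum2_def by (subst sum.swap) simp
  also have "\<dots> = (\<Sum>l=0..<m. of_int m * (\<Sum>x=0..<m. (norm (dft m (f x) l))\<^sup>2))"
    by (simp add: parseval[OF assms])
  also have "\<dots> = of_int m * (\<Sum>x=0..<m. \<Sum>l=0..<m. (norm (dft m (f x) l))\<^sup>2)"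
    unfolding sum_distrib_left[symmetric] by (subst sum.swap) (rule refl)
  also have "\<dots> = (of_int m)\<^sup>2 * sum2 m (\<lambda>x y. (norm (f x y))\<^sup>2)"
    by (simp only: parseval[OF assms] sum2_def sum_distrib_left[symmetric] power2_eq_square[of "of_int m"] mult.assoc)
  finally show ?thesis .
qed

lemma char_period2:
  assumes "0 < m"
  shows "char m ((k + m) * x + l * y) = char m (k * x + l * y)"
    "char m (k * x + (l + m) * y) = char m (k * x + l * y)"
    "char m (k * (x + m) + l * y) = char m (k * x + l * y)"
    "char m (k * x + l * (y + m)) = char m (k * x + l * y)"
  using assms char_period[of m "k * x + l * y" x] char_period[of m "k * x + l * y" y]
    char_period[of m "k * x + l * y" k] char_period[of m "k * x + l * y" l]
  by (simp_all add: algebra_simps)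

lemma periodic2_dft2: "0 < m \<Longrightarrow> periodic2 m (dft2 m f)"
  by (simp add: periodic2_def dft2_def char_period2)

lemma periodic2_mult_char:
  "0 < m \<Longrightarrow> periodic2 m f \<Longrightarrow> periodic2 m (\<lambda>x y. f x y * char m (k * x + l * y))"
  by (simp add: periodic2_def char_period2)

text \<open>Substituting \<open>x - y\<close> for \<open>x\<close> moves the shear onto the
  character: \<open>k * (x - y) + l * y = k * x + (l - k) * y\<close>. The frequencies undergo the
  inverse transposed shear.\<close>

lemma dft2_shear1:
  assumes "0 < m" "periodic2 m f"
  shows "dft2 m (\<lambda>x y. f (x + y) y) k l = dft2 m f k (l - k)"
proof -
  have "dft2 m (\<lambda>x y. f (x + y) y) k l
      = sum2 m (\<lambda>x y. (\<lambda>x y. f x y * char m (k * x + (l - k) * y)) (x + 1 * y) y)"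
    by (simp add: dft2_def algebra_simps)
  also have "\<dots> = dft2 m f k (l - k)"
    unfolding dft2_def
    by (rule sum2_shear1[OF assms(1) periodic2_mult_char[OF assms]])
  finally show ?thesis .
qed

lemma dft2_swap: "dft2 m (\<lambda>x y. f y x) k l = dft2 m f l k"
  unfolding dft2_def sum2_def by (subst sum.swap) (simp add: algebra_simps)

lemma dft2_shear2:
  assumes "0 < m" "periodic2 m f"
  shows "dft2 m (\<lambda>x y. f x (y + x)) k l = dft2 m f (k - l) l"
proof -
  have "dft2 m (\<lambda>x y. f x (y + x)) k l = dft2 m (\<lambda>x y. f y (x + y)) l k"
    by (rule dft2_swap[where f = "\<lambda>x y. f y (x + y)"])
  also have "\<dots> = dft2 m (\<lambda>x y. f y x) l (k - l)"
    using dft2_shear1[of m "\<lambda>x y. f y x" l k] assms by (simp add: periodic2_def)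
  also have "\<dots> = dft2 m f (k - l) l" by (rule dft2_swap)
  finally show ?thesis .
qed

lemma dft2_translate1:
  assumes "0 < m" "periodic2 m f"
  shows "dft2 m (\<lambda>x y. f (x + 1) y) k l = char m (- k) * dft2 m f k l"
proof -
  have "dft2 m (\<lambda>x y. f (x + 1) y) k l
      = char m (- k) * sum2 m (\<lambda>x y. (\<lambda>x y. f x y * char m (k * x + l * y)) (x + 1) (y + 0))"
  proof -
    have "char m (k * x + l * y) = char m (- k) * char m (k * (x + 1) + l * y)" for x y
      by (subst char_add[symmetric]) (simp add: algebra_simps)
    then show ?thesis by (simp add: dft2_def sum2_def sum_distrib_left mult_ac)
  qed
  also have "\<dots> = char m (- k) * dft2 m f k l"
    unfolding dft2_def
    by (rule arg_cong[of _ _ "(*) _"], rule sum2_shift[OF assms(1) periodic2_mult_char[OF assms]])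
  finally show ?thesis .
qed

lemma dft2_translate2:
  assumes "0 < m" "periodic2 m f"
  shows "dft2 m (\<lambda>x y. f x (y + 1)) k l = char m (- l) * dft2 m f k l"
proof -
  have "dft2 m (\<lambda>x y. f x (y + 1)) k l = dft2 m (\<lambda>x y. f y (x + 1)) l k"
    by (rule dft2_swap[where f = "\<lambda>x y. f y (x + 1)"])
  also have "\<dots> = char m (- l) * dft2 m (\<lambda>x y. f y x) l k"
    using dft2_translate1[of m "\<lambda>x y. f y x" l k] assms by (simp add: periodic2_def)
  finally show ?thesis unfolding dft2_swap[of m f] .
qed

section \<open>The spectral gap of the grid graph\<close>

lemma norm_one_minus_char:
  assumes "0 < m" "m \<le> 4 * \<bar>k\<bar>" "2 * \<bar>k\<bar> \<le> m"
  shows "2 \<le> (norm (1 - char m (- k)))\<^sup>2"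
proof -
  define t where "t = 2 * pi * real_of_int k / real_of_int m"
  \<comment> \<open>The hypotheses place the angle between a quarter and half of a full turn. This
    is how translations detect mass away from the origin of the frequency plane.\<close>
  have "cos t \<le> 0"
  proof -
    define a where "a = real_of_int \<bar>k\<bar> / real_of_int m"
    have r: "real_of_int m \<le> real_of_int (4 * \<bar>k\<bar>)" "real_of_int (2 * \<bar>k\<bar>) \<le> real_of_int m"
      using assms by linarith+
    then have "1/4 \<le> a" "a \<le> 1/2" using assms(1) by (auto simp: a_def field_simps)
    moreover have at: "\<bar>t\<bar> = 2 * pi * a" using assms(1) by (simp add: t_def a_def abs_mult)
    ultimately have "pi / 2 \<le> \<bar>t\<bar>" "\<bar>t\<bar> \<le> pi"
      using mult_left_mono[of "1/4" a "2 * pi"] mult_left_mono[of a "1/2" "2 * pi"] by simp_all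
    then have "cos \<bar>t\<bar> \<le> cos (pi / 2)" by (intro cos_monotone_0_pi_le) auto
    then show ?thesis by simp
  qed
  have "char m (- k) = cis (- t)" by (simp add: char_def t_def)
  then have "(norm (1 - char m (- k)))\<^sup>2 = (1 - cos t)\<^sup>2 + (sin t)\<^sup>2"
    by (simp add: cmod_power2)
  also have "\<dots> = 2 - 2 * cos t" using sin_cos_squared_add[of t] by (simp add: power2_diff)
  finally show ?thesis using \<open>cos t \<le> 0\<close> by simp
qed

text \<open>A weighted inequality of arithmetic and geometric means. The weight 1/32 is so small
  that the error terms of the quadrant argument add up to only half of the total mass, which can be
  absorbed on the left-hand side.\<close>

lemma sq_diff_bound:
  fixes u v :: complex
  shows "\<bar>(norm u)\<^sup>2 - (norm v)\<^sup>2\<bar> \<le> 16 * (norm (u - v))\<^sup>2 + ((norm u)\<^sup>2 + (norm v)\<^sup>2) / 32"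
proof -
  define a b e where "a = norm u" and "b = norm v" and "e = norm (u - v)"
  have "\<bar>a - b\<bar> \<le> e" unfolding a_def b_def e_def by (rule norm_triangle_ineq3)
  then have "\<bar>a - b\<bar> * (a + b) \<le> e * (a + b)"
    by (intro mult_right_mono) (auto simp: a_def b_def)
  moreover have "\<bar>a\<^sup>2 - b\<^sup>2\<bar> = \<bar>a - b\<bar> * (a + b)"
  proof -
    have "a\<^sup>2 - b\<^sup>2 = (a - b) * (a + b)" by (simp add: power2_eq_square algebra_simps)
    then show ?thesis by (simp add: abs_mult a_def b_def)
  qed
  moreover have "e * (a + b) \<le> 16 * e\<^sup>2 + (a\<^sup>2 + b\<^sup>2) / 32"
  proof -
    have "0 \<le> (4 * e - (a + b) / 8)\<^sup>2" "0 \<le> (a - b)\<^sup>2" by simp_all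
    then have "e * (a + b) \<le> 16 * e\<^sup>2 + (a + b)\<^sup>2 / 64" "(a + b)\<^sup>2 \<le> 2 * (a\<^sup>2 + b\<^sup>2)"
      by (simp_all add: power2_eq_square algebra_simps)
    then show ?thesis by linarith
  qed
  ultimately show ?thesis by (simp add: a_def b_def e_def)
qed

definition cdist :: "(int \<Rightarrow> int \<Rightarrow> complex) \<Rightarrow> (int \<Rightarrow> int \<Rightarrow> complex) \<Rightarrow> int \<Rightarrow> real" where
  "cdist f g m = sum2 m (\<lambda>x y. (norm (f x y - g x y))\<^sup>2)"

lemma cdist_dft2:
  assumes "0 < m"
  shows "cdist (dft2 m f) (dft2 m g) m = (of_int m)\<^sup>2 * cdist f g m"
proof -
  have "dft2 m f k l - dft2 m g k l = dft2 m (\<lambda>x y. f x y - g x y) k l" for k l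
    by (simp add: dft2_def sum2_def sum_subtractf left_diff_distrib)
  then show ?thesis unfolding cdist_def by (simp add: parseval2[OF assms])
qed

lemma sum2_mono:
  fixes h :: "int \<Rightarrow> int \<Rightarrow> real"
  shows "(\<And>x y. h x y \<le> h' x y) \<Longrightarrow> sum2 m h \<le> sum2 m h'"
  unfolding sum2_def by (intro sum_mono)

text \<open>In every quadrant two shears map the part inside the central box injectively to disjoint
  subsets of the same quadrant. If both images carried nearly the same mass as the part itself, the
  quadrant would hold that mass twice; so the mass in the box is bounded by the defects of the
  shears and the mass outside the box. The latter is seen by the translations. The origin is fixed
  by all shears, which is why its mass has to vanish.\<close>

lemma spectral_quadrant_bound:
  fixes F :: "int \<Rightarrow> int \<Rightarrow> complex"
  assumes m: "0 < m" and per: "periodic2 m F" and F0: "F 0 0 = 0"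
  defines "M \<equiv> sum2 m (\<lambda>k l. (norm (F k l))\<^sup>2)"
  shows "M \<le> 128 * (cdist (\<lambda>k l. F k (l - k)) F m + cdist (\<lambda>k l. F (k - l) l) F m)
     + 2 * (cdist (\<lambda>k l. char m (- k) * F k l) F m + cdist (\<lambda>k l. char m (- l) * F k l) F m)"
proof -
  define \<mu> where "\<mu> = (\<lambda>z. (norm (F (fst z) (snd z)))\<^sup>2)"
  define h where "h = m div 2"
  define W where "W = {- h..<- h + m} \<times> {- h..<- h + m}"
  \<comment> \<open>With coordinates below \<open>m / 4\<close> in absolute value, a sheared point
    has coordinates below \<open>m / 2\<close> and remains in the window \<open>W\<close>, so that
    no shear wraps around.\<close>
  define B where "B = {z \<in> W. 4 * \<bar>fst z\<bar> < m \<and> 4 * \<bar>snd z\<bar> < m}"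
  define dS where "dS = (\<lambda>z. \<bar>\<mu> (fst z + snd z, snd z) - \<mu> z\<bar>)"
  define dS' where "dS' = (\<lambda>z. \<bar>\<mu> (fst z - snd z, snd z) - \<mu> z\<bar>)"
  define dT where "dT = (\<lambda>z. \<bar>\<mu> (fst z, snd z + fst z) - \<mu> z\<bar>)"
  define dT' where "dT' = (\<lambda>z. \<bar>\<mu> (fst z, snd z - fst z) - \<mu> z\<bar>)"
  have fW: "finite W" by (simp add: W_def)
  have pF: "F (x + m) y = F x y" "F x (y + m) = F x y" for x y
    using per by (auto simp: periodic2_def)
  have pF': "F (m + x) y = F x y" "F x (m + y) = F x y" for x y
    using pF[of x y] by (simp_all add: add.commute)
  have pFa: "F (x + m + z) y = F (x + z) y" "F x (y + m + z) = F x (y + z)"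
     "F (x + (y + m)) u = F (x + y) u" "F u (x + (y + m)) = F u (x + y)" for x y z u
    using pF(1)[of "x + z"] pF(2)[of _ "y + z"] pF(1)[of "x + y"] pF(2)[of _ "x + y"]
    by (simp_all add: algebra_simps)
  have pFs: "F (x + m - z) y = F (x - z) y" "F x (y + m - z) = F x (y - z)"
     "F (x - (z + m)) y = F (x - z) y" "F u (y - (z + m)) = F u (y - z)" for x y z u
    using pF(1)[of "x - z"] pF(2)[of _ "y - z"] pF(1)[of "x - z - m"] pF(2)[of _ "y - z - m"]
    by (simp_all add: algebra_simps)
  note ps = pF pFa pFs periodic2_def
  have win: "sum2 m H = (\<Sum>z\<in>W. H (fst z) (snd z))" if "periodic2 m H" for H :: "int \<Rightarrow> int \<Rightarrow> real"
    unfolding W_def using sum2_window[OF m that, of "- h"] by (simp add: case_prod_beta)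
  have M: "M = sum \<mu> W" unfolding M_def \<mu>_def by (rule win) (simp add: ps)
  have mu0: "0 \<le> \<mu> z" for z by (simp add: \<mu>_def)
  have bnd: "sum2 m (\<lambda>k l. \<bar>(norm (G k l))\<^sup>2 - (norm (F k l))\<^sup>2\<bar>) \<le> 16 * cdist G F m + M / 16"
    if "sum2 m (\<lambda>k l. (norm (G k l))\<^sup>2) = M" for G
  proof -
    have "sum2 m (\<lambda>k l. \<bar>(norm (G k l))\<^sup>2 - (norm (F k l))\<^sup>2\<bar>)
       \<le> sum2 m (\<lambda>k l. 16 * (norm (G k l - F k l))\<^sup>2 + ((norm (G k l))\<^sup>2 + (norm (F k l))\<^sup>2) / 32)"
      by (rule sum2_mono) (rule sq_diff_bound)
    also have "\<dots> = 16 * cdist G F m + (sum2 m (\<lambda>k l. (norm (G k l))\<^sup>2) + M) / 32"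
      unfolding cdist_def M_def sum2_def
      by (simp add: sum.distrib add_divide_distrib sum_distrib_left sum_divide_distrib)
    finally show ?thesis using that by simp
  qed
  define ES ET where "ES = cdist (\<lambda>k l. F (k - l) l) F m" and "ET = cdist (\<lambda>k l. F k (l - k)) F m"
  have perm: "periodic2 m (\<lambda>k l. (norm (F k l))\<^sup>2)" by (simp add: ps)
  have S': "sum dS' W \<le> 16 * ES + M / 16"
  proof -
    have "sum dS' W = sum2 m (\<lambda>k l. \<bar>(norm (F (k - l) l))\<^sup>2 - (norm (F k l))\<^sup>2\<bar>)"
      unfolding dS'_def \<mu>_def by (subst win) (simp_all add: ps)
    also have "\<dots> \<le> 16 * ES + M / 16"
      unfolding ES_def using sum2_shear1[OF m perm, of "- 1"] by (intro bnd) (simp add: M_def)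
    finally show ?thesis .
  qed
  have T': "sum dT' W \<le> 16 * ET + M / 16"
  proof -
    have "sum dT' W = sum2 m (\<lambda>k l. \<bar>(norm (F k (l - k)))\<^sup>2 - (norm (F k l))\<^sup>2\<bar>)"
      unfolding dT'_def \<mu>_def by (subst win) (simp_all add: ps)
    also have "\<dots> \<le> 16 * ET + M / 16"
      unfolding ET_def using sum2_shear2[OF m perm, of "- 1"] by (intro bnd) (simp add: M_def)
    finally show ?thesis .
  qed
  \<comment> \<open>The defect of a shear equals that of its inverse, by substituting the sheared
    point. The bound is to mention inverse shears only, whereas \<open>Q1\<close> and
    \<open>Q3\<close> are moved into themselves by the forward ones.\<close>
  have S: "sum dS W = sum dS' W"
  proof -
    have "sum dS' W = sum2 m (\<lambda>k l. \<bar>(norm (F (k - l) l))\<^sup>2 - (norm (F k l))\<^sup>2\<bar>)"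
      unfolding dS'_def \<mu>_def by (subst win) (simp_all add: ps)
    also have "\<dots> = sum2 m (\<lambda>k l. \<bar>(norm (F (k + 1 * l - l) l))\<^sup>2 - (norm (F (k + 1 * l) l))\<^sup>2\<bar>)"
      by (rule sum2_shear1[OF m, symmetric]) (simp add: ps)
    also have "\<dots> = sum dS W"
      unfolding dS_def \<mu>_def by (subst win) (simp_all add: ps abs_minus_commute)
    finally show ?thesis by simp
  qed
  have T: "sum dT W = sum dT' W"
  proof -
    have "sum dT' W = sum2 m (\<lambda>k l. \<bar>(norm (F k (l - k)))\<^sup>2 - (norm (F k l))\<^sup>2\<bar>)"
      unfolding dT'_def \<mu>_def by (subst win) (simp_all add: ps)
    also have "\<dots> = sum2 m (\<lambda>k l. \<bar>(norm (F k (l + 1 * k - k)))\<^sup>2 - (norm (F k (l + 1 * k)))\<^sup>2\<bar>)"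
      by (rule sum2_shear2[OF m, symmetric]) (simp add: ps)
    also have "\<dots> = sum dT W"
      unfolding dT_def \<mu>_def by (subst win) (simp_all add: ps abs_minus_commute)
    finally show ?thesis by simp
  qed
  \<comment> \<open>A cone whose images under two shears are disjoint subcones carries little mass, because the
    shears almost preserve the mass.\<close>
  have quad: "sum \<mu> (Q \<inter> B) \<le> sum d1 W + sum d2 W + sum \<mu> (Q - B)"
    if Q: "Q \<subseteq> W" and i1: "inj f1" and i2: "inj f2" and sub: "f1 ` (Q \<inter> B) \<subseteq> Q" "f2 ` (Q \<inter> B) \<subseteq> Q"
      and disj: "f1 ` (Q \<inter> B) \<inter> f2 ` (Q \<inter> B) = {}"
      and d: "\<And>z. d1 z = \<bar>\<mu> (f1 z) - \<mu> z\<bar>" "\<And>z. d2 z = \<bar>\<mu> (f2 z) - \<mu> z\<bar>" for Q f1 f2 d1 d2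
  proof -
    have fQ: "finite Q" using Q fW by (rule finite_subset)
    have *: "sum \<mu> (Q \<inter> B) \<le> sum \<mu> (f ` (Q \<inter> B)) + sum d' W"
      if "inj f" and d': "\<And>z. d' z = \<bar>\<mu> (f z) - \<mu> z\<bar>" for f :: "int \<times> int \<Rightarrow> int \<times> int" and d'
    proof -
      have "sum \<mu> (Q \<inter> B) \<le> (\<Sum>z\<in>Q \<inter> B. \<mu> (f z) + d' z)" by (rule sum_mono) (simp add: d')
      also have "\<dots> = sum \<mu> (f ` (Q \<inter> B)) + sum d' (Q \<inter> B)"
        using inj_on_subset[OF \<open>inj f\<close> subset_UNIV] by (simp add: sum.distrib sum.reindex)
      also have "sum d' (Q \<inter> B) \<le> sum d' W"
        by (rule sum_mono2[OF fW]) (use Q d' in auto)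
      finally show ?thesis by simp
    qed
    have "sum \<mu> (f1 ` (Q \<inter> B)) + sum \<mu> (f2 ` (Q \<inter> B)) = sum \<mu> (f1 ` (Q \<inter> B) \<union> f2 ` (Q \<inter> B))"
      using disj fQ by (intro sum.union_disjoint[symmetric]) auto
    also have "\<dots> \<le> sum \<mu> Q" using sub by (intro sum_mono2[OF fQ]) (auto simp: mu0)
    also have "\<dots> = sum \<mu> (Q \<inter> B) + sum \<mu> (Q - B)"
      by (rule sum.Int_Diff[OF fQ])
    finally show ?thesis using *[OF i1 d(1)] *[OF i2 d(2)] by linarith
  qed
  \<comment> \<open>Each quadrant owns exactly one of its two bounding half-axes. The quadrants then
    partition the nonzero points, and the two images in a quadrant are separated by comparing the
    absolute values of the coordinates: one comparison is strict, the other is not.\<close>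
  define Q1 where "Q1 = {z \<in> W. 0 < fst z \<and> 0 \<le> snd z}"
  define Q2 where "Q2 = {z \<in> W. fst z \<le> 0 \<and> 0 < snd z}"
  define Q3 where "Q3 = {z \<in> W. fst z < 0 \<and> snd z \<le> 0}"
  define Q4 where "Q4 = {z \<in> W. 0 \<le> fst z \<and> snd z < 0}"
  note qd = Q1_def Q2_def Q3_def Q4_def B_def W_def h_def
  have injs: "inj (\<lambda>z::int\<times>int. (fst z + snd z, snd z))" "inj (\<lambda>z::int\<times>int. (fst z, snd z + fst z))"
    "inj (\<lambda>z::int\<times>int. (fst z - snd z, snd z))" "inj (\<lambda>z::int\<times>int. (fst z, snd z - fst z))"
    by (auto simp: inj_def prod_eq_iff)
  have q1: "sum \<mu> (Q1 \<inter> B) \<le> sum dS W + sum dT W + sum \<mu> (Q1 - B)"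
    by (rule quad[OF _ injs(1,2) _ _ _ dS_def[THEN fun_cong] dT_def[THEN fun_cong]]) (use m in \<open>auto simp: qd\<close>)
  have q3: "sum \<mu> (Q3 \<inter> B) \<le> sum dS W + sum dT W + sum \<mu> (Q3 - B)"
    by (rule quad[OF _ injs(1,2) _ _ _ dS_def[THEN fun_cong] dT_def[THEN fun_cong]]) (use m in \<open>auto simp: qd\<close>)
  have q2: "sum \<mu> (Q2 \<inter> B) \<le> sum dS' W + sum dT' W + sum \<mu> (Q2 - B)"
    by (rule quad[OF _ injs(3,4) _ _ _ dS'_def[THEN fun_cong] dT'_def[THEN fun_cong]]) (use m in \<open>auto simp: qd\<close>)
  have q4: "sum \<mu> (Q4 \<inter> B) \<le> sum dS' W + sum dT' W + sum \<mu> (Q4 - B)"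
    by (rule quad[OF _ injs(3,4) _ _ _ dS'_def[THEN fun_cong] dT'_def[THEN fun_cong]]) (use m in \<open>auto simp: qd\<close>)
  have split: "sum \<mu> (W \<inter> A) = sum \<mu> (Q1 \<inter> A) + sum \<mu> (Q2 \<inter> A) + sum \<mu> (Q3 \<inter> A) + sum \<mu> (Q4 \<inter> A)" for A
  proof -
    have "sum \<mu> (W \<inter> A) = sum \<mu> ((Q1 \<inter> A) \<union> (Q2 \<inter> A) \<union> (Q3 \<inter> A) \<union> (Q4 \<inter> A))"
    proof (rule sum.mono_neutral_right)
      show "finite (W \<inter> A)" using fW by simp
      show "\<forall>z\<in>W \<inter> A - (Q1 \<inter> A \<union> Q2 \<inter> A \<union> Q3 \<inter> A \<union> Q4 \<inter> A). \<mu> z = 0"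
      proof
        fix z assume "z \<in> W \<inter> A - (Q1 \<inter> A \<union> Q2 \<inter> A \<union> Q3 \<inter> A \<union> Q4 \<inter> A)"
        then have "fst z = 0 \<and> snd z = 0" by (auto simp: Q1_def Q2_def Q3_def Q4_def)
        then show "\<mu> z = 0" by (simp add: \<mu>_def F0)
      qed
    qed (auto simp: qd)
    also have "\<dots> = sum \<mu> (Q1 \<inter> A) + sum \<mu> (Q2 \<inter> A) + sum \<mu> (Q3 \<inter> A) + sum \<mu> (Q4 \<inter> A)"
    proof -
      have "finite (Q1 \<inter> A)" "finite (Q2 \<inter> A)" "finite (Q3 \<inter> A)" "finite (Q4 \<inter> A)"
        using fW by (simp_all add: Q1_def Q2_def Q3_def Q4_def)
      moreover have "(Q1 \<inter> A) \<inter> (Q2 \<inter> A) = {}" "(Q1 \<inter> A \<union> Q2 \<inter> A) \<inter> (Q3 \<inter> A) = {}"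
        "(Q1 \<inter> A \<union> Q2 \<inter> A \<union> Q3 \<inter> A) \<inter> (Q4 \<inter> A) = {}"
        by (auto simp: Q1_def Q2_def Q3_def Q4_def)
      ultimately show ?thesis by (simp only: sum.union_disjoint finite_Un simp_thms)
    qed
    finally show ?thesis .
  qed
  have "sum \<mu> (W \<inter> B) \<le> 2 * (sum dS W + sum dT W) + 2 * (sum dS' W + sum dT' W) + sum \<mu> (W - B)"
    using q1 q2 q3 q4 split[of B] split[of "- B"] unfolding Diff_eq
    by argo
  then have 1: "M \<le> 4 * (16 * ES + 16 * ET + M / 8) + 2 * sum \<mu> (W - B)"
    using S T S' T' sum.Int_Diff[OF fW, of \<mu> B] M by argo
  have "sum \<mu> (W - B) * 2 \<le> (\<Sum>z\<in>W - B. (norm (char m (- fst z) * F (fst z) (snd z) - F (fst z) (snd z)))\<^sup>2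
      + (norm (char m (- snd z) * F (fst z) (snd z) - F (fst z) (snd z)))\<^sup>2)"
    unfolding sum_distrib_right
  proof (rule sum_mono)
    fix z assume z: "z \<in> W - B"
    have e: "(norm (c * w - w))\<^sup>2 = (norm w)\<^sup>2 * (norm (1 - c))\<^sup>2" for c w :: complex
    proof -
      have "c * w - w = - (w * (1 - c))" by (simp add: algebra_simps)
      then show ?thesis by (simp only: norm_minus_cancel norm_mult power_mult_distrib)
    qed
    have r: "2 * \<bar>fst z\<bar> \<le> m" "2 * \<bar>snd z\<bar> \<le> m" using z by (auto simp: W_def h_def)
    have "m \<le> 4 * \<bar>fst z\<bar> \<or> m \<le> 4 * \<bar>snd z\<bar>" using z by (auto simp: B_def)
    then have "2 \<le> (norm (1 - char m (- fst z)))\<^sup>2 + (norm (1 - char m (- snd z)))\<^sup>2"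
      using norm_one_minus_char[OF m _ r(1)] norm_one_minus_char[OF m _ r(2)]
      by (smt (verit) zero_le_power2)
    then have "\<mu> z * 2 \<le> \<mu> z * ((norm (1 - char m (- fst z)))\<^sup>2 + (norm (1 - char m (- snd z)))\<^sup>2)"
      by (rule mult_left_mono) (rule mu0)
    then show "\<mu> z * 2 \<le> (norm (char m (- fst z) * F (fst z) (snd z) - F (fst z) (snd z)))\<^sup>2
      + (norm (char m (- snd z) * F (fst z) (snd z) - F (fst z) (snd z)))\<^sup>2"
      by (simp add: e \<mu>_def distrib_left)
  qed
  also have "\<dots> \<le> (\<Sum>z\<in>W. (norm (char m (- fst z) * F (fst z) (snd z) - F (fst z) (snd z)))\<^sup>2
      + (norm (char m (- snd z) * F (fst z) (snd z) - F (fst z) (snd z)))\<^sup>2)"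
    by (rule sum_mono2[OF fW]) auto
  also have "\<dots> = cdist (\<lambda>k l. char m (- k) * F k l) F m + cdist (\<lambda>k l. char m (- l) * F k l) F m"
  proof -
    have cm: "char m (- (k + m)) = char m (- k)" for k
      using char_period[of m "- k" "- 1"] m by simp
    show ?thesis unfolding cdist_def sum.distrib
      by (subst (1 2) win) (simp_all only: cm ps simp_thms)
  qed
  finally have "2 * sum \<mu> (W - B) \<le> cdist (\<lambda>k l. char m (- k) * F k l) F m + cdist (\<lambda>k l. char m (- l) * F k l) F m"
    by simp
  then show ?thesis using 1 unfolding ES_def ET_def by (simp add: field_simps)
qed

text \<open>A Poincare inequality whose constant does not depend on \<open>m\<close>. Parseval
  transports the quadrant bound back to the grid: mean zero becomes vanishing at frequency 0, shears
  become inverse transposed shears, and translations become multiplication by characters.\<close>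

theorem gabber_galil:
  fixes f :: "int \<Rightarrow> int \<Rightarrow> complex"
  assumes m: "0 < m" and per: "periodic2 m f" and f0: "sum2 m f = 0"
  shows "sum2 m (\<lambda>x y. (norm (f x y))\<^sup>2) \<le> 128 *
    (cdist (\<lambda>x y. f (x + y) y) f m + cdist (\<lambda>x y. f x (y + x)) f m
     + cdist (\<lambda>x y. f (x + 1) y) f m + cdist (\<lambda>x y. f x (y + 1)) f m)"
proof -
  let ?F = "dft2 m f"
  have mm: "0 < (of_int m :: real)\<^sup>2" using m by simp
  have c: "cdist (\<lambda>k l. dft2 m g k l) ?F m = (of_int m)\<^sup>2 * cdist g f m" for g
    using cdist_dft2[OF m] by simp
  have nn: "0 \<le> cdist g f m" for g by (auto simp: cdist_def sum2_def intro!: sum_nonneg)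
  have "(of_int m)\<^sup>2 * sum2 m (\<lambda>x y. (norm (f x y))\<^sup>2) = sum2 m (\<lambda>k l. (norm (?F k l))\<^sup>2)"
    by (simp add: parseval2[OF m])
  also have "\<dots> \<le> 128 * (cdist (\<lambda>k l. ?F k (l - k)) ?F m + cdist (\<lambda>k l. ?F (k - l) l) ?F m)
     + 2 * (cdist (\<lambda>k l. char m (- k) * ?F k l) ?F m + cdist (\<lambda>k l. char m (- l) * ?F k l) ?F m)"
    by (rule spectral_quadrant_bound[OF m periodic2_dft2[OF m]])
       (use f0 in \<open>simp add: dft2_def\<close>)
  also have "\<dots> = (of_int m)\<^sup>2 * (128 * (cdist (\<lambda>x y. f (x + y) y) f m + cdist (\<lambda>x y. f x (y + x)) f m)
     + 2 * (cdist (\<lambda>x y. f (x + 1) y) f m + cdist (\<lambda>x y. f x (y + 1)) f m))"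
    unfolding dft2_shear1[OF m per, symmetric] dft2_shear2[OF m per, symmetric]
      dft2_translate1[OF m per, symmetric] dft2_translate2[OF m per, symmetric] c
    by (simp add: algebra_simps)
  finally have "sum2 m (\<lambda>x y. (norm (f x y))\<^sup>2) \<le> 128 * (cdist (\<lambda>x y. f (x + y) y) f m + cdist (\<lambda>x y. f x (y + x)) f m)
     + 2 * (cdist (\<lambda>x y. f (x + 1) y) f m + cdist (\<lambda>x y. f x (y + 1)) f m)"
    using mm by (simp only: mult_le_cancel_left_pos)
  then show ?thesis
    using nn[of "\<lambda>x y. f (x + 1) y"] nn[of "\<lambda>x y. f x (y + 1)"] by simp
qed

section \<open>The expander on \<open>n\<close> vertices obtained by folding the grid\<close>

definition grid_nbrs :: "nat \<Rightarrow> nat \<Rightarrow> nat list" where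
  "grid_nbrs m z = (let x = z div m; y = z mod m in
     [((x + y) mod m) * m + y, x * m + (x + y) mod m, ((x + 1) mod m) * m + y, x * m + (y + 1) mod m])"

definition expander_row :: "nat \<Rightarrow> nat \<Rightarrow> nat \<Rightarrow> (nat \<times> nat) list" where
  "expander_row n m z = map (\<lambda>w. (z mod n, w mod n)) (grid_nbrs m z)"

text \<open>Reducing the vertices of a square grid modulo \<open>n\<close> gives an expander for
  every \<open>n\<close>. Loops and repeated pairs can arise and are kept, so that crossings are
  counted with multiplicity.\<close>

definition expander :: "nat \<Rightarrow> nat \<Rightarrow> (nat \<times> nat) list" where
  "expander n m = concat (map (expander_row n m) [0..<m * m])"

definition crossing :: "nat set \<Rightarrow> (nat \<times> nat) list \<Rightarrow> nat" where
  "crossing X ps = length (filter (\<lambda>(u, v). (u \<in> X) \<noteq> (v \<in> X)) ps)"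

lemma length_filter_expander:
  "length (filter P (expander n m)) = (\<Sum>z<m * m. length (filter P (expander_row n m z)))"
  by (simp add: expander_def filter_concat length_concat comp_def
      interv_sum_list_conv_sum_set_nat atLeast0LessThan)

lemma grid_decode:
  assumes "y < (m::nat)" shows "(x * m + y) div m = x" "(x * m + y) mod m = y"
  using assms by simp_all

lemma grid_bound:
  assumes "x < m" "y < (m::nat)" shows "x * m + y < m * m"
proof -
  have "x * m + y < (x + 1) * m" using assms by simp
  also have "\<dots> \<le> m * m" using assms by (intro mult_right_mono) auto
  finally show ?thesis .
qed

lemma mod_add_if:
  assumes "x < m" "y < (m::nat)"
  shows "(x + y) mod m = (if x + y < m then x + y else x + y - m)"
proof (cases "x + y < m")
  case False
  then have "(x + y) mod m = (x + y - m) mod m" by (simp add: le_mod_geq)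
  then show ?thesis using False assms by simp
qed simp

lemma mod_add_right_cancel:
  assumes "x < m" "x' < m" "(x + y) mod m = (x' + y) mod (m::nat)" shows "x = x'"
proof -
  have "(x + y mod m) mod m = (x' + y mod m) mod m" using assms(3) by (simp add: mod_simps)
  moreover have "y mod m < m" using assms(1) by simp
  ultimately show ?thesis using assms(1,2) by (auto simp: mod_add_if split: if_splits)
qed

lemma grid_nbrs_nth:
  "grid_nbrs m z ! 0 = ((z div m + z mod m) mod m) * m + z mod m"
  "grid_nbrs m z ! 1 = (z div m) * m + (z div m + z mod m) mod m"
  "grid_nbrs m z ! 2 = ((z div m + 1) mod m) * m + z mod m"
  "grid_nbrs m z ! 3 = (z div m) * m + (z mod m + 1) mod m"
  by (simp_all add: grid_nbrs_def Let_def)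

text \<open>Each of the four generators permutes the grid. Hence a point is the \<open>j\<close>-th
  neighbour of only one other point, which controls the pairs that end at a vertex.\<close>

lemma grid_nbrs_inj:
  assumes "j < 4"
  shows "inj_on (\<lambda>z. grid_nbrs m z ! j) {..<m * m}" "(\<lambda>z. grid_nbrs m z ! j) ` {..<m * m} \<subseteq> {..<m * m}"
proof -
  have m: "0 < m" if "z < m * m" for z using that by (cases m) auto
  have zd: "z div m < m" if "z < m * m" for z using that by (simp add: less_mult_imp_div_less)
  have ze: "z = z'" if "z div m = z' div m" "z mod m = z' mod m" for z z'
    using that by (metis div_mult_mod_eq)
  have dec: "a = a' \<and> b = b'" if "a * m + b = a' * m + b'" "b < m" "b' < m" for a b a' b'
    using grid_decode[OF that(2)] grid_decode[OF that(3)] that(1) by metis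
  have cases: "j = 0 \<or> j = 1 \<or> j = 2 \<or> j = 3" using assms by auto
  show "(\<lambda>z. grid_nbrs m z ! j) ` {..<m * m} \<subseteq> {..<m * m}"
    using cases m zd by (auto simp: grid_nbrs_def Let_def intro!: grid_bound)
  show "inj_on (\<lambda>z. grid_nbrs m z ! j) {..<m * m}"
  proof (rule inj_onI)
    fix z z' assume z: "z \<in> {..<m * m}" "z' \<in> {..<m * m}" and eq: "grid_nbrs m z ! j = grid_nbrs m z' ! j"
    have zm: "0 < m" "z div m < m" "z' div m < m" "z mod m < m" "z' mod m < m"
      using z m[of z] zd[of z] zd[of z'] by auto
    consider "j = 0" | "j = 1" | "j = 2" | "j = 3" using cases by auto
    then show "z = z'"
    proof cases
      case 1
      have "(z div m + z mod m) mod m = (z' div m + z' mod m) mod m \<and> z mod m = z' mod m"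
        by (rule dec[OF eq[unfolded 1 grid_nbrs_nth]]) (use zm in simp_all)
      then show ?thesis by (metis ze mod_add_right_cancel[OF zm(2,3)])
    next
      case 2
      have "z div m = z' div m \<and> (z div m + z mod m) mod m = (z' div m + z' mod m) mod m"
        by (rule dec[OF eq[unfolded 2 grid_nbrs_nth]]) (use zm in simp_all)
      then show ?thesis by (metis ze add.commute mod_add_right_cancel[OF zm(4,5)])
    next
      case 3
      have "(z div m + 1) mod m = (z' div m + 1) mod m \<and> z mod m = z' mod m"
        by (rule dec[OF eq[unfolded 3 grid_nbrs_nth]]) (use zm in simp_all)
      then show ?thesis by (metis ze mod_add_right_cancel[OF zm(2,3)])
    next
      case 4
      have "z div m = z' div m \<and> (z mod m + 1) mod m = (z' mod m + 1) mod m"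
        by (rule dec[OF eq[unfolded 4 grid_nbrs_nth]]) (use zm in simp_all)
      then show ?thesis by (metis ze mod_add_right_cancel[OF zm(4,5)])
    qed
  qed
qed

lemma card_residue_class:
  fixes n N v :: nat
  assumes "0 < n" "N \<le> 4 * n"
  shows "card {z. z < N \<and> z mod n = v} \<le> 4"
proof -
  have "{z. z < N \<and> z mod n = v} \<subseteq> (\<lambda>q. q * n + v) ` {..<4}"
  proof
    fix z assume z: "z \<in> {z. z < N \<and> z mod n = v}"
    then have "z mod n = v" by simp
    then have "z = (z div n) * n + v" using div_mult_mod_eq[of z n, symmetric] by (simp only:)
    moreover have "z div n < 4" using z assms by (simp add: less_mult_imp_div_less)
    ultimately show "z \<in> (\<lambda>q. q * n + v) ` {..<4}" by blast
  qed
  then have "card {z. z < N \<and> z mod n = v} \<le> card ((\<lambda>q. q * n + v) ` {..<4::nat})"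
    by (rule card_mono[rotated]) simp
  also have "\<dots> \<le> 4" using card_image_le[of "{..<4::nat}"] by simp
  finally show ?thesis .
qed

text \<open>At most four grid points fold onto \<open>v\<close>. Each is the first component of four
  pairs and, the generators being injective, the second component of at most four:
  \<open>4 * 4 + 4 * 4 = 32\<close>.\<close>

lemma expander_degree:
  assumes n: "0 < n" and m: "m * m \<le> 4 * n"
  shows "length (filter (\<lambda>(a, b). a = v \<or> b = v) (expander n m)) \<le> 32"
proof -
  let ?N = "m * m"
  define A where "A = (\<lambda>z. of_bool (z mod n = v) :: nat)"
  define C where "C = (\<lambda>j z. of_bool (grid_nbrs m z ! j mod n = v) :: nat)"
  have s1: "sum A {..<?N} \<le> 4"
  proof -
    have "sum A {..<?N} = card {z. z < ?N \<and> z mod n = v}"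
      by (simp add: A_def of_bool_def sum.If_cases Int_def)
    then show ?thesis using card_residue_class[OF n m] by simp
  qed
  have s2: "sum (C j) {..<?N} \<le> 4" if "j < 4" for j
  proof -
    have "sum (C j) {..<?N} = sum A ((\<lambda>z. grid_nbrs m z ! j) ` {..<?N})"
      by (subst sum.reindex[OF grid_nbrs_inj(1)[OF that]]) (simp add: A_def C_def comp_def)
    also have "\<dots> \<le> sum A {..<?N}"
      by (rule sum_mono2) (use grid_nbrs_inj(2)[OF that] in \<open>auto simp: A_def\<close>)
    finally show ?thesis using s1 by simp
  qed
  have "length (filter (\<lambda>(a, b). a = v \<or> b = v) (expander_row n m z))
      \<le> 4 * A z + (C 0 z + C 1 z + C 2 z + C 3 z)" for z
    by (auto simp: expander_row_def grid_nbrs_def Let_def A_def C_def)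
  then have "length (filter (\<lambda>(a, b). a = v \<or> b = v) (expander n m))
      \<le> (\<Sum>z<?N. 4 * A z + (C 0 z + C 1 z + C 2 z + C 3 z))"
    unfolding length_filter_expander by (intro sum_mono)
  also have "\<dots> = 4 * sum A {..<?N} + (sum (C 0) {..<?N} + sum (C 1) {..<?N} + sum (C 2) {..<?N} + sum (C 3) {..<?N})"
    by (simp add: sum.distrib sum_distrib_left)
  also have "\<dots> \<le> 32" using s1 s2[of 0] s2[of 1] s2[of 2] s2[of 3] by simp
  finally show ?thesis .
qed

lemma sum2_grid:
  assumes "0 < m"
  shows "sum2 (int m) h = (\<Sum>z<m * m. h (int (z div m)) (int (z mod m)))"
proof -
  have "sum2 (int m) h = (\<Sum>p\<in>{0..<int m} \<times> {0..<int m}. h (fst p) (snd p))"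
    by (simp add: sum2_def sum.cartesian_product case_prod_beta)
  also have "\<dots> = (\<Sum>z<m * m. h (int (z div m)) (int (z mod m)))"
    by (rule sum.reindex_bij_witness[of _ "\<lambda>z. (int (z div m), int (z mod m))"
          "\<lambda>p. nat (fst p) * m + nat (snd p)"])
       (use assms in \<open>auto simp: less_mult_imp_div_less intro!: grid_bound\<close>)
  finally show ?thesis .
qed

text \<open>The Poincare inequality is applied to the indicator of the preimage \<open>A\<close> of
  \<open>X\<close>, minus its density. Every crossing pair contributes exactly 1 to the energy, and
  the squared norm \<open>|A| (N - |A|) / N\<close> is at least half of the smaller side because the
  larger side has at least \<open>N / 2\<close> points; this turns 128 into 256. Passing from
  \<open>X\<close> to its preimage shrinks neither side, as \<open>n \<le> m * m\<close>.\<close>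

theorem expander_expansion:
  assumes n: "0 < n" "n \<le> m * m" and X: "X \<subseteq> {..<n}"
  shows "min (card X) (card ({..<n} - X)) \<le> 256 * crossing X (expander n m)"
proof -
  let ?N = "m * m"
  have m: "0 < m" using n by (cases m) auto
  define A where "A = {z. z < ?N \<and> z mod n \<in> X}"
  define p where "p = real (card A) / real ?N"
  define g where "g = (\<lambda>x y. (nat (x mod int m) * m + nat (y mod int m)) mod n)"
  define f where "f = (\<lambda>x y. complex_of_real (of_bool (g x y \<in> X) - p))"
  have gz: "g (int (z div m)) (int (z mod m)) = z mod n" if "z < ?N" for z
    using that m by (simp add: g_def less_mult_imp_div_less flip: zmod_int)
  have g0: "g (int (z div m) + int (z mod m)) (int (z mod m)) = grid_nbrs m z ! 0 mod n"
     "g (int (z div m)) (int (z mod m) + int (z div m)) = grid_nbrs m z ! 1 mod n"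
     "g (int (z div m) + 1) (int (z mod m)) = grid_nbrs m z ! 2 mod n"
     "g (int (z div m)) (int (z mod m) + 1) = grid_nbrs m z ! 3 mod n" if "z < ?N" for z
  proof -
    have *: "nat ((int a + int b) mod int m) = (a + b) mod m" "nat ((int a + 1) mod int m) = (a + 1) mod m"
      "nat (int a mod int m) = a mod m" for a b
      by (simp_all flip: zmod_int of_nat_add of_nat_Suc add: add.commute)
    have d: "z div m < m" using that by (simp add: less_mult_imp_div_less)
    show "g (int (z div m) + int (z mod m)) (int (z mod m)) = grid_nbrs m z ! 0 mod n"
     "g (int (z div m)) (int (z mod m) + int (z div m)) = grid_nbrs m z ! 1 mod n"
     "g (int (z div m) + 1) (int (z mod m)) = grid_nbrs m z ! 2 mod n"
     "g (int (z div m)) (int (z mod m) + 1) = grid_nbrs m z ! 3 mod n"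
      using d by (simp_all only: g_def *) (simp_all add: grid_nbrs_def Let_def add.commute)
  qed
  have gper: "g (x + int m) y = g x y" "g x (y + int m) = g x y" for x y by (simp_all add: g_def)
  have per: "periodic2 (int m) f" by (simp add: periodic2_def f_def gper)
  have cA: "(\<Sum>z<?N. of_bool (z mod n \<in> X)) = real (card A)"
    by (simp add: A_def of_bool_def sum.If_cases Int_def)
  have cAN: "card A \<le> ?N"
    using card_mono[of "{..<?N}" A] by (auto simp: A_def)
  have Npos: "0 < real ?N" using m by simp
  have "sum2 (int m) f = complex_of_real (\<Sum>z<?N. of_bool (z mod n \<in> X) - p)"
    unfolding sum2_grid[OF m] of_real_sum by (intro sum.cong refl) (simp add: f_def gz)
  also have "(\<Sum>z<?N. of_bool (z mod n \<in> X) - p) = 0"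
    using m by (simp add: sum_subtractf cA p_def)
  finally have f0: "sum2 (int m) f = 0" by simp
  have nf: "sum2 (int m) (\<lambda>x y. (norm (f x y))\<^sup>2) = real (card A) * (real ?N - real (card A)) / real ?N"
  proof -
    have "sum2 (int m) (\<lambda>x y. (norm (f x y))\<^sup>2) = (\<Sum>z<?N. (of_bool (z mod n \<in> X) - p)\<^sup>2)"
      unfolding sum2_grid[OF m] by (intro sum.cong refl) (simp add: f_def gz flip: of_real_diff)
    also have "\<dots> = (\<Sum>z<?N. of_bool (z mod n \<in> X) * (1 - 2 * p) + p\<^sup>2)"
      by (intro sum.cong refl) (simp add: power2_eq_square algebra_simps)
    also have "\<dots> = real (card A) * (1 - 2 * p) + real ?N * p\<^sup>2"
      by (simp add: sum.distrib sum_distrib_right[symmetric] cA)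
    also have "\<dots> = real (card A) * (real ?N - real (card A)) / real ?N"
      using m by (simp add: p_def power2_eq_square field_simps)
    finally show ?thesis .
  qed
  have cd: "cdist (\<lambda>x y. f (a x y) (b x y)) f (int m)
      = (\<Sum>z<?N. of_bool ((z mod n \<in> X) \<noteq> (grid_nbrs m z ! j mod n \<in> X)))"
    if "\<And>z. z < ?N \<Longrightarrow> g (a (int (z div m)) (int (z mod m))) (b (int (z div m)) (int (z mod m))) = grid_nbrs m z ! j mod n"
    for a b :: "int \<Rightarrow> int \<Rightarrow> int" and j
    unfolding cdist_def sum2_grid[OF m]
    by (intro sum.cong refl) (simp add: f_def gz that flip: of_real_diff)
  have row: "real (crossing X (expander_row n m z)) =
     of_bool ((z mod n \<in> X) \<noteq> (grid_nbrs m z ! 0 mod n \<in> X)) + of_bool ((z mod n \<in> X) \<noteq> (grid_nbrs m z ! 1 mod n \<in> X))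
     + of_bool ((z mod n \<in> X) \<noteq> (grid_nbrs m z ! 2 mod n \<in> X)) + of_bool ((z mod n \<in> X) \<noteq> (grid_nbrs m z ! 3 mod n \<in> X))" for z
    by (auto simp: crossing_def expander_row_def grid_nbrs_def Let_def)
  have "sum2 (int m) (\<lambda>x y. (norm (f x y))\<^sup>2) \<le> 128 * real (crossing X (expander n m))"
  proof -
    have "sum2 (int m) (\<lambda>x y. (norm (f x y))\<^sup>2) \<le> 128 *
      (cdist (\<lambda>x y. f (x + y) y) f (int m) + cdist (\<lambda>x y. f x (y + x)) f (int m)
       + cdist (\<lambda>x y. f (x + 1) y) f (int m) + cdist (\<lambda>x y. f x (y + 1)) f (int m))"
      using m by (intro gabber_galil[OF _ per f0]) simp
    also have "cdist (\<lambda>x y. f (x + y) y) f (int m) + cdist (\<lambda>x y. f x (y + x)) f (int m)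
       + cdist (\<lambda>x y. f (x + 1) y) f (int m) + cdist (\<lambda>x y. f x (y + 1)) f (int m)
      = (\<Sum>z<?N. real (crossing X (expander_row n m z)))"
      by (subst (1) cd[OF g0(1)], assumption, subst (1) cd[OF g0(2)], assumption,
          subst (1) cd[OF g0(3)], assumption, subst (1) cd[OF g0(4)], assumption)
         (simp only: row sum.distrib)
    also have "\<dots> = real (crossing X (expander n m))"
      unfolding crossing_def length_filter_expander by simp
    finally show ?thesis .
  qed
  then have *: "real (card A) * (real ?N - real (card A)) / real ?N \<le> 128 * real (crossing X (expander n m))"
    by (simp add: nf)
  have half: "real (min (card A) (?N - card A)) \<le> 2 * (real (card A) * (real ?N - real (card A)) / real ?N)"
  proof -
    define a where "a = real (card A)"
    define N where "N = real ?N"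
    have aN: "0 \<le> a" "a \<le> N" "0 < N" using cAN Npos by (auto simp: a_def N_def simp flip: of_nat_mult)
    have "min a (N - a) * N \<le> 2 * (a * (N - a))"
    proof (cases "a \<le> N - a")
      case True
      have "a * N \<le> a * (2 * (N - a))" using True aN by (intro mult_left_mono) auto
      then show ?thesis using True by (simp add: min_def algebra_simps)
    next
      case False
      have "(N - a) * N \<le> (N - a) * (2 * a)" using False aN by (intro mult_left_mono) auto
      then show ?thesis using False by (simp add: min_def algebra_simps)
    qed
    then have "min a (N - a) \<le> 2 * (a * (N - a) / N)" using aN by (simp add: field_simps)
    moreover have "real (min (card A) (?N - card A)) = min a (N - a)"
      using cAN by (simp add: a_def N_def of_nat_diff of_nat_min)
    ultimately show ?thesis by (simp add: a_def N_def)
  qed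
  have "card X \<le> card A"
    using n X by (intro card_mono) (auto simp: A_def)
  moreover have "card ({..<n} - X) \<le> ?N - card A"
  proof -
    have "card ({..<n} - X) \<le> card ({..<?N} - A)"
      using n by (intro card_mono) (auto simp: A_def)
    also have "\<dots> = ?N - card A" by (subst card_Diff_subset) (auto simp: A_def)
    finally show ?thesis .
  qed
  ultimately have "real (min (card X) (card ({..<n} - X))) \<le> real (min (card A) (?N - card A))"
    by linarith
  also have "\<dots> \<le> real (256 * crossing X (expander n m))" using half * by simp
  finally show ?thesis by (simp only: of_nat_le_iff)
qed

section \<open>Weakest preconditions\<close>

lemma sel_simps [simp]:
  "nmem (nset a i x s) = (nmem s)(a := (nmem s a)(i := x))"
  "rmem (nset a i x s) = rmem s"
  "path_buffer (nset a i x s) = path_buffer s"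
  "init_weights (nset a i x s) = init_weights s"
  "history (nset a i x s) = history s"
  "steps (nset a i x s) = steps s"
  "nmem (rset a i r s) = nmem s"
  "rmem (rset a i r s) = (rmem s)(a := (rmem s a)(i := r))"
  "path_buffer (rset a i r s) = path_buffer s"
  "init_weights (rset a i r s) = init_weights s"
  "history (rset a i r s) = history s"
  "steps (rset a i r s) = steps s"
  "nmem (tick s) = nmem s"
  "rmem (tick s) = rmem s"
  "path_buffer (tick s) = path_buffer s"
  "init_weights (tick s) = init_weights s"
  "history (tick s) = history s"
  "steps (tick s) = Suc (steps s)"
  "nmem (log_op q s) = nmem s"
  "rmem (log_op q s) = rmem s"
  "path_buffer (log_op q s) = path_buffer s"
  "init_weights (log_op q s) = init_weights s"
  "history (log_op q s) = history s @ [q]"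
  "steps (log_op q s) = steps s"
  by (simp_all add: nset_def rset_def tick_def log_op_def)

locale ram =
  fixes n :: nat and es :: "(nat \<times> nat) list" and D :: apsp
begin

text \<open>Execution is deterministic, so the existence of a run with the required end state is
  total correctness. An illegal call of the data structure has no run; legality is therefore part of
  what has to be proved.\<close>

definition wp :: "com \<Rightarrow> (state \<Rightarrow> bool) \<Rightarrow> state \<Rightarrow> bool" where
  "wp c Q s \<longleftrightarrow> (\<exists>t. exec n es D c s t \<and> Q t)"

lemma wp_Skip [simp]: "wp Skip Q s = Q (tick s)"
  by (auto simp: wp_def intro: exec.intros elim: exec.cases)

lemma wp_NSet [simp]: "wp (NSet a i x) Q s = Q (tick (nset a (neval s i) (neval s x) s))"
  by (auto simp: wp_def intro: exec.intros elim: exec.cases)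

lemma wp_RSet [simp]: "wp (RSet a i x) Q s = Q (tick (rset a (neval s i) (reval s x) s))"
  by (auto simp: wp_def intro: exec.intros elim: exec.cases)

lemma wp_Seq [simp]: "wp (Seq c1 c2) Q = wp c1 (wp c2 Q)"
proof (rule ext, rule iffI)
  fix s
  assume "wp (Seq c1 c2) Q s"
  then obtain t where "exec n es D (Seq c1 c2) s t" "Q t" by (auto simp: wp_def)
  then show "wp c1 (wp c2 Q) s" by (cases rule: exec.cases) (auto simp: wp_def)
qed (auto simp: wp_def intro: exec.intros)

lemma wp_Cond [simp]:
  "wp (Cond b c1 c2) Q s = (if beval s b then wp c1 Q (tick s) else wp c2 Q (tick s))"
proof
  assume "wp (Cond b c1 c2) Q s"
  then obtain t where "exec n es D (Cond b c1 c2) s t" "Q t" by (auto simp: wp_def)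
  then show "if beval s b then wp c1 Q (tick s) else wp c2 Q (tick s)"
    by (cases rule: exec.cases) (auto simp: wp_def)
qed (auto simp: wp_def intro: exec.intros split: if_splits)

lemma wp_ApspInit [simp]:
  "wp (ApspInit a) Q s \<longleftrightarrow> init_weights s = None \<and> (\<forall>i<length es. 0 < rmem s a i) \<and>
     Q (tick (s\<lparr>init_weights := Some (weights_from es (rmem s a))\<rparr>))"
  by (auto simp: wp_def intro: exec.intros elim: exec.cases)

lemma wp_ApspIncreaseI:
  assumes "init_weights s \<noteq> None"
    and "q = IncreaseEdgeWeight (neval s u) (neval s v) (reval s d)"
    and "legal_op n (set (map edge_of es)) q" and "Q (tick (log_op q s))"
  shows "wp (ApspIncrease u v d) Q s"
  unfolding wp_def using assms(1) exec_Increase[OF _ assms(2,3)] assms(4) by blast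

lemma wp_ApspDistanceI:
  assumes "init_weights s = Some w"
    and "q = QueryDistance (neval s u) (neval s v)"
    and "legal_op n (set (map edge_of es)) q"
    and "x = estimate D w (history s) (neval s u) (neval s v)"
    and "Q (tick (log_op q (nset a 0 (if x = \<infinity> then 0 else 1) (rset a 0 (real_of_ereal x) s))))"
  shows "wp (ApspDistance a u v) Q s"
  unfolding wp_def using exec_Distance[OF assms(1-4), of a] assms(5) by blast

lemma wp_ApspPathI:
  assumes "init_weights s = Some w"
    and "q = QueryPath (neval s u) (neval s v)"
    and "legal_op n (set (map edge_of es)) q"
    and "p = reported_path D w (history s) (neval s u) (neval s v)"
    and "Q (tick (log_op q (s\<lparr>path_buffer := p\<rparr>)))"
  shows "wp (ApspPath u v) Q s"
  unfolding wp_def using exec_Path[OF assms(1-4)] assms(5) by blast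

lemma wp_mono: "wp c Q s \<Longrightarrow> (\<And>t. Q t \<Longrightarrow> Q' t) \<Longrightarrow> wp c Q' s"
  by (auto simp: wp_def)

text \<open>The invariant speaks of the state before the test. The body and the exit start from
  \<open>tick s\<close> because the test itself costs a step.\<close>

lemma wp_Loop:
  fixes \<mu> :: "state \<Rightarrow> nat"
  assumes "I s"
    and body: "\<And>s. I s \<Longrightarrow> beval s b \<Longrightarrow> wp c (\<lambda>t. I t \<and> \<mu> t < \<mu> s) (tick s)"
    and exit: "\<And>s. I s \<Longrightarrow> \<not> beval s b \<Longrightarrow> Q (tick s)"
  shows "wp (Loop b c) Q s"
  using assms(1)
proof (induction "\<mu> s" arbitrary: s rule: less_induct)
  case less
  show ?case
  proof (cases "beval s b")
    case True
    then obtain t where t: "exec n es D c (tick s) t" "I t" "\<mu> t < \<mu> s"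
      using body[OF less.prems] by (auto simp: wp_def)
    then obtain u where "exec n es D (Loop b c) t u" "Q u"
      using less.hyps by (auto simp: wp_def)
    then show ?thesis using True t by (auto simp: wp_def intro: exec.intros)
  next
    case False
    then show ?thesis using exit[OF less.prems] by (auto simp: wp_def intro: exec.intros)
  qed
qed

end

section \<open>The input graph\<close>

locale cut_input = ram n es D for n es D +
  fixes E :: "edge set" and \<alpha> \<psi> b :: real
  assumes n_pos: "0 < n" and graph: "simple_graph n E" and edges: "edge_list E es"
    and degree: "v < n \<Longrightarrow> vertex_degree E v \<le> 10"
    and alpha: "1 \<le> \<alpha>" and apsp: "approx_apsp n E \<alpha> D"
    and psi: "0 < \<psi>" "\<psi> \<le> 1" and bal: "1 / real n \<le> b" "b \<le> 1 / 4"
begin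

abbreviation m :: nat where "m \<equiv> length es"
abbreviation eu :: "nat \<Rightarrow> nat" where "eu e \<equiv> fst (es ! e)"
abbreviation ev :: "nat \<Rightarrow> nat" where "ev e \<equiv> snd (es ! e)"

section \<open>Incidences, volumes and boundaries\<close>

definition inc :: "nat \<Rightarrow> nat set" where
  "inc v = {e. e < m \<and> (eu e = v \<or> ev e = v)}"

text \<open>The far endpoint is written as a difference because the program obtains it in this way
  from the two arrays of endpoints.\<close>

definition oth :: "nat \<Rightarrow> nat \<Rightarrow> nat" where
  "oth e v = eu e + ev e - v"

lemma E_eq: "E = edge_of ` set es" and edges_distinct: "distinct (map edge_of es)"
  using edges by (auto simp: edge_list_def)

lemma edge_in_E: "e < m \<Longrightarrow> edge_of (es ! e) \<in> E"
  by (simp add: E_eq)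

lemma edge_numberE:
  assumes "X \<in> E" obtains e where "e < m" "X = edge_of (es ! e)"
proof -
  from assms obtain p where "p \<in> set es" "X = edge_of p" by (auto simp: E_eq)
  then show thesis using that by (metis in_set_conv_nth)
qed

lemma edge_ends:
  assumes "e < m" shows "eu e < n" "ev e < n" "eu e \<noteq> ev e"
proof -
  obtain u v where "u < n" "v < n" "u \<noteq> v" "edge_of (es ! e) = {u, v}"
    using edge_in_E[OF assms] graph by (auto simp: simple_graph_def)
  then show "eu e < n" "ev e < n" "eu e \<noteq> ev e" by (auto simp: edge_of_def doubleton_eq_iff)
qed

lemma edge_index_inj: "e < m \<Longrightarrow> e' < m \<Longrightarrow> edge_of (es ! e) = edge_of (es ! e') \<Longrightarrow> e = e'"
  using edges_distinct by (auto simp: distinct_conv_nth)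

lemma incD:
  assumes "e \<in> inc v"
  shows "e < m" "v < n" "oth e v < n" "oth e v \<noteq> v" "oth e (oth e v) = v" "e \<in> inc (oth e v)"
    "edge_of (es ! e) = {v, oth e v}"
  using assms edge_ends[of e] by (auto simp: inc_def oth_def edge_of_def)

lemma finite_inc [simp]: "finite (inc v)" by (simp add: inc_def)

lemma edge_indexE:
  assumes "{x, y} \<in> E"
  obtains e where "e \<in> inc x" "oth e x = y"
proof -
  from assms obtain e where e: "e < m" "edge_of (es ! e) = {x, y}"
    by (auto simp: E_eq in_set_conv_nth)
  then have "e \<in> inc x" by (auto simp: inc_def edge_of_def doubleton_eq_iff)
  moreover from this e incD(4,7)[of e x] have "oth e x = y" by (auto simp: doubleton_eq_iff)
  ultimately show thesis by (rule that)
qed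

lemma oth_inj: "e \<in> inc x \<Longrightarrow> e' \<in> inc x \<Longrightarrow> oth e x = oth e' x \<Longrightarrow> e = e'"
  using incD(1,7) edge_index_inj by metis

lemma card_inc: "card (inc v) = vertex_degree E v"
  unfolding vertex_degree_def
proof (rule bij_betw_same_card[of "\<lambda>e. edge_of (es ! e)"], rule bij_betwI')
  fix e e' assume "e \<in> inc v" "e' \<in> inc v"
  then show "(edge_of (es ! e) = edge_of (es ! e')) = (e = e')"
    using edge_index_inj by (auto simp: inc_def)
next
  fix e assume "e \<in> inc v"
  then show "edge_of (es ! e) \<in> {e \<in> E. v \<in> e}" using edge_in_E by (auto simp: inc_def edge_of_def)
next
  fix X assume "X \<in> {e \<in> E. v \<in> e}"
  then have "X \<in> E" "v \<in> X" by auto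
  then obtain e where "e < m" "X = edge_of (es ! e)" "v \<in> X" using edge_numberE by metis
  then show "\<exists>e\<in>inc v. X = edge_of (es ! e)"
    by (intro bexI[of _ e]) (auto simp: inc_def edge_of_def)
qed

lemma card_inc_le: "v < n \<Longrightarrow> card (inc v) \<le> 10"
  using degree card_inc by simp

lemma n_ge4: "4 \<le> n"
proof -
  have "1 / real n \<le> 1 / 4" using bal by linarith
  then have "4 \<le> real n" using n_pos by (simp add: field_simps)
  then show ?thesis by linarith
qed

definition vol :: "(nat \<Rightarrow> nat) \<Rightarrow> nat set \<Rightarrow> nat" where
  "vol L S = (\<Sum>v\<in>S. \<Sum>e\<in>inc v. L e)"

lemma vol_all: "vol L {..<n} = 2 * (\<Sum>e<m. L e)"
proof -
  have "vol L {..<n} = (\<Sum>v<n. \<Sum>e<m. if e \<in> inc v then L e else 0)"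
    unfolding vol_def
    by (intro sum.cong refl sum.mono_neutral_cong_left) (auto simp: inc_def)
  also have "\<dots> = (\<Sum>e<m. \<Sum>v<n. if e \<in> inc v then L e else 0)"
    by (rule sum.swap)
  also have "\<dots> = (\<Sum>e<m. 2 * L e)"
  proof (rule sum.cong[OF refl])
    fix e assume "e \<in> {..<m}"
    then have e: "e < m" by simp
    have "(\<Sum>v<n. if e \<in> inc v then L e else 0) = (\<Sum>v\<in>{eu e, ev e}. L e)"
      using e edge_ends[OF e] by (intro sum.mono_neutral_cong_right) (auto simp: inc_def)
    then show "(\<Sum>v<n. if e \<in> inc v then L e else 0) = 2 * L e" using edge_ends(3)[OF e] by simp
  qed
  also have "\<dots> = 2 * (\<Sum>e<m. L e)" by (simp add: sum_distrib_left)
  finally show ?thesis .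
qed

lemma vol_mono: "S \<subseteq> S' \<Longrightarrow> finite S' \<Longrightarrow> vol L S \<le> vol L S'"
  unfolding vol_def by (intro sum_mono2) auto

lemma vol_Un: "finite S \<Longrightarrow> finite S' \<Longrightarrow> S \<inter> S' = {} \<Longrightarrow> vol L (S \<union> S') = vol L S + vol L S'"
  unfolding vol_def by (rule sum.union_disjoint)

lemma m_le: "m \<le> 5 * n"
proof -
  have "2 * m = vol (\<lambda>_. 1) {..<n}" by (simp add: vol_all)
  also have "\<dots> = (\<Sum>v<n. card (inc v))" by (simp add: vol_def)
  also have "\<dots> \<le> (\<Sum>v<n. 10)" by (intro sum_mono) (simp add: card_inc_le)
  finally show ?thesis by simp
qed

definition cutx :: "nat set \<Rightarrow> nat set" where
  "cutx X = {e. e < m \<and> (eu e \<in> X) \<noteq> (ev e \<in> X)}"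

lemma finite_cutx [simp]: "finite (cutx X)" by (simp add: cutx_def)

lemma cutx_inc: "e \<in> inc v \<Longrightarrow> e \<in> cutx X \<longleftrightarrow> (v \<in> X) \<noteq> (oth e v \<in> X)"
  by (auto simp: inc_def cutx_def oth_def)

lemma card_cut_edges: "card (cut_edges E X) = card (cutx X)"
proof -
  have c: "card (edge_of (es ! e) \<inter> X) = 1 \<longleftrightarrow> e \<in> cutx X" if e: "e < m" for e
  proof -
    have "card ({eu e, ev e} \<inter> X) = 1 \<longleftrightarrow> (eu e \<in> X) \<noteq> (ev e \<in> X)"
      using edge_ends(3)[OF e] by (cases "eu e \<in> X"; cases "ev e \<in> X") simp_all
    then show ?thesis using e by (simp only: edge_of_def cutx_def mem_Collect_eq simp_thms)
  qed
  have "cut_edges E X = (\<lambda>e. edge_of (es ! e)) ` cutx X"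
  proof (intro equalityI subsetI)
    fix A assume A: "A \<in> cut_edges E X"
    then have "A \<in> E" by (simp add: cut_edges_def)
    then obtain e where e: "e < m" "A = edge_of (es ! e)" by (rule edge_numberE)
    then show "A \<in> (\<lambda>e. edge_of (es ! e)) ` cutx X" using A c[OF e(1)] by (auto simp: cut_edges_def)
  next
    fix A assume "A \<in> (\<lambda>e. edge_of (es ! e)) ` cutx X"
    then obtain e where e: "e \<in> cutx X" "A = edge_of (es ! e)" by blast
    then have "e < m" by (simp add: cutx_def)
    then show "A \<in> cut_edges E X" using e c edge_in_E by (simp add: cut_edges_def)
  qed
  moreover have "inj_on (\<lambda>e. edge_of (es ! e)) (cutx X)"
    using edge_index_inj by (auto simp: inj_on_def cutx_def)
  ultimately show ?thesis by (simp add: card_image)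
qed

section \<open>Walks that avoid removed vertices\<close>

inductive walk :: "nat set \<Rightarrow> (nat \<Rightarrow> nat) \<Rightarrow> nat \<Rightarrow> nat \<Rightarrow> nat \<Rightarrow> bool" for U L x where
  walk_refl: "x \<notin> U \<Longrightarrow> walk U L x 0 x"
| walk_step: "walk U L x r y \<Longrightarrow> e \<in> inc y \<Longrightarrow> oth e y \<notin> U \<Longrightarrow> walk U L x (r + L e) (oth e y)"

lemma walk_ends: "walk U L x r y \<Longrightarrow> x \<notin> U \<and> y \<notin> U"
  by (induction rule: walk.induct) auto

lemma walk_mono: "walk U L x r y \<Longrightarrow> U' \<subseteq> U \<Longrightarrow> walk U' L x r y"
proof (induction rule: walk.induct)
  case (walk_step r y e)
  then show ?case by (intro walk.walk_step) auto
qed (auto intro: walk_refl)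

lemma walk_trans: "walk U L y r' z \<Longrightarrow> walk U L x r y \<Longrightarrow> walk U L x (r + r') z"
proof (induction rule: walk.induct)
  case (walk_step r' z e)
  then show ?case using walk.walk_step[of U L x "r + r'" z e] by (simp add: add.assoc)
qed simp

lemma walk_sym: "walk U L x r y \<Longrightarrow> walk U L y r x"
proof (induction rule: walk.induct)
  case (walk_step r y e)
  have "y \<notin> U" using walk_step.hyps(1) walk_ends by blast
  then have "walk U L (oth e y) (0 + L e) (oth e (oth e y))"
    using walk_step.hyps incD[of e y] by (intro walk.walk_step walk_refl) auto
  then have "walk U L (oth e y) (L e) y" using walk_step.hyps incD[of e y] by simp
  then show ?case using walk_trans[OF walk_step.IH, of "oth e y" "L e"] by (simp add: add.commute)
qed (rule walk_refl)

text \<open>Distances are infima over paths with distinct vertices, while ball growing produces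
  walks. If the next vertex already lies on the path built so far, the path is cut back to it; the
  weights being nonnegative, it only becomes lighter.\<close>

lemma walk_path:
  assumes "walk {} L x r y" and w: "\<And>e. e < m \<Longrightarrow> w (edge_of (es ! e)) = real (L e)"
  shows "\<exists>p. is_path E x y p \<and> path_weight w p \<le> real r"
  using assms(1)
proof (induction rule: walk.induct)
  case walk_refl
  have "is_path E x x [x]" "path_weight w [x] \<le> real 0" by (simp_all add: is_path_def path_weight_def)
  then show ?case by blast
next
  case (walk_step r y e)
  then obtain p where p: "is_path E x y p" "path_weight w p \<le> real r" by blast
  let ?z = "oth e y"
  have pe: "{p ! i, p ! Suc i} \<in> E" if "Suc i < length p" for i using p(1) that by (simp add: is_path_def)
  have wE: "0 \<le> w X" if X: "X \<in> E" for X
  proof -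
    obtain e where "e < m" "X = edge_of (es ! e)" using edge_numberE[OF X] by blast
    then show ?thesis using w by simp
  qed
  have edge: "{y, ?z} \<in> E" "w {y, ?z} = real (L e)"
    using incD[OF walk_step.hyps(2)] edge_in_E[of e] w[of e] by simp_all
  show ?case
  proof (cases "?z \<in> set p")
    case True
    then obtain k where k: "k < length p" "p ! k = ?z" by (auto simp: in_set_conv_nth)
    have "is_path E x ?z (take (Suc k) p)"
      unfolding is_path_def
    proof (intro conjI allI impI)
      show "last (take (Suc k) p) = ?z" using k by (simp add: take_Suc_conv_app_nth)
    qed (use p(1) k in \<open>auto simp: is_path_def\<close>)
    moreover have "path_weight w (take (Suc k) p) \<le> path_weight w p"
    proof -
      have "path_weight w (take (Suc k) p) = (\<Sum>i<k. w {p ! i, p ! Suc i})"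
        unfolding path_weight_def using k by (intro sum.cong) (auto simp: min_def)
      also have "\<dots> \<le> path_weight w p"
        unfolding path_weight_def using k by (intro sum_mono2) (auto intro!: wE pe)
      finally show ?thesis .
    qed
    ultimately show ?thesis using p(2) by (intro exI[of _ "take (Suc k) p"]) auto
  next
    case False
    have len: "0 < length p" and lst: "p ! (length p - 1) = y"
      using p(1) by (auto simp: is_path_def last_conv_nth)
    have "is_path E x ?z (p @ [?z])"
      unfolding is_path_def
    proof (intro conjI allI impI)
      fix i assume i: "Suc i < length (p @ [?z])"
      show "{(p @ [?z]) ! i, (p @ [?z]) ! Suc i} \<in> E"
      proof (cases "Suc i < length p")
        case True
        then show ?thesis using pe[OF True] by (simp add: nth_append)
      next
        case False
        then have "i = length p - 1" using i len by auto
        then show ?thesis using edge(1) lst len by (simp add: nth_append)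
      qed
    qed (use p(1) False in \<open>auto simp: is_path_def\<close>)
    moreover have "path_weight w (p @ [?z]) = path_weight w p + real (L e)"
    proof -
      obtain k where k: "length p = Suc k" using len by (cases "length p") auto
      have "path_weight w (p @ [?z]) = (\<Sum>i<k. w {p ! i, p ! Suc i}) + w {p ! k, ?z}"
        unfolding path_weight_def by (simp add: k nth_append)
      then show ?thesis using lst edge(2) by (simp add: path_weight_def k)
    qed
    ultimately show ?thesis using p(2) by (intro exI[of _ "p @ [?z]"]) auto
  qed
qed

section \<open>Growing a ball\<close>

text \<open>The growth proceeds in unit time steps: an arc \<open>(v, e)\<close> in \<open>K\<close> has been examined at time \<open>t\<close> and is
  kept for the next step, an arc in \<open>P\<close> is still to be examined at time \<open>t\<close>.\<close>

definition ball_inv :: "nat set \<Rightarrow> (nat \<Rightarrow> nat) \<Rightarrow> nat \<Rightarrow> nat \<Rightarrow> nat set \<Rightarrow> (nat \<Rightarrow> nat)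
    \<Rightarrow> (nat \<times> nat) list \<Rightarrow> (nat \<times> nat) list \<Rightarrow> bool" where
  "ball_inv U L x t B d K P \<longleftrightarrow> x \<in> B \<and> B \<subseteq> {..<n} - U \<and>
     (\<forall>v\<in>B. d v \<le> t \<and> walk U L x (d v) v) \<and> distinct (K @ P) \<and>
     (\<forall>(v, e)\<in>set K. v \<in> B \<and> e \<in> inc v \<and> t < d v + L e) \<and>
     (\<forall>(v, e)\<in>set P. v \<in> B \<and> e \<in> inc v \<and> t \<le> d v + L e) \<and>
     (\<forall>v\<in>B. \<forall>e\<in>inc v. oth e v \<notin> U \<union> B \<longrightarrow> (v, e) \<in> set (K @ P)) \<and>
     (\<forall>v\<in>B. \<forall>e\<in>inc v. oth e v \<in> B \<longrightarrow> d (oth e v) \<le> d v + L e)"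

lemma ball_inv_drop:
  assumes "ball_inv U L x t B d K ((v, e) # P)" "oth e v \<in> U \<union> B"
  shows "ball_inv U L x t B d K P"
  using assms unfolding ball_inv_def by auto

lemma ball_inv_keep:
  assumes "ball_inv U L x t B d K ((v, e) # P)" "t < d v + L e"
  shows "ball_inv U L x t B d (K @ [(v, e)]) P"
  using assms unfolding ball_inv_def by auto

text \<open>A pending arc is never overdue, so an arc that has reached its head has done so exactly
  at time \<open>t\<close>, and the new label \<open>t\<close> is the length of a walk. No label is
  too large either: every arc from \<open>B\<close> to the new vertex is still kept or pending and
  therefore arrives at time \<open>t\<close> or later.\<close>

lemma ball_inv_add:
  assumes inv: "ball_inv U L x t B d K ((v, e) # P)" and y: "oth e v \<notin> U \<union> B" and t: "\<not> t < d v + L e"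
    and new: "distinct N" "set N = Pair (oth e v) ` inc (oth e v)"
  shows "ball_inv U L x t (insert (oth e v) B) (d(oth e v := t)) K (P @ N)"
proof -
  let ?y = "oth e v"
  from inv have v: "v \<in> B" "e \<in> inc v" "t \<le> d v + L e" and w: "walk U L x (d v) v"
    and dist: "distinct (K @ (v, e) # P)"
    and K: "\<And>a f. (a, f) \<in> set K \<Longrightarrow> a \<in> B \<and> f \<in> inc a \<and> t < d a + L f"
    and P: "\<And>a f. (a, f) \<in> set P \<Longrightarrow> a \<in> B \<and> f \<in> inc a \<and> t \<le> d a + L f"
    and out: "\<And>a f. a \<in> B \<Longrightarrow> f \<in> inc a \<Longrightarrow> oth f a \<notin> U \<union> B \<Longrightarrow> (a, f) \<in> set (K @ (v, e) # P)"
    and BB: "\<And>a f. a \<in> B \<Longrightarrow> f \<in> inc a \<Longrightarrow> oth f a \<in> B \<Longrightarrow> d (oth f a) \<le> d a + L f"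
    and B: "x \<in> B" "B \<subseteq> {..<n} - U" "\<And>a. a \<in> B \<Longrightarrow> d a \<le> t \<and> walk U L x (d a) a"
    unfolding ball_inv_def by (auto; blast)+
  have wy: "walk U L x t ?y" using walk_step[OF w v(2)] y t v(3) by (simp add: le_antisym)
  have yB: "?y \<notin> B" "?y \<notin> U" "?y < n" using y incD[OF v(2)] by auto
  have ty: "t \<le> d a + L f" if "a \<in> B" "f \<in> inc a" "oth f a = ?y" for a f
  proof -
    have "(a, f) \<in> set (K @ (v, e) # P)" using out[OF that(1,2)] that(3) y by simp
    then show ?thesis using K[of a f] P[of a f] v(3) by auto
  qed
  have "distinct (K @ P @ N)" using dist new K P yB(1) by (auto; blast)
  moreover have "\<forall>(a, f)\<in>set K. a \<in> insert ?y B \<and> f \<in> inc a \<and> t < (d(?y := t)) a + L f"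
    using K yB(1) by (auto; metis)
  moreover have "\<forall>(a, f)\<in>set (P @ N). a \<in> insert ?y B \<and> f \<in> inc a \<and> t \<le> (d(?y := t)) a + L f"
    using P yB(1) new(2) by (auto; metis)
  moreover have "\<forall>a\<in>insert ?y B. \<forall>f\<in>inc a. oth f a \<notin> U \<union> insert ?y B \<longrightarrow> (a, f) \<in> set (K @ P @ N)"
    using out new(2) by fastforce
  moreover have "\<forall>a\<in>insert ?y B. \<forall>f\<in>inc a. oth f a \<in> insert ?y B \<longrightarrow> (d(?y := t)) (oth f a) \<le> (d(?y := t)) a + L f"
    using BB ty B(3) yB(1) incD(4) by (auto simp: trans_le_add1)
  ultimately show ?thesis
    using B wy yB unfolding ball_inv_def by auto
qed

lemma ball_inv_tick: "ball_inv U L x t B d K [] \<Longrightarrow> ball_inv U L x (Suc t) B d [] K"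
  unfolding ball_inv_def case_prod_beta by (simp add: Suc_le_eq le_SucI)

lemma ball_inv_start:
  assumes "x < n" "x \<notin> U" "distinct N" "set N = Pair x ` inc x" "d x = 0"
  shows "ball_inv U L x 0 {x} d [] N"
  using assms incD(4) unfolding ball_inv_def by (auto intro: walk_refl)

text \<open>Along a walk the labels grow at most by the edge lengths. A step that left the ball
  would use an arc in \<open>K\<close>, and such an arc arrives only after time
  \<open>t\<close>.\<close>

lemma ball_inv_complete:
  assumes inv: "ball_inv U L x t B d K []" and "walk U L x r y" "r \<le> t" "d x = 0"
  shows "y \<in> B \<and> d y \<le> r"
  using assms(2,3)
proof (induction rule: walk.induct)
  case walk_refl
  then show ?case using inv \<open>d x = 0\<close> by (simp add: ball_inv_def)
next
  case (walk_step r y e)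
  then have y: "y \<in> B" "d y \<le> r" by auto
  have "oth e y \<in> B"
  proof (rule ccontr)
    assume "oth e y \<notin> B"
    then have "(y, e) \<in> set K" using inv y walk_step.hyps unfolding ball_inv_def by auto
    then have "t < d y + L e" using inv unfolding ball_inv_def by auto
    then show False using y walk_step.prems by linarith
  qed
  moreover have "d (oth e y) \<le> d y + L e"
    using inv y walk_step.hyps \<open>oth e y \<in> B\<close> unfolding ball_inv_def by blast
  ultimately show ?case using y by simp
qed

text \<open>Arcs from the ball into \<open>U\<close> need not be in \<open>K\<close>, but their
  edges already belong to the boundary of \<open>U\<close> and are paid for there.\<close>

lemma ball_inv_boundary:
  assumes inv: "ball_inv U L x t B d K []"
  shows "card (cutx (U \<union> B)) \<le> card (cutx U) + length K"
proof -
  have "cutx (U \<union> B) \<subseteq> cutx U \<union> snd ` set K"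
  proof
    fix e assume e: "e \<in> cutx (U \<union> B)"
    then have "e < m" by (simp add: cutx_def)
    then have i: "e \<in> inc (eu e)" by (simp add: inc_def)
    define v where "v = (if eu e \<in> U \<union> B then eu e else ev e)"
    have v: "e \<in> inc v" "v \<in> U \<union> B" "oth e v \<notin> U \<union> B"
      using e by (auto simp: v_def cutx_def inc_def oth_def)
    show "e \<in> cutx U \<union> snd ` set K"
    proof (cases "v \<in> U")
      case True
      then show ?thesis using v cutx_inc[OF v(1)] by auto
    next
      case False
      then have "(v, e) \<in> set K" using inv v unfolding ball_inv_def by auto
      then show ?thesis by force
    qed
  qed
  then have "card (cutx (U \<union> B)) \<le> card (cutx U \<union> snd ` set K)" by (intro card_mono) auto
  also have "\<dots> \<le> card (cutx U) + card (snd ` set K)" by (rule card_Un_le)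
  also have "card (snd ` set K) \<le> length K"
    using card_image_le[of "set K" snd] card_length[of K] by simp
  finally show ?thesis by simp
qed

text \<open>Each time step adds the number of active arcs to the swept length, which never exceeds the volume;
  hence a ball whose number of active arcs stays large must grow exponentially.\<close>

definition swept :: "(nat \<Rightarrow> nat) \<Rightarrow> nat \<Rightarrow> (nat \<Rightarrow> nat) \<Rightarrow> nat set \<Rightarrow> nat" where
  "swept L t d B = (\<Sum>v\<in>B. \<Sum>e\<in>inc v. min (L e) (t - d v))"

lemma swept_le_vol: "swept L t d B \<le> vol L B"
  unfolding swept_def vol_def by (intro sum_mono) auto

lemma swept_mono:
  assumes "B \<subseteq> B'" "finite B'" "\<And>v. v \<in> B \<Longrightarrow> d' v = d v" shows "swept L t d B \<le> swept L t d' B'"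
proof -
  have "swept L t d B = swept L t d' B" unfolding swept_def using assms(3) by (intro sum.cong) auto
  also have "\<dots> \<le> swept L t d' B'" unfolding swept_def using assms by (intro sum_mono2) auto
  finally show ?thesis .
qed

text \<open>An arc in \<open>K\<close> has not been swept to its end at time \<open>t\<close>, so
  its term rises by one in the next unit of time.\<close>

lemma swept_step:
  assumes inv: "ball_inv U L x t B d K []"
  shows "swept L t d B + length K \<le> swept L (Suc t) d B"
proof -
  have fB: "finite B" using inv unfolding ball_inv_def by (metis finite_Diff finite_lessThan finite_subset)
  have "length K = card (set K)" using inv by (simp add: ball_inv_def distinct_card)
  also have "set K = (SIGMA v:B. {e \<in> inc v. (v, e) \<in> set K})"
    using inv by (auto simp: ball_inv_def)
  also have "card \<dots> = (\<Sum>v\<in>B. card {e \<in> inc v. (v, e) \<in> set K})"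
    using fB by (intro card_SigmaI) auto
  also have "\<dots> = (\<Sum>v\<in>B. \<Sum>e\<in>inc v. of_bool ((v, e) \<in> set K))"
    by (intro sum.cong refl) (simp add: of_bool_def sum.If_cases Int_def)
  finally have "swept L t d B + length K
      = (\<Sum>v\<in>B. \<Sum>e\<in>inc v. min (L e) (t - d v) + of_bool ((v, e) \<in> set K))"
    by (simp add: swept_def sum.distrib)
  also have "\<dots> \<le> swept L (Suc t) d B"
    unfolding swept_def
  proof (intro sum_mono)
    fix v e assume v: "v \<in> B" "e \<in> inc v"
    have "d v \<le> t" "(v, e) \<in> set K \<Longrightarrow> t < d v + L e" using inv v unfolding ball_inv_def by auto
    then show "min (L e) (t - d v) + of_bool ((v, e) \<in> set K) \<le> min (L e) (Suc t - d v)"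
      by (auto simp: of_bool_def)
  qed
  finally show ?thesis .
qed

end

section \<open>The program for growing a ball\<close>

text \<open>Numbers of arrays; scalar variables occupy cell 0 of an array of their own. \<open>BLK\<close> is the output array
  and holds the number of the ball containing a vertex, 0 if there is none. \<open>MRK\<close> marks the vertices of the
  ball that is not cut off. The edges at \<open>v\<close> are stored from cell \<open>10 * v\<close> of \<open>ADJ\<close>, the active arcs in \<open>AV\<close>
  and \<open>AE\<close>, and the pairs to be routed in \<open>FA\<close> and \<open>FB\<close>. An edge has length \<open>LEN\<close> and has been used \<open>CNT\<close>
  times since its last doubling.\<close>

abbreviation (input) BLK :: nat where "BLK \<equiv> 4"
abbreviation (input) LEN :: nat where "LEN \<equiv> 5"
abbreviation (input) CNT :: nat where "CNT \<equiv> 6"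
abbreviation (input) DEG :: nat where "DEG \<equiv> 7"
abbreviation (input) ADJ :: nat where "ADJ \<equiv> 8"
abbreviation (input) FA :: nat where "FA \<equiv> 9"
abbreviation (input) FB :: nat where "FB \<equiv> 10"
abbreviation (input) AV :: nat where "AV \<equiv> 13"
abbreviation (input) AE :: nat where "AE \<equiv> 14"
abbreviation (input) DD :: nat where "DD \<equiv> 15"
abbreviation (input) MRK :: nat where "MRK \<equiv> 16"
abbreviation (input) vX :: nat where "vX \<equiv> 28"
abbreviation (input) vP :: nat where "vP \<equiv> 31"
abbreviation (input) vQ :: nat where "vQ \<equiv> 32"
abbreviation (input) vAN :: nat where "vAN \<equiv> 33"
abbreviation (input) vT :: nat where "vT \<equiv> 34"
abbreviation (input) vPROG :: nat where "vPROG \<equiv> 35"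
abbreviation (input) vBC :: nat where "vBC \<equiv> 36"
abbreviation (input) vUC :: nat where "vUC \<equiv> 37"
abbreviation (input) vID :: nat where "vID \<equiv> 38"
abbreviation (input) vV :: nat where "vV \<equiv> 39"
abbreviation (input) vE :: nat where "vE \<equiv> 40"
abbreviation (input) vY :: nat where "vY \<equiv> 41"
abbreviation (input) vJJ :: nat where "vJJ \<equiv> 45"
abbreviation (input) rBETA :: nat where "rBETA \<equiv> 8"
abbreviation (input) rGAM :: nat where "rGAM \<equiv> 9"
abbreviation (input) rH :: nat where "rH \<equiv> 10"

abbreviation (input) var :: "nat \<Rightarrow> nexp" where "var a \<equiv> NGet a (NConst 0)"
abbreviation (input) rvar :: "nat \<Rightarrow> rexp" where "rvar a \<equiv> RGet a (NConst 0)"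
abbreviation (input) setv :: "nat \<Rightarrow> nexp \<Rightarrow> com" where "setv a x \<equiv> NSet a (NConst 0) x"
abbreviation (input) rsetv :: "nat \<Rightarrow> rexp \<Rightarrow> com" where "rsetv a x \<equiv> RSet a (NConst 0) x"
abbreviation (input) incv :: "nat \<Rightarrow> com" where "incv a \<equiv> NSet a (NConst 0) (NAdd (NGet a (NConst 0)) (NConst 1))"

fun seqs :: "com list \<Rightarrow> com" where
  "seqs [] = Skip"
| "seqs [c] = c"
| "seqs (c # cs) = Seq c (seqs cs)"

text \<open>The machine cannot multiply: \<open>10 x = 8 x + 2 x\<close> by repeated
  doubling.\<close>

definition times10 :: "nexp \<Rightarrow> nexp" where
  "times10 x = (let y = NAdd x x; z = NAdd y y in NAdd (NAdd z z) y)"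

lemma neval_times10 [simp]: "neval s (times10 x) = 10 * neval s x"
  by (simp add: times10_def Let_def)

definition push :: com where
  "push = seqs [setv vJJ (NConst 0),
     Loop (NLess (var vJJ) (NGet DEG (var vY)))
       (seqs [NSet AV (var vAN) (var vY),
              NSet AE (var vAN) (NGet ADJ (NAdd (times10 (var vY)) (var vJJ))),
              incv vAN, incv vJJ])]"

text \<open>The list of active arcs is compacted in place. \<open>vP\<close> reads,
  \<open>vQ\<close> never overtakes it and writes the arcs that are kept, and the arcs of new
  vertices are appended at the end, where the same pass still reaches them; edges need not be
  examined in any particular order.\<close>

definition pass :: com where
  "pass = seqs [setv vP (NConst 0), setv vQ (NConst 0),
     Loop (NLess (var vP) (var vAN))
       (seqs [setv vV (NGet AV (var vP)), setv vE (NGet AE (var vP)),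
          setv vY (NSub (NAdd (NGet 1 (var vE)) (NGet 2 (var vE))) (var vV)),
          incv vP,
          Cond (NLess (NGet BLK (var vY)) (NConst 1))
            (Cond (NLess (var vT) (NAdd (NGet DD (var vV)) (NGet LEN (var vE))))
              (seqs [NSet AV (var vQ) (var vV), NSet AE (var vQ) (var vE), incv vQ])
              (seqs [NSet BLK (var vY) (var vID), NSet DD (var vY) (var vT), incv vBC, push]))
            Skip]),
     setv vAN (var vQ)]"

text \<open>Disjunction has to be expressed by negations. Growth goes on, up to time
  \<open>rH\<close>, while the ball has too many active arcs or more than half of the vertices: a
  ball of the second kind is not cut off, and it has to reach the full radius.\<close>

definition ball_guard :: bexp where
  "ball_guard = BAnd
     (BNot (BAnd (BNot (RLess (RAdd (RMul (rvar rBETA) (ROfNat (var vPROG))) (RMul (rvar rGAM) (ROfNat (var vBC))))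
                              (ROfNat (var vAN))))
                 (BNot (NLess (var 0) (NAdd (var vBC) (var vBC))))))
     (RLess (ROfNat (var vT)) (rvar rH))"

definition ball :: com where
  "ball = seqs [incv vID, NSet BLK (var vX) (var vID), NSet DD (var vX) (NConst 0),
     setv vBC (NConst 1), setv vPROG (NConst 0), setv vT (NConst 0), setv vAN (NConst 0),
     setv vY (var vX), push, pass,
     Loop ball_guard (seqs [setv vPROG (NAdd (var vPROG) (var vAN)), incv vT, pass])]"

section \<open>Frame conditions and correctness of the growth\<close>

definition same :: "nat set \<Rightarrow> state \<Rightarrow> state \<Rightarrow> bool" where
  "same A s t \<longleftrightarrow> (\<forall>a. a \<notin> A \<longrightarrow> nmem t a = nmem s a) \<and> rmem t = rmem s \<and> history t = history s
     \<and> init_weights t = init_weights s \<and> path_buffer t = path_buffer s"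

lemma same_refl [simp]: "same A s s" by (simp add: same_def)
lemma same_tick [simp]: "same A s (tick t) \<longleftrightarrow> same A s t" by (simp add: same_def)
lemma same_nset [simp]: "a \<in> A \<Longrightarrow> same A s (nset a i x t) \<longleftrightarrow> same A s t"
  by (auto simp: same_def)
lemma same_tickL [simp]: "same A (tick s) t \<longleftrightarrow> same A s t" by (simp add: same_def)
lemma same_nsetL [simp]: "a \<in> A \<Longrightarrow> same A (nset a i x s) t \<longleftrightarrow> same A s t"
  by (auto simp: same_def)
lemma sameD: "same A s t \<Longrightarrow> a \<notin> A \<Longrightarrow> nmem t a = nmem s a"
  and sameD2: "same A s t \<Longrightarrow> rmem t = rmem s" "same A s t \<Longrightarrow> history t = history s"
    "same A s t \<Longrightarrow> init_weights t = init_weights s" "same A s t \<Longrightarrow> path_buffer t = path_buffer s"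
  by (simp_all add: same_def)
lemma same_trans: "same A s t \<Longrightarrow> same B t u \<Longrightarrow> A \<subseteq> C \<Longrightarrow> B \<subseteq> C \<Longrightarrow> same C s u"
  unfolding same_def by (metis subsetD)

definition arcs :: "state \<Rightarrow> nat \<Rightarrow> nat \<Rightarrow> (nat \<times> nat) list" where
  "arcs s i j = map (\<lambda>p. (nmem s AV p, nmem s AE p)) [i..<j]"

lemma arcs_cong:
  assumes "\<And>p. i \<le> p \<Longrightarrow> p < j \<Longrightarrow> nmem t AV p = nmem s AV p"
    "\<And>p. i \<le> p \<Longrightarrow> p < j \<Longrightarrow> nmem t AE p = nmem s AE p"
  shows "arcs t i j = arcs s i j"
  using assms by (simp add: arcs_def)

lemma arcs_Cons: "i < j \<Longrightarrow> arcs s i j = (nmem s AV i, nmem s AE i) # arcs s (Suc i) j"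
  by (simp add: arcs_def upt_conv_Cons)

lemma arcs_snoc: "i \<le> j \<Longrightarrow> arcs s i (Suc j) = arcs s i j @ [(nmem s AV j, nmem s AE j)]"
  by (simp add: arcs_def)

lemma arcs_append: "i \<le> j \<Longrightarrow> j \<le> k \<Longrightarrow> arcs s i k = arcs s i j @ arcs s j k"
  unfolding arcs_def map_append[symmetric] by (metis le_Suc_ex upt_add_eq_append)

lemma arcs_empty [simp]: "arcs s i i = []" by (simp add: arcs_def)

lemma length_arcs [simp]: "length (arcs s i j) = j - i" by (simp add: arcs_def)

context cut_input
begin

definition static :: "state \<Rightarrow> bool" where
  "static s \<longleftrightarrow> nmem s 0 0 = n \<and> nmem s 0 1 = m \<and> (\<forall>i<m. nmem s 1 i = eu i \<and> nmem s 2 i = ev i) \<and>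
     (\<forall>v<n. bij_betw (\<lambda>j. nmem s ADJ (10 * v + j)) {..<nmem s DEG v} (inc v))"

lemma static_cong:
  assumes "nmem t 0 = nmem s 0" "nmem t 1 = nmem s 1" "nmem t 2 = nmem s 2"
    "nmem t DEG = nmem s DEG" "nmem t ADJ = nmem s ADJ"
  shows "static t = static s"
  using assms by (simp add: static_def)

lemma static_same: "static s \<Longrightarrow> same A s t \<Longrightarrow> A \<inter> {0, 1, 2, DEG, ADJ} = {} \<Longrightarrow> static t"
  using static_cong[OF sameD sameD sameD sameD sameD, of A s t] by blast

lemma static_deg: "static s \<Longrightarrow> v < n \<Longrightarrow> nmem s DEG v = card (inc v)"
  unfolding static_def by (metis bij_betw_same_card card_lessThan)

lemma wp_push:
  assumes st: "static s" and y: "nmem s vY 0 = y" "y < n" and an: "nmem s vAN 0 = an"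
  shows "wp push (\<lambda>t. same {vJJ, AV, AE, vAN} s t \<and> steps t \<le> steps s + 60 \<and>
     nmem t vAN 0 \<le> an + 10 \<and> an \<le> nmem t vAN 0 \<and>
     (\<forall>p<an. nmem t AV p = nmem s AV p \<and> nmem t AE p = nmem s AE p) \<and>
     distinct (arcs t an (nmem t vAN 0)) \<and> set (arcs t an (nmem t vAN 0)) = Pair y ` inc y) s"
proof -
  let ?d = "nmem s DEG y"
  let ?adj = "\<lambda>j. nmem s ADJ (10 * y + j)"
  have d10: "?d \<le> 10" using static_deg[OF st y(2)] card_inc_le[OF y(2)] by simp
  define I where "I = (\<lambda>t. same {vJJ, AV, AE, vAN} s t \<and> steps t \<le> steps s + 1 + 5 * nmem t vJJ 0 \<and>
     nmem t vJJ 0 \<le> ?d \<and> nmem t vAN 0 = an + nmem t vJJ 0 \<and>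
     (\<forall>p<an. nmem t AV p = nmem s AV p \<and> nmem t AE p = nmem s AE p) \<and>
     arcs t an (an + nmem t vJJ 0) = map (\<lambda>j. (y, ?adj j)) [0..<nmem t vJJ 0])"
  have "wp (Loop (NLess (var vJJ) (NGet DEG (var vY)))
       (seqs [NSet AV (var vAN) (var vY),
              NSet AE (var vAN) (NGet ADJ (NAdd (times10 (var vY)) (var vJJ))),
              incv vAN, incv vJJ])) (\<lambda>t. same {vJJ, AV, AE, vAN} s t \<and> steps t \<le> steps s + 60 \<and>
     nmem t vAN 0 \<le> an + 10 \<and> an \<le> nmem t vAN 0 \<and>
     (\<forall>p<an. nmem t AV p = nmem s AV p \<and> nmem t AE p = nmem s AE p) \<and>
     distinct (arcs t an (nmem t vAN 0)) \<and> set (arcs t an (nmem t vAN 0)) = Pair y ` inc y)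
     (tick (nset vJJ 0 0 s))"
  proof (rule wp_Loop[where I = I and \<mu> = "\<lambda>t. ?d - nmem t vJJ 0"])
    show "I (tick (nset vJJ 0 0 s))" using an by (simp add: I_def)
  next
    fix t assume I: "I t" and g: "beval t (NLess (var vJJ) (NGet DEG (var vY)))"
    have sm: "nmem t DEG = nmem s DEG" "nmem t vY = nmem s vY" "nmem t ADJ = nmem s ADJ"
      using I by (auto simp: I_def sameD)
    have J: "nmem t vJJ 0 < ?d" using g sm y by simp
    let ?t' = "tick (nset vJJ 0 (nmem t vJJ 0 + 1) (tick (nset vAN 0 (nmem t vAN 0 + 1)
        (tick (nset AE (nmem t vAN 0) (?adj (nmem t vJJ 0)) (tick (nset AV (nmem t vAN 0) y (tick t))))))))"
    have "arcs ?t' an (an + nmem t vJJ 0) = arcs t an (an + nmem t vJJ 0)"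
      using I by (intro arcs_cong) (auto simp: I_def)
    then have "I ?t'"
      using I J by (auto simp: I_def arcs_snoc)
    then show "wp (seqs [NSet AV (var vAN) (var vY),
              NSet AE (var vAN) (NGet ADJ (NAdd (times10 (var vY)) (var vJJ))),
              incv vAN, incv vJJ]) (\<lambda>t'. I t' \<and> ?d - nmem t' vJJ 0 < ?d - nmem t vJJ 0) (tick t)"
      using J sm y by simp
  next
    fix t assume I: "I t" and g: "\<not> beval t (NLess (var vJJ) (NGet DEG (var vY)))"
    have sm: "nmem t DEG = nmem s DEG" "nmem t vY = nmem s vY"
      using I by (auto simp: I_def sameD)
    have J: "nmem t vJJ 0 = ?d" using g sm y I by (simp add: I_def)
    have bij: "bij_betw ?adj {..<?d} (inc y)" using st y by (simp add: static_def)
    have a: "arcs t an (an + ?d) = map (\<lambda>j. (y, ?adj j)) [0..<?d]" using I J by (simp add: I_def)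
    have "arcs (tick t) an (an + ?d) = arcs t an (an + ?d)" by (simp add: arcs_def)
    moreover have "distinct (arcs t an (an + ?d))"
      unfolding a using bij by (auto simp: distinct_map bij_betw_def inj_on_def)
    moreover have "set (arcs t an (an + ?d)) = Pair y ` inc y"
      unfolding a using bij by (auto simp: bij_betw_def image_image atLeast0LessThan)
    ultimately show "same {vJJ, AV, AE, vAN} s (tick t) \<and> steps (tick t) \<le> steps s + 60 \<and>
     nmem (tick t) vAN 0 \<le> an + 10 \<and> an \<le> nmem (tick t) vAN 0 \<and>
     (\<forall>p<an. nmem (tick t) AV p = nmem s AV p \<and> nmem (tick t) AE p = nmem s AE p) \<and>
     distinct (arcs (tick t) an (nmem (tick t) vAN 0)) \<and> set (arcs (tick t) an (nmem (tick t) vAN 0)) = Pair y ` inc y"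
      using I J d10 by (simp add: I_def)
  qed
  then show ?thesis by (simp add: push_def)
qed

abbreviation (input) pass_frame :: "nat set" where
  "pass_frame \<equiv> {vP, vQ, vAN, vV, vE, vY, vJJ, AV, AE, BLK, DD, vBC}"

abbreviation (input) blocked :: "(nat \<Rightarrow> nat) \<Rightarrow> nat set" where
  "blocked blk \<equiv> {v. v < n \<and> blk v \<noteq> 0}"

definition paint :: "nat set \<Rightarrow> nat \<Rightarrow> (nat \<Rightarrow> nat) \<Rightarrow> nat \<Rightarrow> nat" where
  "paint B i blk = (\<lambda>v. if v \<in> B then i else blk v)"

definition ball_state :: "(nat \<Rightarrow> nat) \<Rightarrow> (nat \<Rightarrow> nat) \<Rightarrow> nat \<Rightarrow> nat set \<Rightarrow> state \<Rightarrow> bool" where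
  "ball_state blk L x B s \<longleftrightarrow> static s \<and> nmem s LEN = L \<and> 0 < nmem s vID 0 \<and>
     nmem s BLK = paint B (nmem s vID 0) blk \<and> nmem s vBC 0 = card B \<and>
     nmem s DD x = 0"

text \<open>A new vertex appends at most ten arcs. The termination measure therefore weighs a
  missing vertex with 11, and at most \<open>an0\<close> plus ten arcs per new vertex are read; at
  12 steps per arc and 100 per vertex this gives 220 steps per new vertex.\<close>

lemma wp_pass:
  assumes bs: "ball_state blk L x B0 s" and an0: "nmem s vAN 0 = an0" and t: "nmem s vT 0 = t"
    and inv: "ball_inv (blocked blk) L x t B0 (nmem s DD) [] (arcs s 0 an0)"
  shows "wp pass (\<lambda>u. \<exists>B. same pass_frame s u \<and> ball_state blk L x B u \<and> B0 \<subseteq> B \<and>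
     ball_inv (blocked blk) L x t B (nmem u DD) (arcs u 0 (nmem u vAN 0)) [] \<and>
     (\<forall>v\<in>B0. nmem u DD v = nmem s DD v) \<and>
     steps u \<le> steps s + 5 + 12 * an0 + 220 * (card B - card B0)) s"
proof -
  let ?U = "blocked blk"
  let ?id = "nmem s vID 0"
  have finB: "finite B \<and> B \<subseteq> {..<n} - ?U \<and> card B \<le> n" if "ball_inv ?U L x t B d K P" for B d K P
  proof -
    have "B \<subseteq> {..<n} - ?U" using that by (simp add: ball_inv_def)
    moreover from this have "finite B" by (rule finite_subset) simp
    ultimately show ?thesis using card_mono[of "{..<n}" B] by auto
  qed
  define I where "I = (\<lambda>u. \<exists>B. same pass_frame s u \<and> ball_state blk L x B u \<and> B0 \<subseteq> B \<and>
     nmem u vQ 0 \<le> nmem u vP 0 \<and> nmem u vP 0 \<le> nmem u vAN 0 \<and>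
     ball_inv ?U L x t B (nmem u DD) (arcs u 0 (nmem u vQ 0)) (arcs u (nmem u vP 0) (nmem u vAN 0)) \<and>
     (\<forall>v\<in>B0. nmem u DD v = nmem s DD v) \<and>
     nmem u vAN 0 \<le> an0 + 10 * (card B - card B0) \<and>
     steps u \<le> steps s + 2 + 12 * nmem u vP 0 + 100 * (card B - card B0))"
  have "wp (Loop (NLess (var vP) (var vAN))
       (seqs [setv vV (NGet AV (var vP)), setv vE (NGet AE (var vP)),
          setv vY (NSub (NAdd (NGet 1 (var vE)) (NGet 2 (var vE))) (var vV)),
          incv vP,
          Cond (NLess (NGet BLK (var vY)) (NConst 1))
            (Cond (NLess (var vT) (NAdd (NGet DD (var vV)) (NGet LEN (var vE))))
              (seqs [NSet AV (var vQ) (var vV), NSet AE (var vQ) (var vE), incv vQ])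
              (seqs [NSet BLK (var vY) (var vID), NSet DD (var vY) (var vT), incv vBC, push]))
            Skip]))
     (wp (setv vAN (var vQ)) (\<lambda>u. \<exists>B. same pass_frame s u \<and> ball_state blk L x B u \<and> B0 \<subseteq> B \<and>
     ball_inv ?U L x t B (nmem u DD) (arcs u 0 (nmem u vAN 0)) [] \<and>
     (\<forall>v\<in>B0. nmem u DD v = nmem s DD v) \<and>
     steps u \<le> steps s + 5 + 12 * an0 + 220 * (card B - card B0)))
     (tick (nset vQ 0 0 (tick (nset vP 0 0 s))))"
  proof (rule wp_Loop[where I = I and \<mu> = "\<lambda>u. 11 * (n - nmem u vBC 0) + (nmem u vAN 0 - nmem u vP 0)"])
    let ?s' = "tick (nset vQ 0 0 (tick (nset vP 0 0 s)))"
    have "arcs ?s' 0 an0 = arcs s 0 an0" by (simp add: arcs_def)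
    moreover have "static ?s' = static s" by (rule static_cong) auto
    ultimately show "I ?s'"
      unfolding I_def using bs an0 inv by (intro exI[of _ B0]) (simp add: ball_state_def)
  next
    fix u assume "I u" and g: "beval u (NLess (var vP) (var vAN))"
    then obtain B where sm: "same pass_frame s u" and bu: "ball_state blk L x B u" and B0: "B0 \<subseteq> B"
      and q: "nmem u vQ 0 \<le> nmem u vP 0"
      and iu: "ball_inv ?U L x t B (nmem u DD) (arcs u 0 (nmem u vQ 0)) (arcs u (nmem u vP 0) (nmem u vAN 0))"
      and dd: "\<forall>v\<in>B0. nmem u DD v = nmem s DD v"
      and an: "nmem u vAN 0 \<le> an0 + 10 * (card B - card B0)"
      and stp: "steps u \<le> steps s + 2 + 12 * nmem u vP 0 + 100 * (card B - card B0)"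
      unfolding I_def by blast
    define p where "p = nmem u vP 0"
    define v where "v = nmem u AV p"
    define e where "e = nmem u AE p"
    define y where "y = oth e v"
    have p: "p < nmem u vAN 0" using g by (simp add: p_def)
    have P: "arcs u p (nmem u vAN 0) = (v, e) # arcs u (Suc p) (nmem u vAN 0)"
      using arcs_Cons[OF p] by (simp add: v_def e_def)
    have iu': "ball_inv ?U L x t B (nmem u DD) (arcs u 0 (nmem u vQ 0)) ((v, e) # arcs u (Suc p) (nmem u vAN 0))"
      using iu P by (simp add: p_def)
    have ve: "v \<in> B" "e \<in> inc v" using iu' by (auto simp: ball_inv_def)
    have yn: "y < n" using incD(3)[OF ve(2)] by (simp add: y_def)
    have su: "static u" using bu by (simp add: ball_state_def)
    have yc: "nmem u 1 e + nmem u 2 e - v = y"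
      using su incD(1)[OF ve(2)] by (simp add: static_def y_def oth_def)
    have T: "nmem u vT 0 = t" using sm t by (simp add: sameD)
    have ID: "nmem u vID = nmem s vID" using sm by (simp add: sameD)
    have idpos: "0 < ?id" using bs by (simp add: ball_state_def)
    have blku: "nmem u BLK = (\<lambda>v. if v \<in> B then ?id else blk v)" using bu ID by (simp add: ball_state_def paint_def)
    have Lu: "nmem u LEN = L" and BC: "nmem u vBC 0 = card B" and dx: "nmem u DD x = 0"
      using bu by (simp_all add: ball_state_def)
    note fB = finB[OF iu]
    let ?u1 = "tick (nset vP 0 (Suc p) (tick (nset vY 0 y (tick (nset vE 0 e (tick (nset vV 0 v (tick u))))))))"
    have st1: "static w" if "nmem w 0 = nmem u 0" "nmem w 1 = nmem u 1" "nmem w 2 = nmem u 2"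
      "nmem w DEG = nmem u DEG" "nmem w ADJ = nmem u ADJ" for w
      using static_cong[of w u] su that by simp
    have fin: "I w \<and> 11 * (n - nmem w vBC 0) + (nmem w vAN 0 - nmem w vP 0)
            < 11 * (n - nmem u vBC 0) + (nmem u vAN 0 - nmem u vP 0)"
      if "same pass_frame s w" "ball_state blk L x B w"
        "nmem w vQ 0 \<le> nmem w vP 0" "nmem w vP 0 = Suc p" "nmem w vAN 0 = nmem u vAN 0"
        "ball_inv ?U L x t B (nmem w DD) (arcs w 0 (nmem w vQ 0)) (arcs w (Suc p) (nmem w vAN 0))"
        "nmem w DD = nmem u DD" "steps w \<le> steps u + 12" for w
    proof
      show "I w" unfolding I_def
        by (intro exI[of _ B]) (use that B0 dd an stp p in \<open>simp add: p_def\<close>)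
      show "11 * (n - nmem w vBC 0) + (nmem w vAN 0 - nmem w vP 0)
            < 11 * (n - nmem u vBC 0) + (nmem u vAN 0 - nmem u vP 0)"
        using that(2,4,5) BC p by (simp add: ball_state_def p_def)
    qed
    have key: "if nmem u BLK y < 1
        then if t < nmem u DD v + L e
          then wp (seqs [NSet AV (var vQ) (var vV), NSet AE (var vQ) (var vE), incv vQ])
             (\<lambda>w. I w \<and> 11 * (n - nmem w vBC 0) + (nmem w vAN 0 - nmem w vP 0)
                < 11 * (n - nmem u vBC 0) + (nmem u vAN 0 - nmem u vP 0)) (tick (tick ?u1))
          else wp (seqs [NSet BLK (var vY) (var vID), NSet DD (var vY) (var vT), incv vBC, push])
             (\<lambda>w. I w \<and> 11 * (n - nmem w vBC 0) + (nmem w vAN 0 - nmem w vP 0)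
                < 11 * (n - nmem u vBC 0) + (nmem u vAN 0 - nmem u vP 0)) (tick (tick ?u1))
        else (\<lambda>w. I w \<and> 11 * (n - nmem w vBC 0) + (nmem w vAN 0 - nmem w vP 0)
                < 11 * (n - nmem u vBC 0) + (nmem u vAN 0 - nmem u vP 0)) (tick (tick ?u1))"
    proof (cases "nmem u BLK y < 1")
      case False
      then have "oth e v \<in> ?U \<union> B" using yn blku by (auto simp: y_def split: if_splits)
      then have "ball_inv ?U L x t B (nmem u DD) (arcs u 0 (nmem u vQ 0)) (arcs u (Suc p) (nmem u vAN 0))"
        by (rule ball_inv_drop[OF iu'])
      moreover have "arcs (tick (tick ?u1)) i j = arcs u i j" for i j by (simp add: arcs_def)
      moreover have "ball_state blk L x B (tick (tick ?u1))"
        using bu st1[of "tick (tick ?u1)"] by (simp add: ball_state_def)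
      ultimately have "I (tick (tick ?u1)) \<and> 11 * (n - nmem (tick (tick ?u1)) vBC 0) + (nmem (tick (tick ?u1)) vAN 0 - nmem (tick (tick ?u1)) vP 0)
            < 11 * (n - nmem u vBC 0) + (nmem u vAN 0 - nmem u vP 0)"
        using sm q by (intro fin) (simp_all add: p_def)
      then show ?thesis using False by simp
    next
      case True
      then have yU: "oth e v \<notin> ?U \<union> B" using yn blku idpos by (auto simp: y_def split: if_splits)
      show ?thesis
      proof (cases "t < nmem u DD v + L e")
        case keep: True
        let ?q = "nmem u vQ 0"
        let ?w = "tick (nset vQ 0 (?q + 1) (tick (nset AE ?q e (tick (nset AV ?q v (tick (tick ?u1)))))))"
        have "ball_inv ?U L x t B (nmem u DD) (arcs u 0 ?q @ [(v, e)]) (arcs u (Suc p) (nmem u vAN 0))"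
          by (rule ball_inv_keep[OF iu' keep])
        moreover have "arcs ?w 0 ?q = arcs u 0 ?q" by (rule arcs_cong) auto
        then have "arcs ?w 0 (Suc ?q) = arcs u 0 ?q @ [(v, e)]" by (simp add: arcs_snoc)
        moreover have "arcs ?w (Suc p) (nmem u vAN 0) = arcs u (Suc p) (nmem u vAN 0)"
          using q by (intro arcs_cong) (auto simp: p_def)
        moreover have "ball_state blk L x B ?w"
          using bu st1[of ?w] by (simp add: ball_state_def)
        ultimately have "I ?w \<and> 11 * (n - nmem ?w vBC 0) + (nmem ?w vAN 0 - nmem ?w vP 0)
            < 11 * (n - nmem u vBC 0) + (nmem u vAN 0 - nmem u vP 0)"
          using sm q by (intro fin) (simp_all add: p_def)
        then show ?thesis using True keep by simp
      next
        case add: False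
        let ?u2 = "tick (nset vBC 0 (card B + 1) (tick (nset DD y t (tick (nset BLK y ?id (tick (tick ?u1)))))))"
        have s2: "static ?u2" by (rule st1) simp_all
        have post: "I w \<and> 11 * (n - nmem w vBC 0) + (nmem w vAN 0 - nmem w vP 0)
                < 11 * (n - nmem u vBC 0) + (nmem u vAN 0 - nmem u vP 0)"
          if w: "same {vJJ, AV, AE, vAN} ?u2 w" "steps w \<le> steps ?u2 + 60"
             "nmem w vAN 0 \<le> nmem u vAN 0 + 10" "nmem u vAN 0 \<le> nmem w vAN 0"
             "\<forall>p<nmem u vAN 0. nmem w AV p = nmem ?u2 AV p \<and> nmem w AE p = nmem ?u2 AE p"
             "distinct (arcs w (nmem u vAN 0) (nmem w vAN 0))"
             "set (arcs w (nmem u vAN 0) (nmem w vAN 0)) = Pair y ` inc y" for w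
        proof -
          let ?B = "insert y B"
          have wm: "nmem w a = nmem ?u2 a" if "a \<notin> {vJJ, AV, AE, vAN}" for a
            using sameD[OF w(1) that] .
          have a1: "arcs w 0 (nmem u vQ 0) = arcs u 0 (nmem u vQ 0)"
            using w(5) q p by (intro arcs_cong) (auto simp: p_def)
          have a2: "arcs w (Suc p) (nmem w vAN 0) = arcs u (Suc p) (nmem u vAN 0) @ arcs w (nmem u vAN 0) (nmem w vAN 0)"
          proof -
            have "arcs w (Suc p) (nmem u vAN 0) = arcs u (Suc p) (nmem u vAN 0)"
              using w(5) by (intro arcs_cong) auto
            then show ?thesis using arcs_append[of "Suc p" "nmem u vAN 0" "nmem w vAN 0" w] p w(4) by simp
          qed
          have dw: "nmem w DD = (nmem u DD)(y := t)" using wm[of DD] by simp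
          have inv': "ball_inv ?U L x t ?B (nmem w DD) (arcs w 0 (nmem u vQ 0)) (arcs w (Suc p) (nmem w vAN 0))"
            unfolding a1 a2 dw unfolding y_def
            by (rule ball_inv_add[OF iu' yU add w(6)]) (use w(7) in \<open>simp add: y_def\<close>)
          have cB: "card ?B = Suc (card B)" using yU fB by (simp add: y_def)
          have cB0: "card B0 \<le> card B" using B0 fB by (simp add: card_mono)
          have yx: "y \<noteq> x" using iu' yU by (auto simp: ball_inv_def y_def)
          have sw: "static w" by (rule static_same[OF s2 w(1)]) simp
          have bw: "ball_state blk L x ?B w"
            using wm[of LEN] wm[of vID] wm[of BLK] wm[of vBC] sw Lu ID idpos cB blku dx yx
            by (auto simp: ball_state_def dw paint_def)
          have smw: "same pass_frame s w"
          proof -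
            have "same pass_frame s ?u2" using sm by simp
            then show ?thesis by (rule same_trans[OF _ w(1)]) auto
          qed
          have "I w" unfolding I_def
          proof (intro exI[of _ ?B] conjI)
            show "\<forall>v\<in>B0. nmem w DD v = nmem s DD v" using dd B0 yU by (auto simp: dw y_def)
            show "nmem w vAN 0 \<le> an0 + 10 * (card ?B - card B0)" using w(3) an cB cB0 by simp
            show "steps w \<le> steps s + 2 + 12 * nmem w vP 0 + 100 * (card ?B - card B0)"
              using w(2) stp cB cB0 wm[of vP] by (simp add: p_def)
          qed (use smw bw B0 wm[of vQ] wm[of vP] q p w(4) inv' in \<open>auto simp: p_def\<close>)
          moreover have "card ?B \<le> n" using finB[OF inv'] by simp
          ultimately show ?thesis using wm[of vBC] wm[of vP] w(3) p cB BC by (simp add: p_def)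
        qed
        have "wp push (\<lambda>w. I w \<and> 11 * (n - nmem w vBC 0) + (nmem w vAN 0 - nmem w vP 0)
                < 11 * (n - nmem u vBC 0) + (nmem u vAN 0 - nmem u vP 0)) ?u2"
          by (rule wp_mono[OF wp_push[OF s2, of y "nmem u vAN 0"]]) (use yn post in auto)
        then show ?thesis using True add T ID BC by simp
      qed
    qed
    show "wp (seqs [setv vV (NGet AV (var vP)), setv vE (NGet AE (var vP)),
          setv vY (NSub (NAdd (NGet 1 (var vE)) (NGet 2 (var vE))) (var vV)),
          incv vP,
          Cond (NLess (NGet BLK (var vY)) (NConst 1))
            (Cond (NLess (var vT) (NAdd (NGet DD (var vV)) (NGet LEN (var vE))))
              (seqs [NSet AV (var vQ) (var vV), NSet AE (var vQ) (var vE), incv vQ])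
              (seqs [NSet BLK (var vY) (var vID), NSet DD (var vY) (var vT), incv vBC, push]))
            Skip])
        (\<lambda>w. I w \<and> 11 * (n - nmem w vBC 0) + (nmem w vAN 0 - nmem w vP 0)
                < 11 * (n - nmem u vBC 0) + (nmem u vAN 0 - nmem u vP 0)) (tick u)"
      by (cases "nmem u BLK y < 1"; cases "t < nmem u DD v + L e")
         (use key yc Lu T in \<open>simp_all add: p_def[symmetric] v_def[symmetric] e_def[symmetric]\<close>)
  next
    fix u assume "I u" and g: "\<not> beval u (NLess (var vP) (var vAN))"
    then obtain B where sm: "same pass_frame s u" and bu: "ball_state blk L x B u" and B0: "B0 \<subseteq> B"
      and pa: "nmem u vP 0 = nmem u vAN 0"
      and iu: "ball_inv ?U L x t B (nmem u DD) (arcs u 0 (nmem u vQ 0)) []"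
      and dd: "\<forall>v\<in>B0. nmem u DD v = nmem s DD v"
      and an: "nmem u vAN 0 \<le> an0 + 10 * (card B - card B0)"
      and stp: "steps u \<le> steps s + 2 + 12 * nmem u vP 0 + 100 * (card B - card B0)"
      unfolding I_def by (auto simp: le_antisym)
    let ?w = "tick (nset vAN 0 (nmem u vQ 0) (tick u))"
    have "static ?w" using bu static_cong[of ?w u] by (simp add: ball_state_def)
    then have "ball_state blk L x B ?w" using bu by (simp add: ball_state_def)
    moreover have "arcs ?w 0 (nmem u vQ 0) = arcs u 0 (nmem u vQ 0)" by (simp add: arcs_def)
    ultimately show "wp (setv vAN (var vQ)) (\<lambda>u. \<exists>B. same pass_frame s u \<and> ball_state blk L x B u \<and> B0 \<subseteq> B \<and>
       ball_inv ?U L x t B (nmem u DD) (arcs u 0 (nmem u vAN 0)) [] \<and>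
       (\<forall>v\<in>B0. nmem u DD v = nmem s DD v) \<and>
       steps u \<le> steps s + 5 + 12 * an0 + 220 * (card B - card B0)) (tick u)"
      using sm B0 iu dd pa an stp by (auto intro!: exI[of _ B])
  qed
  then show ?thesis unfolding pass_def by simp
qed

end

context cut_input
begin

text \<open>As long as the ball has at most half of the vertices and violates the stopping rule,
  \<open>\<beta> * vPROG + \<gamma> * vBC\<close> grows by the factor \<open>1 + \<beta>\<close> in
  each unit of time, since \<open>vPROG\<close> increases by the number of active arcs. By time
  \<open>R\<close> it would exceed what the whole graph allows. A ball that ends with more than half
  of the vertices must thus have passed one half by time \<open>R\<close>; the vertices labelled at
  most \<open>R\<close> form its core.\<close>

lemma wp_ball:
  assumes st: "static s" and x: "nmem s vX 0 = x" "x < n" and blk: "nmem s BLK = blk" "blk x = 0"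
    and L: "nmem s LEN = L"
    and params: "rmem s rBETA 0 = \<beta>" "rmem s rGAM 0 = \<gamma>" "rmem s rH 0 = H" "0 \<le> \<beta>" "0 < \<gamma>"
    and R: "0 < R" "real R \<le> H" "\<beta> * real (vol L {..<n}) + \<gamma> * real n < (1 + \<beta>) ^ R * \<gamma>"
  shows "wp ball (\<lambda>u. \<exists>B. same (pass_frame \<union> {vID, vPROG, vT}) s u \<and> ball_state blk L x B u \<and>
     nmem u vID 0 = Suc (nmem s vID 0) \<and>
     ball_inv (blocked blk) L x (nmem u vT 0) B (nmem u DD) (arcs u 0 (nmem u vAN 0)) [] \<and>
     nmem u vPROG 0 \<le> vol L B \<and> real (nmem u vT 0) < H + 1 \<and>
     (2 * card B \<le> n \<longrightarrow> real (nmem u vAN 0) \<le> \<beta> * real (nmem u vPROG 0) + \<gamma> * real (card B)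
        \<and> nmem u vT 0 \<le> nmem u vPROG 0) \<and>
     (n < 2 * card B \<longrightarrow> H \<le> real (nmem u vT 0) \<and> n < 2 * card {v \<in> B. nmem u DD v \<le> R}) \<and>
     steps u \<le> steps s + 400 + 12 * nmem u vPROG 0 + 220 * card B + 10 * nmem u vT 0) s"
proof -
  let ?U = "blocked blk"
  let ?F = "pass_frame \<union> {vID, vPROG, vT}"
  have finB: "finite B \<and> B \<subseteq> {..<n} - ?U \<and> card B \<le> n" if "ball_inv ?U L x t B d K P" for t B d K P
  proof -
    have "B \<subseteq> {..<n} - ?U" using that by (simp add: ball_inv_def)
    moreover from this have "finite B" by (rule finite_subset) simp
    ultimately show ?thesis using card_mono[of "{..<n}" B] by auto
  qed
  define J where "J = (\<lambda>u. \<exists>B. same ?F s u \<and> ball_state blk L x B u \<and>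
     nmem u vID 0 = Suc (nmem s vID 0) \<and>
     ball_inv ?U L x (nmem u vT 0) B (nmem u DD) (arcs u 0 (nmem u vAN 0)) [] \<and>
     nmem u vPROG 0 \<le> swept L (nmem u vT 0) (nmem u DD) B \<and> real (nmem u vT 0) < H + 1 \<and>
     (2 * card B \<le> n \<longrightarrow> (1 + \<beta>) ^ nmem u vT 0 * \<gamma> \<le> \<beta> * real (nmem u vPROG 0) + \<gamma> * real (card B)
        \<and> nmem u vT 0 \<le> nmem u vPROG 0) \<and>
     (R \<le> nmem u vT 0 \<longrightarrow> n < 2 * card {v \<in> B. nmem u DD v \<le> R}) \<and>
     steps u \<le> steps s + 390 + 12 * nmem u vPROG 0 + 220 * (card B - 1) + 10 * nmem u vT 0)"
  let ?Q = "\<lambda>u. \<exists>B. same ?F s u \<and> ball_state blk L x B u \<and>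
     nmem u vID 0 = Suc (nmem s vID 0) \<and>
     ball_inv ?U L x (nmem u vT 0) B (nmem u DD) (arcs u 0 (nmem u vAN 0)) [] \<and>
     nmem u vPROG 0 \<le> vol L B \<and> real (nmem u vT 0) < H + 1 \<and>
     (2 * card B \<le> n \<longrightarrow> real (nmem u vAN 0) \<le> \<beta> * real (nmem u vPROG 0) + \<gamma> * real (card B)
        \<and> nmem u vT 0 \<le> nmem u vPROG 0) \<and>
     (n < 2 * card B \<longrightarrow> H \<le> real (nmem u vT 0) \<and> n < 2 * card {v \<in> B. nmem u DD v \<le> R}) \<and>
     steps u \<le> steps s + 400 + 12 * nmem u vPROG 0 + 220 * card B + 10 * nmem u vT 0"
  have rm: "rmem u = rmem s" "nmem u 0 = nmem s 0" if "same ?F s u" for u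
    using sameD[OF that, of 0] sameD2[OF that] by auto
  have n0: "nmem s 0 0 = n" using st by (simp add: static_def)
  have guard: "beval u ball_guard \<longleftrightarrow>
      \<not> (real (nmem u vAN 0) \<le> \<beta> * real (nmem u vPROG 0) + \<gamma> * real (nmem u vBC 0) \<and> 2 * nmem u vBC 0 \<le> n)
      \<and> real (nmem u vT 0) < H" if "same ?F s u" for u
    using rm[OF that] params n0 by (auto simp: ball_guard_def not_less)
  have loop: "wp (Loop ball_guard (seqs [setv vPROG (NAdd (var vPROG) (var vAN)), incv vT, pass])) ?Q u"
    if "J u" for u
  proof (rule wp_Loop[where I = J and \<mu> = "\<lambda>u. nat \<lceil>H\<rceil> - nmem u vT 0", OF that])
    fix u assume "J u" and g: "beval u ball_guard"
    then obtain B where sm: "same ?F s u" and bu: "ball_state blk L x B u"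
      and ID: "nmem u vID 0 = Suc (nmem s vID 0)"
      and iu: "ball_inv ?U L x (nmem u vT 0) B (nmem u DD) (arcs u 0 (nmem u vAN 0)) []"
      and pr: "nmem u vPROG 0 \<le> swept L (nmem u vT 0) (nmem u DD) B"
      and gr: "2 * card B \<le> n \<longrightarrow> (1 + \<beta>) ^ nmem u vT 0 * \<gamma> \<le> \<beta> * real (nmem u vPROG 0) + \<gamma> * real (card B)
        \<and> nmem u vT 0 \<le> nmem u vPROG 0"
      and core: "R \<le> nmem u vT 0 \<longrightarrow> n < 2 * card {v \<in> B. nmem u DD v \<le> R}"
      and stp: "steps u \<le> steps s + 390 + 12 * nmem u vPROG 0 + 220 * (card B - 1) + 10 * nmem u vT 0"
      unfolding J_def by blast
    define t where "t = nmem u vT 0"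
    define pg where "pg = nmem u vPROG 0"
    define an where "an = nmem u vAN 0"
    have bc: "nmem u vBC 0 = card B" using bu by (simp add: ball_state_def)
    have g': "\<not> (real an \<le> \<beta> * real pg + \<gamma> * real (card B) \<and> 2 * card B \<le> n)" "real t < H"
      using g guard[OF sm] bc by (auto simp: t_def pg_def an_def)
    let ?u1 = "tick (nset vT 0 (Suc t) (tick (nset vPROG 0 (pg + an) (tick u))))"
    have b1: "ball_state blk L x B ?u1"
      using bu static_cong[of ?u1 u] by (simp add: ball_state_def)
    have a1: "arcs ?u1 0 an = arcs u 0 an" by (simp add: arcs_def)
    have i1: "ball_inv ?U L x (Suc t) B (nmem ?u1 DD) [] (arcs ?u1 0 an)"
      using ball_inv_tick[OF iu[folded t_def an_def]] a1 by simp
    have "wp pass (\<lambda>w. J w \<and> nat \<lceil>H\<rceil> - nmem w vT 0 < nat \<lceil>H\<rceil> - nmem u vT 0) ?u1"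
    proof (rule wp_mono[OF wp_pass[OF b1 _ _ i1]])
      fix w assume "\<exists>B'. same pass_frame ?u1 w \<and> ball_state blk L x B' w \<and> B \<subseteq> B' \<and>
         ball_inv ?U L x (Suc t) B' (nmem w DD) (arcs w 0 (nmem w vAN 0)) [] \<and>
         (\<forall>v\<in>B. nmem w DD v = nmem ?u1 DD v) \<and>
         steps w \<le> steps ?u1 + 5 + 12 * an + 220 * (card B' - card B)"
      then obtain B' where sw: "same pass_frame ?u1 w" and bw: "ball_state blk L x B' w" and sub: "B \<subseteq> B'"
        and iw: "ball_inv ?U L x (Suc t) B' (nmem w DD) (arcs w 0 (nmem w vAN 0)) []"
        and dd: "\<And>v. v \<in> B \<Longrightarrow> nmem w DD v = nmem u DD v"
        and stw: "steps w \<le> steps ?u1 + 5 + 12 * an + 220 * (card B' - card B)" by auto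
      have W: "nmem w vT 0 = Suc t" "nmem w vPROG 0 = pg + an" "nmem w vID 0 = nmem u vID 0"
        using sameD[OF sw] by simp_all
      note f = finB[OF iu] and f' = finB[OF iw]
      have cBB: "card B \<le> card B'" using sub f' by (simp add: card_mono)
      have "x \<in> B" using iu by (simp add: ball_inv_def)
      then have x1: "1 \<le> card B" using f card_mono[of B "{x}"] by simp
      have small: "2 * card B' \<le> n \<Longrightarrow> (1 + \<beta>) ^ Suc t * \<gamma> \<le> \<beta> * real (pg + an) + \<gamma> * real (card B')
          \<and> Suc t \<le> pg + an"
      proof -
        assume s: "2 * card B' \<le> n"
        then have s2: "2 * card B \<le> n" using cBB by simp
        then have h: "(1 + \<beta>) ^ t * \<gamma> \<le> \<beta> * real pg + \<gamma> * real (card B)" "t \<le> pg"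
          using gr by (auto simp: t_def pg_def)
        have a: "\<beta> * real pg + \<gamma> * real (card B) < real an" using g' s2 by auto
        have "0 \<le> \<beta> * real pg + \<gamma> * real (card B)" using params by simp
        \<comment> \<open>Every unit of time that a small ball survives adds at least one to
          \<open>vPROG\<close>. Elapsed time is thereby bounded by swept length, and the time steps
          of small balls are paid for by their volumes.\<close>
        then have "0 < an" using a by linarith
        have "(1 + \<beta>) ^ Suc t * \<gamma> \<le> (1 + \<beta>) * (\<beta> * real pg + \<gamma> * real (card B))"
          using mult_left_mono[OF h(1), of "1 + \<beta>"] params by (simp add: mult.assoc)
        also have "\<dots> \<le> \<beta> * real pg + \<gamma> * real (card B) + \<beta> * real an"
          using mult_left_mono[OF less_imp_le[OF a], of \<beta>] params by (simp add: algebra_simps)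
        also have "\<dots> \<le> \<beta> * real (pg + an) + \<gamma> * real (card B')"
          using cBB params by (simp add: algebra_simps)
        finally show ?thesis using h(2) \<open>0 < an\<close> by simp
      qed
      have prog: "pg + an \<le> swept L (Suc t) (nmem w DD) B'"
      proof -
        have "pg + an \<le> swept L (Suc t) (nmem u DD) B"
          using swept_step[OF iu] pr by (simp add: t_def pg_def an_def)
        also have "\<dots> \<le> swept L (Suc t) (nmem w DD) B'"
          by (rule swept_mono[OF sub]) (use f' dd in auto)
        finally show ?thesis .
      qed
      have core': "n < 2 * card {v \<in> B'. nmem w DD v \<le> R}" if Rt: "R \<le> Suc t"
      proof (cases "R \<le> t")
        case True
        have "card {v \<in> B. nmem u DD v \<le> R} \<le> card {v \<in> B'. nmem w DD v \<le> R}"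
          using sub dd f' by (intro card_mono) auto
        then show ?thesis using core True by (simp add: t_def)
      next
        case False
        then have Req: "R = Suc t" using Rt by simp
        have "\<not> 2 * card B' \<le> n"
        proof
          assume "2 * card B' \<le> n"
          then have "(1 + \<beta>) ^ R * \<gamma> \<le> \<beta> * real (pg + an) + \<gamma> * real (card B')" using small Req by simp
          also have "\<dots> \<le> \<beta> * real (vol L {..<n}) + \<gamma> * real n"
          proof (intro add_mono mult_left_mono)
            have "pg + an \<le> vol L B'" using prog swept_le_vol order_trans by blast
            also have "\<dots> \<le> vol L {..<n}" using f' by (intro vol_mono) auto
            finally show "real (pg + an) \<le> real (vol L {..<n})" by simp
          qed (use params f' in auto)
          finally show False using R(3) by simp
        qed
        moreover have "{v \<in> B'. nmem w DD v \<le> R} = B'" using iw Req by (auto simp: ball_inv_def)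
        ultimately show ?thesis by simp
      qed
      have "same ?F s w"
      proof -
        have "same ?F s ?u1" using sm by simp
        then show ?thesis by (rule same_trans[OF _ sw]) auto
      qed
      then have "J w" unfolding J_def
        using bw ID W iw prog g'(2) small core' stw stp cBB x1
        by (intro exI[of _ B']) (auto simp: t_def pg_def an_def)
      moreover have "t < nat \<lceil>H\<rceil>" using g'(2) by linarith
      ultimately show "J w \<and> nat \<lceil>H\<rceil> - nmem w vT 0 < nat \<lceil>H\<rceil> - nmem u vT 0"
        using W by (simp add: t_def)
    qed (simp_all add: an_def)
    then show "wp (seqs [setv vPROG (NAdd (var vPROG) (var vAN)), incv vT, pass])
       (\<lambda>w. J w \<and> nat \<lceil>H\<rceil> - nmem w vT 0 < nat \<lceil>H\<rceil> - nmem u vT 0) (tick u)"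
      by (simp add: t_def pg_def an_def)
  next
    fix u assume "J u" and g: "\<not> beval u ball_guard"
    then obtain B where sm: "same ?F s u" and bu: "ball_state blk L x B u"
      and ID: "nmem u vID 0 = Suc (nmem s vID 0)"
      and iu: "ball_inv ?U L x (nmem u vT 0) B (nmem u DD) (arcs u 0 (nmem u vAN 0)) []"
      and pr: "nmem u vPROG 0 \<le> swept L (nmem u vT 0) (nmem u DD) B" and tH: "real (nmem u vT 0) < H + 1"
      and gr: "2 * card B \<le> n \<longrightarrow> (1 + \<beta>) ^ nmem u vT 0 * \<gamma> \<le> \<beta> * real (nmem u vPROG 0) + \<gamma> * real (card B)
        \<and> nmem u vT 0 \<le> nmem u vPROG 0"
      and core: "R \<le> nmem u vT 0 \<longrightarrow> n < 2 * card {v \<in> B. nmem u DD v \<le> R}"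
      and stp: "steps u \<le> steps s + 390 + 12 * nmem u vPROG 0 + 220 * (card B - 1) + 10 * nmem u vT 0"
      unfolding J_def by blast
    note f = finB[OF iu]
    have bc: "nmem u vBC 0 = card B" using bu by (simp add: ball_state_def)
    have "card {v \<in> B. nmem u DD v \<le> R} \<le> card B" using f by (intro card_mono) auto
    then have big: "R \<le> nmem u vT 0 \<Longrightarrow> n < 2 * card B" using core by simp
    have small: "real (nmem u vAN 0) \<le> \<beta> * real (nmem u vPROG 0) + \<gamma> * real (card B)" if "2 * card B \<le> n"
      using g guard[OF sm] big that R(2) bc by (auto simp: not_less)
    have large: "H \<le> real (nmem u vT 0)" if "n < 2 * card B"
      using g guard[OF sm] that bc by (auto simp: not_less)
    have largeR: "R \<le> nmem u vT 0" if "n < 2 * card B" using large[OF that] R(2) by linarith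
    have "ball_state blk L x B (tick u)" using bu static_cong[of "tick u" u] by (simp add: ball_state_def)
    moreover have "arcs (tick u) 0 j = arcs u 0 j" for j by (simp add: arcs_def)
    moreover have "nmem u vPROG 0 \<le> vol L B" using pr swept_le_vol order_trans by blast
    ultimately show "?Q (tick u)"
      using sm ID iu tH gr small large largeR core stp by (intro exI[of _ B]) auto
  qed
  let ?i = "Suc (nmem s vID 0)"
  let ?s1 = "tick (nset vY 0 x (tick (nset vAN 0 0 (tick (nset vT 0 0 (tick (nset vPROG 0 0 (tick (nset vBC 0 1
      (tick (nset DD x 0 (tick (nset BLK x ?i (tick (nset vID 0 ?i s)))))))))))))))"
  have s1: "static ?s1" using st static_cong[of ?s1 s] by simp
  have "wp push (\<lambda>w. wp pass (\<lambda>u. wp (Loop ball_guard (seqs [setv vPROG (NAdd (var vPROG) (var vAN)), incv vT, pass])) ?Q u) w) ?s1"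
  proof (rule wp_mono[OF wp_push[OF s1, of x 0]])
    fix w assume w: "same {vJJ, AV, AE, vAN} ?s1 w \<and> steps w \<le> steps ?s1 + 60 \<and>
       nmem w vAN 0 \<le> 0 + 10 \<and> 0 \<le> nmem w vAN 0 \<and>
       (\<forall>p<0. nmem w AV p = nmem ?s1 AV p \<and> nmem w AE p = nmem ?s1 AE p) \<and>
       distinct (arcs w 0 (nmem w vAN 0)) \<and> set (arcs w 0 (nmem w vAN 0)) = Pair x ` inc x"
    then have sw: "same {vJJ, AV, AE, vAN} ?s1 w" by blast
    have wm: "nmem w a = nmem ?s1 a" if "a \<notin> {vJJ, AV, AE, vAN}" for a using sameD[OF sw that] .
    have stw: "static w" by (rule static_same[OF s1 sw]) simp
    have bw: "ball_state blk L x {x} w"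
      using stw wm[of LEN] wm[of vID] wm[of BLK] wm[of vBC] wm[of DD] blk L
      by (auto simp: ball_state_def paint_def)
    have iw: "ball_inv ?U L x 0 {x} (nmem w DD) [] (arcs w 0 (nmem w vAN 0))"
      using w x blk wm[of DD] by (intro ball_inv_start) auto
    have smw: "same ?F s w"
    proof -
      have "same ?F s ?s1" by simp
      then show ?thesis by (rule same_trans[OF _ sw]) auto
    qed
    show "wp pass (\<lambda>u. wp (Loop ball_guard (seqs [setv vPROG (NAdd (var vPROG) (var vAN)), incv vT, pass])) ?Q u) w"
    proof (rule wp_mono[OF wp_pass[OF bw refl _ iw]])
      show "nmem w vT 0 = 0" using wm[of vT] by simp
    next
      fix u assume "\<exists>B. same pass_frame w u \<and> ball_state blk L x B u \<and> {x} \<subseteq> B \<and>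
         ball_inv ?U L x 0 B (nmem u DD) (arcs u 0 (nmem u vAN 0)) [] \<and>
         (\<forall>v\<in>{x}. nmem u DD v = nmem w DD v) \<and>
         steps u \<le> steps w + 5 + 12 * nmem w vAN 0 + 220 * (card B - card {x})"
      then obtain B where su: "same pass_frame w u" and bu: "ball_state blk L x B u" and xB: "{x} \<subseteq> B"
        and iu: "ball_inv ?U L x 0 B (nmem u DD) (arcs u 0 (nmem u vAN 0)) []"
        and stu: "steps u \<le> steps w + 5 + 12 * nmem w vAN 0 + 220 * (card B - 1)" by auto
      have W: "nmem u vT 0 = 0" "nmem u vPROG 0 = 0" "nmem u vID 0 = ?i"
        using sameD[OF su] wm[of vT] wm[of vPROG] wm[of vID] by simp_all
      have smu: "same ?F s u" by (rule same_trans[OF smw su]) auto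
      have x1: "1 \<le> card B" using xB finB[OF iu] card_mono[of B "{x}"] by simp
      have H0: "0 \<le> H" using R by linarith
      have "J u" unfolding J_def
        using smu bu W iu H0 x1 R(1) params stu w
        by (intro exI[of _ B]) (auto simp: mult_le_cancel_left)
      then show "wp (Loop ball_guard (seqs [setv vPROG (NAdd (var vPROG) (var vAN)), incv vT, pass])) ?Q u"
        by (rule loop)
    qed
  qed (use x in simp_all)
  then show ?thesis unfolding ball_def using x by simp
qed

end

section \<open>Carving out a sparse cut\<close>

abbreviation (input) vJ :: nat where "vJ \<equiv> 21"
abbreviation (input) vKF :: nat where "vKF \<equiv> 22"

text \<open>Ball numbers increase, so the vertices with a number not below \<open>vID\<close> are
  those of the latest ball. Resetting their entries withdraws the ball from the cut.\<close>

definition mark :: com where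
  "mark = seqs [setv vV (NConst 0),
     Loop (NLess (var vV) (var 0))
       (seqs [Cond (NLess (NGet BLK (var vV)) (var vID)) Skip
                (seqs [NSet MRK (var vV) (NConst 1), NSet BLK (var vV) (NConst 0)]),
              incv vV])]"

text \<open>After a ball the index of the pair stays put. Either the ball was added to the cut and
  the next test finds a blocked endpoint, or it was marked and the pair is tried again from an
  unmarked endpoint. Stopping at a quarter of the vertices ensures that one more ball, with at most
  half of them, leaves the cut at three quarters.\<close>

definition carve :: com where
  "carve = seqs [setv vUC (NConst 0), setv vJ (NConst 0),
     Loop (BAnd (NLess (var vJ) (var vKF))
                (NLess (NAdd (NAdd (var vUC) (var vUC)) (NAdd (var vUC) (var vUC))) (var 0)))
       (Cond (BAnd (NLess (NGet BLK (NGet FA (var vJ))) (NConst 1)) (NLess (NGet BLK (NGet FB (var vJ))) (NConst 1)))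
         (seqs [Cond (NLess (NConst 0) (NGet MRK (NGet FA (var vJ))))
                  (setv vX (NGet FB (var vJ))) (setv vX (NGet FA (var vJ))),
                ball,
                Cond (NLess (var 0) (NAdd (var vBC) (var vBC))) mark (setv vUC (NAdd (var vUC) (var vBC)))])
         (incv vJ))]"

context cut_input
begin

lemma paint_simps [simp]: "paint {} i f = f" "paint B i (paint B j f) = paint B i f"
  by (auto simp: paint_def)

lemma wp_mark:
  assumes st: "static s" and blk: "nmem s BLK = paint B i blk" and i: "nmem s vID 0 = i"
    and lt: "\<And>v. v < n \<Longrightarrow> blk v < i" and B: "B \<subseteq> {..<n}"
  shows "wp mark (\<lambda>t. same {vV, MRK, BLK} s t \<and> nmem t BLK = paint B 0 blk \<and>
     nmem t MRK = paint B 1 (nmem s MRK) \<and> steps t \<le> steps s + 2 + 5 * n) s"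
proof -
  have n0: "nmem s 0 0 = n" using st by (simp add: static_def)
  define I where "I = (\<lambda>t. same {vV, MRK, BLK} s t \<and> nmem t vV 0 \<le> n \<and>
     nmem t BLK = paint (B \<inter> {..<nmem t vV 0}) 0 (paint B i blk) \<and>
     nmem t MRK = paint (B \<inter> {..<nmem t vV 0}) 1 (nmem s MRK) \<and>
     steps t \<le> steps s + 1 + 5 * nmem t vV 0)"
  have "wp (Loop (NLess (var vV) (var 0))
       (seqs [Cond (NLess (NGet BLK (var vV)) (var vID)) Skip
                (seqs [NSet MRK (var vV) (NConst 1), NSet BLK (var vV) (NConst 0)]),
              incv vV])) (\<lambda>t. same {vV, MRK, BLK} s t \<and> nmem t BLK = paint B 0 blk \<and>
     nmem t MRK = paint B 1 (nmem s MRK) \<and> steps t \<le> steps s + 2 + 5 * n) (tick (nset vV 0 0 s))"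
  proof (rule wp_Loop[where I = I and \<mu> = "\<lambda>t. n - nmem t vV 0"])
    show "I (tick (nset vV 0 0 s))" using blk by (simp add: I_def)
  next
    fix t assume I: "I t" and g: "beval t (NLess (var vV) (var 0))"
    define v where "v = nmem t vV 0"
    have sm: "nmem t 0 = nmem s 0" "nmem t vID = nmem s vID" using I by (auto simp: I_def sameD)
    have v: "v < n" using g sm n0 by (simp add: v_def)
    have c: "nmem t BLK v < i \<longleftrightarrow> v \<notin> B"
      using I lt[OF v] by (auto simp: I_def paint_def v_def)
    have p: "paint (B \<inter> {..<Suc v}) k f = (if v \<in> B then (paint (B \<inter> {..<v}) k f)(v := k) else paint (B \<inter> {..<v}) k f)"
      for k :: nat and f
      by (auto simp: paint_def fun_eq_iff less_Suc_eq)
    show "wp (seqs [Cond (NLess (NGet BLK (var vV)) (var vID)) Skip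
                (seqs [NSet MRK (var vV) (NConst 1), NSet BLK (var vV) (NConst 0)]),
              incv vV]) (\<lambda>u. I u \<and> n - nmem u vV 0 < n - nmem t vV 0) (tick t)"
      using I c v p sm i unfolding v_def by (cases "nmem t vV 0 \<in> B") (simp_all add: I_def)
  next
    fix t assume I: "I t" and g: "\<not> beval t (NLess (var vV) (var 0))"
    have sm: "nmem t 0 = nmem s 0" using I by (auto simp: I_def sameD)
    have v: "nmem t vV 0 = n" using g sm n0 I by (auto simp: I_def)
    have "B \<inter> {..<n} = B" using B by blast
    then show "same {vV, MRK, BLK} s (tick t) \<and> nmem (tick t) BLK = paint B 0 blk \<and>
     nmem (tick t) MRK = paint B 1 (nmem s MRK) \<and> steps (tick t) \<le> steps s + 2 + 5 * n"
      using I v by (simp add: I_def)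
  qed
  then show ?thesis by (simp add: mark_def)
qed

abbreviation (input) carve_frame :: "nat set" where
  "carve_frame \<equiv> {vP, vQ, vAN, vV, vE, vY, vJJ, AV, AE, BLK, DD, vBC, vID, vPROG, vT, MRK, vX, vUC, vJ}"

text \<open>\<open>M\<close> is the set of marked vertices and \<open>C\<close> the large ball at an earlier radius: a second large ball would
  meet \<open>C\<close>, so its centre would already be marked.\<close>

definition far_core :: "(nat \<Rightarrow> nat) \<Rightarrow> nat \<Rightarrow> real \<Rightarrow> nat set \<Rightarrow> nat set \<Rightarrow> bool" where
  "far_core L R dst U M \<longleftrightarrow> (\<forall>v\<in>M. \<forall>w\<in>M. \<exists>r. walk {} L v r w \<and> real r < dst) \<and>
     (M = {} \<or> (\<exists>U' C. U' \<subseteq> U \<and> C \<subseteq> {..<n} \<and> n < 2 * card C \<and>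
        (\<forall>z\<in>C. \<forall>y r. walk U' L y r z \<longrightarrow> r \<le> R \<longrightarrow> y \<in> M)))"

lemma far_core_mono:
  assumes "far_core L R dst U M" "U \<subseteq> W"
  shows "far_core L R dst W M"
  unfolding far_core_def
proof (intro conjI)
  show "\<forall>v\<in>M. \<forall>w\<in>M. \<exists>r. walk {} L v r w \<and> real r < dst"
    using assms(1) unfolding far_core_def by (rule conjunct1)
  show "M = {} \<or> (\<exists>U' C. U' \<subseteq> W \<and> C \<subseteq> {..<n} \<and> n < 2 * card C \<and>
        (\<forall>z\<in>C. \<forall>y r. walk U' L y r z \<longrightarrow> r \<le> R \<longrightarrow> y \<in> M))"
  proof (cases "M = {}")
    case False
    then obtain U' C where "U' \<subseteq> U" "C \<subseteq> {..<n}" "n < 2 * card C"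
        "\<forall>z\<in>C. \<forall>y r. walk U' L y r z \<longrightarrow> r \<le> R \<longrightarrow> y \<in> M"
      using assms(1) unfolding far_core_def by auto
    then show ?thesis using order_trans[OF \<open>U' \<subseteq> U\<close> assms(2)] by (intro disjI2 exI[of _ U'] exI[of _ C] conjI)
  qed simp
qed

text \<open>Each ball is grown in the graph without the earlier ones, so the boundaries add up while
  volumes and sizes are those of disjoint sets, and the stopping rule of the single balls carries
  over to their union. If the pairs are exhausted before a quarter of the vertices is reached, every
  pair has an endpoint in the union, and a vertex accounts for at most 32 pairs.\<close>

lemma wp_carve:
  assumes st: "static s" and blk0: "nmem s BLK = (\<lambda>_. 0)" and mrk0: "nmem s MRK = (\<lambda>_. 0)"
    and L: "nmem s LEN = L" and kf: "nmem s vKF 0 = kf"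
    and pairs: "\<And>j. j < kf \<Longrightarrow> nmem s FA j < n \<and> nmem s FB j < n"
    and far: "\<And>j r. j < kf \<Longrightarrow> walk {} L (nmem s FA j) r (nmem s FB j) \<Longrightarrow> dst \<le> real r"
    and mult: "\<And>v. card {j. j < kf \<and> (nmem s FA j = v \<or> nmem s FB j = v)} \<le> 32"
    and params: "rmem s rBETA 0 = \<beta>" "rmem s rGAM 0 = \<gamma>" "rmem s rH 0 = H" "0 \<le> \<beta>" "0 < \<gamma>"
    and R: "0 < R" "2 * real R \<le> H" "\<beta> * real (vol L {..<n}) + \<gamma> * real n < (1 + \<beta>) ^ R * \<gamma>"
    and dst: "2 * (H + 1) \<le> dst"
  shows "wp carve (\<lambda>t. same carve_frame s t \<and>
     real (card (cutx (blocked (nmem t BLK)))) \<le> \<beta> * real (vol L (blocked (nmem t BLK))) + \<gamma> * real (card (blocked (nmem t BLK))) \<and>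
     4 * card (blocked (nmem t BLK)) \<le> 3 * n \<and>
     (n \<le> 4 * card (blocked (nmem t BLK)) \<or> kf \<le> 32 * card (blocked (nmem t BLK))) \<and>
     real (steps t) \<le> real (steps s) + 3000 * (real (vol L {..<n}) + real n + real kf + H)) s"
proof -
  let ?U = "\<lambda>u. blocked (nmem u BLK)"
  have n0: "nmem s 0 0 = n" using st by (simp add: static_def)
  have H0: "2 \<le> H" using R by linarith
  \<comment> \<open>The cost of growing and marking the one large ball. Its volume is not part of
    the cut, so this cost is charged separately, and only once.\<close>
  define K where "K = real (12 * vol L {..<n} + 1000 * n) + 10 * (H + 1)"
  have K0: "0 \<le> K" using H0 by (simp add: K_def)
  define I where "I = (\<lambda>u. \<exists>M. same carve_frame s u \<and> static u \<and> (\<forall>v. nmem u BLK v \<le> nmem u vID 0) \<and>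
     nmem u vUC 0 = card (?U u) \<and> 4 * card (?U u) \<le> 3 * n \<and> nmem u vJ 0 \<le> kf \<and>
     real (card (cutx (?U u))) \<le> \<beta> * real (vol L (?U u)) + \<gamma> * real (card (?U u)) \<and>
     (\<forall>j<nmem u vJ 0. nmem s FA j \<in> ?U u \<or> nmem s FB j \<in> ?U u) \<and>
     nmem u MRK = paint M 1 (\<lambda>_. 0) \<and> far_core L R dst (?U u) M \<and>
     real (steps u) \<le> real (steps s) + 2 + 10 * real (nmem u vJ 0) + 700 * (real (vol L (?U u)) + real (card (?U u)))
        + (if M = {} then 0 else K))"
  have Ifacts: "nmem u 0 0 = n" "nmem u vKF 0 = kf" "nmem u FA = nmem s FA" "nmem u FB = nmem s FB"
    "nmem u LEN = L" "rmem u = rmem s" if "same carve_frame s u" for u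
    using sameD[OF that] sameD2[OF that] n0 kf L by auto
  have "wp (Loop (BAnd (NLess (var vJ) (var vKF))
                (NLess (NAdd (NAdd (var vUC) (var vUC)) (NAdd (var vUC) (var vUC))) (var 0)))
       (Cond (BAnd (NLess (NGet BLK (NGet FA (var vJ))) (NConst 1)) (NLess (NGet BLK (NGet FB (var vJ))) (NConst 1)))
         (seqs [Cond (NLess (NConst 0) (NGet MRK (NGet FA (var vJ))))
                  (setv vX (NGet FB (var vJ))) (setv vX (NGet FA (var vJ))),
                ball,
                Cond (NLess (var 0) (NAdd (var vBC) (var vBC))) mark (setv vUC (NAdd (var vUC) (var vBC)))])
         (incv vJ)))
    (\<lambda>t. same carve_frame s t \<and>
     real (card (cutx (?U t))) \<le> \<beta> * real (vol L (?U t)) + \<gamma> * real (card (?U t)) \<and>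
     4 * card (?U t) \<le> 3 * n \<and>
     (n \<le> 4 * card (?U t) \<or> kf \<le> 32 * card (?U t)) \<and>
     real (steps t) \<le> real (steps s) + 3000 * (real (vol L {..<n}) + real n + real kf + H))
    (tick (nset vJ 0 0 (tick (nset vUC 0 0 s))))"
  proof (rule wp_Loop[where I = I and \<mu> = "\<lambda>u. (kf - nmem u vJ 0) + (n - nmem u vUC 0)
        + (if nmem u MRK = (\<lambda>_. 0) then 1 else 0)"])
    let ?s1 = "tick (nset vJ 0 0 (tick (nset vUC 0 0 s)))"
    have "static ?s1" using st static_cong[of ?s1 s] by simp
    then show "I ?s1" unfolding I_def using blk0 mrk0
      by (intro exI[of _ "{}"]) (simp add: cutx_def vol_def far_core_def)
  next
    fix u assume "I u" and g: "beval u (BAnd (NLess (var vJ) (var vKF))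
                (NLess (NAdd (NAdd (var vUC) (var vUC)) (NAdd (var vUC) (var vUC))) (var 0)))"
    then obtain M where sm: "same carve_frame s u" and su: "static u" and ids: "\<And>v. nmem u BLK v \<le> nmem u vID 0"
      and UC: "nmem u vUC 0 = card (?U u)" and U3: "4 * card (?U u) \<le> 3 * n"
      and cutU: "real (card (cutx (?U u))) \<le> \<beta> * real (vol L (?U u)) + \<gamma> * real (card (?U u))"
      and hit: "\<forall>j<nmem u vJ 0. nmem s FA j \<in> ?U u \<or> nmem s FB j \<in> ?U u"
      and MRK: "nmem u MRK = paint M 1 (\<lambda>_. 0)" and core: "far_core L R dst (?U u) M"
      and stp: "real (steps u) \<le> real (steps s) + 2 + 10 * real (nmem u vJ 0) + 700 * (real (vol L (?U u)) + real (card (?U u)))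
        + (if M = {} then 0 else K)"
      unfolding I_def by blast
    note If = Ifacts[OF sm]
    define j where "j = nmem u vJ 0"
    define U where "U = ?U u"
    define a b where "a = nmem s FA j" and "b = nmem s FB j"
    have j: "j < kf" and U4: "4 * card U < n" using g UC If by (auto simp: j_def U_def)
    have ab: "a < n" "b < n" using pairs[OF j] by (auto simp: a_def b_def)
    have finU: "finite U" "U \<subseteq> {..<n}" by (auto simp: U_def)
    let ?goal = "\<lambda>w. I w \<and> (kf - nmem w vJ 0) + (n - nmem w vUC 0) + (if nmem w MRK = (\<lambda>_. 0) then 1 else 0)
        < (kf - nmem u vJ 0) + (n - nmem u vUC 0) + (if nmem u MRK = (\<lambda>_. 0) then 1 else 0)"
    show "wp (Cond (BAnd (NLess (NGet BLK (NGet FA (var vJ))) (NConst 1)) (NLess (NGet BLK (NGet FB (var vJ))) (NConst 1)))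
         (seqs [Cond (NLess (NConst 0) (NGet MRK (NGet FA (var vJ))))
                  (setv vX (NGet FB (var vJ))) (setv vX (NGet FA (var vJ))),
                ball,
                Cond (NLess (var 0) (NAdd (var vBC) (var vBC))) mark (setv vUC (NAdd (var vUC) (var vBC)))])
         (incv vJ)) ?goal (tick u)"
    proof (cases "nmem u BLK a = 0 \<and> nmem u BLK b = 0")
      case False
      then have "a \<in> ?U u \<or> b \<in> ?U u" using ab by auto
      then have hit': "\<forall>i<Suc j. nmem s FA i \<in> ?U u \<or> nmem s FB i \<in> ?U u"
        using hit by (auto simp: less_Suc_eq j_def a_def b_def)
      let ?w = "tick (nset vJ 0 (Suc j) (tick (tick u)))"
      have "static ?w" using su static_cong[of ?w u] by simp
      then have "I ?w" unfolding I_def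
        using sm ids UC U3 cutU hit' MRK core stp j by (intro exI[of _ M]) (simp add: j_def)
      then show ?thesis using False If j by (auto simp: a_def b_def j_def)
    next
      case True
      define x where "x = (if a \<in> M then b else a)"
      have x: "x < n" "nmem u BLK x = 0" using ab True by (auto simp: x_def)
      \<comment> \<open>Otherwise both endpoints would be marked, and the marked ball would join
        them by a walk shorter than the distance guaranteed for the pair.\<close>
      have xM: "x \<notin> M"
      proof
        assume xM: "x \<in> M"
        then have "a \<in> M" "b \<in> M" by (auto simp: x_def split: if_splits)
        then obtain r where "walk {} L a r b" "real r < dst" using core unfolding far_core_def by blast
        then show False using far[OF j, of r] by (simp add: a_def b_def)
      qed
      let ?u1 = "tick (nset vX 0 x (tick (tick (tick u))))"
      have s1: "static ?u1" using su static_cong[of ?u1 u] by simp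
      have rp: "rmem ?u1 rBETA 0 = \<beta>" "rmem ?u1 rGAM 0 = \<gamma>" "rmem ?u1 rH 0 = H" using params If by auto
      have RH: "real R \<le> H" using R H0 by linarith
      have mk: "0 < nmem u MRK a \<longleftrightarrow> a \<in> M" using MRK by (simp add: paint_def)
      have "wp ball (wp (Cond (NLess (var 0) (NAdd (var vBC) (var vBC))) mark (setv vUC (NAdd (var vUC) (var vBC)))) ?goal) ?u1"
      proof (rule wp_mono[OF wp_ball[where blk = "nmem u BLK" and L = L, OF s1 _ x(1) _ x(2) _ rp params(4,5) R(1) RH R(3)]])
        fix w assume "\<exists>B. same (pass_frame \<union> {vID, vPROG, vT}) ?u1 w \<and> ball_state (nmem u BLK) L x B w \<and>
           nmem w vID 0 = Suc (nmem ?u1 vID 0) \<and>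
           ball_inv (?U u) L x (nmem w vT 0) B (nmem w DD) (arcs w 0 (nmem w vAN 0)) [] \<and>
           nmem w vPROG 0 \<le> vol L B \<and> real (nmem w vT 0) < H + 1 \<and>
           (2 * card B \<le> n \<longrightarrow> real (nmem w vAN 0) \<le> \<beta> * real (nmem w vPROG 0) + \<gamma> * real (card B)
              \<and> nmem w vT 0 \<le> nmem w vPROG 0) \<and>
           (n < 2 * card B \<longrightarrow> H \<le> real (nmem w vT 0) \<and> n < 2 * card {v \<in> B. nmem w DD v \<le> R}) \<and>
           steps w \<le> steps ?u1 + 400 + 12 * nmem w vPROG 0 + 220 * card B + 10 * nmem w vT 0"
        then obtain B where sw: "same (pass_frame \<union> {vID, vPROG, vT}) ?u1 w" and bw: "ball_state (nmem u BLK) L x B w"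
          and ID: "nmem w vID 0 = Suc (nmem u vID 0)"
          and iw: "ball_inv U L x (nmem w vT 0) B (nmem w DD) (arcs w 0 (nmem w vAN 0)) []"
          and prog: "nmem w vPROG 0 \<le> vol L B" and T: "real (nmem w vT 0) < H + 1"
          and small: "2 * card B \<le> n \<Longrightarrow> real (nmem w vAN 0) \<le> \<beta> * real (nmem w vPROG 0) + \<gamma> * real (card B)
              \<and> nmem w vT 0 \<le> nmem w vPROG 0"
          and large: "n < 2 * card B \<Longrightarrow> H \<le> real (nmem w vT 0) \<and> n < 2 * card {v \<in> B. nmem w DD v \<le> R}"
          and stw: "steps w \<le> steps u + 404 + 12 * nmem w vPROG 0 + 220 * card B + 10 * nmem w vT 0"
          unfolding U_def by auto
        have wm: "nmem w c = nmem u c" if "c \<notin> insert vX (pass_frame \<union> {vID, vPROG, vT})" for c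
          using sameD[OF sw, of c] that by auto
        have B: "x \<in> B" "B \<subseteq> {..<n} - U" using iw by (auto simp: ball_inv_def)
        then have finB: "finite B" by (meson finite_Diff finite_lessThan finite_subset)
        have B1: "1 \<le> card B" using B finB card_mono[of B "{x}"] by simp
        have Bn: "card B \<le> n" using card_mono[of "{..<n}" B] B by auto
        have BC: "nmem w vBC 0 = card B" and ws: "static w"
          and BLKw: "nmem w BLK = paint B (Suc (nmem u vID 0)) (nmem u BLK)"
          using bw ID by (auto simp: ball_state_def)
        have bl0: "nmem u BLK v = 0" if "v \<in> B" for v using that B by (auto simp: U_def)
        have smw: "same carve_frame s w"
        proof -
          have "same carve_frame s ?u1" using sm by simp
          then show ?thesis by (rule same_trans[OF _ sw]) auto
        qed
        have w0: "nmem w 0 0 = n" using Ifacts[OF smw] by simp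
        show "wp (Cond (NLess (var 0) (NAdd (var vBC) (var vBC))) mark (setv vUC (NAdd (var vUC) (var vBC)))) ?goal w"
        proof (cases "n < 2 * card B")
          case False
          then have sml: "real (nmem w vAN 0) \<le> \<beta> * real (nmem w vPROG 0) + \<gamma> * real (card B)"
            "nmem w vT 0 \<le> nmem w vPROG 0" using small by auto
          let ?w = "tick (nset vUC 0 (nmem w vUC 0 + card B) (tick w))"
          have Uw: "?U ?w = U \<union> B" using B by (auto simp: BLKw paint_def U_def)
          have cU: "card (U \<union> B) = card U + card B" using finU finB B by (intro card_Un_disjoint) auto
          have vU: "vol L (U \<union> B) = vol L U + vol L B" using finU finB B by (intro vol_Un) auto
          have "static ?w" using ws static_cong[of ?w w] by simp
          moreover have "real (card (cutx (U \<union> B))) \<le> \<beta> * real (vol L (U \<union> B)) + \<gamma> * real (card (U \<union> B))"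
          proof -
            have "real (card (cutx (U \<union> B))) \<le> real (card (cutx U)) + real (nmem w vAN 0)"
              using ball_inv_boundary[OF iw] by simp
            also have "\<dots> \<le> \<beta> * real (vol L U) + \<gamma> * real (card U) + (\<beta> * real (vol L B) + \<gamma> * real (card B))"
              using cutU sml(1) mult_left_mono[of "real (nmem w vPROG 0)" "real (vol L B)" \<beta>] prog params(4)
              by (simp add: U_def)
            finally show ?thesis by (simp add: cU vU algebra_simps)
          qed
          moreover have "far_core L R dst (U \<union> B) M"
            by (rule far_core_mono[OF core]) (simp add: U_def)
          moreover have "real (steps ?w) \<le> real (steps s) + 2 + 10 * real j + 700 * (real (vol L (U \<union> B)) + real (card (U \<union> B)))
            + (if M = {} then 0 else K)"
          proof -
            have "real (steps ?w) \<le> real (steps u + 406 + 12 * nmem w vPROG 0 + 220 * card B + 10 * nmem w vT 0)"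
              using stw by simp
            also have "\<dots> \<le> real (steps u) + 700 * (real (vol L B) + real (card B))"
              using prog sml(2) B1 by simp
            finally show ?thesis using stp[folded U_def j_def] unfolding cU vU of_nat_add by argo
          qed
          moreover have "\<forall>v. nmem ?w BLK v \<le> nmem ?w vID 0" using ids ID by (auto simp: BLKw paint_def le_SucI)
          moreover have "\<forall>i<j. nmem s FA i \<in> U \<union> B \<or> nmem s FB i \<in> U \<union> B" using hit by (auto simp: U_def j_def)
          ultimately have "I ?w" unfolding I_def Uw
            using smw UC U4 False cU wm[of vUC] wm[of vJ] wm[of MRK] MRK j
            by (intro exI[of _ M]) (simp add: U_def j_def)
          moreover have "(kf - nmem ?w vJ 0) + (n - nmem ?w vUC 0) + (if nmem ?w MRK = (\<lambda>_. 0) then 1 else 0)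
             < (kf - nmem u vJ 0) + (n - nmem u vUC 0) + (if nmem u MRK = (\<lambda>_. 0) then 1 else 0)"
            using wm[of vUC] wm[of vJ] wm[of MRK] UC B1 U4 by (simp add: U_def)
          ultimately show ?thesis using False BC w0 by simp
        next
          case True
          define C where "C = {v \<in> B. nmem w DD v \<le> R}"
          have lg: "H \<le> real (nmem w vT 0)" "n < 2 * card C" using large[OF True] by (auto simp: C_def)
          have walkB: "walk U L x (nmem w DD v) v" "nmem w DD v \<le> nmem w vT 0" if "v \<in> B" for v
            using iw that by (auto simp: ball_inv_def)
          \<comment> \<open>Two cores with more than half of the vertices share a vertex
            \<open>z\<close>. The walk of length at most \<open>R\<close> from the new centre
            \<open>x\<close> to \<open>z\<close> avoids \<open>U\<close>, hence also the smaller set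
            removed when the first core arose, so \<open>x\<close> would have been marked.\<close>
          have M: "M = {}"
          proof (rule ccontr)
            assume "M \<noteq> {}"
            then obtain U' C' where C': "U' \<subseteq> U" "C' \<subseteq> {..<n}" "n < 2 * card C'"
              "\<forall>z\<in>C'. \<forall>y r. walk U' L y r z \<longrightarrow> r \<le> R \<longrightarrow> y \<in> M"
              using core unfolding far_core_def U_def by blast
            have "C \<inter> C' \<noteq> {}"
            proof
              assume "C \<inter> C' = {}"
              then have "card C + card C' = card (C \<union> C')"
                using C'(2) finB by (intro card_Un_disjoint[symmetric]) (auto simp: C_def intro: finite_subset)
              also have "\<dots> \<le> n" using card_mono[of "{..<n}" "C \<union> C'"] C'(2) B by (auto simp: C_def)
              finally show False using C'(3) lg(2) by linarith
            qed
            then obtain z where z: "z \<in> C" "z \<in> C'" by blast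
            then have "walk U' L x (nmem w DD z) z" "nmem w DD z \<le> R"
              using walkB[of z] walk_mono C'(1) by (auto simp: C_def)
            then show False using C'(4) z xM by blast
          qed
          have "wp mark ?goal (tick w)"
          proof (rule wp_mono[OF wp_mark[of "tick w" B "Suc (nmem u vID 0)" "nmem u BLK"]])
            fix t assume t: "same {vV, MRK, BLK} (tick w) t \<and> nmem t BLK = paint B 0 (nmem u BLK) \<and>
               nmem t MRK = paint B 1 (nmem (tick w) MRK) \<and> steps t \<le> steps (tick w) + 2 + 5 * n"
            then have st': "same {vV, MRK, BLK} w t" by simp
            have tm: "nmem t c = nmem w c" if "c \<notin> {vV, MRK, BLK}" for c using sameD[OF st' that] .
            have BLKt: "nmem t BLK = nmem u BLK" using t bl0 by (auto simp: paint_def)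
            then have Ut: "?U t = U" by (simp add: U_def)
            have MRKt: "nmem t MRK = paint B 1 (\<lambda>_. 0)" using t wm[of MRK] MRK M by simp
            have smt: "same carve_frame s t" by (rule same_trans[OF smw st']) auto
            have "static t" by (rule static_same[OF ws st']) simp
            moreover have "far_core L R dst U B"
              unfolding far_core_def
            proof (intro conjI ballI disjI2)
              fix v z assume vz: "v \<in> B" "z \<in> B"
              have "walk U L v (nmem w DD v + nmem w DD z) z"
                using walk_trans[OF walkB(1)[OF vz(2)] walk_sym[OF walkB(1)[OF vz(1)]]] .
              then have "walk {} L v (nmem w DD v + nmem w DD z) z" by (rule walk_mono) simp
              moreover have "real (nmem w DD v + nmem w DD z) \<le> real (nmem w vT 0 + nmem w vT 0)"
                using walkB(2)[OF vz(1)] walkB(2)[OF vz(2)] by (intro of_nat_mono add_mono)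
              then have "real (nmem w DD v + nmem w DD z) < dst" using T dst by simp
              ultimately show "\<exists>r. walk {} L v r z \<and> real r < dst" by blast
            next
              \<comment> \<open>A walk of length \<open>R\<close> from a core vertex ends within
                \<open>2 R\<close> of the centre. This is at most \<open>H\<close>, hence at most
                the final time, up to which the ball is complete.\<close>
              have "\<forall>z\<in>C. \<forall>y r. walk U L y r z \<longrightarrow> r \<le> R \<longrightarrow> y \<in> B"
              proof (intro ballI allI impI)
                fix z y r assume z: "z \<in> C" and y: "walk U L y r z" and r: "r \<le> R"
                have "walk U L x (nmem w DD z + r) y"
                  using walk_trans[OF walk_sym[OF y] walkB(1)[of z]] z by (simp add: C_def)
                moreover have "nmem w DD z + r \<le> nmem w vT 0"
                  using z r lg(1) R(2) by (simp add: C_def)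
                ultimately show "y \<in> B"
                  using ball_inv_complete[OF iw] bw by (simp add: ball_state_def)
              qed
              moreover have "C \<subseteq> {..<n}" using B by (auto simp: C_def)
              ultimately show "\<exists>U' C. U' \<subseteq> U \<and> C \<subseteq> {..<n} \<and> n < 2 * card C \<and>
                  (\<forall>z\<in>C. \<forall>y r. walk U' L y r z \<longrightarrow> r \<le> R \<longrightarrow> y \<in> B)"
                using lg(2) by blast
            qed
            moreover have "real (steps t) \<le> real (steps s) + 2 + 10 * real j + 700 * (real (vol L U) + real (card U)) + K"
            proof -
              have "vol L B \<le> vol L {..<n}" using B by (intro vol_mono) auto
              then have "real (steps t) \<le> real (steps u) + 407 + 12 * real (vol L {..<n}) + 220 * real (card B) + 10 * (H + 1) + 5 * real n"
                using t stw prog T by simp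
              also have "\<dots> \<le> real (steps u) + K"
                using Bn n_ge4 unfolding K_def by simp
              finally show ?thesis using stp M by (simp add: U_def j_def)
            qed
            ultimately have "I t" unfolding I_def Ut
              using smt ids BLKt ID tm[of vID] tm[of vUC] wm[of vUC] UC U3 cutU hit MRKt B(1)
                tm[of vJ] wm[of vJ] j
              by (intro exI[of _ B]) (auto simp: U_def j_def le_SucI)
            moreover have "nmem t MRK \<noteq> (\<lambda>_. 0)"
            proof
              assume "nmem t MRK = (\<lambda>_. 0)"
              then have "nmem t MRK x = 0" by simp
              then show False using MRKt B(1) by (simp add: paint_def)
            qed
            ultimately show "?goal t" using tm[of vUC] wm[of vUC] tm[of vJ] wm[of vJ] MRK M by simp
          next
            show "static (tick w)" using ws static_cong[of "tick w" w] by simp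
          qed (use BLKw ID ids B in \<open>auto simp: less_Suc_eq_le\<close>)
          then show ?thesis using True BC w0 by simp
        qed
      qed (use If in simp_all)
      moreover have "wp (Cond (BAnd (NLess (NGet BLK (NGet FA (var vJ))) (NConst 1)) (NLess (NGet BLK (NGet FB (var vJ))) (NConst 1)))
         (seqs [Cond (NLess (NConst 0) (NGet MRK (NGet FA (var vJ))))
                  (setv vX (NGet FB (var vJ))) (setv vX (NGet FA (var vJ))),
                ball,
                Cond (NLess (var 0) (NAdd (var vBC) (var vBC))) mark (setv vUC (NAdd (var vUC) (var vBC)))])
         (incv vJ)) G (tick u)
         = wp ball (wp (Cond (NLess (var 0) (NAdd (var vBC) (var vBC))) mark (setv vUC (NAdd (var vUC) (var vBC)))) G) ?u1" for G
        using True If mk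
        by (cases "a \<in> M") (simp_all add: a_def[symmetric] b_def[symmetric] j_def[symmetric] x_def)
      ultimately show ?thesis by (simp only:)
    qed
  next
    fix u assume "I u" and g: "\<not> beval u (BAnd (NLess (var vJ) (var vKF))
                (NLess (NAdd (NAdd (var vUC) (var vUC)) (NAdd (var vUC) (var vUC))) (var 0)))"
    then obtain M where sm: "same carve_frame s u" and "static u" "\<forall>v. nmem u BLK v \<le> nmem u vID 0"
      and UC: "nmem u vUC 0 = card (?U u)" and U3: "4 * card (?U u) \<le> 3 * n" and jk: "nmem u vJ 0 \<le> kf"
      and cutU: "real (card (cutx (?U u))) \<le> \<beta> * real (vol L (?U u)) + \<gamma> * real (card (?U u))"
      and hit: "\<forall>j<nmem u vJ 0. nmem s FA j \<in> ?U u \<or> nmem s FB j \<in> ?U u"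
      and "nmem u MRK = paint M 1 (\<lambda>_. 0)" "far_core L R dst (?U u) M"
      and stp: "real (steps u) \<le> real (steps s) + 2 + 10 * real (nmem u vJ 0) + 700 * (real (vol L (?U u)) + real (card (?U u)))
        + (if M = {} then 0 else K)"
      unfolding I_def by (elim exE conjE) (rule that)
    note If = Ifacts[OF sm]
    have "n \<le> 4 * card (?U u) \<or> kf \<le> 32 * card (?U u)"
    proof (cases "nmem u vJ 0 < kf")
      case True
      then show ?thesis using g If UC by auto
    next
      case False
      have "j \<in> (\<Union>v\<in>?U u. {j. j < kf \<and> (nmem s FA j = v \<or> nmem s FB j = v)})" if "j < kf" for j
      proof -
        have "nmem s FA j \<in> ?U u \<or> nmem s FB j \<in> ?U u" using hit that False by simp
        then show ?thesis using that by blast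
      qed
      then have "{..<kf} \<subseteq> (\<Union>v\<in>?U u. {j. j < kf \<and> (nmem s FA j = v \<or> nmem s FB j = v)})"
        by blast
      then have "kf \<le> card (\<Union>v\<in>?U u. {j. j < kf \<and> (nmem s FA j = v \<or> nmem s FB j = v)})"
        using card_mono[of _ "{..<kf}"] by fastforce
      also have "\<dots> \<le> (\<Sum>v\<in>?U u. card {j. j < kf \<and> (nmem s FA j = v \<or> nmem s FB j = v)})"
        by (rule card_UN_le) simp
      also have "\<dots> \<le> (\<Sum>v\<in>?U u. 32)" by (rule sum_mono) (rule mult)
      finally show ?thesis by simp
    qed
    moreover have "real (steps (tick u)) \<le> real (steps s) + 3000 * (real (vol L {..<n}) + real n + real kf + H)"
    proof -
      have "vol L (?U u) \<le> vol L {..<n}" by (intro vol_mono) auto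
      moreover have "card (?U u) \<le> n" using U3 by simp
      moreover have "(if M = {} then 0 else K) \<le> K" using K0 by simp
      ultimately have "real (steps u) \<le> real (steps s) + 2 + 10 * real kf + 700 * (real (vol L {..<n}) + real n) + K"
        using stp jk by simp
      then show ?thesis using H0 n_ge4 unfolding K_def by simp
    qed
    ultimately show "same carve_frame s (tick u) \<and>
     real (card (cutx (?U (tick u)))) \<le> \<beta> * real (vol L (?U (tick u))) + \<gamma> * real (card (?U (tick u))) \<and>
     4 * card (?U (tick u)) \<le> 3 * n \<and>
     (n \<le> 4 * card (?U (tick u)) \<or> kf \<le> 32 * card (?U (tick u))) \<and>
     real (steps (tick u)) \<le> real (steps s) + 3000 * (real (vol L {..<n}) + real n + real kf + H)"
      using sm U3 cutU by simp
  qed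
  then show ?thesis by (simp add: carve_def)
qed

end

section \<open>Routing along reported paths\<close>

text \<open>Unrouted pairs are moved to the front of \<open>FA\<close> and \<open>FB\<close>; \<open>vFLAG\<close> names both the reachability flag and the
  array of reals that receives the distance estimate.\<close>

abbreviation (input) vF :: nat where "vF \<equiv> 23"
abbreviation (input) vFLAG :: nat where "vFLAG \<equiv> 44"
abbreviation (input) rT :: nat where "rT \<equiv> 3"
abbreviation (input) rTH :: nat where "rTH \<equiv> 4"

text \<open>A reported path lists vertices, while lengths and counts are stored by edge number. As a
  vertex has at most ten edges, a linear search takes constant time.\<close>

definition find_edge :: com where
  "find_edge = seqs [setv vJJ (NConst 0),
     (let a = NGet ADJ (NAdd (times10 (var vV)) (var vJJ));
          y = NSub (NAdd (NGet 1 a) (NGet 2 a)) (var vV)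
      in Loop (BNot (BAnd (BNot (NLess y (var vY))) (BNot (NLess (var vY) y)))) (incv vJJ))]"

definition load_edge :: com where
  "load_edge = seqs [setv vV (PathVertex (var vP)), setv vY (PathVertex (NAdd (var vP) (NConst 1))),
     find_edge, setv vE (NGet ADJ (NAdd (times10 (var vV)) (var vJJ))),
     NSet CNT (var vE) (NAdd (NGet CNT (var vE)) (NConst 1)),
     Cond (RLess (ROfNat (NGet CNT (var vE))) (rvar rT)) Skip
       (seqs [ApspIncrease (var vV) (var vY) (ROfNat (NGet LEN (var vE))),
              NSet LEN (var vE) (NAdd (NGet LEN (var vE)) (NGet LEN (var vE))),
              NSet CNT (var vE) (NConst 0)]),
     incv vP]"

definition load_path :: com where
  "load_path = seqs [setv vP (NConst 0), Loop (NLess (NAdd (var vP) (NConst 1)) PathLength) load_edge]"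

text \<open>An infinite estimate leaves the value 0 in the array of reals, so the flag has to be
  tested in addition to the threshold.\<close>

definition route :: com where
  "route = seqs [ApspDistance vFLAG (NGet FA (var vJ)) (NGet FB (var vJ)),
     Cond (BAnd (NLess (NConst 0) (var vFLAG)) (BNot (RLess (rvar rTH) (rvar vFLAG))))
       (seqs [ApspPath (NGet FA (var vJ)) (NGet FB (var vJ)), load_path])
       (seqs [NSet FA (var vF) (NGet FA (var vJ)), NSet FB (var vF) (NGet FB (var vJ)), incv vF])]"

definition route_all :: com where
  "route_all = seqs [setv vF (NConst 0), setv vJ (NConst 0),
     Loop (NLess (var vJ) (var vKF)) (seqs [route, incv vJ]),
     setv vKF (var vF)]"

lemma num_updates_simps [simp]: "num_updates (tick s) = num_updates s" "num_updates (nset a i x s) = num_updates s"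
  "num_updates (rset a i r s) = num_updates s"
  "num_updates (log_op q s) = num_updates s + (if is_update q then 1 else 0)"
  by (simp_all add: num_updates_def)

lemma num_queries_simps [simp]: "num_queries (tick s) = num_queries s" "num_queries (nset a i x s) = num_queries s"
  "num_queries (rset a i r s) = num_queries s"
  "num_queries (log_op q s) = num_queries s + (if is_update q then 0 else 1)"
  by (simp_all add: num_queries_def)

lemma num_path_buffer [simp]: "num_updates (s\<lparr>path_buffer := p\<rparr>) = num_updates s"
  "num_queries (s\<lparr>path_buffer := p\<rparr>) = num_queries s"
  by (simp_all add: num_updates_def num_queries_def)

lemma current_weight_snoc [simp]: "current_weight w (h @ [q]) = apply_op q (current_weight w h)"
  by (simp add: current_weight_def)

context cut_input
begin

lemma set_edges: "set (map edge_of es) = E" using edges by (simp add: edge_list_def)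

text \<open>The program keeps its own copy of the edge weights in \<open>LEN\<close>, because the
  data structure offers no way to read them. This predicate ties the copy to the weights implied by
  the history.\<close>

definition apsp_ok :: "state \<Rightarrow> bool" where
  "apsp_ok s \<longleftrightarrow> (\<exists>w. init_weights s = Some w \<and> (\<forall>e\<in>E. 0 < w e) \<and>
     (\<forall>q\<in>set (history s). legal_op n E q) \<and>
     (\<forall>e<m. current_weight w (history s) (edge_of (es ! e)) = real (nmem s LEN e) \<and> 1 \<le> nmem s LEN e))"

lemma apsp_ok_cong:
  assumes "init_weights t = init_weights s" "history t = history s" "nmem t LEN = nmem s LEN"
  shows "apsp_ok t = apsp_ok s"
  using assms by (simp add: apsp_ok_def)

lemma walk_len_mono:
  assumes "walk U L x r y" "\<And>e. e < m \<Longrightarrow> L' e \<le> L e"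
  shows "\<exists>r'\<le>r. walk U L' x r' y"
  using assms(1)
proof (induction rule: walk.induct)
  case (walk_step r y e)
  then obtain r' where r': "r' \<le> r" "walk U L' x r' y" by blast
  have "walk U L' x (r' + L' e) (oth e y)" using r'(2) walk_step.hyps by (intro walk.walk_step)
  moreover have "r' + L' e \<le> r + L e" using r'(1) assms(2)[of e] incD(1)[OF walk_step.hyps(2)] by (simp add: add_mono)
  ultimately show ?case by blast
qed (use walk_refl in blast)

text \<open>Since the vertices of a path are distinct, no edge occurs twice. While a path is being
  loaded, an edge ahead therefore still has the length with which the path was reported.\<close>

lemma path_edges:
  assumes "is_path E u v p"
  obtains f where "\<And>i. Suc i < length p \<Longrightarrow> f i \<in> inc (p ! i) \<and> oth (f i) (p ! i) = p ! Suc i"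
    and "\<And>i j. Suc i < length p \<Longrightarrow> Suc j < length p \<Longrightarrow> f i = f j \<Longrightarrow> i = j"
    and "\<And>w. path_weight w p = (\<Sum>i<length p - 1. w (edge_of (es ! f i)))"
proof -
  have "\<forall>i. \<exists>e. Suc i < length p \<longrightarrow> e \<in> inc (p ! i) \<and> oth e (p ! i) = p ! Suc i"
    using assms edge_indexE unfolding is_path_def by metis
  then obtain f where f: "\<And>i. Suc i < length p \<Longrightarrow> f i \<in> inc (p ! i) \<and> oth (f i) (p ! i) = p ! Suc i"
    by metis
  have fe: "edge_of (es ! f i) = {p ! i, p ! Suc i}" if "Suc i < length p" for i
    using f[OF that] incD(7)[of "f i" "p ! i"] by simp
  show thesis
  proof (rule that[OF f])
    fix i j assume ij: "Suc i < length p" "Suc j < length p" "f i = f j"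
    have d: "distinct p" using assms by (simp add: is_path_def)
    have "{p ! i, p ! Suc i} = {p ! j, p ! Suc j}" using fe ij by metis
    then have "(p ! i = p ! j \<and> p ! Suc i = p ! Suc j) \<or> (p ! i = p ! Suc j \<and> p ! Suc i = p ! j)"
      by (auto simp: doubleton_eq_iff)
    then show "i = j" using ij d by (auto simp: nth_eq_iff_index_eq)
  next
    fix w show "path_weight w p = (\<Sum>i<length p - 1. w (edge_of (es ! f i)))"
      unfolding path_weight_def by (intro sum.cong refl) (simp add: fe)
  qed
qed

text \<open>The path is requested after one more operation than the estimate, but a query does not
  change the estimate, so the reported path still has the weight tested before. If the test fails,
  the estimate exceeds \<open>th\<close> while it is at most \<alpha> times the distance, so no path
  has weight \<open>th / \<alpha>\<close> or less.\<close>

lemma apsp_query: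
  assumes ok: "apsp_ok s" and uv: "u < n" "v < n" and w: "init_weights s = Some w"
  defines "est \<equiv> estimate D w (history s) u v"
    and "p \<equiv> reported_path D w (history s @ [QueryDistance u v]) u v"
    and "cw \<equiv> current_weight w (history s)"
  shows "est \<noteq> \<infinity> \<Longrightarrow> real_of_ereal est \<le> th \<Longrightarrow> is_path E u v p \<and> path_weight cw p \<le> th"
    and "\<not> (est \<noteq> \<infinity> \<and> real_of_ereal est \<le> th) \<Longrightarrow> is_path E u v p' \<Longrightarrow> th / \<alpha> < path_weight cw p'"
proof -
  obtain w' where w': "init_weights s = Some w'" "\<forall>e\<in>E. 0 < w' e" "\<forall>q\<in>set (history s). legal_op n E q"
     "\<forall>e<m. current_weight w' (history s) (edge_of (es ! e)) = real (nmem s LEN e) \<and> 1 \<le> nmem s LEN e"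
    using ok unfolding apsp_ok_def by (elim exE conjE) (rule that)
  have "w' = w" using w w'(1) by simp
  then have pos: "\<forall>e\<in>E. 0 < w e" and leg: "\<forall>q\<in>set (history s). legal_op n E q"
    and cwL: "\<And>e. e < m \<Longrightarrow> cw (edge_of (es ! e)) = real (nmem s LEN e)"
    using w'(2-4) by (simp_all only: cw_def)
  let ?d = "wdist E cw u v"
  have AP: "wdist E (current_weight w h) u v \<le> estimate D w h u v \<and>
      estimate D w h u v \<le> ereal \<alpha> * wdist E (current_weight w h) u v \<and>
      (wdist E (current_weight w h) u v < \<infinity> \<longrightarrow> is_path E u v (reported_path D w h u v) \<and>
         ereal (path_weight (current_weight w h) (reported_path D w h u v)) = estimate D w h u v) \<and>
      (\<forall>q. legal_op n E q \<and> \<not> is_update q \<longrightarrow> estimate D w (h @ [q]) u v = estimate D w h u v)"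
    if h: "\<forall>q\<in>set h. legal_op n E q" for h
    by (rule apsp[unfolded approx_apsp_def Let_def, THEN spec[of _ w], THEN spec[of _ h], THEN spec[of _ u],
        THEN spec[of _ v], THEN mp, OF pos, THEN mp, OF h, THEN mp, OF uv(1), THEN mp, OF uv(2)])
  have A: "?d \<le> est" "est \<le> ereal \<alpha> * ?d"
    using AP[OF leg] unfolding est_def cw_def by simp_all
  have est': "estimate D w (history s @ [QueryDistance u v]) u v = est"
    using AP[OF leg] uv unfolding est_def by simp
  have leg': "\<forall>q\<in>set (history s @ [QueryDistance u v]). legal_op n E q" using leg uv by simp
  have B: "?d < \<infinity> \<longrightarrow> is_path E u v p \<and> ereal (path_weight cw p) = est"
    using AP[OF leg'] est' unfolding p_def cw_def by simp
  have nonneg: "0 \<le> path_weight cw q" if q: "is_path E u v q" for q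
  proof -
    obtain f where f: "\<And>i. Suc i < length q \<Longrightarrow> f i \<in> inc (q ! i) \<and> oth (f i) (q ! i) = q ! Suc i"
      and "\<And>i j. Suc i < length q \<Longrightarrow> Suc j < length q \<Longrightarrow> f i = f j \<Longrightarrow> i = j"
      and pw: "\<And>w. path_weight w q = (\<Sum>i<length q - 1. w (edge_of (es ! f i)))"
      by (rule path_edges[OF q]) blast
    have "0 \<le> cw (edge_of (es ! f i))" if "i \<in> {..<length q - 1}" for i
      using f[of i] that incD(1)[of "f i" "q ! i"] cwL[of "f i"] by auto
    then show ?thesis unfolding pw by (rule sum_nonneg)
  qed
  have d0: "0 \<le> ?d" unfolding wdist_def by (rule INF_greatest) (use nonneg in auto)
  \<comment> \<open>This excludes the value of minus infinity, which \<open>real_of_ereal\<close>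
    would turn into 0.\<close>
  have e0: "0 \<le> est" using d0 A(1) by (rule order_trans)
  {
    assume h: "est \<noteq> \<infinity>" "real_of_ereal est \<le> th"
    then have r: "est = ereal (real_of_ereal est)" using e0 by (cases est) auto
    have "?d < \<infinity>" by (rule order_le_less_trans[OF A(1)]) (use h(1) in simp)
    then have "is_path E u v p" "ereal (path_weight cw p) = est" using B by auto
    then show "is_path E u v p \<and> path_weight cw p \<le> th" using r h(2) by (metis real_of_ereal.simps(1))
  }
  {
    assume h: "\<not> (est \<noteq> \<infinity> \<and> real_of_ereal est \<le> th)" and p': "is_path E u v p'"
    have big: "ereal th < est" using h e0 by (cases est) auto
    show "th / \<alpha> < path_weight cw p'"
    proof (rule ccontr)
      assume "\<not> th / \<alpha> < path_weight cw p'"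
      then have "path_weight cw p' * \<alpha> \<le> th" using alpha by (simp add: not_less field_simps)
      have "?d \<le> ereal (path_weight cw p')" unfolding wdist_def by (rule INF_lower) (use p' in simp)
      then have "ereal \<alpha> * ?d \<le> ereal \<alpha> * ereal (path_weight cw p')"
        using alpha by (intro ereal_mult_left_mono) auto
      also have "\<dots> \<le> ereal th" using \<open>path_weight cw p' * \<alpha> \<le> th\<close> by (simp add: mult.commute)
      finally have "est \<le> ereal th" using A(2) by (rule order_trans[rotated])
      then show False using big by simp
    qed
  }
qed

lemma wp_find_edge:
  assumes st: "static s" and v: "nmem s vV 0 = v" "nmem s vY 0 = oth e v" and e: "e \<in> inc v"
  shows "wp find_edge (\<lambda>t. same {vJJ} s t \<and> nmem t ADJ (10 * v + nmem t vJJ 0) = e \<and> steps t \<le> steps s + 25) s"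
proof -
  have vn: "v < n" using incD[OF e] by simp
  let ?d = "nmem s DEG v"
  let ?adj = "\<lambda>j. nmem s ADJ (10 * v + j)"
  have bij: "bij_betw ?adj {..<?d} (inc v)" using st vn by (simp add: static_def)
  have d10: "?d \<le> 10" using static_deg[OF st vn] card_inc_le[OF vn] by simp
  have "e \<in> ?adj ` {..<?d}" using bij e unfolding bij_betw_def by simp
  then obtain j0 where j0: "j0 < ?d" "?adj j0 = e" by auto
  have adjinc: "?adj j \<in> inc v" if "j < ?d" for j using bij_betwE[OF bij] that by simp
  have ends: "nmem s 1 f + nmem s 2 f - v = oth f v" if "f \<in> inc v" for f
    using st incD(1)[OF that] by (simp add: static_def oth_def)
  define a where "a = NGet ADJ (NAdd (times10 (var vV)) (var vJJ))"
  define y where "y = NSub (NAdd (NGet 1 a) (NGet 2 a)) (var vV)"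
  define g where "g = BNot (BAnd (BNot (NLess y (var vY))) (BNot (NLess (var vY) y)))"
  define I where "I = (\<lambda>t. same {vJJ} s t \<and> nmem t vJJ 0 \<le> j0 \<and> steps t \<le> steps s + 1 + 2 * nmem t vJJ 0)"
  have sm: "nmem t c = nmem s c" if "I t" "c \<noteq> vJJ" for t c using that by (auto simp: I_def intro: sameD)
  have g: "beval t g \<longleftrightarrow> ?adj (nmem t vJJ 0) \<noteq> e" if "I t" for t
  proof -
    have "?adj (nmem t vJJ 0) \<in> inc v" using that j0(1) by (intro adjinc) (simp add: I_def)
    then have "beval t g \<longleftrightarrow> oth (?adj (nmem t vJJ 0)) v \<noteq> oth e v"
      using v sm[OF that] ends by (auto simp: g_def y_def a_def)
    then show ?thesis using oth_inj[OF \<open>?adj (nmem t vJJ 0) \<in> inc v\<close> e] by blast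
  qed
  have "wp (Loop g (incv vJJ)) (\<lambda>t. same {vJJ} s t \<and> nmem t ADJ (10 * v + nmem t vJJ 0) = e \<and> steps t \<le> steps s + 25)
      (tick (nset vJJ 0 0 s))"
  proof (rule wp_Loop[where I = I and \<mu> = "\<lambda>t. j0 - nmem t vJJ 0"])
    show "I (tick (nset vJJ 0 0 s))" by (simp add: I_def)
  next
    fix t assume I: "I t" and "beval t g"
    then have "nmem t vJJ 0 \<noteq> j0" using g[OF I] j0 by auto
    then have "nmem t vJJ 0 < j0" using I by (simp add: I_def)
    then show "wp (incv vJJ) (\<lambda>u. I u \<and> j0 - nmem u vJJ 0 < j0 - nmem t vJJ 0) (tick t)"
      using I by (simp add: I_def)
  next
    fix t assume I: "I t" and "\<not> beval t g"
    then have "?adj (nmem t vJJ 0) = e" using g[OF I] by simp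
    then show "same {vJJ} s (tick t) \<and> nmem (tick t) ADJ (10 * v + nmem (tick t) vJJ 0) = e \<and> steps (tick t) \<le> steps s + 25"
      using I sm[OF I, of ADJ] j0(1) d10 by (simp add: I_def)
  qed
  then show ?thesis by (simp add: find_edge_def Let_def g_def y_def a_def)
qed

text \<open>An upper bound for the number of paths loaded on an edge: the logarithm counts the
  doublings, and the load that triggers a doubling brings the count to less than
  \<open>T + 1\<close>. As \<open>T\<close> need not be an integer, \<open>T\<close> itself would be
  too small.\<close>

definition usage :: "real \<Rightarrow> state \<Rightarrow> nat \<Rightarrow> real" where
  "usage T s e = real (nmem s CNT e) + (T + 1) * log 2 (real (nmem s LEN e))"

text \<open>The potential is linear in \<open>CNT\<close> between doublings, so that routing a path raises it by the length of the
  path divided by \<open>T\<close>, and a doubling leaves it no larger.\<close>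

definition potential :: "real \<Rightarrow> state \<Rightarrow> real" where
  "potential T s = (\<Sum>e<m. real (nmem s LEN e) * (1 + real (nmem s CNT e) / T))"

text \<open>The frame \<open>same\<close> is too strict here: routing extends the history, fills the
  path buffer and writes the estimate to an array of reals.\<close>

definition route_same :: "nat set \<Rightarrow> state \<Rightarrow> state \<Rightarrow> bool" where
  "route_same A s t \<longleftrightarrow> (\<forall>a. a \<notin> A \<longrightarrow> nmem t a = nmem s a) \<and> (\<forall>a. a \<noteq> vFLAG \<longrightarrow> rmem t a = rmem s a)"

lemma route_sameD: "route_same A s t \<Longrightarrow> a \<notin> A \<Longrightarrow> nmem t a = nmem s a"
  "route_same A s t \<Longrightarrow> a \<noteq> vFLAG \<Longrightarrow> rmem t a = rmem s a"
  by (simp_all add: route_same_def)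

lemma route_same_trans: "route_same A s t \<Longrightarrow> route_same B t u \<Longrightarrow> A \<subseteq> C \<Longrightarrow> B \<subseteq> C \<Longrightarrow> route_same C s u"
  unfolding route_same_def by (metis subsetD)

abbreviation (input) load_frame :: "nat set" where
  "load_frame \<equiv> {vP, vV, vY, vJJ, vE, CNT, LEN}"

lemma wp_load_edge:
  assumes st: "static s" and ok: "apsp_ok s" and T: "rmem s rT 0 = T" "1 \<le> T"
    and cnt: "\<And>e. e < m \<Longrightarrow> real (nmem s CNT e) < T"
    and i: "nmem s vP 0 = i" "Suc i < length (path_buffer s)"
    and e: "e \<in> inc (path_buffer s ! i)" "oth e (path_buffer s ! i) = path_buffer s ! Suc i"
  shows "wp load_edge (\<lambda>t. route_same load_frame s t \<and> apsp_ok t \<and> path_buffer t = path_buffer s \<and>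
     nmem t vP 0 = Suc i \<and> (\<forall>e<m. real (nmem t CNT e) < T) \<and>
     (\<forall>f. f \<noteq> e \<longrightarrow> nmem t LEN f = nmem s LEN f \<and> nmem t CNT f = nmem s CNT f) \<and>
     nmem s LEN e \<le> nmem t LEN e \<and> nmem t LEN e \<le> 2 * nmem s LEN e \<and>
     usage T s e + 1 \<le> usage T t e \<and> potential T t \<le> potential T s + real (nmem s LEN e) / T \<and>
     num_updates t \<le> num_updates s + 1 \<and> num_queries t = num_queries s \<and> steps t \<le> steps s + 40) s"
proof -
  let ?v = "path_buffer s ! i" and ?y = "path_buffer s ! Suc i"
  let ?s1 = "tick (nset vY 0 ?y (tick (nset vV 0 ?v s)))"
  have em: "e < m" using incD[OF e(1)] by simp
  have s1: "static ?s1" using st static_cong[of ?s1 s] by simp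
  have "wp find_edge (wp (seqs [setv vE (NGet ADJ (NAdd (times10 (var vV)) (var vJJ))),
     NSet CNT (var vE) (NAdd (NGet CNT (var vE)) (NConst 1)),
     Cond (RLess (ROfNat (NGet CNT (var vE))) (rvar rT)) Skip
       (seqs [ApspIncrease (var vV) (var vY) (ROfNat (NGet LEN (var vE))),
              NSet LEN (var vE) (NAdd (NGet LEN (var vE)) (NGet LEN (var vE))),
              NSet CNT (var vE) (NConst 0)]),
     incv vP]) (\<lambda>t. route_same load_frame s t \<and> apsp_ok t \<and> path_buffer t = path_buffer s \<and>
     nmem t vP 0 = Suc i \<and> (\<forall>e<m. real (nmem t CNT e) < T) \<and>
     (\<forall>f. f \<noteq> e \<longrightarrow> nmem t LEN f = nmem s LEN f \<and> nmem t CNT f = nmem s CNT f) \<and>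
     nmem s LEN e \<le> nmem t LEN e \<and> nmem t LEN e \<le> 2 * nmem s LEN e \<and>
     usage T s e + 1 \<le> usage T t e \<and> potential T t \<le> potential T s + real (nmem s LEN e) / T \<and>
     num_updates t \<le> num_updates s + 1 \<and> num_queries t = num_queries s \<and> steps t \<le> steps s + 40)) ?s1"
  proof (rule wp_mono[OF wp_find_edge[OF s1 _ _ e(1)]])
    fix u assume u: "same {vJJ} ?s1 u \<and> nmem u ADJ (10 * ?v + nmem u vJJ 0) = e \<and> steps u \<le> steps ?s1 + 25"
    then have sm: "same {vJJ} ?s1 u" by simp
    have um: "nmem u c = nmem ?s1 c" if "c \<noteq> vJJ" for c using sameD[OF sm, of c] that by simp
    have ur: "rmem u = rmem s" "history u = history s" "init_weights u = init_weights s" "path_buffer u = path_buffer s"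
      using sameD2[OF sm] by simp_all
    have nu: "num_updates u = num_updates s" "num_queries u = num_queries s"
      using ur by (simp_all add: num_updates_def num_queries_def)
    have ui: "nmem u CNT = nmem s CNT" "nmem u LEN = nmem s LEN" "nmem u vP 0 = i" "nmem u vV 0 = ?v" "nmem u vY 0 = ?y"
      using um[of CNT] um[of LEN] um[of vP] um[of vV] um[of vY] i by simp_all
    define c where "c = nmem s CNT e"
    define l where "l = nmem s LEN e"
    have l1: "1 \<le> l" using ok em by (auto simp: apsp_ok_def l_def)
    have ct: "real c < T" using cnt[OF em] by (simp add: c_def)
    have rs: "route_same load_frame s t" if "\<And>a. a \<notin> load_frame \<Longrightarrow> nmem t a = nmem u a" "rmem t = rmem u" for t
      using that um ur unfolding route_same_def by (auto simp: fun_eq_iff)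
    have pot: "potential T t = potential T s - real l * (1 + real c / T) + real (nmem t LEN e) * (1 + real (nmem t CNT e) / T)"
      if "\<And>f. f \<noteq> e \<Longrightarrow> nmem t LEN f = nmem s LEN f \<and> nmem t CNT f = nmem s CNT f" for t
    proof -
      have "potential T r = (\<Sum>f\<in>{..<m} - {e}. real (nmem r LEN f) * (1 + real (nmem r CNT f) / T))
          + real (nmem r LEN e) * (1 + real (nmem r CNT e) / T)" for r
        unfolding potential_def using em by (subst sum.remove[of _ e]) auto
      moreover have "(\<Sum>f\<in>{..<m} - {e}. real (nmem t LEN f) * (1 + real (nmem t CNT f) / T))
          = (\<Sum>f\<in>{..<m} - {e}. real (nmem s LEN f) * (1 + real (nmem s CNT f) / T))"
        using that by (intro sum.cong refl) auto
      ultimately show ?thesis by (simp add: c_def l_def)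
    qed
    let ?u2 = "tick (nset CNT e (Suc c) (tick (nset vE 0 e u)))"
    show "wp (seqs [setv vE (NGet ADJ (NAdd (times10 (var vV)) (var vJJ))),
     NSet CNT (var vE) (NAdd (NGet CNT (var vE)) (NConst 1)),
     Cond (RLess (ROfNat (NGet CNT (var vE))) (rvar rT)) Skip
       (seqs [ApspIncrease (var vV) (var vY) (ROfNat (NGet LEN (var vE))),
              NSet LEN (var vE) (NAdd (NGet LEN (var vE)) (NGet LEN (var vE))),
              NSet CNT (var vE) (NConst 0)]),
     incv vP]) (\<lambda>t. route_same load_frame s t \<and> apsp_ok t \<and> path_buffer t = path_buffer s \<and>
     nmem t vP 0 = Suc i \<and> (\<forall>e<m. real (nmem t CNT e) < T) \<and>
     (\<forall>f. f \<noteq> e \<longrightarrow> nmem t LEN f = nmem s LEN f \<and> nmem t CNT f = nmem s CNT f) \<and>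
     nmem s LEN e \<le> nmem t LEN e \<and> nmem t LEN e \<le> 2 * nmem s LEN e \<and>
     usage T s e + 1 \<le> usage T t e \<and> potential T t \<le> potential T s + real (nmem s LEN e) / T \<and>
     num_updates t \<le> num_updates s + 1 \<and> num_queries t = num_queries s \<and> steps t \<le> steps s + 40) u"
    proof (cases "real (Suc c) < T")
      case True
      let ?t = "tick (nset vP 0 (Suc i) (tick (tick ?u2)))"
      have 1: "route_same load_frame s ?t" by (rule rs) simp_all
      have 2: "apsp_ok ?t" using ok apsp_ok_cong[of ?t s] ur ui by simp
      have f: "nmem ?t LEN f = nmem s LEN f \<and> nmem ?t CNT f = nmem s CNT f" if "f \<noteq> e" for f using ui that by simp
      have 3: "potential T ?t \<le> potential T s + real l / T"
        using pot[OF f] ui T by (simp add: l_def c_def field_simps)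
      have 4: "usage T s e + 1 \<le> usage T ?t e" using ui by (simp add: usage_def c_def)
      have 5: "\<forall>f<m. real (nmem ?t CNT f) < T" using cnt True ui by simp
      show ?thesis
        using u True 1 2 3 4 5 ui ur nu T by (simp add: c_def[symmetric] l_def[symmetric])
    next
      case False
      let ?q = "IncreaseEdgeWeight ?v ?y (real l)"
      let ?u3 = "tick (log_op ?q (tick ?u2))"
      let ?t = "tick (nset vP 0 (Suc i) (tick (nset CNT e 0 (tick (nset LEN e (l + l) ?u3)))))"
      have eE: "edge_of (es ! e) = {?v, ?y}" using incD(7)[OF e(1)] e(2) by simp
      have leg: "legal_op n (set (map edge_of es)) ?q"
        unfolding set_edges using edge_in_E[OF em] eE by simp
      have 1: "route_same load_frame s ?t" by (rule rs) simp_all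
      have 2: "apsp_ok ?t"
      proof -
        obtain w where w: "init_weights s = Some w" "\<forall>e\<in>E. 0 < w e" "\<forall>q\<in>set (history s). legal_op n E q"
          "\<And>e. e < m \<Longrightarrow> current_weight w (history s) (edge_of (es ! e)) = real (nmem s LEN e) \<and> 1 \<le> nmem s LEN e"
          using ok by (auto simp: apsp_ok_def)
        have "current_weight w (history ?t) (edge_of (es ! f)) = real (nmem ?t LEN f) \<and> 1 \<le> nmem ?t LEN f" if f: "f < m" for f
        proof (cases "f = e")
          case True
          then show ?thesis using w(4)[OF em] ur ui l1 by (simp add: eE[symmetric] l_def)
        next
          case False
          then have "edge_of (es ! f) \<noteq> {?v, ?y}" using edge_index_inj[OF f em] eE by auto
          then show ?thesis using w(4)[OF f] ur ui False by simp
        qed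
        then show ?thesis using w(1-3) ur leg set_edges unfolding apsp_ok_def by auto
      qed
      have f: "nmem ?t LEN f = nmem s LEN f \<and> nmem ?t CNT f = nmem s CNT f" if "f \<noteq> e" for f using ui that by simp
      \<comment> \<open>The doubling replaces \<open>l * (1 + c / T)\<close> by
        \<open>2 * l\<close>, an increase of \<open>l * (1 - c / T)\<close>, which is at most
        \<open>l / T\<close> because \<open>T \<le> c + 1\<close>.\<close>
      have 3: "potential T ?t \<le> potential T s + real l / T"
      proof -
        have "potential T ?t = potential T s - real l * (1 + real c / T) + 2 * real l"
          using pot[OF f] by simp
        moreover have "real l * T \<le> real l * (real c + 1)" using False by (intro mult_left_mono) auto
        ultimately show ?thesis using T by (simp add: field_simps)
      qed
      \<comment> \<open>The logarithm gains one, worth \<open>T + 1\<close>, and the count loses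
        \<open>c < T\<close>.\<close>
      have 4: "usage T s e + 1 \<le> usage T ?t e"
      proof -
        have "log 2 (real (l + l)) = 1 + log 2 (real l)" using l1 log_mult[of 2 "real l" 2] by (simp add: mult.commute)
        then have "usage T ?t e = (T + 1) * (1 + log 2 (real l))" by (simp add: usage_def)
        then show ?thesis using ct by (simp add: usage_def c_def l_def algebra_simps)
      qed
      have 5: "\<forall>f<m. real (nmem ?t CNT f) < T" using cnt ui T by simp
      have "wp (ApspIncrease (var vV) (var vY) (ROfNat (NGet LEN (var vE)))) Q (tick ?u2) \<longleftrightarrow> Q ?u3 \<or> wp (ApspIncrease (var vV) (var vY) (ROfNat (NGet LEN (var vE)))) Q (tick ?u2)" for Q
        using wp_ApspIncreaseI[of "tick ?u2" ?q "var vV" "var vY" "ROfNat (NGet LEN (var vE))" Q] leg ui ur ok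
        by (auto simp: apsp_ok_def l_def)
      then have inc: "Q ?u3 \<Longrightarrow> wp (ApspIncrease (var vV) (var vY) (ROfNat (NGet LEN (var vE)))) Q (tick ?u2)" for Q
        by blast
      have "wp (seqs [ApspIncrease (var vV) (var vY) (ROfNat (NGet LEN (var vE))),
              NSet LEN (var vE) (NAdd (NGet LEN (var vE)) (NGet LEN (var vE))),
              NSet CNT (var vE) (NConst 0), incv vP]) (\<lambda>t. route_same load_frame s t \<and> apsp_ok t \<and> path_buffer t = path_buffer s \<and>
     nmem t vP 0 = Suc i \<and> (\<forall>e<m. real (nmem t CNT e) < T) \<and>
     (\<forall>f. f \<noteq> e \<longrightarrow> nmem t LEN f = nmem s LEN f \<and> nmem t CNT f = nmem s CNT f) \<and>
     nmem s LEN e \<le> nmem t LEN e \<and> nmem t LEN e \<le> 2 * nmem s LEN e \<and>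
     usage T s e + 1 \<le> usage T t e \<and> potential T t \<le> potential T s + real (nmem s LEN e) / T \<and>
     num_updates t \<le> num_updates s + 1 \<and> num_queries t = num_queries s \<and> steps t \<le> steps s + 40) (tick ?u2)"
        unfolding seqs.simps wp_Seq
        by (rule inc) (use u 1 2 3 4 5 ui ur nu in \<open>simp add: l_def[symmetric]\<close>)
      then show ?thesis
        using u False ui ur T by (simp add: c_def[symmetric])
    qed
  qed (use e in simp_all)
  then show ?thesis using i by (simp add: load_edge_def)
qed

end

context cut_input
begin

lemma cut_walk_step:
  fixes p :: "nat list"
  assumes "p \<noteq> []" "(hd p \<in> X) \<noteq> (last p \<in> X)"
  shows "\<exists>i. Suc i < length p \<and> (p ! i \<in> X) \<noteq> (p ! Suc i \<in> X)"
  using assms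
proof (induction p)
  case (Cons a p)
  show ?case
  proof (cases "p = []")
    case False
    show ?thesis
    proof (cases "(a \<in> X) = (hd p \<in> X)")
      case True
      then obtain i where "Suc i < length p" "(p ! i \<in> X) \<noteq> (p ! Suc i \<in> X)"
        using Cons False by auto
      then show ?thesis by (intro exI[of _ "Suc i"]) simp
    next
      case neq: False
      then show ?thesis using False by (intro exI[of _ 0]) (simp add: hd_conv_nth)
    qed
  qed (use Cons in simp)
qed simp

text \<open>Every edge of the path is met once and at its reported length, so the increases of the
  potential add up to at most \<open>W / T\<close>, and a length reaches at most
  \<open>2 * W\<close>. Lengths are at least 1, so the path has at most \<open>W\<close> edges,
  which bounds updates and steps. If its ends lie on different sides of \<open>X\<close>, it crosses
  the boundary and adds at least one unit of usage there.\<close>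

lemma wp_load_path:
  assumes st: "static s" and ok: "apsp_ok s" and T: "rmem s rT 0 = T" "1 \<le> T"
    and cnt: "\<And>e. e < m \<Longrightarrow> real (nmem s CNT e) < T"
    and p: "is_path E u v p" "path_buffer s = p"
    and W: "path_weight cw p \<le> W" and cw: "\<And>e. e < m \<Longrightarrow> cw (edge_of (es ! e)) = real (nmem s LEN e)"
  shows "wp load_path (\<lambda>t. route_same load_frame s t \<and> apsp_ok t \<and>
     (\<forall>e<m. real (nmem t CNT e) < T) \<and>
     (\<forall>e<m. nmem s LEN e \<le> nmem t LEN e \<and> real (nmem t LEN e) \<le> max (real (nmem s LEN e)) (2 * W)) \<and>
     (\<forall>X. sum (usage T s) (cutx X) + of_bool ((u \<in> X) \<noteq> (v \<in> X)) \<le> sum (usage T t) (cutx X)) \<and>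
     potential T t \<le> potential T s + W / T \<and>
     real (num_updates t) \<le> real (num_updates s) + W \<and> num_queries t = num_queries s \<and>
     real (steps t) \<le> real (steps s) + 2 + 41 * W) s"
proof -
  obtain f where f: "\<And>i. Suc i < length p \<Longrightarrow> f i \<in> inc (p ! i) \<and> oth (f i) (p ! i) = p ! Suc i"
    and finj: "\<And>i j. Suc i < length p \<Longrightarrow> Suc j < length p \<Longrightarrow> f i = f j \<Longrightarrow> i = j"
    and pw: "\<And>w. path_weight w p = (\<Sum>i<length p - 1. w (edge_of (es ! f i)))"
    by (rule path_edges[OF p(1)]) blast
  have fm: "f i < m" if "Suc i < length p" for i using f[OF that] incD(1) by blast
  define l where "l = (\<lambda>i. real (nmem s LEN (f i)))"
  have l1: "1 \<le> l i" if "Suc i < length p" for i using ok fm[OF that] by (auto simp: apsp_ok_def l_def)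
  have plen: "length p - 1 < length p" using p(1) by (simp add: is_path_def)
  have sumW: "(\<Sum>i<length p - 1. l i) \<le> W"
  proof -
    have "path_weight cw p = (\<Sum>i<length p - 1. l i)"
      unfolding pw by (intro sum.cong refl) (simp add: cw fm l_def)
    then show ?thesis using W by simp
  qed
  have lW: "l i \<le> W" if "Suc i < length p" for i
  proof -
    have "l i \<le> (\<Sum>i<length p - 1. l i)" using that by (intro member_le_sum) (auto simp: l_def)
    then show ?thesis using sumW by simp
  qed
  have lenW: "real (length p - 1) \<le> W"
  proof -
    have "real (length p - 1) = (\<Sum>i<length p - 1. 1)" by simp
    also have "\<dots> \<le> (\<Sum>i<length p - 1. l i)" by (intro sum_mono l1) auto
    finally show ?thesis using sumW by simp
  qed
  have W0: "0 \<le> W" using lenW by linarith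
  define I where "I = (\<lambda>t. route_same load_frame s t \<and> apsp_ok t \<and> path_buffer t = p \<and> nmem t vP 0 \<le> length p - 1 \<and>
     (\<forall>e<m. real (nmem t CNT e) < T) \<and>
     (\<forall>r. nmem t vP 0 \<le> r \<longrightarrow> Suc r < length p \<longrightarrow> nmem t LEN (f r) = nmem s LEN (f r)) \<and>
     (\<forall>e<m. nmem s LEN e \<le> nmem t LEN e \<and> real (nmem t LEN e) \<le> max (real (nmem s LEN e)) (2 * W)) \<and>
     (\<forall>X. sum (usage T s) (cutx X) + real (card {r. r < nmem t vP 0 \<and> (p ! r \<in> X) \<noteq> (p ! Suc r \<in> X)}) \<le> sum (usage T t) (cutx X)) \<and>
     potential T t \<le> potential T s + (\<Sum>r<nmem t vP 0. l r) / T \<and>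
     num_updates t \<le> num_updates s + nmem t vP 0 \<and> num_queries t = num_queries s \<and>
     steps t \<le> steps s + 1 + 41 * nmem t vP 0)"
  have "wp (Loop (NLess (NAdd (var vP) (NConst 1)) PathLength) load_edge)
    (\<lambda>t. route_same load_frame s t \<and> apsp_ok t \<and>
     (\<forall>e<m. real (nmem t CNT e) < T) \<and>
     (\<forall>e<m. nmem s LEN e \<le> nmem t LEN e \<and> real (nmem t LEN e) \<le> max (real (nmem s LEN e)) (2 * W)) \<and>
     (\<forall>X. sum (usage T s) (cutx X) + of_bool ((u \<in> X) \<noteq> (v \<in> X)) \<le> sum (usage T t) (cutx X)) \<and>
     potential T t \<le> potential T s + W / T \<and>
     real (num_updates t) \<le> real (num_updates s) + W \<and> num_queries t = num_queries s \<and>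
     real (steps t) \<le> real (steps s) + 2 + 41 * W) (tick (nset vP 0 0 s))"
  proof (rule wp_Loop[where I = I and \<mu> = "\<lambda>t. length p - nmem t vP 0"])
    let ?s1 = "tick (nset vP 0 0 s)"
    have "apsp_ok ?s1" using ok apsp_ok_cong[of ?s1 s] by simp
    moreover have "usage T ?s1 = usage T s" "potential T ?s1 = potential T s"
      by (auto simp: usage_def potential_def fun_eq_iff)
    ultimately show "I ?s1" using cnt p by (simp add: I_def route_same_def)
  next
    fix t assume I: "I t" and g: "beval t (NLess (NAdd (var vP) (NConst 1)) PathLength)"
    define i where "i = nmem t vP 0"
    have pb: "path_buffer t = p" using I by (simp add: I_def)
    have i: "Suc i < length p" using g pb by (simp add: i_def)
    have rs: "route_same load_frame s t" using I by (simp add: I_def)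
    have tm: "nmem t a = nmem s a" if "a \<notin> load_frame" for a using route_sameD(1)[OF rs that] .
    let ?t = "tick t"
    have s1: "static ?t" using st static_cong[of ?t s] tm by simp
    have ok1: "apsp_ok ?t" using I apsp_ok_cong[of ?t t] by (simp add: I_def)
    have us: "usage T ?t = usage T t" "potential T ?t = potential T t"
      by (auto simp: usage_def potential_def fun_eq_iff)
    have Tt: "rmem ?t rT 0 = T" using route_sameD(2)[OF rs, of rT] T by simp
    have fi: "f i \<in> inc (p ! i)" "oth (f i) (p ! i) = p ! Suc i" using f[OF i] by auto
    show "wp load_edge (\<lambda>w. I w \<and> length p - nmem w vP 0 < length p - nmem t vP 0) ?t"
    proof (rule wp_mono[OF wp_load_edge[OF s1 ok1 Tt T(2), of i "f i"]])
      fix w assume w: "route_same load_frame ?t w \<and> apsp_ok w \<and> path_buffer w = path_buffer ?t \<and>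
       nmem w vP 0 = Suc i \<and> (\<forall>e<m. real (nmem w CNT e) < T) \<and>
       (\<forall>g. g \<noteq> f i \<longrightarrow> nmem w LEN g = nmem ?t LEN g \<and> nmem w CNT g = nmem ?t CNT g) \<and>
       nmem ?t LEN (f i) \<le> nmem w LEN (f i) \<and> nmem w LEN (f i) \<le> 2 * nmem ?t LEN (f i) \<and>
       usage T ?t (f i) + 1 \<le> usage T w (f i) \<and> potential T w \<le> potential T ?t + real (nmem ?t LEN (f i)) / T \<and>
       num_updates w \<le> num_updates ?t + 1 \<and> num_queries w = num_queries ?t \<and> steps w \<le> steps ?t + 40"
      then have W1: "route_same load_frame t w" "apsp_ok w" "path_buffer w = p" "nmem w vP 0 = Suc i"
        and W2: "\<forall>e<m. real (nmem w CNT e) < T"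
        and W3: "\<And>g. g \<noteq> f i \<Longrightarrow> nmem w LEN g = nmem t LEN g \<and> nmem w CNT g = nmem t CNT g"
        and W4: "nmem t LEN (f i) \<le> nmem w LEN (f i)" "nmem w LEN (f i) \<le> 2 * nmem t LEN (f i)"
        and W5: "usage T t (f i) + 1 \<le> usage T w (f i)"
        and W6: "potential T w \<le> potential T t + real (nmem t LEN (f i)) / T"
        and W7: "num_updates w \<le> num_updates t + 1" "num_queries w = num_queries t" "steps w \<le> steps t + 41"
        using pb us by (simp_all add: route_same_def)
      have Lfi: "real (nmem t LEN (f i)) = l i" using I i by (simp add: I_def i_def l_def)
      have "I w" unfolding I_def
      proof (intro conjI)
        show "route_same load_frame s w" by (rule route_same_trans[OF rs W1(1)]) auto
        show "\<forall>r\<ge>nmem w vP 0. Suc r < length p \<longrightarrow> nmem w LEN (f r) = nmem s LEN (f r)"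
        proof (intro allI impI)
          fix r assume r: "nmem w vP 0 \<le> r" "Suc r < length p"
          then have "f r \<noteq> f i" using finj[OF r(2) i] W1(4) by auto
          then show "nmem w LEN (f r) = nmem s LEN (f r)" using W3 I r W1(4) by (simp add: I_def i_def)
        qed
        show "\<forall>e<m. nmem s LEN e \<le> nmem w LEN e \<and> real (nmem w LEN e) \<le> max (real (nmem s LEN e)) (2 * W)"
        proof (intro allI impI)
          fix e assume e: "e < m"
          have It: "nmem s LEN e \<le> nmem t LEN e" "real (nmem t LEN e) \<le> max (real (nmem s LEN e)) (2 * W)"
            using I e by (auto simp: I_def)
          show "nmem s LEN e \<le> nmem w LEN e \<and> real (nmem w LEN e) \<le> max (real (nmem s LEN e)) (2 * W)"
          proof (cases "e = f i")
            case True
            have "real (nmem w LEN e) \<le> 2 * l i" using of_nat_mono[OF W4(2), where 'a = real] Lfi True by simp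
            then show ?thesis using W4(1) It True lW[OF i] by auto
          next
            case False
            then show ?thesis using W3 It by simp
          qed
        qed
        show "\<forall>X. sum (usage T s) (cutx X) + real (card {r. r < nmem w vP 0 \<and> (p ! r \<in> X) \<noteq> (p ! Suc r \<in> X)}) \<le> sum (usage T w) (cutx X)"
        proof
          fix X
          let ?S = "\<lambda>k. {r. r < k \<and> (p ! r \<in> X) \<noteq> (p ! Suc r \<in> X)}"
          let ?c = "(p ! i \<in> X) \<noteq> (p ! Suc i \<in> X)"
          have "?S (Suc i) = (if ?c then insert i (?S i) else ?S i)" by (auto simp: less_Suc_eq)
          then have c: "card (?S (Suc i)) = card (?S i) + of_bool ?c" by simp
          have fc: "f i \<in> cutx X \<longleftrightarrow> ?c" using cutx_inc[OF fi(1)] fi(2) by simp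
          have "sum (usage T t) (cutx X) + of_bool ?c \<le> sum (usage T w) (cutx X)"
          proof -
            have "sum (usage T t) (cutx X) + of_bool ?c = (\<Sum>e\<in>cutx X. usage T t e + (if e = f i then 1 else 0))"
              by (simp add: sum.distrib fc)
            also have "\<dots> \<le> sum (usage T w) (cutx X)"
              using W5 W3 by (intro sum_mono) (auto simp: usage_def)
            finally show ?thesis .
          qed
          moreover have "sum (usage T s) (cutx X) + real (card (?S i)) \<le> sum (usage T t) (cutx X)"
            using I by (simp add: I_def i_def)
          ultimately show "sum (usage T s) (cutx X) + real (card (?S (nmem w vP 0))) \<le> sum (usage T w) (cutx X)"
            using c W1(4) by simp
        qed
        show "potential T w \<le> potential T s + (\<Sum>r<nmem w vP 0. l r) / T"
        proof -
          have "potential T t \<le> potential T s + (\<Sum>r<i. l r) / T" using I by (simp add: I_def i_def)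
          then show ?thesis using W6 Lfi W1(4) by (simp add: add_divide_distrib)
        qed
        show "num_updates w \<le> num_updates s + nmem w vP 0" "num_queries w = num_queries s"
          "steps w \<le> steps s + 1 + 41 * nmem w vP 0"
          using I W7 W1(4) by (auto simp: I_def i_def)
      qed (use W1 W2 i in auto)
      then show "I w \<and> length p - nmem w vP 0 < length p - nmem t vP 0"
        using W1(4) i by (simp add: i_def)
    next
      fix e assume "e < m" then show "real (nmem (tick t) CNT e) < T" using I by (simp add: I_def)
    qed (use i pb fi in \<open>simp_all add: i_def\<close>)
  next
    fix t assume I: "I t" and g: "\<not> beval t (NLess (NAdd (var vP) (NConst 1)) PathLength)"
    let ?t = "tick t"
    have i: "nmem t vP 0 = length p - 1" using I g plen by (auto simp: I_def)
    have ok1: "apsp_ok ?t" using I apsp_ok_cong[of ?t t] by (simp add: I_def)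
    have us: "usage T ?t = usage T t" "potential T ?t = potential T t"
      by (auto simp: usage_def potential_def fun_eq_iff)
    have "\<forall>X. sum (usage T s) (cutx X) + of_bool ((u \<in> X) \<noteq> (v \<in> X)) \<le> sum (usage T t) (cutx X)"
    proof
      fix X
      let ?S = "{r. r < length p - 1 \<and> (p ! r \<in> X) \<noteq> (p ! Suc r \<in> X)}"
      have "of_bool ((u \<in> X) \<noteq> (v \<in> X)) \<le> real (card ?S)"
      proof (cases "(u \<in> X) \<noteq> (v \<in> X)")
        case True
        then obtain r where r: "Suc r < length p" "(p ! r \<in> X) \<noteq> (p ! Suc r \<in> X)"
          using cut_walk_step[of p X] p(1) by (auto simp: is_path_def)
        then have "r \<in> ?S" by simp
        then have "1 \<le> card ?S" using card_mono[of ?S "{r}"] by simp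
        then show ?thesis by simp
      qed simp
      moreover have "sum (usage T s) (cutx X) + real (card ?S) \<le> sum (usage T t) (cutx X)"
        using I i unfolding I_def by simp
      ultimately show "sum (usage T s) (cutx X) + of_bool ((u \<in> X) \<noteq> (v \<in> X)) \<le> sum (usage T t) (cutx X)" by linarith
    qed
    moreover have "potential T t \<le> potential T s + W / T"
    proof -
      have "potential T t \<le> potential T s + (\<Sum>r<length p - 1. l r) / T" using I i by (simp add: I_def)
      also have "(\<Sum>r<length p - 1. l r) / T \<le> W / T" using sumW T by (simp add: divide_right_mono)
      finally show ?thesis by simp
    qed
    moreover have "real (num_updates t) \<le> real (num_updates s) + W"
    proof -
      have "real (num_updates t) \<le> real (num_updates s + (length p - 1))" using I i by (simp add: I_def)
      then show ?thesis using lenW by simp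
    qed
    moreover have "real (steps ?t) \<le> real (steps s) + 2 + 41 * W"
    proof -
      have "steps t \<le> steps s + 1 + 41 * (length p - 1)" using I i by (simp add: I_def)
      then have "real (steps ?t) \<le> real (steps s + 2 + 41 * (length p - 1))" by simp
      then show ?thesis using lenW by simp
    qed
    ultimately show "route_same load_frame s ?t \<and> apsp_ok ?t \<and>
     (\<forall>e<m. real (nmem ?t CNT e) < T) \<and>
     (\<forall>e<m. nmem s LEN e \<le> nmem ?t LEN e \<and> real (nmem ?t LEN e) \<le> max (real (nmem s LEN e)) (2 * W)) \<and>
     (\<forall>X. sum (usage T s) (cutx X) + of_bool ((u \<in> X) \<noteq> (v \<in> X)) \<le> sum (usage T ?t) (cutx X)) \<and>
     potential T ?t \<le> potential T s + W / T \<and>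
     real (num_updates ?t) \<le> real (num_updates s) + W \<and> num_queries ?t = num_queries s \<and>
     real (steps ?t) \<le> real (steps s) + 2 + 41 * W"
      using I ok1 us by (simp add: I_def route_same_def)
  qed
  then show ?thesis by (simp add: load_path_def)
qed

definition far_apart :: "(nat \<Rightarrow> nat) \<Rightarrow> real \<Rightarrow> nat \<Rightarrow> nat \<Rightarrow> bool" where
  "far_apart L r u v \<longleftrightarrow> (\<forall>k. walk {} L u k v \<longrightarrow> r < real k)"

text \<open>Lengths never decrease. A pair found to be far apart early in a round is still far apart
  when the round ends, after all other pairs have been handled.\<close>

lemma far_apart_mono:
  assumes "far_apart L r u v" "\<And>e. e < m \<Longrightarrow> L e \<le> L' e"
  shows "far_apart L' r u v"
  unfolding far_apart_def
proof (intro allI impI)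
  fix k assume "walk {} L' u k v"
  then obtain k' where "k' \<le> k" "walk {} L u k' v" using walk_len_mono[of "{}" L' u k v L] assms(2) by blast
  then show "r < real k" using assms(1) unfolding far_apart_def by fastforce
qed

abbreviation (input) route_frame :: "nat set" where
  "route_frame \<equiv> {vP, vV, vY, vJJ, vE, CNT, LEN, vFLAG, FA, FB, vF}"

definition routed :: "real \<Rightarrow> real \<Rightarrow> bool \<Rightarrow> nat \<Rightarrow> nat \<Rightarrow> state \<Rightarrow> state \<Rightarrow> bool" where
  "routed T th ok u v s t \<longleftrightarrow> route_same route_frame s t \<and> apsp_ok t \<and>
     (\<forall>e<m. real (nmem t CNT e) < T) \<and>
     (\<forall>e<m. nmem s LEN e \<le> nmem t LEN e \<and> real (nmem t LEN e) \<le> max (real (nmem s LEN e)) (2 * th)) \<and>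
     (\<forall>X. sum (usage T s) (cutx X) + of_bool (ok \<and> (u \<in> X) \<noteq> (v \<in> X)) \<le> sum (usage T t) (cutx X)) \<and>
     potential T t \<le> potential T s + th / T \<and>
     real (num_updates t) \<le> real (num_updates s) + th \<and> num_queries t \<le> num_queries s + 2 \<and>
     real (steps t) \<le> real (steps s) + 12 + 41 * th \<and>
     nmem t vF 0 = (if ok then nmem s vF 0 else Suc (nmem s vF 0)) \<and>
     nmem t FA = (if ok then nmem s FA else (nmem s FA)(nmem s vF 0 := u)) \<and>
     nmem t FB = (if ok then nmem s FB else (nmem s FB)(nmem s vF 0 := v)) \<and>
     (\<not> ok \<longrightarrow> far_apart (nmem t LEN) (th / \<alpha>) u v)"

lemma wp_route:
  assumes st: "static s" and ok: "apsp_ok s" and T: "rmem s rT 0 = T" "1 \<le> T" and th: "rmem s rTH 0 = th" "0 \<le> th"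
    and cnt: "\<And>e. e < m \<Longrightarrow> real (nmem s CNT e) < T"
    and uv: "nmem s FA (nmem s vJ 0) = u" "nmem s FB (nmem s vJ 0) = v" "u < n" "v < n"
  shows "wp route (\<lambda>t. \<exists>ok. routed T th ok u v s t) s"
proof -
  obtain w where w: "init_weights s = Some w" "\<forall>e\<in>E. 0 < w e" "\<forall>q\<in>set (history s). legal_op n E q"
     "\<forall>e<m. current_weight w (history s) (edge_of (es ! e)) = real (nmem s LEN e) \<and> 1 \<le> nmem s LEN e"
    using ok unfolding apsp_ok_def by (elim exE conjE) (rule that)
  define x where "x = estimate D w (history s) u v"
  define p where "p = reported_path D w (history s @ [QueryDistance u v]) u v"
  define cw where "cw = current_weight w (history s)"
  define s1 where "s1 = tick (log_op (QueryDistance u v)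
     (nset vFLAG 0 (if x = \<infinity> then 0 else 1) (rset vFLAG 0 (real_of_ereal x) s)))"
  have s1: "nmem s1 = (nmem s)(vFLAG := (nmem s vFLAG)(0 := (if x = \<infinity> then 0 else 1)))"
    "rmem s1 = (rmem s)(vFLAG := (rmem s vFLAG)(0 := real_of_ereal x))"
    "history s1 = history s @ [QueryDistance u v]" "init_weights s1 = Some w" "steps s1 = Suc (steps s)"
    "num_updates s1 = num_updates s" "num_queries s1 = Suc (num_queries s)"
    using w(1) by (simp_all add: s1_def)
  have cwL: "cw (edge_of (es ! e)) = real (nmem s LEN e)" if "e < m" for e using w(4) that by (simp add: cw_def)
  have cond: "beval s1 (BAnd (NLess (NConst 0) (var vFLAG)) (BNot (RLess (rvar rTH) (rvar vFLAG))))
      \<longleftrightarrow> x \<noteq> \<infinity> \<and> real_of_ereal x \<le> th"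
    using th by (simp add: s1 not_less)
  have "wp (Cond (BAnd (NLess (NConst 0) (var vFLAG)) (BNot (RLess (rvar rTH) (rvar vFLAG))))
       (seqs [ApspPath (NGet FA (var vJ)) (NGet FB (var vJ)), load_path])
       (seqs [NSet FA (var vF) (NGet FA (var vJ)), NSet FB (var vF) (NGet FB (var vJ)), incv vF]))
     (\<lambda>t. \<exists>ok. routed T th ok u v s t) s1"
  proof (cases "x \<noteq> \<infinity> \<and> real_of_ereal x \<le> th")
    case True
    have path: "is_path E u v p" "path_weight cw p \<le> th"
      using apsp_query(1)[OF ok uv(3,4) w(1)] True by (auto simp: x_def p_def cw_def)
    define s2 where "s2 = tick (log_op (QueryPath u v) ((tick s1)\<lparr>path_buffer := p\<rparr>))"
    have s2: "nmem s2 = nmem s1" "rmem s2 = rmem s1" "history s2 = history s1 @ [QueryPath u v]"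
      "init_weights s2 = Some w" "path_buffer s2 = p" "steps s2 = steps s + 3"
      "num_updates s2 = num_updates s" "num_queries s2 = num_queries s + 2"
      using s1 by (simp_all add: s2_def)
    have st2: "static s2" using st static_cong[of s2 s] by (simp add: s1 s2)
    have ok2: "apsp_ok s2" unfolding apsp_ok_def using w uv
      by (intro exI[of _ w]) (simp add: s1 s2 current_weight_def)
    have us: "usage T s2 = usage T s" "potential T s2 = potential T s"
      by (auto simp: usage_def potential_def fun_eq_iff s1 s2)
    have "wp load_path (\<lambda>t. \<exists>ok. routed T th ok u v s t) s2"
    proof (rule wp_mono[OF wp_load_path[OF st2 ok2 _ T(2) _ path(1) s2(5) path(2)]])
      fix t assume t: "route_same load_frame s2 t \<and> apsp_ok t \<and>
         (\<forall>e<m. real (nmem t CNT e) < T) \<and>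
         (\<forall>e<m. nmem s2 LEN e \<le> nmem t LEN e \<and> real (nmem t LEN e) \<le> max (real (nmem s2 LEN e)) (2 * th)) \<and>
         (\<forall>X. sum (usage T s2) (cutx X) + of_bool ((u \<in> X) \<noteq> (v \<in> X)) \<le> sum (usage T t) (cutx X)) \<and>
         potential T t \<le> potential T s2 + th / T \<and>
         real (num_updates t) \<le> real (num_updates s2) + th \<and> num_queries t = num_queries s2 \<and>
         real (steps t) \<le> real (steps s2) + 2 + 41 * th"
      then have rs: "route_same load_frame s2 t" by simp
      have tm: "nmem t a = nmem s2 a" if "a \<notin> load_frame" for a using route_sameD(1)[OF rs that] .
      have "route_same route_frame s t"
        using rs unfolding route_same_def by (simp add: s1 s2)
      then have "routed T th True u v s t"
        unfolding routed_def using t tm[of vF] tm[of FA] tm[of FB] by (simp add: s1 s2 us)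
      then show "\<exists>ok. routed T th ok u v s t" by blast
    next
      show "rmem s2 rT 0 = T" using T by (simp add: s1 s2)
    next
      fix e assume "e < m"
      then show "real (nmem s2 CNT e) < T" "cw (edge_of (es ! e)) = real (nmem s2 LEN e)"
        using cnt cwL by (simp_all add: s1 s2)
    qed
    then have "wp (ApspPath (NGet FA (var vJ)) (NGet FB (var vJ))) (wp load_path (\<lambda>t. \<exists>ok. routed T th ok u v s t)) (tick s1)"
      by (intro wp_ApspPathI[where w = w and q = "QueryPath u v" and p = p])
         (use uv s1 in \<open>simp_all add: s2_def p_def\<close>)
    then show ?thesis using True cond by simp
  next
    case False
    have far: "far_apart (nmem s LEN) (th / \<alpha>) u v"
      unfolding far_apart_def
    proof (intro allI impI)
      fix k assume "walk {} (nmem s LEN) u k v"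
      then obtain q where q: "is_path E u v q" "path_weight cw q \<le> real k"
        using walk_path[of "nmem s LEN" u k v cw] cwL by blast
      have "th / \<alpha> < path_weight cw q"
        using apsp_query(2)[OF ok uv(3,4) w(1) _ q(1), of th] False by (simp add: x_def cw_def)
      then show "th / \<alpha> < real k" using q(2) by linarith
    qed
    let ?f = "nmem s vF 0"
    let ?t = "tick (nset vF 0 (Suc ?f) (tick (nset FB ?f v (tick (nset FA ?f u (tick s1))))))"
    have ok1: "apsp_ok ?t" unfolding apsp_ok_def using w uv by (intro exI[of _ w]) (simp add: s1)
    have us: "usage T ?t = usage T s" "potential T ?t = potential T s"
      by (auto simp: usage_def potential_def fun_eq_iff s1)
    have "routed T th False u v s ?t"
      unfolding routed_def using ok1 us far cnt th T by (simp add: s1 route_same_def)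
    moreover have "nmem (tick (nset FA ?f u (tick s1))) FB (nmem s vJ 0) = v" using uv by (simp add: s1)
    ultimately show ?thesis using False cond uv by (auto simp: s1)
  qed
  then have "wp (ApspDistance vFLAG (NGet FA (var vJ)) (NGet FB (var vJ)))
     (wp (Cond (BAnd (NLess (NConst 0) (var vFLAG)) (BNot (RLess (rvar rTH) (rvar vFLAG))))
       (seqs [ApspPath (NGet FA (var vJ)) (NGet FB (var vJ)), load_path])
       (seqs [NSet FA (var vF) (NGet FA (var vJ)), NSet FB (var vF) (NGet FB (var vJ)), incv vF]))
     (\<lambda>t. \<exists>ok. routed T th ok u v s t)) s"
    by (intro wp_ApspDistanceI[where w = w and q = "QueryDistance u v" and x = x])
       (use uv w in \<open>simp_all add: s1_def x_def\<close>)
  then show ?thesis by (simp add: route_def)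
qed

end

section \<open>One round over the unrouted pairs\<close>

definition pairs :: "state \<Rightarrow> nat \<Rightarrow> nat \<Rightarrow> (nat \<times> nat) list" where
  "pairs s i j = map (\<lambda>k. (nmem s FA k, nmem s FB k)) [i..<j]"

lemma pairs_cong:
  assumes "\<And>k. i \<le> k \<Longrightarrow> k < j \<Longrightarrow> nmem t FA k = nmem s FA k \<and> nmem t FB k = nmem s FB k"
  shows "pairs t i j = pairs s i j"
  using assms by (simp add: pairs_def)

lemma pairs_Cons: "i < j \<Longrightarrow> pairs s i j = (nmem s FA i, nmem s FB i) # pairs s (Suc i) j"
  by (simp add: pairs_def upt_conv_Cons)

lemma pairs_snoc: "i \<le> j \<Longrightarrow> pairs s i (Suc j) = pairs s i j @ [(nmem s FA j, nmem s FB j)]"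
  by (simp add: pairs_def)

lemma pairs_empty [simp]: "pairs s i i = []" by (simp add: pairs_def)

lemma length_pairs [simp]: "length (pairs s i j) = j - i" by (simp add: pairs_def)

lemma nth_pairs [simp]: "k < j \<Longrightarrow> pairs s 0 j ! k = (nmem s FA k, nmem s FB k)" by (simp add: pairs_def)

lemma crossing_simps [simp]: "crossing X [] = 0"
  "crossing X (p # ps) = of_bool ((fst p \<in> X) \<noteq> (snd p \<in> X)) + crossing X ps"
  "crossing X (ps @ qs) = crossing X ps + crossing X qs"
  by (auto simp: crossing_def case_prod_beta)

context cut_input
begin

abbreviation (input) route_all_frame :: "nat set" where
  "route_all_frame \<equiv> {vP, vV, vY, vJJ, vE, CNT, LEN, vFLAG, FA, FB, vF, vJ, vKF}"

text \<open>The write index never overtakes the read index, so unread pairs are intact. The clause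
  for arbitrary \<open>P\<close> says that the surviving pairs form a sub-multiset of the old ones;
  the degree bound and the range of the vertices are instances of it. For a cut \<open>X\<close>, a
  crossing pair that is routed leaves the first summand and reappears in the usage of the boundary
  edges.\<close>

lemma wp_route_all:
  assumes st: "static s" and ok: "apsp_ok s" and T: "rmem s rT 0 = T" "1 \<le> T" and th: "rmem s rTH 0 = th" "0 \<le> th"
    and cnt: "\<And>e. e < m \<Longrightarrow> real (nmem s CNT e) < T"
    and kf: "nmem s vKF 0 = kf" and uv: "\<And>k. k < kf \<Longrightarrow> nmem s FA k < n \<and> nmem s FB k < n"
  shows "wp route_all (\<lambda>t. route_same route_all_frame s t \<and> apsp_ok t \<and>
     (\<forall>e<m. real (nmem t CNT e) < T) \<and>
     (\<forall>e<m. nmem s LEN e \<le> nmem t LEN e \<and> real (nmem t LEN e) \<le> max (real (nmem s LEN e)) (2 * th)) \<and>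
     (\<forall>P. length (filter P (pairs t 0 (nmem t vKF 0))) \<le> length (filter P (pairs s 0 kf))) \<and>
     (\<forall>X. real (crossing X (pairs s 0 kf)) + sum (usage T s) (cutx X)
        \<le> real (crossing X (pairs t 0 (nmem t vKF 0))) + sum (usage T t) (cutx X)) \<and>
     potential T t \<le> potential T s + real kf * (th / T) \<and>
     (\<forall>k<nmem t vKF 0. far_apart (nmem t LEN) (th / \<alpha>) (nmem t FA k) (nmem t FB k)) \<and>
     real (num_updates t) \<le> real (num_updates s) + real kf * th \<and> num_queries t \<le> num_queries s + 2 * kf \<and>
     real (steps t) \<le> real (steps s) + 5 + real kf * (20 + 41 * th)) s"
proof -
  let ?F = "{vP, vV, vY, vJJ, vE, CNT, LEN, vFLAG, FA, FB, vF, vJ}"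
  define I where "I = (\<lambda>t. route_same ?F s t \<and> apsp_ok t \<and> nmem t vF 0 \<le> nmem t vJ 0 \<and> nmem t vJ 0 \<le> kf \<and>
     (\<forall>k. nmem t vJ 0 \<le> k \<longrightarrow> k < kf \<longrightarrow> nmem t FA k = nmem s FA k \<and> nmem t FB k = nmem s FB k) \<and>
     (\<forall>e<m. real (nmem t CNT e) < T) \<and>
     (\<forall>e<m. nmem s LEN e \<le> nmem t LEN e \<and> real (nmem t LEN e) \<le> max (real (nmem s LEN e)) (2 * th)) \<and>
     (\<forall>P. length (filter P (pairs t 0 (nmem t vF 0))) + length (filter P (pairs s (nmem t vJ 0) kf)) \<le> length (filter P (pairs s 0 kf))) \<and>
     (\<forall>X. real (crossing X (pairs s 0 kf)) + sum (usage T s) (cutx X)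
        \<le> real (crossing X (pairs t 0 (nmem t vF 0))) + real (crossing X (pairs s (nmem t vJ 0) kf)) + sum (usage T t) (cutx X)) \<and>
     potential T t \<le> potential T s + real (nmem t vJ 0) * (th / T) \<and>
     (\<forall>k<nmem t vF 0. far_apart (nmem t LEN) (th / \<alpha>) (nmem t FA k) (nmem t FB k)) \<and>
     real (num_updates t) \<le> real (num_updates s) + real (nmem t vJ 0) * th \<and> num_queries t \<le> num_queries s + 2 * nmem t vJ 0 \<and>
     real (steps t) \<le> real (steps s) + 2 + real (nmem t vJ 0) * (20 + 41 * th))"
  let ?Q = "\<lambda>t. route_same route_all_frame s t \<and> apsp_ok t \<and>
     (\<forall>e<m. real (nmem t CNT e) < T) \<and>
     (\<forall>e<m. nmem s LEN e \<le> nmem t LEN e \<and> real (nmem t LEN e) \<le> max (real (nmem s LEN e)) (2 * th)) \<and>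
     (\<forall>P. length (filter P (pairs t 0 (nmem t vKF 0))) \<le> length (filter P (pairs s 0 kf))) \<and>
     (\<forall>X. real (crossing X (pairs s 0 kf)) + sum (usage T s) (cutx X)
        \<le> real (crossing X (pairs t 0 (nmem t vKF 0))) + sum (usage T t) (cutx X)) \<and>
     potential T t \<le> potential T s + real kf * (th / T) \<and>
     (\<forall>k<nmem t vKF 0. far_apart (nmem t LEN) (th / \<alpha>) (nmem t FA k) (nmem t FB k)) \<and>
     real (num_updates t) \<le> real (num_updates s) + real kf * th \<and> num_queries t \<le> num_queries s + 2 * kf \<and>
     real (steps t) \<le> real (steps s) + 5 + real kf * (20 + 41 * th)"
  have "wp (Loop (NLess (var vJ) (var vKF)) (seqs [route, incv vJ])) (wp (setv vKF (var vF)) ?Q)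
      (tick (nset vJ 0 0 (tick (nset vF 0 0 s))))"
  proof (rule wp_Loop[where I = I and \<mu> = "\<lambda>t. kf - nmem t vJ 0"])
    let ?s1 = "tick (nset vJ 0 0 (tick (nset vF 0 0 s)))"
    have "apsp_ok ?s1" using ok apsp_ok_cong[of ?s1 s] by simp
    moreover have "usage T ?s1 = usage T s" "potential T ?s1 = potential T s"
      by (auto simp: usage_def potential_def fun_eq_iff)
    ultimately show "I ?s1" using cnt by (simp add: I_def route_same_def)
  next
    fix t assume I: "I t" and g: "beval t (NLess (var vJ) (var vKF))"
    define j where "j = nmem t vJ 0"
    define f where "f = nmem t vF 0"
    define u where "u = nmem s FA j"
    define v where "v = nmem s FB j"
    have rs: "route_same ?F s t" using I by (simp add: I_def)
    have tm: "nmem t a = nmem s a" if "a \<notin> ?F" for a using route_sameD(1)[OF rs that] .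
    have j: "j < kf" using g tm[of vKF] kf by (simp add: j_def)
    have fj: "f \<le> j" using I by (simp add: I_def f_def j_def)
    let ?t = "tick t"
    have st1: "static ?t" using st static_cong[of ?t s] tm by simp
    have ok1: "apsp_ok ?t" using I apsp_ok_cong[of ?t t] by (simp add: I_def)
    have us: "usage T ?t = usage T t" "potential T ?t = potential T t"
      by (auto simp: usage_def potential_def fun_eq_iff)
    have rt: "rmem ?t rT 0 = T" "rmem ?t rTH 0 = th" using route_sameD(2)[OF rs] T th by simp_all
    have uvt: "nmem ?t FA (nmem ?t vJ 0) = u" "nmem ?t FB (nmem ?t vJ 0) = v" "u < n" "v < n"
      using I j uv[OF j] by (auto simp: I_def j_def u_def v_def)
    have P: "pairs s j kf = (u, v) # pairs s (Suc j) kf" using pairs_Cons[OF j] by (simp add: u_def v_def)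
    have "wp route (wp (incv vJ) (\<lambda>w. I w \<and> kf - nmem w vJ 0 < kf - nmem t vJ 0)) ?t"
    proof (rule wp_mono[OF wp_route[OF st1 ok1 rt(1) T(2) rt(2) th(2) _ uvt]])
      fix w assume "\<exists>ok. routed T th ok u v ?t w"
      then obtain ok where "routed T th ok u v ?t w" by blast
      then have r: "route_same route_frame t w" "apsp_ok w" "\<forall>e<m. real (nmem w CNT e) < T"
        "\<forall>e<m. nmem t LEN e \<le> nmem w LEN e \<and> real (nmem w LEN e) \<le> max (real (nmem t LEN e)) (2 * th)"
        "\<forall>X. sum (usage T t) (cutx X) + of_bool (ok \<and> (u \<in> X) \<noteq> (v \<in> X)) \<le> sum (usage T w) (cutx X)"
        "potential T w \<le> potential T t + th / T"
        "real (num_updates w) \<le> real (num_updates t) + th" "num_queries w \<le> num_queries t + 2"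
        "real (steps w) \<le> real (steps t) + 13 + 41 * th"
        "nmem w vF 0 = (if ok then f else Suc f)"
        "nmem w FA = (if ok then nmem t FA else (nmem t FA)(f := u))"
        "nmem w FB = (if ok then nmem t FB else (nmem t FB)(f := v))"
        "\<not> ok \<longrightarrow> far_apart (nmem w LEN) (th / \<alpha>) u v"
        unfolding routed_def us by (simp_all add: route_same_def f_def)
      let ?w = "tick (nset vJ 0 (Suc j) w)"
      have wj: "nmem w vJ 0 = j" using route_sameD(1)[OF r(1), of vJ] by (simp add: j_def)
      have okw: "apsp_ok ?w" using r(2) apsp_ok_cong[of ?w w] by simp
      have usw: "usage T ?w = usage T w" "potential T ?w = potential T w"
        by (auto simp: usage_def potential_def fun_eq_iff)
      have pw: "pairs ?w 0 (nmem ?w vF 0) = (if ok then pairs t 0 f else pairs t 0 f @ [(u, v)])"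
      proof (cases ok)
        case True
        then show ?thesis using r(10-12) by (auto intro: pairs_cong)
      next
        case False
        have "pairs ?w 0 f = pairs t 0 f" using r(11,12) False by (intro pairs_cong) simp
        then show ?thesis using False r(10-12) by (simp add: pairs_snoc)
      qed
      have "I ?w" unfolding I_def
      proof (intro conjI)
        have "route_same ?F s w" by (rule route_same_trans[OF rs r(1)]) auto
        then show "route_same ?F s ?w" by (simp add: route_same_def)
        show "nmem ?w vF 0 \<le> nmem ?w vJ 0" using r(10) fj by simp
        show "\<forall>k\<ge>nmem ?w vJ 0. k < kf \<longrightarrow> nmem ?w FA k = nmem s FA k \<and> nmem ?w FB k = nmem s FB k"
          using I r(11,12) fj by (auto simp: I_def j_def)
        show "\<forall>e<m. nmem s LEN e \<le> nmem ?w LEN e \<and> real (nmem ?w LEN e) \<le> max (real (nmem s LEN e)) (2 * th)"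
        proof (intro allI impI)
          fix e assume e: "e < m"
          have "nmem s LEN e \<le> nmem t LEN e" "real (nmem t LEN e) \<le> max (real (nmem s LEN e)) (2 * th)"
            using I e by (auto simp: I_def)
          moreover have "nmem t LEN e \<le> nmem w LEN e" "real (nmem w LEN e) \<le> max (real (nmem t LEN e)) (2 * th)"
            using r(4) e by auto
          ultimately show "nmem s LEN e \<le> nmem ?w LEN e \<and> real (nmem ?w LEN e) \<le> max (real (nmem s LEN e)) (2 * th)"
            by auto
        qed
        show "\<forall>P. length (filter P (pairs ?w 0 (nmem ?w vF 0))) + length (filter P (pairs s (nmem ?w vJ 0) kf)) \<le> length (filter P (pairs s 0 kf))"
        proof
          fix P
          have "length (filter P (pairs t 0 f)) + length (filter P (pairs s j kf)) \<le> length (filter P (pairs s 0 kf))"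
            using I by (simp add: I_def f_def j_def)
          then show "length (filter P (pairs ?w 0 (nmem ?w vF 0))) + length (filter P (pairs s (nmem ?w vJ 0) kf)) \<le> length (filter P (pairs s 0 kf))"
            unfolding pw P by (auto split: if_splits)
        qed
        show "\<forall>X. real (crossing X (pairs s 0 kf)) + sum (usage T s) (cutx X)
          \<le> real (crossing X (pairs ?w 0 (nmem ?w vF 0))) + real (crossing X (pairs s (nmem ?w vJ 0) kf)) + sum (usage T ?w) (cutx X)"
        proof
          fix X
          have "real (crossing X (pairs s 0 kf)) + sum (usage T s) (cutx X)
            \<le> real (crossing X (pairs t 0 f)) + real (crossing X (pairs s j kf)) + sum (usage T t) (cutx X)"
            using I by (simp add: I_def f_def j_def)
          moreover have "sum (usage T t) (cutx X) + of_bool (ok \<and> (u \<in> X) \<noteq> (v \<in> X)) \<le> sum (usage T w) (cutx X)"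
            using r(5) by blast
          ultimately show "real (crossing X (pairs s 0 kf)) + sum (usage T s) (cutx X)
            \<le> real (crossing X (pairs ?w 0 (nmem ?w vF 0))) + real (crossing X (pairs s (nmem ?w vJ 0) kf)) + sum (usage T ?w) (cutx X)"
            unfolding pw P usw by (cases ok) simp_all
        qed
        show "potential T ?w \<le> potential T s + real (nmem ?w vJ 0) * (th / T)"
          using I r(6) usw by (simp add: I_def j_def algebra_simps)
        show "\<forall>k<nmem ?w vF 0. far_apart (nmem ?w LEN) (th / \<alpha>) (nmem ?w FA k) (nmem ?w FB k)"
        proof (intro allI impI)
          fix k assume k: "k < nmem ?w vF 0"
          show "far_apart (nmem ?w LEN) (th / \<alpha>) (nmem ?w FA k) (nmem ?w FB k)"
          proof (cases "k < f")
            case True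
            have "far_apart (nmem t LEN) (th / \<alpha>) (nmem t FA k) (nmem t FB k)" using I True by (simp add: I_def f_def)
            then have "far_apart (nmem w LEN) (th / \<alpha>) (nmem t FA k) (nmem t FB k)"
              by (rule far_apart_mono) (use r(4) in blast)
            then show ?thesis using r(11,12) True by simp
          next
            case False
            then have "k = f" "\<not> ok" using k r(10) by (auto split: if_splits)
            then show ?thesis using r(11-13) by simp
          qed
        qed
        show "real (num_updates ?w) \<le> real (num_updates s) + real (nmem ?w vJ 0) * th"
          using I r(7) by (simp add: I_def j_def algebra_simps)
        show "num_queries ?w \<le> num_queries s + 2 * nmem ?w vJ 0"
          using I r(8) by (simp add: I_def j_def)
        show "real (steps ?w) \<le> real (steps s) + 2 + real (nmem ?w vJ 0) * (20 + 41 * th)"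
          using I r(9) by (simp add: I_def j_def algebra_simps)
      qed (use okw j r(3) in auto)
      then show "wp (incv vJ) (\<lambda>w. I w \<and> kf - nmem w vJ 0 < kf - nmem t vJ 0) w"
        using wj j by (simp add: j_def)
    next
      fix e assume "e < m" then show "real (nmem ?t CNT e) < T" using I by (simp add: I_def)
    qed
    then show "wp (seqs [route, incv vJ]) (\<lambda>w. I w \<and> kf - nmem w vJ 0 < kf - nmem t vJ 0) ?t" by simp
  next
    fix t assume I: "I t" and g: "\<not> beval t (NLess (var vJ) (var vKF))"
    have rs: "route_same ?F s t" using I by (simp add: I_def)
    have j: "nmem t vJ 0 = kf" using g route_sameD(1)[OF rs, of vKF] kf I by (simp add: I_def)
    let ?t = "tick (nset vKF 0 (nmem t vF 0) (tick t))"
    have ok1: "apsp_ok ?t" using I apsp_ok_cong[of ?t t] by (simp add: I_def)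
    have us: "usage T ?t = usage T t" "potential T ?t = potential T t"
      by (auto simp: usage_def potential_def fun_eq_iff)
    have "route_same route_all_frame s ?t" using rs by (simp add: route_same_def)
    moreover have "pairs ?t 0 (nmem t vF 0) = pairs t 0 (nmem t vF 0)" by (rule pairs_cong) simp
    ultimately have "?Q ?t" using I ok1 us j unfolding I_def by simp
    then show "wp (setv vKF (var vF)) ?Q (tick t)" by simp
  qed
  then show ?thesis by (simp add: route_all_def)
qed

end

section \<open>Setting up the data\<close>

abbreviation (input) vG :: nat where "vG \<equiv> 11"
abbreviation (input) vRS :: nat where "vRS \<equiv> 12"
abbreviation (input) vLB :: nat where "vLB \<equiv> 24"
abbreviation (input) vLG :: nat where "vLG \<equiv> 25"
abbreviation (input) vMM :: nat where "vMM \<equiv> 26"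
abbreviation (input) vSQ :: nat where "vSQ \<equiv> 27"
abbreviation (input) vC :: nat where "vC \<equiv> 29"
abbreviation (input) vZ :: nat where "vZ \<equiv> 30"
abbreviation (input) vW :: nat where "vW \<equiv> 46"
abbreviation (input) vGX :: nat where "vGX \<equiv> 47"
abbreviation (input) vGY :: nat where "vGY \<equiv> 48"
abbreviation (input) vS :: nat where "vS \<equiv> 49"
abbreviation (input) vX1 :: nat where "vX1 \<equiv> 50"
abbreviation (input) vY1 :: nat where "vY1 \<equiv> 51"
abbreviation (input) rW :: nat where "rW \<equiv> 1"
abbreviation (input) rPW :: nat where "rPW \<equiv> 11"

definition add_adj :: "nat \<Rightarrow> com" where
  "add_adj a = seqs [setv vV (NGet a (var vJ)),
     NSet ADJ (NAdd (times10 (var vV)) (NGet DEG (var vV))) (var vJ),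
     NSet DEG (var vV) (NAdd (NGet DEG (var vV)) (NConst 1))]"

definition setup_edges :: com where
  "setup_edges = seqs [setv vJ (NConst 0), Loop (NLess (var vJ) (NGet 0 (NConst 1)))
     (seqs [RSet rW (var vJ) (RConst 1), NSet LEN (var vJ) (NConst 1), add_adj 1, add_adj 2, incv vJ])]"

text \<open>Repeated doubling yields binary logarithms of \<open>1 / b\<close> and \<open>n\<close>,
  rounded up. They take the place of the natural logarithms, which the machine cannot
  evaluate.\<close>

definition setup_logs :: com where
  "setup_logs = seqs [rsetv rPW (RConst 1), setv vLB (NConst 0),
     Loop (RLess (RMul (rvar rPW) (RGet 0 (NConst 2))) (RConst 1))
       (seqs [rsetv rPW (RAdd (rvar rPW) (rvar rPW)), incv vLB]),
     setv vW (NConst 1), setv vLG (NConst 0),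
     Loop (NLess (var vW) (var 0)) (seqs [setv vW (NAdd (var vW) (var vW)), incv vLG])]"

text \<open>Without multiplication and division, squares are built by adding \<open>2 k + 1\<close>,
  residues modulo \<open>n\<close> by a counter that wraps around, and row offsets by repeated
  addition.\<close>

definition setup_grid :: com where
  "setup_grid = seqs [setv vMM (NConst 0), setv vSQ (NConst 0),
     Loop (NLess (var vSQ) (var 0))
       (seqs [setv vSQ (NAdd (NAdd (var vSQ) (NConst 1)) (NAdd (var vMM) (var vMM))), incv vMM]),
     setv vZ (NConst 0), setv vC (NConst 0),
     Loop (NLess (var vZ) (var vSQ))
       (seqs [NSet vG (var vZ) (var vC), incv vZ, incv vC, Cond (NLess (var vC) (var 0)) Skip (setv vC (NConst 0))]),
     setv vGX (NConst 0), setv vW (NConst 0),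
     Loop (NLess (var vGX) (var vMM))
       (seqs [NSet vRS (var vGX) (var vW), setv vW (NAdd (var vW) (var vMM)), incv vGX])]"

text \<open>One subtraction replaces the reduction modulo \<open>vMM\<close>, since the arguments
  are sums of two coordinates or successors of one.\<close>

definition reduce :: "nat \<Rightarrow> nexp \<Rightarrow> com" where
  "reduce a x = seqs [setv a x, Cond (NLess (var a) (var vMM)) Skip (setv a (NSub (var a) (var vMM)))]"

definition emit :: "nat \<Rightarrow> nat \<Rightarrow> com" where
  "emit a b = seqs [NSet FA (var vKF) (NGet vG (var vZ)),
     NSet FB (var vKF) (NGet vG (NAdd (NGet vRS (var a)) (var b))), incv vKF]"

definition setup_pairs :: com where
  "setup_pairs = seqs [setv vZ (NConst 0), setv vGX (NConst 0), setv vGY (NConst 0), setv vKF (NConst 0),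
     Loop (NLess (var vZ) (var vSQ))
       (seqs [reduce vS (NAdd (var vGX) (var vGY)), reduce vX1 (NAdd (var vGX) (NConst 1)),
          reduce vY1 (NAdd (var vGY) (NConst 1)),
          emit vS vGY, emit vGX vS, emit vX1 vGY, emit vGX vY1,
          incv vZ, incv vGY,
          Cond (NLess (var vGY) (var vMM)) Skip (seqs [setv vGY (NConst 0), incv vGX])])]"

definition same2 :: "nat set \<Rightarrow> nat set \<Rightarrow> state \<Rightarrow> state \<Rightarrow> bool" where
  "same2 A B s t \<longleftrightarrow> (\<forall>a. a \<notin> A \<longrightarrow> nmem t a = nmem s a) \<and> (\<forall>a. a \<notin> B \<longrightarrow> rmem t a = rmem s a) \<and>
     history t = history s \<and> init_weights t = init_weights s"

lemma same2D: "same2 A B s t \<Longrightarrow> a \<notin> A \<Longrightarrow> nmem t a = nmem s a"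
  "same2 A B s t \<Longrightarrow> a \<notin> B \<Longrightarrow> rmem t a = rmem s a"
  "same2 A B s t \<Longrightarrow> history t = history s" "same2 A B s t \<Longrightarrow> init_weights t = init_weights s"
  by (simp_all add: same2_def)

lemma same2_refl [simp]: "same2 A B s s" by (simp add: same2_def)
lemma same2_tick [simp]: "same2 A B s (tick t) \<longleftrightarrow> same2 A B s t" by (simp add: same2_def)
lemma same2_nset [simp]: "a \<in> A \<Longrightarrow> same2 A B s (nset a i x t) \<longleftrightarrow> same2 A B s t"
  by (auto simp: same2_def)
lemma same2_rset [simp]: "a \<in> B \<Longrightarrow> same2 A B s (rset a i r t) \<longleftrightarrow> same2 A B s t"
  by (auto simp: same2_def)

context cut_input
begin

text \<open>Since \<open>i\<close> is incident to \<open>u\<close> and not yet recorded, fewer than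
  ten cells of the block of \<open>u\<close> are in use. The new cell therefore does not run into
  the block of another vertex.\<close>

lemma adj_add:
  fixes A G :: "nat \<Rightarrow> nat"
  assumes bij: "\<And>v. v < n \<Longrightarrow> bij_betw (\<lambda>j. A (10 * v + j)) {..<G v} (S v)"
    and S: "\<And>v. v < n \<Longrightarrow> S v \<subseteq> inc v" and i: "i \<in> inc u" "i \<notin> S u" and v: "v < n"
  shows "bij_betw (\<lambda>j. (A(10 * u + G u := i)) (10 * v + j)) {..<(G(u := Suc (G u))) v} ((S(u := insert i (S u))) v)"
proof -
  have G: "G w = card (S w)" if "w < n" for w using bij_betw_same_card[OF bij[OF that]] by simp
  have un: "u < n" using incD[OF i(1)] by simp
  have lt: "G u < 10"
  proof -
    have "card (insert i (S u)) \<le> card (inc u)" using S[OF un] i by (intro card_mono) auto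
    moreover have "card (insert i (S u)) = Suc (G u)"
      using S[OF un] i G[OF un] finite_subset[OF S[OF un]] by simp
    ultimately show ?thesis using card_inc_le[OF un] by simp
  qed
  show ?thesis
  proof (cases "v = u")
    case True
    have "bij_betw (\<lambda>j. (A(10 * u + G u := i)) (10 * u + j)) {..<G u} (S u)"
      using bij[OF un] by (rule bij_betw_cong[THEN iffD1, rotated]) auto
    then have "bij_betw (\<lambda>j. (A(10 * u + G u := i)) (10 * u + j)) ({..<G u} \<union> {G u}) (S u \<union> {i})"
      by (rule bij_betw_combine) (use i in \<open>auto simp: bij_betw_def\<close>)
    then show ?thesis using True by (simp add: lessThan_Suc)
  next
    case False
    have "G v \<le> 10"
      using G[OF v] S[OF v] card_inc_le[OF v] card_mono[OF finite_inc S[OF v]] by simp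
    then have "(A(10 * u + G u := i)) (10 * v + j) = A (10 * v + j)" if "j < G v" for j
      using that lt False by auto
    then have "bij_betw (\<lambda>j. (A(10 * u + G u := i)) (10 * v + j)) {..<G v} (S v)"
      using bij[OF v] by (subst bij_betw_cong) auto
    then show ?thesis using False by simp
  qed
qed

abbreviation (input) edges_frame :: "nat set" where
  "edges_frame \<equiv> {vJ, vV, LEN, DEG, ADJ}"

lemma wp_setup_edges:
  assumes s: "nmem s 0 0 = n" "nmem s 0 1 = m" "\<And>i. i < m \<Longrightarrow> nmem s 1 i = eu i \<and> nmem s 2 i = ev i"
    and deg: "nmem s DEG = (\<lambda>_. 0)"
  shows "wp setup_edges (\<lambda>t. same2 edges_frame {rW} s t \<and> static t \<and>
     (\<forall>e<m. nmem t LEN e = 1 \<and> rmem t rW e = 1) \<and> steps t \<le> steps s + 2 + 12 * m) s"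
proof -
  define I where "I = (\<lambda>t. same2 edges_frame {rW} s t \<and> nmem t vJ 0 \<le> m \<and>
     (\<forall>e<nmem t vJ 0. nmem t LEN e = 1 \<and> rmem t rW e = 1) \<and>
     (\<forall>v<n. bij_betw (\<lambda>j. nmem t ADJ (10 * v + j)) {..<nmem t DEG v} {e \<in> inc v. e < nmem t vJ 0}) \<and>
     steps t \<le> steps s + 1 + 12 * nmem t vJ 0)"
  have "wp (Loop (NLess (var vJ) (NGet 0 (NConst 1)))
     (seqs [RSet rW (var vJ) (RConst 1), NSet LEN (var vJ) (NConst 1), add_adj 1, add_adj 2, incv vJ]))
     (\<lambda>t. same2 edges_frame {rW} s t \<and> static t \<and>
     (\<forall>e<m. nmem t LEN e = 1 \<and> rmem t rW e = 1) \<and> steps t \<le> steps s + 2 + 12 * m) (tick (nset vJ 0 0 s))"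
  proof (rule wp_Loop[where I = I and \<mu> = "\<lambda>t. m - nmem t vJ 0"])
    show "I (tick (nset vJ 0 0 s))" using deg by (simp add: I_def bij_betw_def)
  next
    fix t assume I: "I t" and g: "beval t (NLess (var vJ) (NGet 0 (NConst 1)))"
    define i where "i = nmem t vJ 0"
    have sm: "same2 edges_frame {rW} s t" using I by (simp add: I_def)
    have tm: "nmem t a = nmem s a" if "a \<notin> edges_frame" for a using same2D(1)[OF sm that] .
    have i: "i < m" using g tm[of 0] s by (simp add: i_def)
    have ends: "nmem t 1 i = eu i" "nmem t 2 i = ev i" using tm[of 1] tm[of 2] s(3)[OF i] by simp_all
    define S where "S = (\<lambda>v. {e \<in> inc v. e < i})"
    define A where "A = nmem t ADJ"
    define G where "G = nmem t DEG"
    define A1 where "A1 = A(10 * eu i + G (eu i) := i)"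
    define G1 where "G1 = G(eu i := Suc (G (eu i)))"
    define S1 where "S1 = S(eu i := insert i (S (eu i)))"
    have ii: "i \<in> inc (eu i)" "i \<in> inc (ev i)" using i by (auto simp: inc_def)
    have b0: "\<And>v. v < n \<Longrightarrow> bij_betw (\<lambda>j. A (10 * v + j)) {..<G v} (S v)"
      using I by (simp add: I_def A_def G_def S_def i_def)
    have b1: "bij_betw (\<lambda>j. A1 (10 * v + j)) {..<G1 v} (S1 v)" if "v < n" for v
      unfolding A1_def G1_def S1_def by (rule adj_add[OF b0 _ ii(1) _ that]) (auto simp: S_def)
    have b2: "bij_betw (\<lambda>j. (A1(10 * ev i + G1 (ev i) := i)) (10 * v + j)) {..<(G1(ev i := Suc (G1 (ev i)))) v} {e \<in> inc v. e < Suc i}"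
      if "v < n" for v
    proof -
      have "(S1(ev i := insert i (S1 (ev i)))) v = {e \<in> inc v. e < Suc i}"
        using ii i by (auto simp: S1_def S_def inc_def less_Suc_eq)
      moreover have "bij_betw (\<lambda>j. (A1(10 * ev i + G1 (ev i) := i)) (10 * v + j)) {..<(G1(ev i := Suc (G1 (ev i)))) v}
          ((S1(ev i := insert i (S1 (ev i)))) v)"
        by (rule adj_add[OF b1 _ ii(2) _ that]) (use ii edge_ends(3)[OF i] in \<open>auto simp: S1_def S_def\<close>)
      ultimately show ?thesis by simp
    qed
    let ?w = "tick (nset vJ 0 (Suc i) (tick (nset DEG (ev i) (Suc (G1 (ev i))) (tick (nset ADJ (10 * ev i + G1 (ev i)) i (tick (nset vV 0 (ev i)
       (tick (nset DEG (eu i) (Suc (G (eu i))) (tick (nset ADJ (10 * eu i + G (eu i)) i (tick (nset vV 0 (eu i)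
       (tick (nset LEN i 1 (tick (rset rW i 1 (tick t))))))))))))))))))"
    have "I ?w"
      unfolding I_def
    proof (intro conjI)
      show "\<forall>v<n. bij_betw (\<lambda>j. nmem ?w ADJ (10 * v + j)) {..<nmem ?w DEG v} {e \<in> inc v. e < nmem ?w vJ 0}"
        using b2 by (simp add: A1_def G1_def A_def G_def)
    qed (use I sm i in \<open>auto simp: I_def i_def less_Suc_eq\<close>)
    then show "wp (seqs [RSet rW (var vJ) (RConst 1), NSet LEN (var vJ) (NConst 1), add_adj 1, add_adj 2, incv vJ])
       (\<lambda>w. I w \<and> m - nmem w vJ 0 < m - nmem t vJ 0) (tick t)"
      using i ends by (simp add: add_adj_def i_def[symmetric] A_def[symmetric] G_def[symmetric] G1_def)
  next
    fix t assume I: "I t" and g: "\<not> beval t (NLess (var vJ) (NGet 0 (NConst 1)))"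
    have sm: "same2 edges_frame {rW} s t" using I by (simp add: I_def)
    have tm: "nmem t a = nmem s a" if "a \<notin> edges_frame" for a using same2D(1)[OF sm that] .
    have j: "nmem t vJ 0 = m" using g tm[of 0] s I by (simp add: I_def)
    have "{e \<in> inc v. e < m} = inc v" for v by (auto simp: inc_def)
    then have "static (tick t)" using I j s tm[of 0] tm[of 1] tm[of 2] by (simp add: static_def I_def)
    then show "same2 edges_frame {rW} s (tick t) \<and> static (tick t) \<and>
     (\<forall>e<m. nmem (tick t) LEN e = 1 \<and> rmem (tick t) rW e = 1) \<and> steps (tick t) \<le> steps s + 2 + 12 * m"
      using I j by (simp add: I_def)
  qed
  then show ?thesis by (simp add: setup_edges_def)
qed

lemma b_pos: "0 < b"
proof -
  have "0 < 1 / real n" using n_pos by simp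
  then show ?thesis using bal(1) by linarith
qed

lemma n_b: "1 \<le> real n * b"
  using bal(1) n_pos by (simp add: field_simps)

lemma wp_setup_logs:
  assumes s: "nmem s 0 0 = n" "rmem s 0 2 = b"
  shows "wp setup_logs (\<lambda>t. same2 {vLB, vW, vLG} {rPW} s t \<and>
     1 \<le> 2 ^ nmem t vLB 0 * b \<and> (nmem t vLB 0 = 0 \<or> 2 ^ (nmem t vLB 0 - 1) * b < 1) \<and>
     n \<le> 2 ^ nmem t vLG 0 \<and> (nmem t vLG 0 = 0 \<or> 2 ^ (nmem t vLG 0 - 1) < n) \<and>
     steps t \<le> steps s + 10 + 6 * n) s"
proof -
  define I1 where "I1 = (\<lambda>t. same2 {vLB, vW, vLG} {rPW} s t \<and> rmem t rPW 0 = 2 ^ nmem t vLB 0 \<and>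
     (nmem t vLB 0 = 0 \<or> 2 ^ (nmem t vLB 0 - 1) * b < 1) \<and> nmem t vLB 0 \<le> n \<and> steps t \<le> steps s + 2 + 3 * nmem t vLB 0)"
  define I2 where "I2 = (\<lambda>t. same2 {vLB, vW, vLG} {rPW} s t \<and> 1 \<le> 2 ^ nmem t vLB 0 * b \<and>
     (nmem t vLB 0 = 0 \<or> 2 ^ (nmem t vLB 0 - 1) * b < 1) \<and> nmem t vW 0 = 2 ^ nmem t vLG 0 \<and>
     (nmem t vLG 0 = 0 \<or> 2 ^ (nmem t vLG 0 - 1) < n) \<and> nmem t vLG 0 \<le> n \<and> steps t \<le> steps s + 5 + 3 * n + 3 * nmem t vLG 0)"
  let ?Q = "\<lambda>t. same2 {vLB, vW, vLG} {rPW} s t \<and>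
     1 \<le> 2 ^ nmem t vLB 0 * b \<and> (nmem t vLB 0 = 0 \<or> 2 ^ (nmem t vLB 0 - 1) * b < 1) \<and>
     n \<le> 2 ^ nmem t vLG 0 \<and> (nmem t vLG 0 = 0 \<or> 2 ^ (nmem t vLG 0 - 1) < n) \<and>
     steps t \<le> steps s + 10 + 6 * n"
  have l2: "wp (Loop (NLess (var vW) (var 0)) (seqs [setv vW (NAdd (var vW) (var vW)), incv vLG])) ?Q t" if "I2 t" for t
  proof (rule wp_Loop[where I = I2 and \<mu> = "\<lambda>t. n - nmem t vLG 0", OF that])
    fix t assume I: "I2 t" and g: "beval t (NLess (var vW) (var 0))"
    have n0: "nmem t 0 0 = n" using I same2D(1)[of "{vLB, vW, vLG}" "{rPW}" s t 0] s by (simp add: I2_def)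
    have lt: "2 ^ nmem t vLG 0 < n" using g I n0 by (simp add: I2_def)
    then have "nmem t vLG 0 < n" using less_exp[of "nmem t vLG 0"] by linarith
    then show "wp (seqs [setv vW (NAdd (var vW) (var vW)), incv vLG]) (\<lambda>w. I2 w \<and> n - nmem w vLG 0 < n - nmem t vLG 0) (tick t)"
      using I lt by (simp add: I2_def mult_2)
  next
    fix t assume I: "I2 t" and g: "\<not> beval t (NLess (var vW) (var 0))"
    have n0: "nmem t 0 0 = n" using I same2D(1)[of "{vLB, vW, vLG}" "{rPW}" s t 0] s by (simp add: I2_def)
    show "?Q (tick t)" using I g n0 by (simp add: I2_def)
  qed
  have "wp (Loop (RLess (RMul (rvar rPW) (RGet 0 (NConst 2))) (RConst 1))
       (seqs [rsetv rPW (RAdd (rvar rPW) (rvar rPW)), incv vLB]))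
     (wp (setv vW (NConst 1)) (wp (setv vLG (NConst 0))
       (wp (Loop (NLess (var vW) (var 0)) (seqs [setv vW (NAdd (var vW) (var vW)), incv vLG])) ?Q)))
     (tick (nset vLB 0 0 (tick (rset rPW 0 1 s))))"
  proof (rule wp_Loop[where I = I1 and \<mu> = "\<lambda>t. n - nmem t vLB 0"])
    show "I1 (tick (nset vLB 0 0 (tick (rset rPW 0 1 s))))" by (simp add: I1_def)
  next
    fix t assume I: "I1 t" and g: "beval t (RLess (RMul (rvar rPW) (RGet 0 (NConst 2))) (RConst 1))"
    have b0: "rmem t 0 2 = b" using I same2D(2)[of "{vLB, vW, vLG}" "{rPW}" s t 0] s by (simp add: I1_def)
    have lt: "2 ^ nmem t vLB 0 * b < 1" using g I b0 by (simp add: I1_def)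
    have "nmem t vLB 0 < n"
    proof (rule ccontr)
      assume "\<not> nmem t vLB 0 < n"
      then have "n \<le> 2 ^ nmem t vLB 0" using less_exp[of "nmem t vLB 0"] by linarith
      then have "real n \<le> 2 ^ nmem t vLB 0" by (metis of_nat_le_iff of_nat_numeral of_nat_power)
      then have "real n * b \<le> 2 ^ nmem t vLB 0 * b" using b_pos by (intro mult_right_mono) auto
      then show False using lt n_b by linarith
    qed
    then show "wp (seqs [rsetv rPW (RAdd (rvar rPW) (rvar rPW)), incv vLB]) (\<lambda>w. I1 w \<and> n - nmem w vLB 0 < n - nmem t vLB 0) (tick t)"
      using I lt by (simp add: I1_def)
  next
    fix t assume I: "I1 t" and g: "\<not> beval t (RLess (RMul (rvar rPW) (RGet 0 (NConst 2))) (RConst 1))"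
    have b0: "rmem t 0 2 = b" using I same2D(2)[of "{vLB, vW, vLG}" "{rPW}" s t 0] s by (simp add: I1_def)
    have "I2 (tick (nset vLG 0 0 (tick (nset vW 0 1 (tick t)))))"
      using I g b0 by (simp add: I1_def I2_def)
    then show "wp (setv vW (NConst 1)) (wp (setv vLG (NConst 0))
       (wp (Loop (NLess (var vW) (var 0)) (seqs [setv vW (NAdd (var vW) (var vW)), incv vLG])) ?Q)) (tick t)"
      using l2 by simp
  qed
  then show ?thesis by (simp add: setup_logs_def)
qed

abbreviation (input) grid_frame :: "nat set" where
  "grid_frame \<equiv> {vMM, vSQ, vZ, vC, vG, vGX, vW, vRS}"

lemma wp_setup_grid:
  assumes s: "nmem s 0 0 = n"
  shows "wp setup_grid (\<lambda>t. same2 grid_frame {} s t \<and>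
     nmem t vSQ 0 = nmem t vMM 0 * nmem t vMM 0 \<and> n \<le> nmem t vSQ 0 \<and> nmem t vSQ 0 \<le> 4 * n \<and>
     (\<forall>z<nmem t vSQ 0. nmem t vG z = z mod n) \<and> (\<forall>x<nmem t vMM 0. nmem t vRS x = x * nmem t vMM 0) \<and>
     steps t \<le> steps s + 20 + 40 * n) s"
proof -
  let ?Q = "\<lambda>t. same2 grid_frame {} s t \<and>
     nmem t vSQ 0 = nmem t vMM 0 * nmem t vMM 0 \<and> n \<le> nmem t vSQ 0 \<and> nmem t vSQ 0 \<le> 4 * n \<and>
     (\<forall>z<nmem t vSQ 0. nmem t vG z = z mod n) \<and> (\<forall>x<nmem t vMM 0. nmem t vRS x = x * nmem t vMM 0) \<and>
     steps t \<le> steps s + 20 + 40 * n"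
  define I1 where "I1 = (\<lambda>t. same2 grid_frame {} s t \<and> nmem t vSQ 0 = nmem t vMM 0 * nmem t vMM 0 \<and>
     (nmem t vMM 0 = 0 \<or> (nmem t vMM 0 - 1) * (nmem t vMM 0 - 1) < n) \<and> steps t \<le> steps s + 2 + 3 * nmem t vMM 0)"
  define base where "base = (\<lambda>t. same2 grid_frame {} s t \<and> nmem t vSQ 0 = nmem t vMM 0 * nmem t vMM 0 \<and>
     n \<le> nmem t vSQ 0 \<and> nmem t vSQ 0 \<le> 4 * n \<and> nmem t vMM 0 \<le> n)"
  define I2 where "I2 = (\<lambda>t. base t \<and> nmem t vC 0 = nmem t vZ 0 mod n \<and> nmem t vZ 0 \<le> nmem t vSQ 0 \<and>
     (\<forall>z<nmem t vZ 0. nmem t vG z = z mod n) \<and> steps t \<le> steps s + 5 + 3 * n + 6 * nmem t vZ 0)"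
  define I3 where "I3 = (\<lambda>t. base t \<and> (\<forall>z<nmem t vSQ 0. nmem t vG z = z mod n) \<and>
     nmem t vW 0 = nmem t vGX 0 * nmem t vMM 0 \<and> nmem t vGX 0 \<le> nmem t vMM 0 \<and>
     (\<forall>x<nmem t vGX 0. nmem t vRS x = x * nmem t vMM 0) \<and> steps t \<le> steps s + 8 + 27 * n + 4 * nmem t vGX 0)"
  have n0: "nmem t 0 0 = n" if "same2 grid_frame {} s t" for t
    using same2D(1)[OF that, of 0] s by simp
  have l3: "wp (Loop (NLess (var vGX) (var vMM))
       (seqs [NSet vRS (var vGX) (var vW), setv vW (NAdd (var vW) (var vMM)), incv vGX])) ?Q t" if "I3 t" for t
  proof (rule wp_Loop[where I = I3 and \<mu> = "\<lambda>t. nmem t vMM 0 - nmem t vGX 0", OF that])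
    fix t assume "I3 t" "beval t (NLess (var vGX) (var vMM))"
    then show "wp (seqs [NSet vRS (var vGX) (var vW), setv vW (NAdd (var vW) (var vMM)), incv vGX])
        (\<lambda>w. I3 w \<and> nmem w vMM 0 - nmem w vGX 0 < nmem t vMM 0 - nmem t vGX 0) (tick t)"
      by (auto simp: I3_def base_def less_Suc_eq)
  next
    fix t assume "I3 t" "\<not> beval t (NLess (var vGX) (var vMM))"
    then show "?Q (tick t)" by (auto simp: I3_def base_def)
  qed
  have l2: "wp (Loop (NLess (var vZ) (var vSQ))
       (seqs [NSet vG (var vZ) (var vC), incv vZ, incv vC, Cond (NLess (var vC) (var 0)) Skip (setv vC (NConst 0))]))
     (wp (setv vGX (NConst 0)) (wp (setv vW (NConst 0)) (wp (Loop (NLess (var vGX) (var vMM))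
       (seqs [NSet vRS (var vGX) (var vW), setv vW (NAdd (var vW) (var vMM)), incv vGX])) ?Q))) t" if "I2 t" for t
  proof (rule wp_Loop[where I = I2 and \<mu> = "\<lambda>t. nmem t vSQ 0 - nmem t vZ 0", OF that])
    fix t assume I: "I2 t" and g: "beval t (NLess (var vZ) (var vSQ))"
    have m0: "nmem t 0 0 = n" using I n0 by (simp add: I2_def base_def)
    have c: "nmem t vZ 0 mod n < n" using n_pos by simp
    have sm: "Suc z mod n = (if Suc (z mod n) < n then Suc (z mod n) else 0)" for z
      using n_pos by (simp add: mod_Suc) (metis Suc_lessI mod_less_divisor)
    show "wp (seqs [NSet vG (var vZ) (var vC), incv vZ, incv vC, Cond (NLess (var vC) (var 0)) Skip (setv vC (NConst 0))])
        (\<lambda>w. I2 w \<and> nmem w vSQ 0 - nmem w vZ 0 < nmem t vSQ 0 - nmem t vZ 0) (tick t)"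
      using I g m0 c by (simp add: I2_def base_def less_Suc_eq sm)
  next
    fix t assume I: "I2 t" and g: "\<not> beval t (NLess (var vZ) (var vSQ))"
    have "I3 (tick (nset vW 0 0 (tick (nset vGX 0 0 (tick t)))))"
      using I g by (simp add: I2_def I3_def base_def)
    then show "wp (setv vGX (NConst 0)) (wp (setv vW (NConst 0)) (wp (Loop (NLess (var vGX) (var vMM))
       (seqs [NSet vRS (var vGX) (var vW), setv vW (NAdd (var vW) (var vMM)), incv vGX])) ?Q)) (tick t)"
      using l3 by simp
  qed
  \<comment> \<open>The loop stops at the first square that is at least \<open>n\<close>. Minimality
    bounds this square by \<open>4 n\<close>, so that at most four grid points fold onto one
    vertex.\<close>
  have sq: "k * k \<le> 4 * n \<and> k \<le> n" if h: "(k - 1) * (k - 1) < n" "k \<noteq> 0" for k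
  proof -
    obtain j where j: "k = Suc j" using h(2) by (cases k) auto
    then have jn: "j * j < n" using h by simp
    have "j < n" using jn le_square[of j] by linarith
    moreover have "k * k = j * j + 2 * j + 1" using j by simp
    then have "k * k \<le> 4 * n" using jn le_square[of j] by linarith
    ultimately show ?thesis using j by simp
  qed
  have "wp (Loop (NLess (var vSQ) (var 0))
       (seqs [setv vSQ (NAdd (NAdd (var vSQ) (NConst 1)) (NAdd (var vMM) (var vMM))), incv vMM]))
     (wp (setv vZ (NConst 0)) (wp (setv vC (NConst 0)) (wp (Loop (NLess (var vZ) (var vSQ))
       (seqs [NSet vG (var vZ) (var vC), incv vZ, incv vC, Cond (NLess (var vC) (var 0)) Skip (setv vC (NConst 0))]))
     (wp (setv vGX (NConst 0)) (wp (setv vW (NConst 0)) (wp (Loop (NLess (var vGX) (var vMM))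
       (seqs [NSet vRS (var vGX) (var vW), setv vW (NAdd (var vW) (var vMM)), incv vGX])) ?Q))))))
     (tick (nset vSQ 0 0 (tick (nset vMM 0 0 s))))"
  proof (rule wp_Loop[where I = I1 and \<mu> = "\<lambda>t. n - nmem t vSQ 0"])
    show "I1 (tick (nset vSQ 0 0 (tick (nset vMM 0 0 s))))" by (simp add: I1_def)
  next
    fix t assume I: "I1 t" and g: "beval t (NLess (var vSQ) (var 0))"
    have m0: "nmem t 0 0 = n" using I n0 by (simp add: I1_def)
    show "wp (seqs [setv vSQ (NAdd (NAdd (var vSQ) (NConst 1)) (NAdd (var vMM) (var vMM))), incv vMM])
        (\<lambda>w. I1 w \<and> n - nmem w vSQ 0 < n - nmem t vSQ 0) (tick t)"
      using I g m0 by (simp add: I1_def)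
  next
    fix t assume I: "I1 t" and g: "\<not> beval t (NLess (var vSQ) (var 0))"
    have m0: "nmem t 0 0 = n" using I n0 by (simp add: I1_def)
    have nz: "nmem t vMM 0 \<noteq> 0"
    proof
      assume "nmem t vMM 0 = 0"
      then have "nmem t vSQ 0 = 0" using I by (simp add: I1_def)
      then show False using g m0 n_pos by simp
    qed
    then have "nmem t vMM 0 * nmem t vMM 0 \<le> 4 * n \<and> nmem t vMM 0 \<le> n" using I by (intro sq) (auto simp: I1_def)
    then have "I2 (tick (nset vC 0 0 (tick (nset vZ 0 0 (tick t)))))"
      using I g m0 by (simp add: I1_def I2_def base_def)
    then show "wp (setv vZ (NConst 0)) (wp (setv vC (NConst 0)) (wp (Loop (NLess (var vZ) (var vSQ))
       (seqs [NSet vG (var vZ) (var vC), incv vZ, incv vC, Cond (NLess (var vC) (var 0)) Skip (setv vC (NConst 0))]))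
     (wp (setv vGX (NConst 0)) (wp (setv vW (NConst 0)) (wp (Loop (NLess (var vGX) (var vMM))
       (seqs [NSet vRS (var vGX) (var vW), setv vW (NAdd (var vW) (var vMM)), incv vGX])) ?Q))))) (tick t)"
      using l2 by simp
  qed
  then show ?thesis by (simp add: setup_grid_def)
qed

abbreviation (input) pairs_frame :: "nat set" where
  "pairs_frame \<equiv> {vZ, vGX, vGY, vKF, vS, vX1, vY1, FA, FB}"

lemma wp_setup_pairs:
  assumes M: "nmem s vMM 0 = M" "nmem s vSQ 0 = M * M"
    and G: "\<And>z. z < M * M \<Longrightarrow> nmem s vG z = z mod n" and RS: "\<And>x. x < M \<Longrightarrow> nmem s vRS x = x * M"
  shows "wp setup_pairs (\<lambda>t. same2 pairs_frame {} s t \<and> nmem t vKF 0 = 4 * (M * M) \<and>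
     pairs t 0 (4 * (M * M)) = expander n M \<and> steps t \<le> steps s + 5 + 40 * (M * M)) s"
proof -
  define I where "I = (\<lambda>t. same2 pairs_frame {} s t \<and> nmem t vZ 0 \<le> M * M \<and>
     (0 < M \<longrightarrow> nmem t vGX 0 = nmem t vZ 0 div M \<and> nmem t vGY 0 = nmem t vZ 0 mod M) \<and>
     nmem t vKF 0 = 4 * nmem t vZ 0 \<and>
     pairs t 0 (4 * nmem t vZ 0) = concat (map (expander_row n M) [0..<nmem t vZ 0]) \<and>
     steps t \<le> steps s + 4 + 40 * nmem t vZ 0)"
  let ?Q = "\<lambda>t. same2 pairs_frame {} s t \<and> nmem t vKF 0 = 4 * (M * M) \<and>
     pairs t 0 (4 * (M * M)) = expander n M \<and> steps t \<le> steps s + 5 + 40 * (M * M)"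
  have fr: "nmem t vMM 0 = M" "nmem t vSQ 0 = M * M" "nmem t vG = nmem s vG" "nmem t vRS = nmem s vRS"
    if "same2 pairs_frame {} s t" for t
    using same2D(1)[OF that] M by simp_all
  have "wp (Loop (NLess (var vZ) (var vSQ))
       (seqs [reduce vS (NAdd (var vGX) (var vGY)), reduce vX1 (NAdd (var vGX) (NConst 1)),
          reduce vY1 (NAdd (var vGY) (NConst 1)),
          emit vS vGY, emit vGX vS, emit vX1 vGY, emit vGX vY1,
          incv vZ, incv vGY,
          Cond (NLess (var vGY) (var vMM)) Skip (seqs [setv vGY (NConst 0), incv vGX])])) ?Q
     (tick (nset vKF 0 0 (tick (nset vGY 0 0 (tick (nset vGX 0 0 (tick (nset vZ 0 0 s))))))))"
  proof (rule wp_Loop[where I = I and \<mu> = "\<lambda>t. M * M - nmem t vZ 0"])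
    show "I (tick (nset vKF 0 0 (tick (nset vGY 0 0 (tick (nset vGX 0 0 (tick (nset vZ 0 0 s))))))))"
      by (simp add: I_def)
  next
    fix t assume I: "I t" and g: "beval t (NLess (var vZ) (var vSQ))"
    note fr = fr[of t]
    have sm: "same2 pairs_frame {} s t" using I by (simp add: I_def)
    define z where "z = nmem t vZ 0"
    have z: "z < M * M" using g fr sm by (simp add: z_def)
    then have M0: "0 < M" by (cases M) auto
    define x where "x = z div M"
    define y where "y = z mod M"
    have xy: "nmem t vGX 0 = x" "nmem t vGY 0 = y" using I M0 by (auto simp: I_def x_def y_def z_def)
    have xM: "x < M" "y < M" using z M0 by (auto simp: x_def y_def less_mult_imp_div_less)
    define a where "a = (x + y) mod M"
    define x1 where "x1 = (x + 1) mod M"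
    define y1 where "y1 = (y + 1) mod M"
    have ra: "(if x + y < M then x + y else x + y - M) = a" using mod_add_if[OF xM] by (simp add: a_def)
    have r1: "(if u + 1 < M then u + 1 else u + 1 - M) = (u + 1) mod M" if "u < M" for u
    proof (cases "u + 1 < M")
      case False
      then have "u + 1 = M" using that by simp
      then show ?thesis by auto
    qed simp
    have aM: "a < M" "x1 < M" "y1 < M" using M0 by (auto simp: a_def x1_def y1_def)
    have Gz: "nmem s vG z = z mod n" "nmem s vG (a * M + y) = (a * M + y) mod n" "nmem s vG (x * M + a) = (x * M + a) mod n"
      "nmem s vG (x1 * M + y) = (x1 * M + y) mod n" "nmem s vG (x * M + y1) = (x * M + y1) mod n"
      using G z grid_bound aM xM by simp_all
    have R: "nmem s vRS x = x * M" "nmem s vRS a = a * M" "nmem s vRS x1 = x1 * M" using RS xM aM by simp_all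
    have row: "expander_row n M z = [(z mod n, (a * M + y) mod n), (z mod n, (x * M + a) mod n),
        (z mod n, (x1 * M + y) mod n), (z mod n, (x * M + y1) mod n)]"
      by (simp add: expander_row_def grid_nbrs_def Let_def a_def x1_def y1_def x_def y_def)
    have nxt: "Suc z div M = (if y + 1 < M then x else Suc x)" "Suc z mod M = (if y + 1 < M then Suc y else 0)"
    proof -
      have "Suc z mod M = (if y + 1 < M then Suc y else 0)"
        unfolding y_def mod_Suc using xM(2) by (auto simp: y_def)
      then show "Suc z mod M = (if y + 1 < M then Suc y else 0)" .
      have "Suc z div M = (if Suc (z mod M) = M then Suc (z div M) else z div M)" by (simp add: div_Suc mod_Suc)
      then show "Suc z div M = (if y + 1 < M then x else Suc x)" using xM(2) by (auto simp: x_def y_def)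
    qed
    define k where "k = 4 * z"
    have kf: "nmem t vKF 0 = k" using I by (simp add: I_def k_def z_def)
    have red: "wp (reduce c e) Q w = Q (let w1 = tick (nset c 0 (neval w e) w) in
          if neval w e < nmem (nset c 0 (neval w e) w) vMM 0 then tick (tick w1)
          else tick (nset c 0 (neval w e - nmem (nset c 0 (neval w e) w) vMM 0) (tick w1)))" for c e Q w
      by (simp add: reduce_def Let_def)
    define w1 where "w1 = (let u = tick (nset vS 0 (x + y) (tick t)) in if x + y < M then tick (tick u) else tick (nset vS 0 (x + y - M) (tick u)))"
    define w2 where "w2 = (let u = tick (nset vX1 0 (x + 1) w1) in if x + 1 < M then tick (tick u) else tick (nset vX1 0 (x + 1 - M) (tick u)))"
    define w3 where "w3 = (let u = tick (nset vY1 0 (y + 1) w2) in if y + 1 < M then tick (tick u) else tick (nset vY1 0 (y + 1 - M) (tick u)))"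
    have w1: "nmem w1 = (nmem t)(vS := (nmem t vS)(0 := a))" "same2 pairs_frame {} s w1" "steps w1 \<le> steps t + 4"
      using ra sm by (auto simp: w1_def Let_def split: if_splits)
    have w2: "nmem w2 = (nmem w1)(vX1 := (nmem w1 vX1)(0 := x1))" "same2 pairs_frame {} s w2" "steps w2 \<le> steps w1 + 3"
      using r1[OF xM(1)] w1(2) by (auto simp: w2_def x1_def Let_def split: if_splits)
    have w3: "nmem w3 = (nmem w2)(vY1 := (nmem w2 vY1)(0 := y1))" "same2 pairs_frame {} s w3" "steps w3 \<le> steps w2 + 3"
      using r1[OF xM(2)] w2(2) by (auto simp: w3_def y1_def Let_def split: if_splits)
    have step: "wp (seqs [reduce vS (NAdd (var vGX) (var vGY)), reduce vX1 (NAdd (var vGX) (NConst 1)),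
          reduce vY1 (NAdd (var vGY) (NConst 1)), c]) Q (tick t) = wp c Q w3" for c Q
      using xy fr sm w1(1) w2(1) by (simp add: red w1_def[symmetric] w2_def[symmetric] w3_def[symmetric])
        (simp add: w1_def w2_def w3_def Let_def xy fr)
    define w4 where "w4 = tick (nset vKF 0 (Suc (Suc (Suc (Suc k))))
      (tick (nset FB (Suc (Suc (Suc k))) ((x * M + y1) mod n) (tick (nset FA (Suc (Suc (Suc k))) (z mod n)
      (tick (nset vKF 0 (Suc (Suc (Suc k))) (tick (nset FB (Suc (Suc k)) ((x1 * M + y) mod n) (tick (nset FA (Suc (Suc k)) (z mod n)
      (tick (nset vKF 0 (Suc (Suc k)) (tick (nset FB (Suc k) ((x * M + a) mod n) (tick (nset FA (Suc k) (z mod n)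
      (tick (nset vKF 0 (Suc k) (tick (nset FB k ((a * M + y) mod n) (tick (nset FA k (z mod n) w3)))))))))))))))))))))))"
    have W3: "nmem w3 vGX 0 = x" "nmem w3 vGY 0 = y" "nmem w3 vKF 0 = k" "nmem w3 vZ 0 = z" "nmem w3 vMM 0 = M"
      "nmem w3 vG = nmem s vG" "nmem w3 vRS = nmem s vRS" "nmem w3 vS 0 = a" "nmem w3 vX1 0 = x1" "nmem w3 vY1 0 = y1"
      using w1 w2 w3 xy kf fr sm by (simp_all add: z_def)
    have emits: "wp (seqs [emit vS vGY, emit vGX vS, emit vX1 vGY, emit vGX vY1, c]) Q w3 = wp c Q w4" for c Q
      by (simp add: emit_def W3 Gz R w4_def)
    have p4: "pairs w4 0 (Suc (Suc (Suc (Suc k)))) = pairs t 0 k @ expander_row n M z"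
    proof -
      have FAt: "nmem w3 FA = nmem t FA" "nmem w3 FB = nmem t FB" by (simp_all add: w1(1) w2(1) w3(1))
      have A: "nmem w4 FA = (nmem t FA)(k := z mod n, Suc k := z mod n, Suc (Suc k) := z mod n, Suc (Suc (Suc k)) := z mod n)"
        by (simp add: w4_def FAt)
      have B: "nmem w4 FB = (nmem t FB)(k := (a * M + y) mod n, Suc k := (x * M + a) mod n,
          Suc (Suc k) := (x1 * M + y) mod n, Suc (Suc (Suc k)) := (x * M + y1) mod n)"
        by (simp add: w4_def FAt)
      have "pairs w4 0 k = pairs t 0 k" by (rule pairs_cong) (simp add: A B)
      moreover have "pairs w4 0 (Suc (Suc (Suc (Suc k)))) = pairs w4 0 k @ [(nmem w4 FA k, nmem w4 FB k),
          (nmem w4 FA (Suc k), nmem w4 FB (Suc k)), (nmem w4 FA (Suc (Suc k)), nmem w4 FB (Suc (Suc k))),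
          (nmem w4 FA (Suc (Suc (Suc k))), nmem w4 FB (Suc (Suc (Suc k))))]"
        by (simp add: pairs_snoc)
      ultimately show ?thesis unfolding row by (simp only: A B) simp
    qed
    have w4: "same2 pairs_frame {} s w4" "steps w4 = steps w3 + 12" "nmem w4 vGX 0 = x" "nmem w4 vGY 0 = y" "nmem w4 vZ 0 = z"
       "nmem w4 vMM 0 = M" "nmem w4 vKF 0 = Suc (Suc (Suc (Suc k)))"
      using w3(2) W3 by (simp_all add: w4_def)
    have I4: "I w" if "same2 pairs_frame {} s w" "nmem w vZ 0 = Suc z" "nmem w vGX 0 = Suc z div M" "nmem w vGY 0 = Suc z mod M"
       "nmem w vKF 0 = nmem w4 vKF 0" "nmem w FA = nmem w4 FA" "nmem w FB = nmem w4 FB" "steps w \<le> steps w4 + 10" for w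
    proof -
      have "pairs w 0 (4 * Suc z) = pairs w4 0 (4 * Suc z)" using that by (intro pairs_cong) simp
      also have "\<dots> = concat (map (expander_row n M) [0..<Suc z])"
      proof -
        have e: "4 * Suc z = Suc (Suc (Suc (Suc k)))" by (simp add: k_def)
        show ?thesis unfolding e p4 using I by (simp add: k_def I_def z_def)
      qed
      finally show ?thesis unfolding I_def
        using that z w4 w3(3) w2(3) w1(3) I by (simp add: k_def I_def z_def)
    qed
    have "wp (seqs [incv vZ, incv vGY, Cond (NLess (var vGY) (var vMM)) Skip (seqs [setv vGY (NConst 0), incv vGX])])
       (\<lambda>w. I w \<and> M * M - nmem w vZ 0 < M * M - nmem t vZ 0) w4"
      using w4 z nxt by (cases "Suc y < M") (auto simp: z_def intro!: I4)
    then have "wp (seqs [reduce vS (NAdd (var vGX) (var vGY)), reduce vX1 (NAdd (var vGX) (NConst 1)),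
          reduce vY1 (NAdd (var vGY) (NConst 1)), seqs [emit vS vGY, emit vGX vS, emit vX1 vGY, emit vGX vY1,
          seqs [incv vZ, incv vGY, Cond (NLess (var vGY) (var vMM)) Skip (seqs [setv vGY (NConst 0), incv vGX])]]])
       (\<lambda>w. I w \<and> M * M - nmem w vZ 0 < M * M - nmem t vZ 0) (tick t)"
      unfolding step emits .
    then show "wp (seqs [reduce vS (NAdd (var vGX) (var vGY)), reduce vX1 (NAdd (var vGX) (NConst 1)),
          reduce vY1 (NAdd (var vGY) (NConst 1)),
          emit vS vGY, emit vGX vS, emit vX1 vGY, emit vGX vY1,
          incv vZ, incv vGY,
          Cond (NLess (var vGY) (var vMM)) Skip (seqs [setv vGY (NConst 0), incv vGX])])
       (\<lambda>w. I w \<and> M * M - nmem w vZ 0 < M * M - nmem t vZ 0) (tick t)"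
      unfolding seqs.simps .
  next
    fix t assume I: "I t" and g: "\<not> beval t (NLess (var vZ) (var vSQ))"
    have sm: "same2 pairs_frame {} s t" using I by (simp add: I_def)
    have z: "nmem t vZ 0 = M * M" using g I fr[OF sm] by (simp add: I_def)
    have "pairs (tick t) 0 (4 * (M * M)) = pairs t 0 (4 * (M * M))" by (rule pairs_cong) simp
    then show "?Q (tick t)" using I z by (simp add: I_def expander_def)
  qed
  then show ?thesis by (simp add: setup_pairs_def)
qed

end

section \<open>The whole algorithm\<close>

abbreviation (input) vMODE :: nat where "vMODE \<equiv> 52"
abbreviation (input) vRND :: nat where "vRND \<equiv> 53"
abbreviation (input) rRHO :: nat where "rRHO \<equiv> 5"
abbreviation (input) rP2 :: nat where "rP2 \<equiv> 6"
abbreviation (input) rD0 :: nat where "rD0 \<equiv> 7"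
abbreviation (input) rLAM :: nat where "rLAM \<equiv> 12"

text \<open>\<open>rLAM\<close> is \<open>5 + 16 * (vLB + 1)\<close>: there are at most
  \<open>5 n\<close> edges of initial length 1, and each of at most \<open>vLB + 1\<close> rounds
  adds at most \<open>16 n\<close> to the potential. \<open>rD0\<close> is the distance required of
  unrouted pairs in round 0, and \<open>rT\<close> is \<alpha> times as large. \<open>rRHO\<close>
  starts as a bound for the number of expander pairs, four for each of at most \<open>4 n\<close>
  grid points.\<close>

definition setup_consts :: com where
  "setup_consts = seqs [
     rsetv rLAM (RAdd (RConst 21) (RMul (RConst 16) (ROfNat (var vLB)))),
     rsetv rD0 (RDiv (RMul (RMul (RConst 200) (rvar rLAM)) (RAdd (ROfNat (var vLG)) (RConst 1))) (RGet 0 (NConst 1))),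
     rsetv rT (RMul (RGet 0 (NConst 0)) (rvar rD0)),
     rsetv rTH (rvar rT),
     rsetv rRHO (RMul (RConst 16) (ROfNat (var 0))),
     rsetv rP2 (RConst 1)]"

definition setup_all :: com where
  "setup_all = seqs [setup_edges, ApspInit rW, setup_logs, setup_grid, setup_pairs, setup_consts]"

text \<open>The charge \<beta> is such that the volume of the whole graph costs at most
  \<open>\<psi> * n / (24 * rP2)\<close>. The cut will have at least \<open>n / (4 * rP2)\<close>
  vertices, which makes this \<open>\<psi> / 6\<close> per vertex; \<gamma> contributes as much
  again. The radius \<open>rH\<close> is chosen so that two vertices of a ball stopped before time
  \<open>rH + 1\<close> are closer than the pairs, whose distance exceeds
  \<open>rP2 * rD0\<close>.\<close>

definition cut_phase :: com where
  "cut_phase = seqs [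
     rsetv rBETA (RDiv (RGet 0 (NConst 1)) (RMul (RMul (RConst 48) (rvar rLAM)) (rvar rP2))),
     rsetv rGAM (RDiv (RGet 0 (NConst 1)) (RConst 6)),
     rsetv rH (RSub (RDiv (RMul (rvar rP2) (rvar rD0)) (RConst 2)) (RConst 1)),
     carve, setv 3 (NConst 1), setv vMODE (NConst 1)]"

definition main_body :: com where
  "main_body = seqs [route_all,
     Cond (RLess (RMul (RMul (RConst 32) (RGet 0 (NConst 2))) (ROfNat (var 0))) (ROfNat (var vKF)))
       (Cond (RLess (RDiv (rvar rRHO) (RConst 2)) (ROfNat (var vKF)))
          cut_phase
          (seqs [rsetv rRHO (RDiv (rvar rRHO) (RConst 2)), rsetv rTH (RAdd (rvar rTH) (rvar rTH)),
             rsetv rP2 (RAdd (rvar rP2) (rvar rP2)), incv vRND]))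
       (setv vMODE (NConst 1))]"

definition sparse_cut_or_certify :: com where
  "sparse_cut_or_certify = Seq setup_all (Loop (NLess (var vMODE) (NConst 1)) main_body)"

context cut_input
begin

section \<open>Constants and invariants of the rounds\<close>

definition lam :: "nat \<Rightarrow> real" where "lam lb = 21 + 16 * real lb"
definition D0 :: "nat \<Rightarrow> nat \<Rightarrow> real" where "D0 lb lg = 200 * lam lb * (real lg + 1) / \<psi>"
definition TT :: "nat \<Rightarrow> nat \<Rightarrow> real" where "TT lb lg = \<alpha> * D0 lb lg"

lemma lam_ge: "21 \<le> lam lb" by (simp add: lam_def)

lemma D0_ge: "200 * lam lb * (real lg + 1) \<le> D0 lb lg" "4200 \<le> D0 lb lg"
proof -
  have "0 \<le> 200 * lam lb * (real lg + 1)" using lam_ge[of lb] by simp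
  then show 1: "200 * lam lb * (real lg + 1) \<le> D0 lb lg"
    using psi unfolding D0_def by (simp add: pos_le_divide_eq mult_left_le)
  have "200 * 21 * 1 \<le> 200 * lam lb * (real lg + 1)" using lam_ge[of lb] by (intro mult_mono) auto
  then show "4200 \<le> D0 lb lg" using 1 by simp
qed

lemma TT_ge: "D0 lb lg \<le> TT lb lg" "4200 \<le> TT lb lg"
proof -
  have "1 * D0 lb lg \<le> TT lb lg" unfolding TT_def using alpha D0_ge[of lb lg] by (intro mult_right_mono) auto
  then show "D0 lb lg \<le> TT lb lg" "4200 \<le> TT lb lg" using D0_ge[of lb lg] by auto
qed

text \<open>The state before round \<open>i\<close>. A round makes at most two queries per remaining
  pair, and the bound on the pairs halves, so the queries form a geometric series: the summand with
  factor 4 reserves room for all later rounds. The inequality \<open>2 ^ i * b \<le> 1\<close>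
  limits the number of rounds.\<close>

definition round_inv :: "nat \<Rightarrow> nat \<Rightarrow> nat \<Rightarrow> real \<Rightarrow> nat \<Rightarrow> state \<Rightarrow> bool" where
  "round_inv M lb lg S0 i t \<longleftrightarrow> static t \<and> apsp_ok t \<and>
     rmem t 0 0 = \<alpha> \<and> rmem t 0 1 = \<psi> \<and> rmem t 0 2 = b \<and> rmem t rLAM 0 = lam lb \<and> rmem t rD0 0 = D0 lb lg \<and>
     rmem t rT 0 = TT lb lg \<and> rmem t rTH 0 = 2 ^ i * TT lb lg \<and> rmem t rRHO 0 = 16 * real n / 2 ^ i \<and>
     rmem t rP2 0 = 2 ^ i \<and> 2 ^ i * b \<le> 1 \<and> nmem t vRND 0 = i \<and>
     nmem t BLK = (\<lambda>_. 0) \<and> nmem t MRK = (\<lambda>_. 0) \<and> nmem t 3 = (\<lambda>_. 0) \<and>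
     real (nmem t vKF 0) \<le> 16 * real n / 2 ^ i \<and>
     (\<forall>P. length (filter P (pairs t 0 (nmem t vKF 0))) \<le> length (filter P (expander n M))) \<and>
     (\<forall>X. real (crossing X (expander n M)) \<le> real (crossing X (pairs t 0 (nmem t vKF 0))) + sum (usage (TT lb lg) t) (cutx X)) \<and>
     potential (TT lb lg) t \<le> 5 * real n + 16 * real n * real i \<and>
     (\<forall>e<m. real (nmem t CNT e) < TT lb lg \<and> real (nmem t LEN e) \<le> 2 * (2 ^ i * TT lb lg)) \<and>
     real (num_updates t) \<le> real i * (16 * real n * TT lb lg) \<and>
     real (num_queries t) + 4 * (16 * real n / 2 ^ i) \<le> 64 * real n \<and>
     real (steps t) \<le> S0 + real i * (1000 * real n * TT lb lg)"

text \<open>The factor 1/3 anticipates that \<open>U\<close> may contain up to three quarters of the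
  vertices, so that the smaller side can be three times smaller than \<open>U\<close>. The
  certificate is still in raw form: unrouted pairs plus the boundary times the largest
  congestion.\<close>

definition finished :: "nat \<Rightarrow> nat \<Rightarrow> nat \<Rightarrow> real \<Rightarrow> state \<Rightarrow> bool" where
  "finished M lb lg S0 t \<longleftrightarrow>
     (if nmem t 3 0 \<noteq> 0
      then (let U = blocked (nmem t BLK) in b * real n \<le> real (card U) \<and> 4 * card U \<le> 3 * n \<and>
              real (card (cutx U)) \<le> \<psi> / 3 * real (card U))
      else (\<forall>X. real (crossing X (expander n M)) \<le> 32 * b * real n
              + real (card (cutx X)) * (TT lb lg + (TT lb lg + 1) * log 2 (2 * TT lb lg / b)))) \<and>
     real (num_updates t) \<le> (real lb + 1) * (16 * real n * TT lb lg) \<and>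
     real (num_queries t) \<le> 64 * real n \<and>
     real (steps t) \<le> S0 + (real lb + 1) * (1000 * real n * TT lb lg) + 7000 * real n * TT lb lg + 3"

text \<open>By Bernoulli's inequality \<open>1 + \<beta>\<close> doubles after \<open>K\<close>
  steps, where \<open>K\<close> is \<open>1 / \<beta>\<close> rounded up, so after
  \<open>K * (lg + 1)\<close> steps it has reached \<open>2 n\<close>; the whole graph only allows
  5/4 of \<open>n\<close> in the same unit. As \<open>1 / \<beta>\<close> is at least 48, rounding
  costs a factor of at most 49/48, so \<open>2 R\<close> is at most 98 units where \<open>H\<close>
  is 100 units minus 1.\<close>

lemma growth_params:
  fixes p2 :: real
  assumes p2: "1 \<le> p2" and lg: "n \<le> 2 ^ lg" and V: "V \<le> 2 * lam lb * real n"
  defines "\<beta> \<equiv> \<psi> / (48 * lam lb * p2)" and "H \<equiv> p2 * D0 lb lg / 2 - 1"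
  obtains R :: nat where "0 < R" "2 * real R \<le> H" "\<beta> * V + \<psi> / 6 * real n < (1 + \<beta>) ^ R * (\<psi> / 6)"
proof -
  define q where "q = 48 * lam lb * p2 / \<psi>"
  have l: "21 \<le> lam lb" by (rule lam_ge)
  have lp: "21 \<le> lam lb * p2" using mult_mono[OF l p2] l by simp
  have lpp: "lam lb * p2 \<le> lam lb * p2 / \<psi>" using psi lp by (simp add: pos_le_divide_eq mult_left_le)
  have q48: "48 \<le> q" using lp lpp by (simp add: q_def)
  define Y where "Y = lam lb * p2 / \<psi>"
  have qY: "q = 48 * Y" by (simp add: q_def Y_def)
  have \<beta>q: "\<beta> * q = 1" "0 < \<beta>" using psi l p2 by (simp_all add: \<beta>_def q_def)
  define K where "K = nat \<lceil>q\<rceil>"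
  have K: "q \<le> real K" "real K \<le> q + 1" using q48 by (simp_all add: K_def)
  define R where "R = K * (lg + 1)"
  have "0 < K" using K q48 by linarith
  then have "0 < R" by (simp add: R_def)
  moreover have "2 * real R \<le> H"
  proof -
    have "2 * real R = 2 * real K * (real lg + 1)" by (simp add: R_def algebra_simps)
    also have "\<dots> \<le> 2 * (49 / 48 * q) * (real lg + 1)" using K q48 by (intro mult_right_mono) auto
    finally have a: "2 * real R \<le> 98 * (Y * (real lg + 1))" by (simp add: qY)
    have h: "H = 100 * (Y * (real lg + 1)) - 1" using psi by (simp add: H_def D0_def Y_def field_simps)
    have "1 * 1 \<le> Y * (real lg + 1)" using lp lpp by (intro mult_mono) (auto simp: Y_def)
    then show ?thesis using a h by linarith
  qed
  moreover have "\<beta> * V + \<psi> / 6 * real n < (1 + \<beta>) ^ R * (\<psi> / 6)"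
  proof -
    have "1 \<le> real K * \<beta>" using mult_right_mono[OF K(1), of \<beta>] \<beta>q by (simp add: mult.commute)
    then have "2 \<le> 1 + real K * \<beta>" by simp
    also have "\<dots> \<le> (1 + \<beta>) ^ K" using \<beta>q by (intro Bernoulli_inequality) auto
    finally have "2 ^ (lg + 1) \<le> ((1 + \<beta>) ^ K) ^ (lg + 1)" by (intro power_mono) auto
    then have "2 ^ (lg + 1) \<le> (1 + \<beta>) ^ R" by (simp only: R_def power_mult)
    moreover have "real n \<le> 2 ^ lg" using of_nat_mono[OF lg, where 'a = real] by simp
    ultimately have g: "2 * real n \<le> (1 + \<beta>) ^ R"
      unfolding Suc_eq_plus1[symmetric] power_Suc by linarith
    have "\<beta> * V \<le> \<beta> * (2 * lam lb * real n)" using V \<beta>q by (intro mult_left_mono) auto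
    also have "\<dots> = \<psi> / 24 * real n / p2" using l p2 by (simp add: \<beta>_def)
    also have "\<dots> \<le> \<psi> / 24 * real n" using divide_left_mono[of 1 p2 "\<psi> / 24 * real n"] p2 psi by simp
    finally have "\<beta> * V + \<psi> / 6 * real n \<le> \<psi> / 6 * (5 / 4 * real n)" by simp
    also have "\<dots> < \<psi> / 6 * (2 * real n)" using psi n_pos by simp
    also have "\<dots> \<le> \<psi> / 6 * (1 + \<beta>) ^ R" using g psi by (intro mult_left_mono) auto
    finally show ?thesis by (simp add: mult.commute)
  qed
  ultimately show thesis by (rule that)
qed

text \<open>A cut with a quarter of the vertices is large enough in any case. Otherwise the pairs
  are exhausted, and a vertex hits at most 32 of them: more than \<open>32 b n\<close> pairs give
  the balance, and more than \<open>8 n / p2\<close> pairs give \<open>n \<le> 4 * p2 * |U|\<close>,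
  which turns the charge for the total volume into one per vertex of \<open>U\<close>.\<close>

lemma cut_quality:
  fixes p2 kf :: real and U :: "nat set"
  assumes p2: "1 \<le> p2" and V: "real (vol L {..<n}) \<le> 2 * lam lb * real n"
    and U: "U \<subseteq> {..<n}" and kf: "32 * b * real n < kf" "8 * real n / p2 < kf"
    and big: "real n \<le> 4 * real (card U) \<or> kf \<le> 32 * real (card U)"
    and cut: "real (card (cutx U)) \<le> \<psi> / (48 * lam lb * p2) * real (vol L U) + \<psi> / 6 * real (card U)"
  shows "b * real n \<le> real (card U)" "real (card (cutx U)) \<le> \<psi> / 3 * real (card U)"
proof -
  have l: "21 \<le> lam lb" by (rule lam_ge)
  show "b * real n \<le> real (card U)"
    using big
  proof
    assume "real n \<le> 4 * real (card U)"
    moreover have "b * real n \<le> 1 / 4 * real n" using bal by (intro mult_right_mono) auto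
    ultimately show ?thesis by linarith
  qed (use kf in linarith)
  have nU: "real n \<le> 4 * p2 * real (card U)"
    using big
  proof
    assume "real n \<le> 4 * real (card U)"
    moreover have "1 * real (card U) \<le> p2 * real (card U)" using p2 by (intro mult_right_mono) auto
    ultimately show ?thesis by linarith
  next
    assume "kf \<le> 32 * real (card U)"
    then have "8 * real n / p2 \<le> 32 * real (card U)" using kf by linarith
    then show ?thesis using p2 by (simp add: field_simps)
  qed
  have "real (vol L U) \<le> real (vol L {..<n})" using U vol_mono[of U "{..<n}" L] by simp
  then have "\<psi> / (48 * lam lb * p2) * real (vol L U) \<le> \<psi> / (48 * lam lb * p2) * (2 * lam lb * real n)"
    using V psi l p2 by (intro mult_left_mono) auto
  also have "\<dots> = \<psi> / 24 / p2 * real n" using l p2 by (simp add: field_simps)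
  also have "\<dots> \<le> \<psi> / 24 / p2 * (4 * p2 * real (card U))" using nU psi p2 by (intro mult_left_mono) auto
  also have "\<dots> = \<psi> / 6 * real (card U)" using p2 by simp
  finally show "real (card (cutx U)) \<le> \<psi> / 3 * real (card U)" using cut by argo
qed

lemma card_pairs_le:
  assumes "length (filter (\<lambda>(a, b). a = v \<or> b = v) (pairs t 0 k)) \<le> c"
  shows "card {j. j < k \<and> (nmem t FA j = v \<or> nmem t FB j = v)} \<le> c"
proof -
  have "{j. j < k \<and> (nmem t FA j = v \<or> nmem t FB j = v)}
      = {j. j < length (pairs t 0 k) \<and> (\<lambda>(a, b). a = v \<or> b = v) (pairs t 0 k ! j)}" by auto
  then show ?thesis using assms by (simp add: length_filter_conv_card)
qed

lemma expander_vertices: "p \<in> set (expander n M) \<Longrightarrow> fst p < n \<and> snd p < n"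
  using n_pos by (auto simp: expander_def expander_row_def)

text \<open>The filter clause is applied to the pairs with an endpoint out of range: the expander
  has none, hence neither has the current list.\<close>

lemma pairs_vertices:
  assumes "\<forall>P. length (filter P (pairs t 0 k)) \<le> length (filter P (expander n M))" "j < k"
  shows "nmem t FA j < n \<and> nmem t FB j < n"
proof (rule ccontr)
  assume c: "\<not> (nmem t FA j < n \<and> nmem t FB j < n)"
  define P where "P = (\<lambda>p. \<not> (fst p < n \<and> snd p < n))"
  have "filter P (expander n M) = []" using expander_vertices unfolding P_def by (auto simp: filter_empty_conv)
  then have "filter P (pairs t 0 k) = []" using assms(1)[rule_format, of P] by simp
  moreover have "(nmem t FA j, nmem t FB j) \<in> set (pairs t 0 k)" using assms(2) by (auto simp: pairs_def)
  ultimately show False using c by (auto simp: filter_empty_conv P_def)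
qed

lemma usage_le:
  assumes ok: "apsp_ok t" and e: "e < m" and c: "real (nmem t CNT e) < T" and l: "real (nmem t LEN e) \<le> B" and T: "0 \<le> T"
  shows "usage T t e \<le> T + (T + 1) * log 2 B"
proof -
  have "1 \<le> real (nmem t LEN e)" using ok e by (auto simp: apsp_ok_def)
  then have "log 2 (real (nmem t LEN e)) \<le> log 2 B" using l by simp
  then have "(T + 1) * log 2 (real (nmem t LEN e)) \<le> (T + 1) * log 2 B" using T by (intro mult_left_mono) auto
  then show ?thesis unfolding usage_def using c by linarith
qed

lemma vol_le_potential:
  assumes "0 < T" shows "real (vol (nmem t LEN) {..<n}) \<le> 2 * potential T t"
proof -
  have "real (\<Sum>e<m. nmem t LEN e) \<le> potential T t"
    unfolding potential_def of_nat_sum using assms by (intro sum_mono) (simp add: mult_le_cancel_left1)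
  then show ?thesis by (simp add: vol_all)
qed

end

context cut_input
begin

lemma wp_setup_all:
  "wp setup_all (\<lambda>t. \<exists>M lb lg. n \<le> M * M \<and> M * M \<le> 4 * n \<and>
     1 \<le> 2 ^ lb * b \<and> (lb = 0 \<or> 2 ^ (lb - 1) * b < 1) \<and> n \<le> 2 ^ lg \<and> (lg = 0 \<or> 2 ^ (lg - 1) < n) \<and>
     nmem t vMODE 0 = 0 \<and> round_inv M lb lg (1000 * real n) 0 t) (init_state n es \<alpha> \<psi> b)"
proof -
  let ?s = "init_state n es \<alpha> \<psi> b"
  have s: "nmem ?s 0 0 = n" "nmem ?s 0 1 = m" "\<And>i. i < m \<Longrightarrow> nmem ?s 1 i = eu i \<and> nmem ?s 2 i = ev i"
    "\<And>a. 2 < a \<Longrightarrow> nmem ?s a = (\<lambda>_. 0)" "rmem ?s 0 0 = \<alpha>" "rmem ?s 0 1 = \<psi>" "rmem ?s 0 2 = b"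
    "init_weights ?s = None" "history ?s = []" "steps ?s = 0"
    by (simp_all add: init_state_def fun_eq_iff)
  let ?Q = "\<lambda>t. \<exists>M lb lg. n \<le> M * M \<and> M * M \<le> 4 * n \<and>
     1 \<le> 2 ^ lb * b \<and> (lb = 0 \<or> 2 ^ (lb - 1) * b < 1) \<and> n \<le> 2 ^ lg \<and> (lg = 0 \<or> 2 ^ (lg - 1) < n) \<and>
     nmem t vMODE 0 = 0 \<and> round_inv M lb lg (1000 * real n) 0 t"
  have "wp setup_edges (wp (ApspInit rW) (wp setup_logs (wp setup_grid (wp setup_pairs (wp setup_consts ?Q))))) ?s"
  proof (rule wp_mono[OF wp_setup_edges[OF s(1-3)]])
    show "nmem ?s DEG = (\<lambda>_. 0)" by (rule s(4)) simp
    fix t1 assume t1: "same2 edges_frame {rW} ?s t1 \<and> static t1 \<and>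
       (\<forall>e<m. nmem t1 LEN e = 1 \<and> rmem t1 rW e = 1) \<and> steps t1 \<le> steps ?s + 2 + 12 * m"
    then have sm1: "same2 edges_frame {rW} ?s t1" by simp
    have n1: "nmem t1 a = nmem ?s a" if "a \<notin> edges_frame" for a using same2D(1)[OF sm1 that] .
    have r1: "rmem t1 0 = rmem ?s 0" using same2D(2)[OF sm1, of 0] by simp
    define w where "w = weights_from es (rmem t1 rW)"
    define t2 where "t2 = tick (t1\<lparr>init_weights := Some w\<rparr>)"
    have t2: "nmem t2 = nmem t1" "rmem t2 = rmem t1" "history t2 = []" "init_weights t2 = Some w" "steps t2 = Suc (steps t1)"
      using same2D(3)[OF sm1] s by (simp_all add: t2_def)
    have wE: "w (edge_of (es ! e)) = 1" if "e < m" for e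
    proof -
      have "map_of (zip (map edge_of es) (map (rmem t1 rW) [0..<m])) (map edge_of es ! e) = Some (map (rmem t1 rW) [0..<m] ! e)"
        using edges_distinct that by (intro map_of_zip_nth) auto
      then show ?thesis using that t1 by (simp add: w_def weights_from_def)
    qed
    have "wp setup_logs (wp setup_grid (wp setup_pairs (wp setup_consts ?Q))) t2"
    proof (rule wp_mono[OF wp_setup_logs])
      show "nmem t2 0 0 = n" "rmem t2 0 2 = b" using t2 n1[of 0] r1 s by simp_all
      fix t3 assume t3: "same2 {vLB, vW, vLG} {rPW} t2 t3 \<and>
         1 \<le> 2 ^ nmem t3 vLB 0 * b \<and> (nmem t3 vLB 0 = 0 \<or> 2 ^ (nmem t3 vLB 0 - 1) * b < 1) \<and>
         n \<le> 2 ^ nmem t3 vLG 0 \<and> (nmem t3 vLG 0 = 0 \<or> 2 ^ (nmem t3 vLG 0 - 1) < n) \<and>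
         steps t3 \<le> steps t2 + 10 + 6 * n"
      then have sm3: "same2 {vLB, vW, vLG} {rPW} t2 t3" by simp
      have n3: "nmem t3 a = nmem t2 a" if "a \<notin> {vLB, vW, vLG}" for a using same2D(1)[OF sm3 that] .
      have r3: "rmem t3 0 = rmem t2 0" using same2D(2)[OF sm3, of 0] by simp
      show "wp setup_grid (wp setup_pairs (wp setup_consts ?Q)) t3"
      proof (rule wp_mono[OF wp_setup_grid])
        show "nmem t3 0 0 = n" using n3[of 0] t2 n1[of 0] s by simp
        fix t4 assume t4: "same2 grid_frame {} t3 t4 \<and>
           nmem t4 vSQ 0 = nmem t4 vMM 0 * nmem t4 vMM 0 \<and> n \<le> nmem t4 vSQ 0 \<and> nmem t4 vSQ 0 \<le> 4 * n \<and>
           (\<forall>z<nmem t4 vSQ 0. nmem t4 vG z = z mod n) \<and> (\<forall>x<nmem t4 vMM 0. nmem t4 vRS x = x * nmem t4 vMM 0) \<and>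
           steps t4 \<le> steps t3 + 20 + 40 * n"
        then have sm4: "same2 grid_frame {} t3 t4" by simp
        have n4: "nmem t4 a = nmem t3 a" if "a \<notin> grid_frame" for a using same2D(1)[OF sm4 that] .
        have r4: "rmem t4 0 = rmem t3 0" using same2D(2)[OF sm4, of 0] by simp
        define M where "M = nmem t4 vMM 0"
        show "wp setup_pairs (wp setup_consts ?Q) t4"
        proof (rule wp_mono[OF wp_setup_pairs[of t4 M]])
          fix t5 assume t5: "same2 pairs_frame {} t4 t5 \<and> nmem t5 vKF 0 = 4 * (M * M) \<and>
             pairs t5 0 (4 * (M * M)) = expander n M \<and> steps t5 \<le> steps t4 + 5 + 40 * (M * M)"
          then have sm5: "same2 pairs_frame {} t4 t5" by simp
          have n5: "nmem t5 a = nmem t4 a" if "a \<notin> pairs_frame" for a using same2D(1)[OF sm5 that] .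
          have r5: "rmem t5 0 = rmem t4 0" using same2D(2)[OF sm5, of 0] by simp
          define lb where "lb = nmem t3 vLB 0"
          define lg where "lg = nmem t3 vLG 0"
          have lbg: "nmem t5 vLB 0 = lb" "nmem t5 vLG 0 = lg"
            using n5[of vLB] n4[of vLB] n5[of vLG] n4[of vLG] by (simp_all add: lb_def lg_def)
          have r: "rmem t5 0 0 = \<alpha>" "rmem t5 0 1 = \<psi>" "rmem t5 0 2 = b" using r5 r4 r3 t2 r1 s by simp_all
          have nn: "nmem t5 a = nmem t1 a" if "a \<notin> pairs_frame \<union> grid_frame \<union> {vLB, vW, vLG}" for a
            using that n5[of a] n4[of a] n3[of a] t2 by simp
          have z: "nmem t5 a = (\<lambda>_. 0)" if "a \<in> {3, BLK, MRK, CNT, vMODE, vRND}" for a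
            using that nn[of a] n1[of a] s(4)[of a] by auto
          have L: "nmem t5 LEN e = 1" if "e < m" for e using nn[of LEN] t1 that by simp
          have h: "history t5 = []" "init_weights t5 = Some w"
            using same2D(3,4)[OF sm5] same2D(3,4)[OF sm4] same2D(3,4)[OF sm3] t2 by simp_all
          let ?t = "tick (rset rP2 0 1 (tick (rset rRHO 0 (16 * real n) (tick (rset rTH 0 (TT lb lg) (tick (rset rT 0 (TT lb lg)
             (tick (rset rD0 0 (D0 lb lg) (tick (rset rLAM 0 (lam lb) t5)))))))))))"
          have st: "static ?t" using static_cong[of ?t t1] t1 nn[of 0] nn[of 1] nn[of 2] nn[of DEG] nn[of ADJ] by simp
          have ok: "apsp_ok ?t" unfolding apsp_ok_def
          proof (intro exI[of _ w] conjI)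
            show "\<forall>e\<in>E. 0 < w e" using wE by (metis edge_numberE zero_less_one)
          qed (use h wE L in \<open>simp_all add: current_weight_def\<close>)
          have Mn: "n \<le> M * M" "M * M \<le> 4 * n" using t4 by (simp_all add: M_def)
          have us: "sum (usage T ?t) (cutx X) = 0" for T X
            using L z[of CNT] by (intro sum.neutral) (auto simp: usage_def cutx_def)
          have pot: "potential T ?t \<le> 5 * real n" for T
          proof -
            have "potential T ?t = (\<Sum>e<m. 1)" unfolding potential_def using L z[of CNT] by (intro sum.cong) auto
            then show ?thesis using m_le by simp
          qed
          have T0: "1 \<le> TT lb lg" using TT_ge(2)[of lb lg] by linarith
          have "real (steps ?t) \<le> 1000 * real n"
            using t5 t4 t3 t2 t1 s m_le Mn n_ge4 by simp
          moreover have "pairs ?t 0 (4 * (M * M)) = expander n M"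
            using t5 pairs_cong[of 0 "4 * (M * M)" ?t t5] by simp
          moreover have "b \<le> 1" using bal by simp
          moreover have "real (M * M) \<le> 4 * real n" using of_nat_mono[OF Mn(2), where 'a = real] by simp
          ultimately have "round_inv M lb lg (1000 * real n) 0 ?t"
            unfolding round_inv_def
            using st ok r t5 z us pot L T0 h by (simp add: num_updates_def num_queries_def)
          moreover have "nmem ?t vMODE 0 = 0" using z[of vMODE] by simp
          ultimately have "?Q ?t" using Mn t3 unfolding lb_def lg_def by blast
          then show "wp setup_consts ?Q t5"
            using r lbg n5[of 0] n4[of 0] n3[of 0] n1[of 0] t2 s
            by (simp add: setup_consts_def lam_def[symmetric] D0_def[symmetric] TT_def[symmetric])
        qed (use t4 in \<open>simp_all add: M_def\<close>)
      qed
    qed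
    then show "wp (ApspInit rW) (wp setup_logs (wp setup_grid (wp setup_pairs (wp setup_consts ?Q)))) t1"
      using t1 same2D(4)[OF sm1] s by (simp add: t2_def w_def)
  qed
  then show ?thesis by (simp add: setup_all_def)
qed

end

context cut_input
begin

lemma round_facts:
  assumes "round_inv M lb lg S0 i t" and lb: "1 \<le> 2 ^ lb * b"
  shows "i \<le> lb"
proof (rule ccontr)
  assume "\<not> i \<le> lb"
  then have "(2::real) ^ (lb + 1) \<le> 2 ^ i" by (intro power_increasing) auto
  then have "2 ^ (lb + 1) * b \<le> 2 ^ i * b" using b_pos by (intro mult_right_mono) auto
  also have "\<dots> \<le> 1" using assms(1) by (simp add: round_inv_def)
  finally show False using lb by simp
qed

lemma wp_cut_phase:
  assumes st: "static s" and r: "rmem s 0 1 = \<psi>" "rmem s rLAM 0 = lam lb" "rmem s rP2 0 = p2" "rmem s rD0 0 = D0 lb lg"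
    and p2: "1 \<le> p2" "p2 * b \<le> 1" and lg: "n \<le> 2 ^ lg"
    and zero: "nmem s BLK = (\<lambda>_. 0)" "nmem s MRK = (\<lambda>_. 0)" and kf: "nmem s vKF 0 = kf"
    and P: "\<forall>P. length (filter P (pairs s 0 kf)) \<le> length (filter P (expander n M))" and M: "M * M \<le> 4 * n"
    and far: "\<forall>k<kf. far_apart (nmem s LEN) (p2 * D0 lb lg) (nmem s FA k) (nmem s FB k)"
    and V: "real (vol (nmem s LEN) {..<n}) \<le> 2 * lam lb * real n"
    and big: "32 * b * real n < real kf" "8 * real n / p2 < real kf" and kf16: "real kf \<le> 16 * real n"
  shows "wp cut_phase (\<lambda>t. nmem t vMODE 0 = 1 \<and> nmem t 3 0 = 1 \<and>
     b * real n \<le> real (card (blocked (nmem t BLK))) \<and> 4 * card (blocked (nmem t BLK)) \<le> 3 * n \<and>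
     real (card (cutx (blocked (nmem t BLK)))) \<le> \<psi> / 3 * real (card (blocked (nmem t BLK))) \<and>
     num_updates t = num_updates s \<and> num_queries t = num_queries s \<and>
     real (steps t) \<le> real (steps s) + 6000 * real n * TT lb lg + 5) s"
proof -
  define \<beta> where "\<beta> = \<psi> / (48 * lam lb * p2)"
  define H where "H = p2 * D0 lb lg / 2 - 1"
  obtain R where R: "0 < R" "2 * real R \<le> H"
    "\<beta> * real (vol (nmem s LEN) {..<n}) + \<psi> / 6 * real n < (1 + \<beta>) ^ R * (\<psi> / 6)"
    unfolding \<beta>_def H_def by (rule growth_params[OF p2(1) lg V])
  have l: "21 \<le> lam lb" by (rule lam_ge)
  have \<beta>0: "0 \<le> \<beta>" using l p2 psi by (simp add: \<beta>_def)
  let ?s = "tick (rset rH 0 H (tick (rset rGAM 0 (\<psi> / 6) (tick (rset rBETA 0 \<beta> s)))))"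
  have st': "static ?s" using st static_cong[of ?s s] by simp
  have "wp carve (wp (setv 3 (NConst 1)) (wp (setv vMODE (NConst 1)) (\<lambda>t. nmem t vMODE 0 = 1 \<and> nmem t 3 0 = 1 \<and>
     b * real n \<le> real (card (blocked (nmem t BLK))) \<and> 4 * card (blocked (nmem t BLK)) \<le> 3 * n \<and>
     real (card (cutx (blocked (nmem t BLK)))) \<le> \<psi> / 3 * real (card (blocked (nmem t BLK))) \<and>
     num_updates t = num_updates s \<and> num_queries t = num_queries s \<and>
     real (steps t) \<le> real (steps s) + 6000 * real n * TT lb lg + 5))) ?s"
  proof (rule wp_mono[OF wp_carve[OF st', of "nmem s LEN" kf "p2 * D0 lb lg" \<beta> "\<psi> / 6" H R]])
    fix t assume t: "same carve_frame ?s t \<and>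
       real (card (cutx (blocked (nmem t BLK)))) \<le> \<beta> * real (vol (nmem s LEN) (blocked (nmem t BLK))) + \<psi> / 6 * real (card (blocked (nmem t BLK))) \<and>
       4 * card (blocked (nmem t BLK)) \<le> 3 * n \<and>
       (n \<le> 4 * card (blocked (nmem t BLK)) \<or> kf \<le> 32 * card (blocked (nmem t BLK))) \<and>
       real (steps t) \<le> real (steps ?s) + 3000 * (real (vol (nmem s LEN) {..<n}) + real n + real kf + H)"
    define U where "U = blocked (nmem t BLK)"
    have sub: "U \<subseteq> {..<n}" by (auto simp: U_def)
    have bg: "real n \<le> 4 * real (card U) \<or> real kf \<le> 32 * real (card U)"
      using t unfolding U_def by (simp add: of_nat_le_iff[where 'a = real, symmetric] del: of_nat_le_iff)
    have cutU: "real (card (cutx U)) \<le> \<psi> / (48 * lam lb * p2) * real (vol (nmem s LEN) U) + \<psi> / 6 * real (card U)"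
      using t by (simp add: U_def \<beta>_def)
    have q: "b * real n \<le> real (card U)" "real (card (cutx U)) \<le> \<psi> / 3 * real (card U)"
      by (rule cut_quality[OF p2(1) V sub big bg cutU])+
    have sm: "same carve_frame ?s t" using t by simp
    have nu: "num_updates t = num_updates s" "num_queries t = num_queries s"
      using sameD2(2)[OF sm] by (simp_all add: num_updates_def num_queries_def)
    have "real (steps t) \<le> real (steps s) + 3 + 6000 * real n * TT lb lg"
    proof -
      have n1: "1 \<le> real n" using n_ge4 by simp
      have D0: "200 * lam lb * 1 \<le> D0 lb lg"
      proof -
        have "200 * lam lb * 1 \<le> 200 * lam lb * (real lg + 1)" using l by (intro mult_left_mono) auto
        then show ?thesis using D0_ge(1)[of lb lg] by linarith
      qed
      \<comment> \<open>The time spent on the radius is affordable because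
        \<open>p2 \<le> 1 / b \<le> n\<close>.\<close>
      have "p2 * 1 \<le> p2 * (real n * b)" using n_b p2(1) by (intro mult_left_mono) auto
      also have "\<dots> = real n * (p2 * b)" by simp
      also have "\<dots> \<le> real n * 1" using p2(2) by (intro mult_left_mono) auto
      finally have pn: "p2 \<le> real n" by simp
      have "p2 * D0 lb lg \<le> real n * D0 lb lg" using pn D0 l by (intro mult_right_mono) auto
      moreover have "real n * (200 * lam lb) \<le> real n * D0 lb lg" using D0 by (intro mult_left_mono) auto
      then have "200 * (real n * lam lb) \<le> real n * D0 lb lg" by (simp add: mult_ac)
      moreover have "real n * 4200 \<le> real n * D0 lb lg" using D0_ge(2)[of lb lg] by (intro mult_left_mono) auto
      moreover have "real (vol (nmem s LEN) {..<n}) \<le> 2 * (real n * lam lb)" using V by (simp add: mult_ac)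
      ultimately have "real (vol (nmem s LEN) {..<n}) + real n + real kf + H \<le> 2 * (real n * D0 lb lg)"
        using kf16 n1 unfolding H_def by argo
      also have "\<dots> \<le> 2 * (real n * TT lb lg)" using TT_ge(1)[of lb lg] by (intro mult_left_mono) auto
      finally show ?thesis using t by simp
    qed
    then show "wp (setv 3 (NConst 1)) (wp (setv vMODE (NConst 1)) (\<lambda>t. nmem t vMODE 0 = 1 \<and> nmem t 3 0 = 1 \<and>
     b * real n \<le> real (card (blocked (nmem t BLK))) \<and> 4 * card (blocked (nmem t BLK)) \<le> 3 * n \<and>
     real (card (cutx (blocked (nmem t BLK)))) \<le> \<psi> / 3 * real (card (blocked (nmem t BLK))) \<and>
     num_updates t = num_updates s \<and> num_queries t = num_queries s \<and>
     real (steps t) \<le> real (steps s) + 6000 * real n * TT lb lg + 5)) t"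
      using q t nu by (simp add: U_def)
  next
    fix j assume j: "j < kf"
    show "nmem ?s FA j < n \<and> nmem ?s FB j < n" using pairs_vertices[OF P j] by simp
  next
    fix j r assume "j < kf" "walk {} (nmem s LEN) (nmem ?s FA j) r (nmem ?s FB j)"
    then show "p2 * D0 lb lg \<le> real r" using far by (simp add: far_apart_def) (metis less_imp_le)
  next
    fix v
    have "length (filter (\<lambda>(a, b). a = v \<or> b = v) (pairs s 0 kf)) \<le> length (filter (\<lambda>(a, b). a = v \<or> b = v) (expander n M))"
      using P by blast
    also have "\<dots> \<le> 32" by (rule expander_degree[OF n_pos M])
    finally show "card {j. j < kf \<and> (nmem ?s FA j = v \<or> nmem ?s FB j = v)} \<le> 32"
      using card_pairs_le[of v s kf 32] by simp
  next
    show "2 * (H + 1) \<le> p2 * D0 lb lg" by (simp add: H_def)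
  qed (use zero kf R \<beta>0 psi in simp_all)
  then show ?thesis using r by (simp add: cut_phase_def \<beta>_def H_def)
qed

text \<open>The product of the number of pairs and the threshold is at most \<open>16 n T\<close> in
  every round, which bounds updates and steps per round. The three branches are the certificate, the
  cut, and a further round with half as many pairs and twice the threshold.\<close>

lemma wp_main_body:
  assumes inv: "round_inv M lb lg S0 i t" and M: "n \<le> M * M" "M * M \<le> 4 * n"
    and lb: "1 \<le> 2 ^ lb * b" and lg: "n \<le> 2 ^ lg" and mode: "nmem t vMODE 0 = 0"
  shows "wp main_body (\<lambda>u. (nmem u vMODE 0 = 0 \<and> round_inv M lb lg S0 (Suc i) u) \<or>
     (nmem u vMODE 0 = 1 \<and> finished M lb lg S0 (tick u))) (tick t)"
proof -
  let ?T = "TT lb lg"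
  define p2 :: real where "p2 = 2 ^ i"
  define kf where "kf = nmem t vKF 0"
  let ?t = "tick t"
  have ib: "i \<le> lb" by (rule round_facts[OF inv lb])
  have T: "4200 \<le> ?T" by (rule TT_ge)
  have p2: "1 \<le> p2" "p2 * b \<le> 1" using inv by (simp_all add: p2_def round_inv_def)
  have n1: "1 \<le> real n" using n_ge4 by simp
  have nT: "4200 * real n \<le> real n * ?T" using T n1 by (simp add: mult.commute)
  have kfr: "real kf \<le> 16 * real n / p2" using inv by (simp add: kf_def p2_def round_inv_def)
  have kfp: "real kf * p2 \<le> 16 * real n" using kfr p2 by (simp add: field_simps)
  have kf16: "real kf \<le> 16 * real n"
  proof -
    have "real kf * 1 \<le> real kf * p2" using p2 by (intro mult_left_mono) auto
    then show ?thesis using kfp by linarith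
  qed
  have kT: "real kf * (p2 * ?T) \<le> 16 * (real n * ?T)" using mult_right_mono[OF kfp, of ?T] T by (simp add: mult_ac)
  have st: "static ?t" using inv static_cong[of ?t t] by (simp add: round_inv_def)
  have ok: "apsp_ok ?t" using inv apsp_ok_cong[of ?t t] by (simp add: round_inv_def)
  have P: "\<forall>P. length (filter P (pairs t 0 kf)) \<le> length (filter P (expander n M))"
    using inv by (simp add: round_inv_def kf_def)
  have pt: "pairs ?t 0 kf = pairs t 0 kf" by (rule pairs_cong) simp
  have us: "usage ?T ?t = usage ?T t" "potential ?T ?t = potential ?T t"
    by (auto simp: usage_def potential_def fun_eq_iff)
  let ?Q = "\<lambda>u. (nmem u vMODE 0 = 0 \<and> round_inv M lb lg S0 (Suc i) u) \<or>
     (nmem u vMODE 0 = 1 \<and> finished M lb lg S0 (tick u))"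
  have "wp route_all (wp (Cond (RLess (RMul (RMul (RConst 32) (RGet 0 (NConst 2))) (ROfNat (var 0))) (ROfNat (var vKF)))
       (Cond (RLess (RDiv (rvar rRHO) (RConst 2)) (ROfNat (var vKF)))
          cut_phase
          (seqs [rsetv rRHO (RDiv (rvar rRHO) (RConst 2)), rsetv rTH (RAdd (rvar rTH) (rvar rTH)),
             rsetv rP2 (RAdd (rvar rP2) (rvar rP2)), incv vRND]))
       (setv vMODE (NConst 1))) ?Q) ?t"
  proof (rule wp_mono[OF wp_route_all[OF st ok, of ?T "p2 * ?T" kf]])
    fix w assume w: "route_same route_all_frame ?t w \<and> apsp_ok w \<and>
     (\<forall>e<m. real (nmem w CNT e) < ?T) \<and>
     (\<forall>e<m. nmem ?t LEN e \<le> nmem w LEN e \<and> real (nmem w LEN e) \<le> max (real (nmem ?t LEN e)) (2 * (p2 * ?T))) \<and>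
     (\<forall>P. length (filter P (pairs w 0 (nmem w vKF 0))) \<le> length (filter P (pairs ?t 0 kf))) \<and>
     (\<forall>X. real (crossing X (pairs ?t 0 kf)) + sum (usage ?T ?t) (cutx X)
        \<le> real (crossing X (pairs w 0 (nmem w vKF 0))) + sum (usage ?T w) (cutx X)) \<and>
     potential ?T w \<le> potential ?T ?t + real kf * (p2 * ?T / ?T) \<and>
     (\<forall>k<nmem w vKF 0. far_apart (nmem w LEN) (p2 * ?T / \<alpha>) (nmem w FA k) (nmem w FB k)) \<and>
     real (num_updates w) \<le> real (num_updates ?t) + real kf * (p2 * ?T) \<and> num_queries w \<le> num_queries ?t + 2 * kf \<and>
     real (steps w) \<le> real (steps ?t) + 5 + real kf * (20 + 41 * (p2 * ?T))"
    define kw where "kw = nmem w vKF 0"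
    have rs: "route_same route_all_frame t w" using w by (simp add: route_same_def)
    have nw: "nmem w a = nmem t a" if "a \<notin> route_all_frame" for a using route_sameD(1)[OF rs that] .
    have rw: "rmem w a = rmem t a" if "a \<noteq> vFLAG" for a using route_sameD(2)[OF rs that] .
    have rws: "rmem w 0 1 = \<psi>" "rmem w 0 0 = \<alpha>" "rmem w 0 2 = b" "rmem w rLAM 0 = lam lb" "rmem w rP2 0 = p2" "rmem w rD0 0 = D0 lb lg"
      "rmem w rRHO 0 = 16 * real n / p2" "rmem w rTH 0 = p2 * ?T" "rmem w rT 0 = ?T"
      using rw inv by (simp_all add: round_inv_def p2_def)
    have stw: "static w" using inv static_cong[of w t] nw by (simp add: round_inv_def)
    have n0: "nmem w 0 0 = n" using stw by (simp add: static_def)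
    have zs: "nmem w BLK = (\<lambda>_. 0)" "nmem w MRK = (\<lambda>_. 0)" "nmem w 3 = (\<lambda>_. 0)" "nmem w vRND 0 = i" "nmem w vMODE 0 = 0"
      using nw inv mode by (simp_all add: round_inv_def)
    have Pw: "\<forall>P. length (filter P (pairs w 0 kw)) \<le> length (filter P (expander n M))"
      using w P pt order_trans unfolding kw_def by metis
    have kwkf: "kw \<le> kf" using w[THEN conjunct2, THEN conjunct2, THEN conjunct2, THEN conjunct2, THEN conjunct1, rule_format, of "\<lambda>_. True"]
      by (simp add: kw_def)
    have Xw: "real (crossing X (expander n M)) \<le> real (crossing X (pairs w 0 kw)) + sum (usage ?T w) (cutx X)" for X
    proof -
      have "real (crossing X (expander n M)) \<le> real (crossing X (pairs t 0 kf)) + sum (usage ?T t) (cutx X)"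
        using inv by (simp add: round_inv_def kf_def)
      moreover have "real (crossing X (pairs t 0 kf)) + sum (usage ?T t) (cutx X)
        \<le> real (crossing X (pairs w 0 kw)) + sum (usage ?T w) (cutx X)"
        using w unfolding pt us kw_def by blast
      ultimately show ?thesis by linarith
    qed
    have potw: "potential ?T w \<le> 5 * real n + 16 * real n * real (Suc i)"
    proof -
      have "potential ?T w \<le> potential ?T t + real kf * p2" using w T us by simp
      then show ?thesis using inv kfp by (simp add: round_inv_def algebra_simps)
    qed
    have Lw: "real (nmem w CNT e) < ?T" "real (nmem w LEN e) \<le> 2 * (p2 * ?T)" if e: "e < m" for e
    proof -
      show "real (nmem w CNT e) < ?T" using w e by blast
      have "real (nmem w LEN e) \<le> max (real (nmem t LEN e)) (2 * (p2 * ?T))" using w e by simp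
      moreover have "real (nmem t LEN e) \<le> 2 * (p2 * ?T)" using inv e by (simp add: round_inv_def p2_def)
      ultimately show "real (nmem w LEN e) \<le> 2 * (p2 * ?T)" by simp
    qed
    have upd: "real (num_updates w) \<le> real (Suc i) * (16 * real n * ?T)"
    proof -
      have "real (num_updates w) \<le> real (num_updates t) + 16 * (real n * ?T)" using w kT by simp
      then show ?thesis using inv by (simp add: round_inv_def algebra_simps)
    qed
    have qry: "real (num_queries w) + 2 * (16 * real n / p2) \<le> 64 * real n"
    proof -
      have "real (num_queries w) \<le> real (num_queries t + 2 * kf)" using w by (simp only: of_nat_le_iff num_queries_simps)
      moreover have "real (num_queries t) + 4 * (16 * real n / p2) \<le> 64 * real n" using inv by (simp add: round_inv_def p2_def)
      ultimately show ?thesis using kfr by simp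
    qed
    have stp: "real (steps w) + 10 \<le> S0 + real (Suc i) * (1000 * real n * ?T)"
    proof -
      have "real (steps w) \<le> real (steps t) + 6 + 20 * real kf + 41 * (real kf * (p2 * ?T))"
        using w by (simp add: algebra_simps)
      also have "\<dots> \<le> real (steps t) + 6 + 20 * (16 * real n) + 41 * (16 * (real n * ?T))"
        using kf16 kT by simp
      finally have "real (steps w) + 10 \<le> real (steps t) + 1000 * (real n * ?T)" using nT n1 by linarith
      moreover have "real (steps t) \<le> S0 + real i * (1000 * real n * ?T)" using inv by (simp add: round_inv_def)
      ultimately show ?thesis by (simp add: algebra_simps)
    qed
    have i1: "real (Suc i) \<le> real lb + 1" using ib by simp
    have nT0: "0 \<le> real n * ?T" using nT by linarith
    have updF: "real (num_updates w) \<le> (real lb + 1) * (16 * real n * ?T)"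
    proof -
      have "real (Suc i) * (16 * real n * ?T) \<le> (real lb + 1) * (16 * real n * ?T)"
        using i1 nT0 by (intro mult_right_mono) auto
      then show ?thesis using upd by linarith
    qed
    have stpF: "real (steps w) + 10 \<le> S0 + (real lb + 1) * (1000 * real n * ?T)"
    proof -
      have "real (Suc i) * (1000 * real n * ?T) \<le> (real lb + 1) * (1000 * real n * ?T)"
        using i1 nT0 by (intro mult_right_mono) auto
      then show ?thesis using stp by linarith
    qed
    have qryF: "real (num_queries w) \<le> 64 * real n"
    proof -
      have "0 \<le> 2 * (16 * real n / p2)" using p2 by simp
      then show ?thesis using qry by linarith
    qed
    show "wp (Cond (RLess (RMul (RMul (RConst 32) (RGet 0 (NConst 2))) (ROfNat (var 0))) (ROfNat (var vKF)))
       (Cond (RLess (RDiv (rvar rRHO) (RConst 2)) (ROfNat (var vKF)))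
          cut_phase
          (seqs [rsetv rRHO (RDiv (rvar rRHO) (RConst 2)), rsetv rTH (RAdd (rvar rTH) (rvar rTH)),
             rsetv rP2 (RAdd (rvar rP2) (rvar rP2)), incv vRND]))
       (setv vMODE (NConst 1))) ?Q w"
    proof (cases "32 * b * real n < real kw")
      case False
      let ?u = "tick (nset vMODE 0 1 (tick w))"
      \<comment> \<open>All but \<open>32 b n\<close> crossing pairs of the expander have been
        routed and are accounted for by usage on the boundary. Lengths are at most
        \<open>2 T / b\<close> since \<open>p2 \<le> 1 / b\<close>, which bounds the usage of a
        single edge.\<close>
      have "finished M lb lg S0 (tick ?u)"
      proof -
        have "real (crossing X (expander n M)) \<le> 32 * b * real n
              + real (card (cutx X)) * (?T + (?T + 1) * log 2 (2 * ?T / b))" for X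
        proof -
          have "crossing X (pairs w 0 kw) \<le> kw"
            using length_filter_le[of _ "pairs w 0 kw"] by (simp add: crossing_def)
          then have "real (crossing X (pairs w 0 kw)) \<le> 32 * b * real n" using False by linarith
          moreover have "sum (usage ?T w) (cutx X) \<le> real (card (cutx X)) * (?T + (?T + 1) * log 2 (2 * ?T / b))"
          proof (rule sum_bounded_above)
            fix e assume "e \<in> cutx X"
            then have e: "e < m" by (simp add: cutx_def)
            have "p2 \<le> 1 / b" using p2 b_pos by (simp add: field_simps)
            then have "2 * (p2 * ?T) \<le> 2 * (1 / b * ?T)" using T by (intro mult_left_mono mult_right_mono) auto
            then have "real (nmem w LEN e) \<le> 2 * ?T / b" using Lw(2)[OF e] by simp
            then show "usage ?T w e \<le> ?T + (?T + 1) * log 2 (2 * ?T / b)"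
              using w e Lw(1)[OF e] T by (intro usage_le) auto
          qed
          ultimately show ?thesis using Xw[of X] by linarith
        qed
        then show ?thesis unfolding finished_def using zs updF qryF stpF nT0 by simp
      qed
      then show ?thesis using False rws n0 by (simp add: kw_def)
    next
      case big: True
      show ?thesis
      proof (cases "16 * real n / p2 / 2 < real kw")
        case False
        let ?u = "tick (nset vRND 0 (Suc i) (tick (rset rP2 0 (p2 + p2) (tick (rset rTH 0 (p2 * ?T + p2 * ?T) (tick (rset rRHO 0 (16 * real n / p2 / 2) (tick (tick w)))))))))"
        have ru: "16 * real n / p2 / 2 = 16 * real n / 2 ^ Suc i" "p2 + p2 = 2 ^ Suc i" "p2 * ?T + p2 * ?T = 2 ^ Suc i * ?T"
          by (simp_all add: p2_def)
        \<comment> \<open>More than \<open>32 b n\<close> but at most \<open>8 n / p2\<close> pairs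
          remain, so \<open>p2 * b\<close> is below 1/4 and one more doubling is possible.\<close>
        have "2 ^ Suc i * b \<le> 1"
        proof -
          have "32 * b * real n < 8 * real n / p2" using big False by simp
          then have "real n * (4 * (p2 * b)) < real n * 1" using p2 by (simp add: field_simps)
          then have "4 * (p2 * b) < 1" using n1 by (simp only: mult_less_cancel_left_pos)
          then show ?thesis by (simp add: p2_def)
        qed
        moreover have "static ?u" using stw static_cong[of ?u w] by simp
        moreover have "apsp_ok ?u" using w apsp_ok_cong[of ?u w] by simp
        moreover have "pairs ?u 0 kw = pairs w 0 kw" by (rule pairs_cong) simp
        moreover have "usage ?T ?u = usage ?T w" "potential ?T ?u = potential ?T w"
          by (auto simp: usage_def potential_def fun_eq_iff)
        moreover have "real (nmem w LEN e) \<le> 2 * (2 ^ Suc i * ?T)" if "e < m" for e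
        proof -
          have "0 \<le> p2 * ?T" using p2 T by simp
          then show ?thesis using Lw(2)[OF that] by (simp add: p2_def)
        qed
        moreover have "real (num_queries w) + 4 * (16 * real n / 2 ^ Suc i) \<le> 64 * real n"
          using qry by (simp add: p2_def)
        moreover have "real kw \<le> 16 * real n / 2 ^ Suc i" using False unfolding ru(1) by simp
        ultimately have "round_inv M lb lg S0 (Suc i) ?u"
          unfolding round_inv_def ru
          using rws zs Pw Xw potw Lw(1) upd stp by (simp add: kw_def[symmetric] del: power_Suc of_nat_Suc)
        then show ?thesis using False big rws n0 zs by (simp add: kw_def[symmetric])
      next
        case True
        have far: "\<forall>k<kw. far_apart (nmem w LEN) (p2 * D0 lb lg) (nmem w FA k) (nmem w FB k)"
        proof -
          have "p2 * ?T / \<alpha> = p2 * D0 lb lg" using alpha by (simp add: TT_def)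
          then show ?thesis using w by (simp add: kw_def)
        qed
        have V: "real (vol (nmem w LEN) {..<n}) \<le> 2 * lam lb * real n"
        proof -
          have "real (vol (nmem w LEN) {..<n}) \<le> 2 * potential ?T w" using T by (intro vol_le_potential) simp
          also have "\<dots> \<le> 2 * (5 * real n + 16 * real n * (real lb + 1))"
          proof -
            have "16 * real n * real (Suc i) \<le> 16 * real n * (real lb + 1)" using i1 by (intro mult_left_mono) auto
            then show ?thesis using potw by argo
          qed
          finally show ?thesis by (simp add: lam_def algebra_simps)
        qed
        let ?w = "tick (tick w)"
        have sw: "static ?w" using stw static_cong[of ?w w] by simp
        have pw: "pairs ?w 0 kw = pairs w 0 kw" by (rule pairs_cong) simp
        have "wp cut_phase ?Q ?w"
        proof (rule wp_mono[OF wp_cut_phase[OF sw, of lb p2 lg kw M]])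
          fix u assume u: "nmem u vMODE 0 = 1 \<and> nmem u 3 0 = 1 \<and>
             b * real n \<le> real (card (blocked (nmem u BLK))) \<and> 4 * card (blocked (nmem u BLK)) \<le> 3 * n \<and>
             real (card (cutx (blocked (nmem u BLK)))) \<le> \<psi> / 3 * real (card (blocked (nmem u BLK))) \<and>
             num_updates u = num_updates ?w \<and> num_queries u = num_queries ?w \<and>
             real (steps u) \<le> real (steps ?w) + 6000 * real n * ?T + 5"
          have "finished M lb lg S0 (tick u)"
            unfolding finished_def using u updF qryF stpF nT0 by (simp add: Let_def)
          then show "?Q u" using u by simp
        qed (use rws p2 lg zs Pw pw M far V big True kwkf kf16 in \<open>simp_all add: kw_def\<close>)
        then show ?thesis using True big rws n0 by (simp add: kw_def[symmetric])
      qed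
    qed
  next
    fix k assume k: "k < kf"
    then show "nmem ?t FA k < n \<and> nmem ?t FB k < n" using pairs_vertices[OF P k] by simp
  qed (use inv T p2 in \<open>simp_all add: round_inv_def p2_def kf_def\<close>)
  then show ?thesis by (simp add: main_body_def)
qed

end

section \<open>Translation of the bounds into natural logarithms\<close>

lemma ln_ge_1: "4 \<le> x \<Longrightarrow> 1 \<le> ln (x :: real)"
  using exp_le by (simp add: ln_ge_iff)

lemma ln_2_ge: "1 / 2 \<le> ln (2 :: real)"
proof -
  have "ln (4 :: real) = 2 * ln 2" using ln_realpow[of 2 2] by simp
  then show ?thesis using ln_ge_1[of 4] by simp
qed

text \<open>From \<open>ln 2 \<ge> 1/2\<close> the number of doublings is at most
  \<open>2 * ln x\<close>, up to rounding; since \<open>ln x \<ge> 1\<close>, the rounding and the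
  additional 1 are absorbed by the larger factor.\<close>

lemma doubling_steps_le:
  fixes x :: real
  assumes "4 \<le> x" "k = 0 \<or> 2 ^ (k - 1) < x"
  shows "real k + 1 \<le> 4 * ln x"
proof (cases "k = 0")
  case False
  then have "ln (2 ^ (k - 1)) < ln x" using assms by (subst ln_less_cancel_iff) auto
  then have "real (k - 1) * ln 2 < ln x" by (simp add: ln_realpow)
  moreover have "real (k - 1) * (1 / 2) \<le> real (k - 1) * ln 2" using ln_2_ge by (intro mult_left_mono) auto
  ultimately have "real (k - 1) < 2 * ln x" by simp
  moreover have "real k = real (k - 1) + 1" using False by simp
  ultimately show ?thesis using ln_ge_1[OF assms(1)] by linarith
qed (use ln_ge_1[OF assms(1)] in simp)

context cut_input
begin

lemma wp_sparse_cut_or_certify: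
  "wp sparse_cut_or_certify (\<lambda>t. \<exists>M lb lg. n \<le> M * M \<and> (lb = 0 \<or> 2 ^ (lb - 1) * b < 1) \<and>
     (lg = 0 \<or> 2 ^ (lg - 1) < n) \<and> finished M lb lg (1000 * real n) t) (init_state n es \<alpha> \<psi> b)"
  unfolding sparse_cut_or_certify_def wp_Seq
proof (rule wp_mono[OF wp_setup_all])
  fix s assume "\<exists>M lb lg. n \<le> M * M \<and> M * M \<le> 4 * n \<and>
     1 \<le> 2 ^ lb * b \<and> (lb = 0 \<or> 2 ^ (lb - 1) * b < 1) \<and> n \<le> 2 ^ lg \<and> (lg = 0 \<or> 2 ^ (lg - 1) < n) \<and>
     nmem s vMODE 0 = 0 \<and> round_inv M lb lg (1000 * real n) 0 s"
  then obtain M lb lg where M: "n \<le> M * M" "M * M \<le> 4 * n" and lb: "1 \<le> 2 ^ lb * b" "lb = 0 \<or> 2 ^ (lb - 1) * b < 1"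
    and lg: "n \<le> 2 ^ lg" "lg = 0 \<or> 2 ^ (lg - 1) < n" and mode: "nmem s vMODE 0 = 0"
    and inv: "round_inv M lb lg (1000 * real n) 0 s" by blast
  let ?S = "1000 * real n"
  \<comment> \<open>\<open>finished\<close> is demanded of \<open>tick t\<close> because the last,
    failing test of the loop costs one more step.\<close>
  let ?I = "\<lambda>t. (nmem t vMODE 0 = 0 \<and> (\<exists>i. round_inv M lb lg ?S i t)) \<or> (nmem t vMODE 0 = 1 \<and> finished M lb lg ?S (tick t))"
  have "wp (Loop (NLess (var vMODE) (NConst 1)) main_body) (\<lambda>t. finished M lb lg ?S t) s"
  proof (rule wp_Loop[where I = ?I and \<mu> = "\<lambda>t. if nmem t vMODE 0 = 0 then lb + 2 - nmem t vRND 0 else 0"])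
    show "?I s" using mode inv by blast
  next
    fix t assume I: "?I t" and "beval t (NLess (var vMODE) (NConst 1))"
    then have m0: "nmem t vMODE 0 = 0" by simp
    then obtain i where ti: "round_inv M lb lg ?S i t" using I by auto
    have il: "i \<le> lb" by (rule round_facts[OF ti lb(1)])
    have rnd: "nmem t vRND 0 = i" using ti by (simp add: round_inv_def)
    show "wp main_body (\<lambda>u. ?I u \<and> (if nmem u vMODE 0 = 0 then lb + 2 - nmem u vRND 0 else 0)
        < (if nmem t vMODE 0 = 0 then lb + 2 - nmem t vRND 0 else 0)) (tick t)"
    proof (rule wp_mono[OF wp_main_body[OF ti M lb(1) lg(1) m0]])
      fix u assume u: "nmem u vMODE 0 = 0 \<and> round_inv M lb lg ?S (Suc i) u \<or> nmem u vMODE 0 = 1 \<and> finished M lb lg ?S (tick u)"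
      then show "?I u \<and> (if nmem u vMODE 0 = 0 then lb + 2 - nmem u vRND 0 else 0)
        < (if nmem t vMODE 0 = 0 then lb + 2 - nmem t vRND 0 else 0)"
      proof
        assume a: "nmem u vMODE 0 = 0 \<and> round_inv M lb lg ?S (Suc i) u"
        then have "nmem u vRND 0 = Suc i" by (simp add: round_inv_def)
        then show ?thesis using a m0 rnd il by auto
      qed (use m0 rnd il in auto)
    qed
  next
    fix t assume "?I t" "\<not> beval t (NLess (var vMODE) (NConst 1))"
    then show "finished M lb lg ?S (tick t)" by auto
  qed
  then show "wp (Loop (NLess (var vMODE) (NConst 1)) main_body) (\<lambda>t. \<exists>M lb lg. n \<le> M * M \<and> (lb = 0 \<or> 2 ^ (lb - 1) * b < 1) \<and>
     (lg = 0 \<or> 2 ^ (lg - 1) < n) \<and> finished M lb lg (1000 * real n) t) s"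
    by (rule wp_mono) (use M lb lg in blast)
qed

lemma inv_b: "4 \<le> 1 / b" "1 / b \<le> real n"
  using bal b_pos n_b by (simp_all add: field_simps)

lemma ln_inv_b: "1 \<le> ln (1 / b)" "ln (1 / b) \<le> ln (real n)"
  using ln_ge_1[OF inv_b(1)] inv_b b_pos by (simp_all add: ln_le_cancel_iff)

text \<open>With \<open>lam lb \<le> 21 * (lb + 1) \<le> 84 * ln (1 / b)\<close> and
  \<open>lg + 1 \<le> 4 * ln n\<close>, the constant is \<open>200 * 84 * 4 = 67200\<close>.\<close>

lemma TT_le:
  assumes lb: "lb = 0 \<or> 2 ^ (lb - 1) * b < 1" and lg: "lg = 0 \<or> 2 ^ (lg - 1) < n"
  shows "real lb + 1 \<le> 4 * ln (1 / b)" "TT lb lg \<le> 67200 * (\<alpha> * (ln (1 / b) * ln (real n)) / \<psi>)"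
proof -
  show 1: "real lb + 1 \<le> 4 * ln (1 / b)"
    using lb b_pos by (intro doubling_steps_le inv_b) (auto simp: field_simps)
  have 2: "real lg + 1 \<le> 4 * ln (real n)"
  proof (rule doubling_steps_le)
    show "4 \<le> real n" using n_ge4 by simp
    show "lg = 0 \<or> 2 ^ (lg - 1) < real n" using lg by (metis of_nat_less_iff of_nat_numeral of_nat_power)
  qed
  have "lam lb \<le> 21 * (real lb + 1)" by (simp add: lam_def)
  then have "lam lb \<le> 84 * ln (1 / b)" using 1 by argo
  then have "lam lb * (real lg + 1) \<le> 84 * ln (1 / b) * (4 * ln (real n))"
    using 2 lam_ge[of lb] ln_inv_b by (intro mult_mono) auto
  then have "\<alpha> * (200 * (lam lb * (real lg + 1))) / \<psi> \<le> \<alpha> * (200 * (84 * ln (1 / b) * (4 * ln (real n)))) / \<psi>"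
    using alpha psi by (intro divide_right_mono mult_left_mono) auto
  then show "TT lb lg \<le> 67200 * (\<alpha> * (ln (1 / b) * ln (real n)) / \<psi>)"
    by (simp add: TT_def D0_def mult_ac)
qed

text \<open>Everything inside the logarithm is polynomial in \<open>x\<close>: both
  \<open>1 / b\<close> and \<open>ln (1 / b)\<close> are at most \<open>x\<close>, so
  \<open>4 * T / b\<close> is at most \<open>268800 * x ^ 2\<close>, and the constant is below
  \<open>4 ^ 10 \<le> x ^ 10\<close>. The binary logarithm is thus at most \<open>24 * ln x\<close>,
  and the factor 48 is twice this.\<close>

lemma congestion_le:
  assumes T: "4200 \<le> T" "T \<le> 67200 * (\<alpha> * (ln (1 / b) * ln (real n)) / \<psi>)"
  defines "x \<equiv> ln (real n) * \<alpha> / (b * \<psi>)"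
  shows "T + (T + 1) * log 2 (2 * T / b) \<le> 48 * 67200 * (\<alpha> * ln (real n) * ln (1 / b) * ln x) / \<psi>" "1 \<le> ln x"
proof -
  have lnn: "1 \<le> ln (real n)" using ln_inv_b by linarith
  have a1: "1 \<le> ln (real n) * \<alpha> / \<psi>"
  proof -
    have "1 * 1 \<le> ln (real n) * \<alpha>" using lnn alpha by (intro mult_mono) auto
    then show ?thesis using psi by (simp add: pos_le_divide_eq)
  qed
  have x: "x = (ln (real n) * \<alpha> / \<psi>) * (1 / b)" by (simp add: x_def)
  have xb: "1 / b \<le> x" using mult_right_mono[OF a1, of "1 / b"] b_pos by (simp add: x)
  have x4: "4 \<le> x" using xb inv_b by linarith
  show lx: "1 \<le> ln x" by (rule ln_ge_1[OF x4])
  have lb1: "ln (1 / b) \<le> 1 / b" using ln_bound[of "1 / b"] b_pos by simp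
  have "4 * T / b \<le> 4 * (67200 * (\<alpha> * (ln (1 / b) * ln (real n)) / \<psi>)) / b"
    using T b_pos by (intro divide_right_mono mult_left_mono) auto
  also have "\<dots> = 268800 * (ln (1 / b) * x)" by (simp add: x_def field_simps)
  also have "\<dots> \<le> 268800 * (x * x)" using lb1 xb x4 by (intro mult_left_mono mult_right_mono) auto
  also have "\<dots> \<le> x ^ 10 * (x * x)"
  proof (rule mult_right_mono)
    have "(4::real) ^ 10 \<le> x ^ 10" using x4 by (intro power_mono) auto
    then show "268800 \<le> x ^ 10" by simp
  qed simp
  also have "\<dots> = x ^ 12" by (simp add: power_numeral_reduce)
  finally have big: "4 * T / b \<le> x ^ 12" .
  have p: "0 < 2 * T / b" using T b_pos by simp
  have l4: "log 2 (4 * T / b) = 1 + log 2 (2 * T / b)"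
    using log_mult[of 2 "2 * T / b" 2] T b_pos by simp
  have "2 * T / b \<ge> 1"
  proof -
    have "2 * 4200 * 4 \<le> 2 * T * (1 / b)" using T inv_b by (intro mult_mono) auto
    then show ?thesis by simp
  qed
  then have y0: "0 \<le> log 2 (2 * T / b)" by simp
  have "log 2 (4 * T / b) \<le> 24 * ln x"
  proof -
    have "ln (4 * T / b) \<le> ln (x ^ 12)" using big p x4 by (subst ln_le_cancel_iff) auto
    also have "\<dots> = 12 * ln x" using x4 by (simp add: ln_realpow)
    finally have l12: "ln (4 * T / b) \<le> 12 * ln x" .
    have "12 * ln x * 1 \<le> 12 * ln x * (2 * ln 2)" using ln_2_ge lx by (intro mult_left_mono) auto
    then have "ln (4 * T / b) \<le> 24 * ln x * ln 2" using l12 by simp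
    then show ?thesis using ln_2_ge by (simp add: log_def pos_divide_le_eq)
  qed
  then have lg4: "1 + log 2 (2 * T / b) \<le> 24 * ln x" using l4 by simp
  have "(T + 1) * log 2 (2 * T / b) \<le> (2 * T) * log 2 (2 * T / b)" using T y0 by (intro mult_right_mono) auto
  then have "T + (T + 1) * log 2 (2 * T / b) \<le> 2 * T * (1 + log 2 (2 * T / b))"
    using T by (simp add: algebra_simps)
  also have "\<dots> \<le> 2 * T * (24 * ln x)" using lg4 T by (intro mult_left_mono) auto
  also have "\<dots> \<le> 2 * (67200 * (\<alpha> * (ln (1 / b) * ln (real n)) / \<psi>)) * (24 * ln x)"
    using T lx by (intro mult_right_mono mult_left_mono) auto
  also have "\<dots> = 48 * 67200 * (\<alpha> * ln (real n) * ln (1 / b) * ln x) / \<psi>" by simp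
  finally show "T + (T + 1) * log 2 (2 * T / b) \<le> 48 * 67200 * (\<alpha> * ln (real n) * ln (1 / b) * ln x) / \<psi>" .
qed

text \<open>\<open>16384 = 2 * 256 * 32\<close>: with this balance the unrouted pairs account for at
  most half of the smaller side in the expansion inequality, and the boundary has to account for the
  rest, whence \<open>512 = 2 * 256\<close>. The third power of \<open>ln n\<close> arises from one
  factor \<open>ln (1 / b)\<close> for the number of rounds and the product
  \<open>ln (1 / b) * ln n\<close> in \<open>T\<close>. In 8002 the excess over
  \<open>1000 + 7000\<close> absorbs the setup, since \<open>T \<ge> 4200\<close>.\<close>

lemma sparse_cut_or_certify_correct:
  "\<exists>t. exec n es D sparse_cut_or_certify (init_state n es \<alpha> \<psi> b) t \<and>
     (if announces_cut t
      then (let S = output_cut n t in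
              is_cut n S \<and>
              b * real n \<le> real (card S) \<and> b * real n \<le> real (card ({..<n} - S)) \<and>
              sparsity n E S \<le> \<psi>)
      else (\<forall>X. is_cut n X \<and>
              16384 * b * real n \<le> real (card X) \<and>
              16384 * b * real n \<le> real (card ({..<n} - X)) \<longrightarrow>
              \<psi> * (1 / (512 * 48 * 67200) * (1 / (\<alpha> * ln (real n) * ln (1 / b) * ln (ln (real n) * \<alpha> / (b * \<psi>)))))
                \<le> sparsity n E X)) \<and>
     real (num_updates t) \<le> (16 * 268800) * (\<alpha> * (real n / \<psi>) * ln (real n) ^ 3) \<and>
     real (num_queries t) \<le> 64 * real n \<and>
     real (steps t) \<le> (8002 * 268800) * (\<alpha> * (real n / \<psi>) * ln (real n) ^ 3)"
proof -
  obtain t M lb lg where ex: "exec n es D sparse_cut_or_certify (init_state n es \<alpha> \<psi> b) t"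
    and M: "n \<le> M * M" and lb: "lb = 0 \<or> 2 ^ (lb - 1) * b < 1" and lg: "lg = 0 \<or> 2 ^ (lg - 1) < n"
    and fin: "finished M lb lg (1000 * real n) t"
    using wp_sparse_cut_or_certify unfolding wp_def by blast
  define T where "T = TT lb lg"
  define A where "A = \<alpha> * (real n / \<psi>) * ln (real n) ^ 3"
  have T: "4200 \<le> T" "T \<le> 67200 * (\<alpha> * (ln (1 / b) * ln (real n)) / \<psi>)"
    using TT_ge(2) TT_le[OF lb lg] by (simp_all add: T_def)
  have lb4: "real lb + 1 \<le> 4 * ln (1 / b)" by (rule TT_le[OF lb lg])
  have lnn: "1 \<le> ln (real n)" using ln_inv_b by linarith
  have n1: "1 \<le> real n" using n_ge4 by simp
  have B: "(real lb + 1) * (real n * T) \<le> 268800 * A"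
  proof -
    have "(real lb + 1) * (real n * T) \<le> (4 * ln (1 / b)) * (real n * (67200 * (\<alpha> * (ln (1 / b) * ln (real n)) / \<psi>)))"
      using lb4 T ln_inv_b(1) by (intro mult_mono) auto
    also have "\<dots> = 268800 * (\<alpha> * (real n / \<psi>) * (ln (1 / b) * ln (1 / b) * ln (real n)))" by (simp add: field_simps)
    also have "\<dots> \<le> 268800 * (\<alpha> * (real n / \<psi>) * (ln (real n) * ln (real n) * ln (real n)))"
      using ln_inv_b lnn alpha psi by (intro mult_left_mono mult_right_mono mult_mono) auto
    also have "\<dots> = 268800 * A" by (simp add: A_def power3_eq_cube)
    finally show ?thesis .
  qed
  have nT: "4200 * real n \<le> real n * T" using T n1 by (simp add: mult.commute)
  have BB: "real n * T \<le> (real lb + 1) * (real n * T)"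
    using mult_right_mono[of 1 "real lb + 1" "real n * T"] nT n1 by simp
  have upd: "real (num_updates t) \<le> (16 * 268800) * A"
  proof -
    have "real (num_updates t) \<le> 16 * ((real lb + 1) * (real n * T))" using fin by (simp add: finished_def T_def mult_ac)
    then show ?thesis using B by linarith
  qed
  have stp: "real (steps t) \<le> (8002 * 268800) * A"
  proof -
    have "real (steps t) \<le> 1000 * real n + 1000 * ((real lb + 1) * (real n * T)) + 7000 * (real n * T) + 3"
      using fin by (simp add: finished_def T_def mult_ac)
    also have "\<dots> \<le> 8002 * ((real lb + 1) * (real n * T))" using BB nT n1 by argo
    finally show ?thesis using B by linarith
  qed
  have qry: "real (num_queries t) \<le> 64 * real n" using fin by (simp add: finished_def)
  have out: "if announces_cut t
      then (let S = output_cut n t in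
              is_cut n S \<and>
              b * real n \<le> real (card S) \<and> b * real n \<le> real (card ({..<n} - S)) \<and>
              sparsity n E S \<le> \<psi>)
      else (\<forall>X. is_cut n X \<and>
              16384 * b * real n \<le> real (card X) \<and>
              16384 * b * real n \<le> real (card ({..<n} - X)) \<longrightarrow>
              \<psi> * (1 / (512 * 48 * 67200) * (1 / (\<alpha> * ln (real n) * ln (1 / b) * ln (ln (real n) * \<alpha> / (b * \<psi>)))))
                \<le> sparsity n E X)"
  proof (cases "announces_cut t")
    case True
    define S where "S = output_cut n t"
    have "nmem t 3 0 \<noteq> 0" using True by (simp add: announces_cut_def)
    then have S: "b * real n \<le> real (card S)" "4 * card S \<le> 3 * n" "real (card (cutx S)) \<le> \<psi> / 3 * real (card S)"
      using fin by (simp_all add: finished_def Let_def S_def output_cut_def)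
    have sub: "S \<subseteq> {..<n}" by (auto simp: S_def output_cut_def)
    have c: "card ({..<n} - S) = n - card S" using sub by (simp add: card_Diff_subset finite_subset)
    have S1: "0 < card S" using S(1) n_b by (simp add: mult.commute)
    have ncS: "real (card ({..<n} - S)) \<ge> 1 / 4 * real n" using S(2) c by simp
    have Sn: "card S < n" using S(2) n_pos by linarith
    have "is_cut n S" using sub S1 Sn by (auto simp: is_cut_def)
    moreover have "b * real n \<le> real (card ({..<n} - S))"
    proof -
      have "b * real n \<le> 1 / 4 * real n" using bal by (intro mult_right_mono) auto
      then show ?thesis using ncS by linarith
    qed
    moreover have "sparsity n E S \<le> \<psi>"
    proof -
      define d where "d = real (min (card S) (card ({..<n} - S)))"
      \<comment> \<open>At most three quarters of the vertices are in \<open>S\<close>, so the other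
        side has at least a third of its size. This uses up the factor 1/3 in the boundary
        bound.\<close>
      have "real (card S) \<le> 3 * d" using S(2) c Sn by (auto simp: d_def min_def)
      then have "\<psi> / 3 * real (card S) \<le> \<psi> / 3 * (3 * d)" using psi by (intro mult_left_mono) auto
      then have "real (card (cutx S)) \<le> \<psi> * d" using S(3) by simp
      moreover have "0 < d" using S1 c Sn by (simp add: d_def)
      ultimately show ?thesis unfolding sparsity_def card_cut_edges d_def[symmetric] by (simp add: pos_divide_le_eq)
    qed
    ultimately show ?thesis using True S(1) by (simp add: Let_def S_def)
  next
    case False
    then have z: "nmem t 3 0 = 0" by (simp add: announces_cut_def)
    define x where "x = ln (real n) * \<alpha> / (b * \<psi>)"
    define Q where "Q = 48 * 67200 * (\<alpha> * ln (real n) * ln (1 / b) * ln x) / \<psi>"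
    have Q: "T + (T + 1) * log 2 (2 * T / b) \<le> Q" "1 \<le> ln x"
      using congestion_le[OF T] by (simp_all add: Q_def x_def)
    have Qpos: "0 < Q" using Q(2) alpha lnn ln_inv_b psi by (simp add: Q_def)
    have "\<psi> * (1 / (512 * 48 * 67200) * (1 / (\<alpha> * ln (real n) * ln (1 / b) * ln x))) \<le> sparsity n E X"
      if X: "is_cut n X" "16384 * b * real n \<le> real (card X)" "16384 * b * real n \<le> real (card ({..<n} - X))" for X
    proof -
      define d where "d = real (min (card X) (card ({..<n} - X)))"
      define C where "C = real (card (cutx X))"
      have sub: "X \<subseteq> {..<n}" using X(1) by (auto simp: is_cut_def)
      have d: "16384 * b * real n \<le> d" using X(2,3) by (simp add: d_def min_def)
      have dpos: "0 < d" using d b_pos n1 by (smt (verit) mult_pos_pos)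
      have cr: "real (crossing X (expander n M)) \<le> 32 * b * real n + C * (T + (T + 1) * log 2 (2 * T / b))"
        using fin z by (simp add: finished_def C_def T_def)
      have "d \<le> real (256 * crossing X (expander n M))"
        unfolding d_def using expander_expansion[OF n_pos M sub] by (simp only: of_nat_le_iff)
      also have "\<dots> \<le> 256 * (32 * b * real n + C * (T + (T + 1) * log 2 (2 * T / b)))"
        using cr by simp
      also have "C * (T + (T + 1) * log 2 (2 * T / b)) \<le> C * Q"
        using Q(1) by (intro mult_left_mono) (auto simp: C_def)
      finally have "d \<le> 256 * (32 * b * real n) + 256 * (C * Q)" by simp
      then have "d \<le> 512 * (C * Q)" using d by simp
      then have "1 / (512 * Q) \<le> C / d" using dpos Qpos by (simp add: field_simps)
      moreover have "\<psi> * (1 / (512 * 48 * 67200) * (1 / (\<alpha> * ln (real n) * ln (1 / b) * ln x))) = 1 / (512 * Q)"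
        by (simp add: Q_def)
      ultimately show ?thesis by (simp add: sparsity_def card_cut_edges C_def d_def)
    qed
    then show ?thesis using False by (simp add: x_def)
  qed
  show ?thesis using ex out upd qry stp unfolding A_def by blast
qed

end

theorem theorem4p1:
  "\<exists>(SparseCutOrCertify :: com) (c_bal :: real) (c_sp :: real) (C_upd :: real) (C_qry :: real) (C_time :: real).
     0 < c_bal \<and> 0 < c_sp \<and> 0 < C_upd \<and> 0 < C_qry \<and> 0 < C_time \<and>
     (\<forall>(n :: nat) (E :: edge set) (es :: (nat \<times> nat) list) (\<alpha> :: real) (\<psi> :: real) (b :: real) (D :: apsp).
        0 < n \<longrightarrow> simple_graph n E \<longrightarrow> edge_list E es \<longrightarrow> (\<forall>v<n. vertex_degree E v \<le> 10) \<longrightarrow>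
        1 \<le> \<alpha> \<longrightarrow> approx_apsp n E \<alpha> D \<longrightarrow>
        0 < \<psi> \<longrightarrow> \<psi> \<le> 1 \<longrightarrow> 1 / real n \<le> b \<longrightarrow> b \<le> 1 / 4 \<longrightarrow>
        (\<exists>t. exec n es D SparseCutOrCertify (init_state n es \<alpha> \<psi> b) t \<and>
           (if announces_cut t
            then (let S = output_cut n t in
                    is_cut n S \<and>
                    b * real n \<le> real (card S) \<and> b * real n \<le> real (card ({..<n} - S)) \<and>
                    sparsity n E S \<le> \<psi>)
            else (\<forall>X. is_cut n X \<and>
                    c_bal * b * real n \<le> real (card X) \<and>
                    c_bal * b * real n \<le> real (card ({..<n} - X)) \<longrightarrow>
                    \<psi> * (c_sp * (1 / (\<alpha> * ln (real n) * ln (1 / b) * ln (ln (real n) * \<alpha> / (b * \<psi>)))))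
                      \<le> sparsity n E X)) \<and>
           real (num_updates t) \<le> C_upd * (\<alpha> * (real n / \<psi>) * ln (real n) ^ 3) \<and>
           real (num_queries t) \<le> C_qry * real n \<and>
           real (steps t) \<le> C_time * (\<alpha> * (real n / \<psi>) * ln (real n) ^ 3)))"
proof (rule exI[of _ sparse_cut_or_certify], rule exI[of _ 16384], rule exI[of _ "1 / (512 * 48 * 67200)"],
    rule exI[of _ "16 * 268800"], rule exI[of _ 64], rule exI[of _ "8002 * 268800"], intro conjI allI impI)
  fix n :: nat and E :: "edge set" and es :: "(nat \<times> nat) list" and \<alpha> \<psi> b :: real and D :: apsp
  assume "0 < n" "simple_graph n E" "edge_list E es" "\<forall>v<n. vertex_degree E v \<le> 10"
    "1 \<le> \<alpha>" "approx_apsp n E \<alpha> D" "0 < \<psi>" "\<psi> \<le> 1" "1 / real n \<le> b" "b \<le> 1 / 4"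
  then interpret cut_input n es D E \<alpha> \<psi> b by unfold_locales auto
  show "\<exists>t. exec n es D sparse_cut_or_certify (init_state n es \<alpha> \<psi> b) t \<and>
     (if announces_cut t
      then (let S = output_cut n t in
              is_cut n S \<and>
              b * real n \<le> real (card S) \<and> b * real n \<le> real (card ({..<n} - S)) \<and>
              sparsity n E S \<le> \<psi>)
      else (\<forall>X. is_cut n X \<and>
              16384 * b * real n \<le> real (card X) \<and>
              16384 * b * real n \<le> real (card ({..<n} - X)) \<longrightarrow>
              \<psi> * (1 / (512 * 48 * 67200) * (1 / (\<alpha> * ln (real n) * ln (1 / b) * ln (ln (real n) * \<alpha> / (b * \<psi>)))))
                \<le> sparsity n E X)) \<and>
     real (num_updates t) \<le> (16 * 268800) * (\<alpha> * (real n / \<psi>) * ln (real n) ^ 3) \<and>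
     real (num_queries t) \<le> 64 * real n \<and>
     real (steps t) \<le> (8002 * 268800) * (\<alpha> * (real n / \<psi>) * ln (real n) ^ 3)"
    by (rule sparse_cut_or_certify_correct)
qed simp_all

end
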